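(* Let $T>0$, $\nu>0$, and let $\omega:\mathbb{R}^+\to\mathbb{R}^+$ be a non-decreasing function with $\lim_{s\to0^+}\omega(s)=0$. Let $\mathbb{R}^3_+=\{x\in\mathbb{R}^3:x_3>0\}$, let $v_0\in H$, and let $v$ be a Leray-Hopf weak solution on $(0,T)\times\mathbb{R}^3_+$ of the Navier-Stokes equations with homogeneous Dirichlet boundary condition $$\partial_t v+(v\cdot\nabla)v-\nu\Delta v+\nabla p=0,\quad \operatorname{div} v=0\ \text{ in }(0,T)\times\mathbb{R}^3_+,\qquad v=0\ \text{ on }\{x_3=0\},\qquad v(0,x)=v_0(x),$$ such that $$v\in L^{2}(0,T;\dot C_{\omega,hor}(\mathbb{R}^3_+)).$$ Then $v$ conserves the energy, i.e. $$\frac12\|v(t)\|^2+\nu\int_0^t\|\nabla v(\tau)\|^2\,d\tau=\frac12\|v_0\|^2\qquad\text{for all }t\in[0,T].$$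
   Context: $(\cdot,\cdot)$ and $\|\cdot\|$ denote the scalar product and norm of $L^2(\mathbb{R}^3_+)$. Points are written $x=(x_h,x_3)$ with horizontal variables $x_h=(x_1,x_2)\in\mathbb{R}^2$. $H$ and $V$ are the closures of the smooth, compactly supported, divergence-free vector fields on $\mathbb{R}^3_+$ in $L^2(\mathbb{R}^3_+)$ and in $\dot W^{1,2}_0(\mathbb{R}^3_+)$ (norm $\|\nabla u\|$), respectively. Leray-Hopf weak solution: given $v_0\in H$, a measurable function $v:(0,T)\times\mathbb{R}^3_+\to\mathbb{R}^3$ is a Leray-Hopf weak solution if $v\in L^\infty(0,T;H)\cap L^2(0,T;V)$ and the following hold: (i) $\displaystyle\int_0^T\Big[(v,\partial_t\varphi)-\nu(\nabla v,\nabla\varphi)-((v\cdot\nabla)v,\varphi)\Big]\,dt=-(v_0,\varphi(0))$ for all vector fields $\varphi\in C_0^\infty([0,T)\times\mathbb{R}^3_+)$ with $\operatorname{div}\varphi=0$; (ii) $\displaystyle\frac12\|v(t)\|^2+\nu\int_0^t\|\nabla v(\tau)\|^2\,d\tau\le\frac12\|v_0\|^2$ for all $t\in[0,T]$; (iii) $\lim_{t\to0^+}\|v(t)-v_0\|=0$. As usual, $v$ is identified with its representative that is weakly continuous from $[0,T]$ into $L^2(\mathbb{R}^3_+)$, with $v(0)=v_0$. Horizontal uniform continuity: $u\in\dot C_{\omega,hor}(\mathbb{R}^3_+)$ means that $u$ is, for almost all $z_3>0$, uniformly continuous in the horizontal variables with modulus of continuity $\omega$, i.e. $|u(x_h,z_3)-u(y_h,z_3)|\le\omega(|x_h-y_h|)$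 for all $x_h\neq y_h$ in $\mathbb{R}^2$. The condition $v\in L^2(0,T;\dot C_{\omega,hor}(\mathbb{R}^3_+))$ means: there exists $f_\omega:[0,T]\to\mathbb{R}^+$ with $\int_0^T f_\omega^2(t)\,dt<\infty$ such that, for a.e. $t\in[0,T]$ and almost all $z_3>0$, $$|v(t,x_h,z_3)-v(t,y_h,z_3)|\le f_\omega(t)\,\omega(|x_h-y_h|)\qquad\text{for all }x_h\neq y_h\text{ in }\mathbb{R}^2.$$ *)

theory Defs
  imports "HOL-Analysis.Analysis"
begin

section \<open>Smooth functions and test functions\<close>

primrec Ck :: "nat \<Rightarrow> ('a::real_normed_vector \<Rightarrow> 'b::real_normed_vector) \<Rightarrow> bool" where
  "Ck 0 f \<longleftrightarrow> continuous_on UNIV f"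
| "Ck (Suc k) f \<longleftrightarrow>
     (\<forall>x. f differentiable (at x)) \<and> (\<forall>h. Ck k (\<lambda>x. frechet_derivative f (at x) h))"

definition smooth :: "('a::real_normed_vector \<Rightarrow> 'b::real_normed_vector) \<Rightarrow> bool" where
  "smooth f \<longleftrightarrow> (\<forall>k. Ck k f)"

text \<open>Functions in \<open>C\<^sub>0\<^sup>\<infinity>(U)\<close> for open \<open>U\<close>, extended by zero to the whole space.\<close>

definition test_function :: "'a::real_normed_vector set \<Rightarrow> ('a \<Rightarrow> 'b::real_normed_vector) \<Rightarrow> bool" where
  "test_function U f \<longleftrightarrow>
     smooth f \<and> compact (closure {x. f x \<noteq> 0}) \<and> closure {x. f x \<noteq> 0} \<subseteq> U"

definition divergence :: "(real^3 \<Rightarrow> real^3) \<Rightarrow> real^3 \<Rightarrow> real" where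
  "divergence f x = trace (jacobian f (at x))"


section \<open>The half space and its Lebesgue spaces\<close>

text \<open>
  Functions on the half space are total functions of which only the values on the half space
  matter; the Lebesgue and Sobolev spaces and H and V are invariant under changes on null sets.
\<close>

definition half_space :: "(real^3) set" where
  "half_space = {x. x $ 3 > 0}"

definition in_Lp :: "nat \<Rightarrow> (real^3 \<Rightarrow> 'b::euclidean_space) \<Rightarrow> bool" where
  "in_Lp p f \<longleftrightarrow> f \<in> borel_measurable (lebesgue_on half_space) \<and>
     integrable (lebesgue_on half_space) (\<lambda>x. norm (f x) ^ p)"

text \<open>
  On matrices the inner product of the type \<open>real^3^3\<close> is the Frobenius product, so the
  following two also give the pairing and the norm of gradients.
\<close>

definition L2_inner :: "(real^3 \<Rightarrow> 'b::euclidean_space) \<Rightarrow> (real^3 \<Rightarrow> 'b) \<Rightarrow> real" where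
  "L2_inner f g = (LINT x|lebesgue_on half_space. f x \<bullet> g x)"

definition L2_norm :: "(real^3 \<Rightarrow> 'b::euclidean_space) \<Rightarrow> real" where
  "L2_norm f = sqrt (LINT x|lebesgue_on half_space. (norm (f x))\<^sup>2)"


section \<open>Weak gradients and the spaces H and V\<close>

definition locally_integrable :: "(real^3 \<Rightarrow> 'b::euclidean_space) \<Rightarrow> bool" where
  "locally_integrable f \<longleftrightarrow>
     (\<forall>K. compact K \<and> K \<subseteq> half_space \<longrightarrow> integrable (lebesgue_on K) f)"

text \<open>As for \<^const>\<open>jacobian\<close>, the entry \<open>G x $ i $ j\<close> is the derivative of \<open>u\<^sub>i\<close> in direction \<open>j\<close>.\<close>

definition has_weak_gradient :: "(real^3 \<Rightarrow> real^3) \<Rightarrow> (real^3 \<Rightarrow> real^3^3) \<Rightarrow> bool" where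
  "has_weak_gradient u G \<longleftrightarrow> locally_integrable u \<and> locally_integrable G \<and>
     (\<forall>\<psi> :: real^3 \<Rightarrow> real. test_function half_space \<psi> \<longrightarrow>
       (\<forall>i j. (LINT x|lebesgue_on half_space. u x $ i * frechet_derivative \<psi> (at x) (axis j 1)) =
              - (LINT x|lebesgue_on half_space. G x $ i $ j * \<psi> x)))"

text \<open>Determined up to a null set, whenever a weak gradient exists.\<close>

definition weak_gradient :: "(real^3 \<Rightarrow> real^3) \<Rightarrow> real^3 \<Rightarrow> real^3^3" where
  "weak_gradient u = (SOME G. has_weak_gradient u G)"

definition solenoidal_test :: "(real^3 \<Rightarrow> real^3) \<Rightarrow> bool" where
  "solenoidal_test f \<longleftrightarrow> test_function half_space f \<and> (\<forall>x. divergence f x = 0)"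

definition space_H :: "(real^3 \<Rightarrow> real^3) set" where
  "space_H = {u. in_Lp 2 u \<and>
     (\<exists>f. (\<forall>n. solenoidal_test (f n)) \<and> (\<lambda>n. L2_norm (\<lambda>x. f n x - u x)) \<longlonglongrightarrow> 0)}"

text \<open>
  Convergence in the homogeneous Sobolev norm.  The space \<open>W12_hom_zero\<close> is the completion of the
  test fields in this norm, realised (by the Sobolev embedding into \<open>L\<^sup>6\<close>) as a space of
  functions: the condition of being in \<open>L\<^sup>6\<close> fixes the additive constant that the norm
  does not see.
\<close>

definition grad_tendsto :: "(nat \<Rightarrow> real^3 \<Rightarrow> real^3) \<Rightarrow> (real^3 \<Rightarrow> real^3) \<Rightarrow> bool" where
  "grad_tendsto f u \<longleftrightarrow>
     (\<lambda>n. L2_norm (\<lambda>x. jacobian (f n) (at x) - weak_gradient u x)) \<longlonglongrightarrow> 0"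

definition W12_hom_zero :: "(real^3 \<Rightarrow> real^3) set" where
  "W12_hom_zero = {u. in_Lp 6 u \<and> (\<exists>G. has_weak_gradient u G) \<and> in_Lp 2 (weak_gradient u) \<and>
     (\<exists>f. (\<forall>n. test_function half_space (f n)) \<and> grad_tendsto f u)}"

definition space_V :: "(real^3 \<Rightarrow> real^3) set" where
  "space_V = {u \<in> W12_hom_zero. \<exists>f. (\<forall>n. solenoidal_test (f n)) \<and> grad_tendsto f u}"


section \<open>Leray--Hopf weak solutions\<close>

definition in_Linf_H :: "real \<Rightarrow> (real \<Rightarrow> real^3 \<Rightarrow> real^3) \<Rightarrow> bool" where
  "in_Linf_H T v \<longleftrightarrow> (\<exists>C. AE t in lebesgue_on {0<..<T}. v t \<in> space_H \<and> L2_norm (v t) \<le> C)"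

definition in_L2_V :: "real \<Rightarrow> (real \<Rightarrow> real^3 \<Rightarrow> real^3) \<Rightarrow> bool" where
  "in_L2_V T v \<longleftrightarrow> (AE t in lebesgue_on {0<..<T}. v t \<in> space_V) \<and>
     integrable (lebesgue_on {0<..<T}) (\<lambda>t. (L2_norm (weak_gradient (v t)))\<^sup>2)"

text \<open>
  Test fields on \<open>[0,T) \<times> half_space\<close> are the restrictions to nonnegative times of test fields
  on \<open>(-\<infinity>,T) \<times> half_space\<close>; they need not vanish at time 0, and only their values
  at nonnegative times are required to be divergence free.
\<close>

definition solenoidal_test_time :: "real \<Rightarrow> (real \<times> (real^3) \<Rightarrow> real^3) \<Rightarrow> bool" where
  "solenoidal_test_time T \<phi> \<longleftrightarrow> test_function ({..<T} \<times> half_space) \<phi> \<and>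
     (\<forall>t\<in>{0..<T}. \<forall>x. divergence (\<lambda>y. \<phi> (t, y)) x = 0)"

definition weak_formulation ::
  "real \<Rightarrow> real \<Rightarrow> (real^3 \<Rightarrow> real^3) \<Rightarrow> (real \<Rightarrow> real^3 \<Rightarrow> real^3) \<Rightarrow> bool" where
  "weak_formulation T \<nu> v0 v \<longleftrightarrow> (\<forall>\<phi>. solenoidal_test_time T \<phi> \<longrightarrow>
     (LINT t|lebesgue_on {0<..<T}.
          L2_inner (v t) (\<lambda>x. frechet_derivative \<phi> (at (t, x)) (1, 0))
        - \<nu> * L2_inner (weak_gradient (v t)) (\<lambda>x. jacobian (\<lambda>y. \<phi> (t, y)) (at x))
        - L2_inner (\<lambda>x. weak_gradient (v t) x *v v t x) (\<lambda>x. \<phi> (t, x)))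
     = - L2_inner v0 (\<lambda>x. \<phi> (0, x)))"

text \<open>
  The last three conditions say that \<open>v\<close> is the representative that is weakly continuous
  from \<open>[0,T]\<close> into \<open>L\<^sup>2\<close> and takes the initial value at time 0.
\<close>

definition leray_hopf ::
  "real \<Rightarrow> real \<Rightarrow> (real^3 \<Rightarrow> real^3) \<Rightarrow> (real \<Rightarrow> real^3 \<Rightarrow> real^3) \<Rightarrow> bool" where
  "leray_hopf T \<nu> v0 v \<longleftrightarrow>
     (\<lambda>(t, x). v t x) \<in> borel_measurable (lebesgue_on ({0<..<T} \<times> half_space)) \<and>
     in_Linf_H T v \<and> in_L2_V T v \<and>
     weak_formulation T \<nu> v0 v \<and>
     (\<forall>t\<in>{0..T}. (L2_norm (v t))\<^sup>2 / 2
        + \<nu> * (LINT \<tau>|lebesgue_on {0..t}. (L2_norm (weak_gradient (v \<tau>)))\<^sup>2)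
        \<le> (L2_norm v0)\<^sup>2 / 2) \<and>
     ((\<lambda>t. L2_norm (\<lambda>x. v t x - v0 x)) \<longlongrightarrow> 0) (at_right 0) \<and>
     (\<forall>t\<in>{0..T}. in_Lp 2 (v t)) \<and>
     (\<forall>w :: real^3 \<Rightarrow> real^3. in_Lp 2 w \<longrightarrow> continuous_on {0..T} (\<lambda>t. L2_inner (v t) w)) \<and>
     (AE x in lebesgue_on half_space. v 0 x = v0 x)"


section \<open>Horizontal uniform continuity\<close>

definition hpoint :: "real^2 \<Rightarrow> real \<Rightarrow> real^3" where
  "hpoint xh x3 = vector [xh $ 1, xh $ 2, x3]"

text \<open>
  Not invariant under changes on null sets: the bound holds pointwise for all pairs of points at
  almost every height.
\<close>

definition C_hor :: "(real \<Rightarrow> real) \<Rightarrow> (real^3 \<Rightarrow> real^3) set" where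
  "C_hor \<omega> = {u. AE z3 in lebesgue_on {0<..}. \<forall>xh yh. xh \<noteq> yh \<longrightarrow>
     norm (u (hpoint xh z3) - u (hpoint yh z3)) \<le> \<omega> (norm (xh - yh))}"

definition in_L2_C_hor :: "real \<Rightarrow> (real \<Rightarrow> real) \<Rightarrow> (real \<Rightarrow> real^3 \<Rightarrow> real^3) \<Rightarrow> bool" where
  "in_L2_C_hor T \<omega> v \<longleftrightarrow> (\<exists>f :: real \<Rightarrow> real. (\<forall>t\<in>{0..T}. 0 \<le> f t) \<and>
     integrable (lebesgue_on {0..T}) (\<lambda>t. (f t)\<^sup>2) \<and>
     (AE t in lebesgue_on {0..T}. v t \<in> C_hor (\<lambda>s. f t * \<omega> s)))"

end

theory Submission
  imports Defs
begin

text \<open>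
  One half of the energy equality, the inequality with \<open>\<le>\<close>, belongs to the definition of a
  Leray--Hopf solution.  What has to be shown is that no energy is lost, and this follows once the
  equation may be tested with the solution itself.  The obstacle is the convective term, which for a
  general field in \<open>L\<^sup>\<infinity>(L\<^sup>2) \<inter> L\<^sup>2(V)\<close> need not be integrable against the field in space and time.

  The horizontal modulus of continuity removes the obstacle, since it makes \<open>v(t)\<close> bounded.  Compare
  the value at a point with the values on a unit cube at that point: moving horizontally costs at most
  \<open>f(t) \<omega>(2)\<close>, moving vertically costs an integral of the vertical derivative, and averaging over the
  cube gives \<open>|v(t)|\<^sup>2 \<le> 3 f(t)\<^sup>2 \<omega>(2)\<^sup>2 + 3 \<parallel>v(t)\<parallel>\<^sup>2 + 3 \<parallel>\<nabla>v(t)\<parallel>\<^sup>2\<close> almost everywhere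
  (\<open>bounded_if_horizontally_continuous\<close>).  The right-hand side is integrable in time, so
  \<open>v \<in> L\<^sup>2(0,T; L\<^sup>\<infinity>)\<close> and therefore \<open>(v \<cdot> \<nabla>)v \<in> L\<^sup>1(0,T; L\<^sup>2)\<close>.

  The next point is that a field \<open>u\<close> in \<open>V \<inter> L\<^sup>2\<close> is an admissible test field.  By definition of \<open>V\<close> it
  is approximated by solenoidal test fields in the gradient norm only, which on the half space does
  not control the \<open>L\<^sup>2\<close> norm.  On a slab \<open>x\<^sub>3 < R\<close> it does, because the fields vanish on the boundary
  and are vertical primitives of their gradients (\<open>slab_err\<close>).  A vertical cutoff of a vector potential
  then produces solenoidal test fields that are bounded in \<open>L\<^sup>2\<close> together with their gradients and
  converge on every slab, hence weakly (\<open>weak_approximants\<close>).  Passing to the limit in the antisymmetry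
  of the convective form gives \<open>((u \<cdot> \<nabla>)u, u) = 0\<close> for bounded \<open>u\<close> (\<open>convective_orthogonal\<close>), and passing
  to the limit in the weak formulation gives the increments of \<open>(v(t), v(s))\<close> in \<open>t\<close> for almost every
  fixed \<open>s\<close> (\<open>increment_identity\<close>).

  The energy balance is obtained by averaging increments over a time \<open>h\<close>.  Integrating
  \<open>\<parallel>v(s')\<parallel>\<^sup>2 - \<parallel>v(s)\<parallel>\<^sup>2 \<ge> 2 (v(s') - v(s), v(s))\<close> with \<open>s' = min (s + h) t\<close> over \<open>s\<close>, the left-hand side
  telescopes to \<open>h \<parallel>v(t)\<parallel>\<^sup>2\<close> minus the integral of \<open>\<parallel>v\<parallel>\<^sup>2\<close> over \<open>[0,h]\<close>, while the right-hand side becomes a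
  double integral of \<open>-2 \<nu> (\<nabla>v(\<tau>), \<nabla>v(s)) - 2 ((v \<cdot> \<nabla>)v(\<tau>), v(s))\<close> over the times \<open>s < \<tau> \<le> s'\<close>.  The
  viscous pairing is at most \<open>(\<parallel>\<nabla>v(\<tau>)\<parallel>\<^sup>2 + \<parallel>\<nabla>v(s)\<parallel>\<^sup>2) / 2\<close>, so that after division by \<open>h\<close> it
  contributes at most twice the dissipation (\<open>energy_increment_lower\<close>).  The convective pairing is
  continuous in \<open>s\<close> by weak continuity of \<open>v\<close> and vanishes at \<open>s = \<tau>\<close>, so that after division by \<open>h\<close> it
  disappears in the limit (\<open>conv_average_tendsto\<close>).  Together with weak lower semicontinuity at the
  initial time this is the missing inequality (\<open>energy_lower_bound\<close>).

  Two devices recur.  Integrals along segments of fixed direction and length are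
  bounded in \<open>L\<^sup>2\<close> by Tonelli's theorem and translation invariance, without splitting the space into
  a product.  And expressions that are quadratic in the solution are measurable in time, although the
  solution is only weakly continuous, because nonnegative ones are lower semicontinuous
  (\<open>quadratic_touched_below\<close>).
\<close>

section \<open>Calculus of smooth functions\<close>

lemma Ck_SucI:
  assumes "\<And>x. (f has_derivative f' x) (at x)" and "\<And>h. Ck k (\<lambda>x. f' x h)"
  shows "Ck (Suc k) f"
proof -
  have "frechet_derivative f (at x) = f' x" for x
    using frechet_derivative_at[OF assms(1)] by simp
  then show ?thesis
    using assms by (auto simp: differentiable_def)
qed

lemma Ck_Suc_has_derivative:
  assumes "Ck (Suc k) f"
  shows "(f has_derivative frechet_derivative f (at x)) (at x)"
  using assms frechet_derivative_works by auto

lemma Ck_Suc_imp_Ck: "Ck (Suc k) f \<Longrightarrow> Ck k f"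
proof (induction k arbitrary: f)
  case 0
  then have "\<And>x. f differentiable (at x)" by simp
  then show ?case
    by (simp add: continuous_at_imp_continuous_on differentiable_imp_continuous_within)
next
  case (Suc k)
  then show ?case by (metis Ck.simps(2))
qed

lemma Ck_imp_continuous: "Ck k f \<Longrightarrow> continuous_on UNIV f"
proof (induction k)
  case 0
  then show ?case by simp
next
  case (Suc k)
  then show ?case using Ck_Suc_imp_Ck by blast
qed

lemma Ck_const: "Ck k (\<lambda>x. c)"
proof (induction k arbitrary: c)
  case 0
  then show ?case by simp
next
  case (Suc k)
  show ?case by (rule Ck_SucI[where f'="\<lambda>x h. 0"]) (use Suc in auto)
qed

lemma Ck_add: "Ck k f \<Longrightarrow> Ck k g \<Longrightarrow> Ck k (\<lambda>x. f x + g x)"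
proof (induction k arbitrary: f g)
  case 0
  then show ?case by (auto intro: continuous_intros)
next
  case (Suc k)
  show ?case
    by (rule Ck_SucI, rule has_derivative_add[OF Ck_Suc_has_derivative Ck_Suc_has_derivative])
      (use Suc in auto)
qed

lemma Ck_bilinear:
  assumes B: "bounded_bilinear B"
  shows "Ck k f \<Longrightarrow> Ck k g \<Longrightarrow> Ck k (\<lambda>x. B (f x) (g x))"
proof (induction k arbitrary: f g)
  case 0
  then show ?case using bounded_bilinear.continuous_on[OF B] by auto
next
  case (Suc k)
  note f = Ck_Suc_has_derivative[OF Suc.prems(1)] and g = Ck_Suc_has_derivative[OF Suc.prems(2)]
  show ?case
  proof (rule Ck_SucI, rule bounded_bilinear.FDERIV[OF B f g])
    show "Ck k (\<lambda>x. B (f x) (frechet_derivative g (at x) h) + B (frechet_derivative f (at x) h) (g x))" for h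
      using Suc.prems Suc.prems[THEN Ck_Suc_imp_Ck] by (intro Ck_add Suc.IH) auto
  qed
qed

lemma Ck_linear:
  assumes L: "bounded_linear L"
  shows "Ck k f \<Longrightarrow> Ck k (\<lambda>x. L (f x))"
proof (induction k arbitrary: f)
  case 0
  then show ?case using bounded_linear.continuous_on[OF L] by auto
next
  case (Suc k)
  show ?case
    by (rule Ck_SucI, rule bounded_linear.has_derivative[OF L Ck_Suc_has_derivative[OF Suc.prems]])
      (use Suc in auto)
qed

lemma Ck_compose_affine:
  assumes L: "bounded_linear L"
  shows "Ck k f \<Longrightarrow> Ck k (\<lambda>x. f (c + L x))"
proof (induction k arbitrary: f)
  case 0
  then show ?case
    by (auto intro!: continuous_on_compose2[of UNIV f] continuous_intros
        bounded_linear.continuous_on[OF L])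
next
  case (Suc k)
  have "((\<lambda>x. f (c + L x)) has_derivative (\<lambda>h. frechet_derivative f (at (c + L x)) (L h))) (at x)" for x
    by (rule has_derivative_compose[OF _ Ck_Suc_has_derivative[OF Suc.prems]])
      (auto intro!: derivative_eq_intros bounded_linear_imp_has_derivative[OF L])
  then show ?case
    by (rule Ck_SucI) (use Suc in auto)
qed

lemma smooth_imp_Ck: "smooth f \<Longrightarrow> Ck k f"
  by (simp add: smooth_def)

lemma smooth_has_derivative: "smooth f \<Longrightarrow> (f has_derivative frechet_derivative f (at x)) (at x)"
  using Ck_Suc_has_derivative[of 0] smooth_imp_Ck by blast

lemma smooth_continuous_on: "smooth f \<Longrightarrow> continuous_on S f"
  using Ck_imp_continuous smooth_imp_Ck continuous_on_subset by blast

lemma smooth_frechet_derivative: "smooth f \<Longrightarrow> smooth (\<lambda>x. frechet_derivative f (at x) h)"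
  unfolding smooth_def by (metis Ck.simps(2))

lemma smooth_const: "smooth (\<lambda>x. c)"
  by (simp add: smooth_def Ck_const)

lemma smooth_add: "smooth f \<Longrightarrow> smooth g \<Longrightarrow> smooth (\<lambda>x. f x + g x)"
  by (simp add: smooth_def Ck_add)

lemma smooth_bilinear:
  "bounded_bilinear B \<Longrightarrow> smooth f \<Longrightarrow> smooth g \<Longrightarrow> smooth (\<lambda>x. B (f x) (g x))"
  by (simp add: smooth_def Ck_bilinear)

lemmas smooth_mult = smooth_bilinear[OF bounded_bilinear_mult]
lemmas smooth_scaleR = smooth_bilinear[OF bounded_bilinear_scaleR]

lemma smooth_linear: "bounded_linear L \<Longrightarrow> smooth f \<Longrightarrow> smooth (\<lambda>x. L (f x))"
  by (simp add: smooth_def Ck_linear)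

lemma smooth_compose_affine: "bounded_linear L \<Longrightarrow> smooth f \<Longrightarrow> smooth (\<lambda>x. f (c + L x))"
  by (simp add: smooth_def Ck_compose_affine)

lemma smooth_compose_linear: "bounded_linear L \<Longrightarrow> smooth f \<Longrightarrow> smooth (\<lambda>x. f (L x))"
  using smooth_compose_affine[of L f 0] by simp

lemma smooth_prod:
  fixes f :: "'i \<Rightarrow> 'a::real_normed_vector \<Rightarrow> real"
  assumes "\<And>i. i \<in> I \<Longrightarrow> smooth (f i)"
  shows "smooth (\<lambda>x. \<Prod>i\<in>I. f i x)"
  using assms by (induction I rule: infinite_finite_induct) (auto intro: smooth_const smooth_mult)

lemma smooth_sum:
  assumes "\<And>i. i \<in> I \<Longrightarrow> smooth (f i)"
  shows "smooth (\<lambda>x. \<Sum>i\<in>I. f i x)"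
  using assms by (induction I rule: infinite_finite_induct) (auto intro: smooth_const smooth_add)

lemma Ck_Suc_real:
  fixes f :: "real \<Rightarrow> real"
  assumes "\<And>x. (f has_real_derivative f' x) (at x)" "Ck k f'"
  shows "Ck (Suc k) f"
proof (rule Ck_SucI)
  show "(f has_derivative (\<lambda>h. f' x * h)) (at x)" for x
    using assms(1)[of x] by (simp add: has_field_derivative_def)
  show "Ck k (\<lambda>x. f' x * h)" for h
    by (intro Ck_bilinear[OF bounded_bilinear_mult] assms Ck_const)
qed

lemma smooth_real_derivative:
  fixes f :: "real \<Rightarrow> real"
  assumes "\<And>x. (f has_real_derivative f' x) (at x)" "smooth f'"
  shows "smooth f"
  unfolding smooth_def
proof
  fix k
  have "Ck (Suc k) f"
    by (rule Ck_Suc_real[OF assms(1)]) (auto intro: smooth_imp_Ck assms)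
  then show "Ck k f" by (rule Ck_Suc_imp_Ck)
qed

lemma smooth_real_has_derivative:
  fixes f :: "real \<Rightarrow> real"
  assumes "smooth f"
  shows "(f has_real_derivative frechet_derivative f (at x) 1) (at x)"
proof -
  let ?D = "frechet_derivative f (at x)"
  have D: "(f has_derivative ?D) (at x)"
    by (rule smooth_has_derivative[OF assms])
  have "?D h = ?D 1 * h" for h
    using linear_scale[OF has_derivative_linear[OF D], of h 1] by simp
  then have "?D = (*) (?D 1)" by (intro ext)
  then show ?thesis
    using D by (simp add: has_field_derivative_def)
qed

section \<open>A smooth step\<close>

text \<open>The polynomial factor makes this family of flat functions closed under differentiation, so that all
  derivatives at \<open>0\<close> are handled at once.\<close>

definition flat_poly_exp :: "real poly \<Rightarrow> real \<Rightarrow> real" where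
  "flat_poly_exp p x = (if x > 0 then poly p (1 / x) * exp (- (1 / x)) else 0)"

lemma poly_exp_tendsto_0: "((\<lambda>y::real. poly p y * exp (- y)) \<longlongrightarrow> 0) at_top"
proof (induction p)
  case 0
  then show ?case by simp
next
  case (pCons a p)
  have "((\<lambda>y::real. a * exp (-y) + (\<Sum>i\<le>degree p. coeff p i * (y ^ Suc i / exp y))) \<longlongrightarrow> a * 0 + (\<Sum>i\<le>degree p. coeff p i * 0)) at_top"
  proof (intro tendsto_intros)
    show "((\<lambda>y::real. exp (-y)) \<longlongrightarrow> 0) at_top"
      by (rule filterlim_compose[OF exp_at_bot filterlim_uminus_at_bot_at_top])
    show "((\<lambda>y::real. y ^ Suc i / exp y) \<longlongrightarrow> 0) at_top" for i
      by (rule tendsto_power_div_exp_0)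
  qed
  moreover have "a * exp (-y) + (\<Sum>i\<le>degree p. coeff p i * (y ^ Suc i / exp y)) = poly (pCons a p) y * exp (- y)" for y
    by (simp add: poly_altdef[of p] algebra_simps sum_distrib_left exp_minus divide_simps)
  ultimately show ?case by simp
qed

lemma flat_poly_exp_has_derivative:
  "(flat_poly_exp p has_real_derivative flat_poly_exp ((p - pderiv p) * [:0, 0, 1:]) x) (at x)"
proof -
  consider "x > 0" | "x < 0" | "x = 0" by linarith
  then show ?thesis
  proof cases
    case 1
    have "((\<lambda>x. poly p (1 / x) * exp (- (1 / x))) has_real_derivative
        flat_poly_exp ((p - pderiv p) * [:0, 0, 1:]) x) (at x)"
      using 1 by (auto intro!: derivative_eq_intros DERIV_chain2[OF poly_DERIV]
          simp: flat_poly_exp_def field_simps power2_eq_square)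
    moreover have "eventually (\<lambda>y. y \<in> {0<..}) (nhds x)"
      using 1 by (intro eventually_nhds_in_open) auto
    then have "eventually (\<lambda>y. flat_poly_exp p y = poly p (1 / y) * exp (- (1 / y))) (nhds x)"
      by (rule eventually_mono) (auto simp: flat_poly_exp_def)
    ultimately show ?thesis by (simp add: DERIV_cong_ev)
  next
    case 2
    have "eventually (\<lambda>y. y \<in> {..<0}) (nhds x)"
      using 2 by (intro eventually_nhds_in_open) auto
    then have "eventually (\<lambda>y. flat_poly_exp p y = 0) (nhds x)"
      by (rule eventually_mono) (auto simp: flat_poly_exp_def)
    then have "(flat_poly_exp p has_real_derivative 0) (at x) \<longleftrightarrow> ((\<lambda>y. 0) has_real_derivative 0) (at x)"
      by (intro DERIV_cong_ev) auto
    then show ?thesis using 2 by (simp add: flat_poly_exp_def)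
  next
    \<comment> \<open>The difference quotient at \<open>0\<close> is again of the form \<open>poly q (1 / h) * exp (- (1 / h))\<close>.\<close>
    case 3
    have "((\<lambda>h. flat_poly_exp p h / h) \<longlongrightarrow> 0) (at_right 0)"
    proof -
      have "((\<lambda>h. poly (pCons 0 p) (inverse h) * exp (- inverse h)) \<longlongrightarrow> 0) (at_right (0::real))"
        by (rule filterlim_compose[OF poly_exp_tendsto_0 filterlim_inverse_at_top_right])
      moreover have "eventually (\<lambda>h. poly (pCons 0 p) (inverse h) * exp (- inverse h)
          = flat_poly_exp p h / h) (at_right (0::real))"
        unfolding eventually_at_right_field flat_poly_exp_def
        by (auto simp: field_simps intro!: exI[of _ 1])
      ultimately show ?thesis by (rule Lim_transform_eventually)
    qed
    moreover have "((\<lambda>h. flat_poly_exp p h / h) \<longlongrightarrow> 0) (at_left 0)"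
      by (rule tendsto_eventually) (auto simp: eventually_at_left_field flat_poly_exp_def intro!: exI[of _ "-1"])
    ultimately have "((\<lambda>h. flat_poly_exp p h / h) \<longlongrightarrow> 0) (at 0)"
      by (simp add: filterlim_at_split)
    then show ?thesis using 3 by (simp add: DERIV_def flat_poly_exp_def)
  qed
qed

lemma smooth_flat_poly_exp: "smooth (flat_poly_exp p)"
proof -
  have "Ck k (flat_poly_exp p)" for k
  proof (induction k arbitrary: p)
    case 0
    show ?case unfolding Ck.simps
      by (rule DERIV_continuous_on) (use flat_poly_exp_has_derivative has_field_derivative_at_within in blast)
  next
    case (Suc k)
    show ?case by (rule Ck_Suc_real[OF flat_poly_exp_has_derivative Suc])
  qed
  then show ?thesis by (simp add: smooth_def)
qed

text \<open>The step is a normalised primitive of the bump \<open>exp (- 1 / x) exp (- 1 / (1 - x))\<close> on \<open>(0, 1)\<close>.\<close>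

lemma smooth_step_exists:
  "\<exists>\<sigma>::real\<Rightarrow>real. smooth \<sigma> \<and> (\<forall>x\<le>0. \<sigma> x = 0) \<and> (\<forall>x\<ge>1. \<sigma> x = 1) \<and> mono \<sigma>"
proof -
  define b where "b x = flat_poly_exp 1 x * flat_poly_exp 1 (1 + - x)" for x
  have sb: "smooth b"
    unfolding b_def
    by (intro smooth_mult smooth_flat_poly_exp smooth_compose_affine bounded_linear_minus bounded_linear_ident)
  have cont: "continuous_on S b" for S using sb by (rule smooth_continuous_on)
  have b0: "b x \<ge> 0" for x by (simp add: b_def flat_poly_exp_def)
  have bz: "b x = 0" if "x \<le> 0 \<or> x \<ge> 1" for x using that by (auto simp: b_def flat_poly_exp_def)
  have "\<exists>F. \<forall>x. (F has_real_derivative b x) (at x)"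
  proof -
    have "\<exists>F. \<forall>x\<in>UNIV. (F has_vector_derivative b x) (at x)"
      using einterval_antiderivative[of "-\<infinity>" \<infinity> b] cont[of UNIV]
      by (auto simp: continuous_on_eq_continuous_at)
    then show ?thesis by (simp add: has_real_derivative_iff_has_vector_derivative)
  qed
  then obtain F where F: "\<And>x. (F has_real_derivative b x) (at x)" by blast
  have mono: "F x \<le> F y" if "x \<le> y" for x y
    using that F b0 by (meson DERIV_nonneg_imp_nondecreasing)
  \<comment> \<open>Otherwise \<open>F\<close> is constant on \<open>(0, 1)\<close> although its derivative is positive there.\<close>
  have lt: "F 0 < F 1"
  proof (rule ccontr)
    assume "\<not> F 0 < F 1"
    then have c: "F x = F 0" if "x \<in> {0<..<1}" for x
      using that mono[of 0 x] mono[of x 1] by auto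
    have "(F has_real_derivative 0) (at (1/2))"
    proof -
      have "eventually (\<lambda>y. y \<in> {0<..<1}) (nhds (1/2::real))"
        by (intro eventually_nhds_in_open) auto
      then have "eventually (\<lambda>y. F y = F 0) (nhds (1/2))"
        by (rule eventually_mono) (use c in auto)
      then have "(F has_real_derivative 0) (at (1/2)) \<longleftrightarrow> ((\<lambda>y. F 0) has_real_derivative 0) (at (1/2))"
        by (intro DERIV_cong_ev) auto
      then show ?thesis by simp
    qed
    from DERIV_unique[OF this F] have "b (1/2) = 0" by simp
    then show False by (simp add: b_def flat_poly_exp_def)
  qed
  have const: "F x = F y" if "convex I" "x \<in> I" "y \<in> I" "\<And>z. z \<in> I \<Longrightarrow> b z = 0" for x y I
  proof -
    have "\<exists>c. \<forall>x\<in>I. F x = c"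
      by (rule has_field_derivative_zero_constant[OF that(1)])
         (metis F has_field_derivative_at_within that(4))
    then show ?thesis using that by auto
  qed
  define \<sigma> where "\<sigma> x = (F x - F 0) / (F 1 - F 0)" for x
  have "smooth \<sigma>"
  proof (rule smooth_real_derivative)
    show "(\<sigma> has_real_derivative b x * inverse (F 1 - F 0)) (at x)" for x
      unfolding \<sigma>_def divide_inverse by (auto intro!: derivative_eq_intros F)
    show "smooth (\<lambda>x. b x * inverse (F 1 - F 0))"
      by (intro smooth_mult sb smooth_const)
  qed
  moreover have "\<sigma> x = 0" if "x \<le> 0" for x
    using const[of "{..0}" x 0] that bz by (auto simp: \<sigma>_def)
  moreover have "\<sigma> x = 1" if "x \<ge> 1" for x
    using const[of "{1..}" x 1] that bz lt by (auto simp: \<sigma>_def)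
  moreover have "mono \<sigma>"
    using mono lt by (auto simp: mono_def \<sigma>_def divide_right_mono)
  ultimately show ?thesis by blast
qed

definition smooth_step :: "real \<Rightarrow> real" where
  "smooth_step = (SOME \<sigma>. smooth \<sigma> \<and> (\<forall>x\<le>0. \<sigma> x = 0) \<and> (\<forall>x\<ge>1. \<sigma> x = 1) \<and> mono \<sigma>)"

lemma
  shows smooth_smooth_step: "smooth smooth_step"
    and smooth_step_eq_0: "x \<le> 0 \<Longrightarrow> smooth_step x = 0"
    and smooth_step_eq_1: "x \<ge> 1 \<Longrightarrow> smooth_step x = 1"
    and mono_smooth_step: "mono smooth_step"
  using someI_ex[OF smooth_step_exists] unfolding smooth_step_def by blast+

lemma smooth_step_bounds: "0 \<le> smooth_step x" "smooth_step x \<le> 1"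
  using mono_smooth_step smooth_step_eq_0[of "min x 0"] smooth_step_eq_1[of "max x 1"]
  by (metis min.cobounded1 min.cobounded2 monoD) (metis max.cobounded1 max.cobounded2 monoD mono_smooth_step smooth_step_eq_1)

section \<open>Square integrable functions\<close>

definition square_integrable :: "'a measure \<Rightarrow> ('a \<Rightarrow> 'b::euclidean_space) \<Rightarrow> bool" where
  "square_integrable M f \<longleftrightarrow> f \<in> borel_measurable M \<and> integrable M (\<lambda>x. (norm (f x))\<^sup>2)"

lemma square_integrableD:
  assumes "square_integrable M f"
  shows "f \<in> borel_measurable M" "integrable M (\<lambda>x. (norm (f x))\<^sup>2)"
  using assms by (auto simp: square_integrable_def)

lemma norm_add_sq_le: "(norm (a + b :: 'b::real_normed_vector))\<^sup>2 \<le> 2 * (norm a)\<^sup>2 + 2 * (norm b)\<^sup>2"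
proof -
  have "(norm (a + b))\<^sup>2 \<le> (norm a + norm b)\<^sup>2"
    by (intro power_mono norm_triangle_ineq) auto
  also have "\<dots> \<le> 2 * (norm a)\<^sup>2 + 2 * (norm b)\<^sup>2"
    using zero_le_power2[of "norm a - norm b"] by (simp add: power2_eq_square algebra_simps)
  finally show ?thesis .
qed

lemma norm_diff_sq_le: "(norm (a - b :: 'b::real_normed_vector))\<^sup>2 \<le> 2 * (norm a)\<^sup>2 + 2 * (norm b)\<^sup>2"
  using norm_add_sq_le[of a "- b"] by simp

lemma square_integrable_bound:
  assumes "f \<in> borel_measurable M" "integrable M g"
    and "AE x in M. (norm (f x))\<^sup>2 \<le> g x"
  shows "square_integrable M f"
  unfolding square_integrable_def
proof
  show "integrable M (\<lambda>x. (norm (f x))\<^sup>2)"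
  proof (rule Bochner_Integration.integrable_bound[OF assms(2)])
    show "AE x in M. norm ((norm (f x))\<^sup>2) \<le> norm (g x)"
      using assms(3) by eventually_elim auto
  qed (use assms(1) in simp)
qed fact

lemma square_integrable_add:
  assumes "square_integrable M f" "square_integrable M g"
  shows "square_integrable M (\<lambda>x. f x + g x)"
  by (rule square_integrable_bound[where g="\<lambda>x. 2 * (norm (f x))\<^sup>2 + 2 * (norm (g x))\<^sup>2"])
    (use assms[THEN square_integrableD(1)] assms[THEN square_integrableD(2)] norm_add_sq_le
      in \<open>auto intro!: AE_I2\<close>)

lemma square_integrable_diff:
  assumes "square_integrable M f" "square_integrable M g"
  shows "square_integrable M (\<lambda>x. f x - g x)"
  by (rule square_integrable_bound[where g="\<lambda>x. 2 * (norm (f x))\<^sup>2 + 2 * (norm (g x))\<^sup>2"])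
    (use assms[THEN square_integrableD(1)] assms[THEN square_integrableD(2)] norm_diff_sq_le
      in \<open>auto intro!: AE_I2\<close>)

lemma square_integrable_inner:
  assumes "square_integrable M f" "square_integrable M g"
  shows "integrable M (\<lambda>x. f x \<bullet> g x)"
proof (rule Bochner_Integration.integrable_bound)
  show "integrable M (\<lambda>x. (norm (f x))\<^sup>2 + (norm (g x))\<^sup>2)"
    using assms[THEN square_integrableD(2)] by simp
  have "\<bar>a \<bullet> b\<bar> \<le> (norm a)\<^sup>2 + (norm b)\<^sup>2" for a b :: 'b
  proof -
    have "\<bar>a \<bullet> b\<bar> \<le> norm a * norm b" by (rule Cauchy_Schwarz_ineq2)
    moreover have "0 \<le> (norm a - norm b)\<^sup>2" by simp
    moreover have "0 \<le> norm a * norm b" by simp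
    ultimately show ?thesis unfolding power2_diff by linarith
  qed
  then show "AE x in M. norm (f x \<bullet> g x) \<le> norm ((norm (f x))\<^sup>2 + (norm (g x))\<^sup>2)"
    by (intro AE_I2) (simp add: order_trans[OF _ abs_ge_self])
qed (use assms[THEN square_integrableD(1)] in simp)

text \<open>The Cauchy--Schwarz inequality, from the discriminant of the nonnegative quadratic
  polynomial \<open>t \<mapsto> \<integral>|f + t g|\<^sup>2\<close>.\<close>

lemma integral_inner_le:
  assumes "square_integrable M f" "square_integrable M g"
  shows "\<bar>LINT x|M. f x \<bullet> g x\<bar> \<le> sqrt (LINT x|M. (norm (f x))\<^sup>2) * sqrt (LINT x|M. (norm (g x))\<^sup>2)"
proof -
  define A B C where "A = (LINT x|M. (norm (f x))\<^sup>2)" and "B = (LINT x|M. (norm (g x))\<^sup>2)"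
    and "C = (LINT x|M. f x \<bullet> g x)"
  have q: "0 \<le> A + t * (2 * C) + t\<^sup>2 * B" for t
  proof -
    have "A + t * (2 * C) + t\<^sup>2 * B = (LINT x|M. (norm (f x))\<^sup>2 + t * (2 * (f x \<bullet> g x)) + t\<^sup>2 * (norm (g x))\<^sup>2)"
      unfolding A_def B_def C_def
      using assms[THEN square_integrableD(2)] square_integrable_inner[OF assms] by simp
    also have "\<dots> = (LINT x|M. (norm (f x + t *\<^sub>R g x))\<^sup>2)"
      by (intro Bochner_Integration.integral_cong refl)
        (simp add: power2_norm_eq_inner inner_add_left inner_add_right inner_commute, simp add: power2_eq_square)
    also have "\<dots> \<ge> 0" by simp
    finally show ?thesis .
  qed
  have AB: "A \<ge> 0" "B \<ge> 0" by (auto simp: A_def B_def)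
  have "C\<^sup>2 \<le> A * B"
  proof (cases "B = 0")
    case True
    have "C = 0"
    proof (rule ccontr)
      assume "C \<noteq> 0"
      then show False using q[of "- (A + 1) / (2 * C)"] True by (simp add: field_simps)
    qed
    then show ?thesis using True by simp
  next
    case False
    then have "0 \<le> (A + (- C / B) * (2 * C) + (- C / B)\<^sup>2 * B) * B"
      using q[of "- C / B"] AB by (intro mult_nonneg_nonneg) auto
    also have "\<dots> = A * B - C\<^sup>2"
      using False by (simp add: field_simps power2_eq_square)
    finally show ?thesis by simp
  qed
  then have "sqrt (C\<^sup>2) \<le> sqrt (A * B)" by (rule real_sqrt_le_mono)
  then show ?thesis by (simp add: real_sqrt_mult A_def B_def C_def)
qed

lemma square_integrable_scaleR:
  assumes "square_integrable M f" "c \<in> borel_measurable M" "\<And>x. \<bar>c x\<bar> \<le> K"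
  shows "square_integrable M (\<lambda>x. c x *\<^sub>R f x)"
proof (rule square_integrable_bound[where g="\<lambda>x. K\<^sup>2 * (norm (f x))\<^sup>2"])
  show "AE x in M. (norm (c x *\<^sub>R f x))\<^sup>2 \<le> K\<^sup>2 * (norm (f x))\<^sup>2"
  proof (intro AE_I2)
    fix x
    have "(norm (c x *\<^sub>R f x))\<^sup>2 = \<bar>c x\<bar>\<^sup>2 * (norm (f x))\<^sup>2" by (simp add: power_mult_distrib)
    also have "\<dots> \<le> K\<^sup>2 * (norm (f x))\<^sup>2"
      by (intro mult_right_mono power_mono assms) auto
    finally show "(norm (c x *\<^sub>R f x))\<^sup>2 \<le> K\<^sup>2 * (norm (f x))\<^sup>2" .
  qed
qed (use assms(2) assms(1)[THEN square_integrableD(1)] assms(1)[THEN square_integrableD(2)] in auto)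

lemma square_integrable_indicator:
  assumes "square_integrable M f" "A \<in> sets M"
  shows "square_integrable M (\<lambda>x. indicator A x *\<^sub>R f x)"
  by (rule square_integrable_scaleR[OF assms(1), where K=1]) (use assms in \<open>auto simp: indicator_def\<close>)

lemma square_integrable_component:
  fixes f :: "'a \<Rightarrow> 'b::euclidean_space ^ 'n"
  assumes "square_integrable M f"
  shows "square_integrable M (\<lambda>x. f x $ i)"
  by (rule square_integrable_bound[where g="\<lambda>x. (norm (f x))\<^sup>2"])
    (use assms square_integrableD in \<open>auto intro!: AE_I2 power_mono Finite_Cartesian_Product.norm_nth_le
      measurable_compose[OF _ borel_measurable_continuous_onI[OF continuous_on_component[OF continuous_on_id]]]\<close>)

section \<open>Integrals over segments\<close>

text \<open>The integral over the segment that ends in \<open>x\<close> and has direction \<open>e\<close>.  As an average of translates it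
  commutes with derivatives and is bounded on \<open>L\<^sup>2\<close>, whatever the direction.\<close>

definition shift_integral ::
    "'a::euclidean_space \<Rightarrow> real \<Rightarrow> ('a \<Rightarrow> 'b::euclidean_space) \<Rightarrow> 'a \<Rightarrow> 'b" where
  "shift_integral e R f x = (LINT s:{0..R}|lborel. f (x - s *\<^sub>R e))"

lemma set_integrable_segment:
  fixes f :: "'a::euclidean_space \<Rightarrow> 'b::euclidean_space"
  assumes "continuous_on UNIV f"
  shows "set_integrable lborel {0..R} (\<lambda>s. f (x - s *\<^sub>R e))"
  by (rule borel_integrable_atLeastAtMost')
    (auto intro!: continuous_on_compose2[OF assms] continuous_intros)

lemma shift_integral_eq_integral:
  fixes f :: "'a::euclidean_space \<Rightarrow> 'b::euclidean_space"
  assumes "continuous_on UNIV f"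
  shows "shift_integral e R f x = integral {0..R} (\<lambda>s. f (x - s *\<^sub>R e))"
  unfolding shift_integral_def
  by (rule set_borel_integral_eq_integral(2)[OF set_integrable_segment[OF assms]])

lemma continuous_on_shift_integral:
  fixes f :: "'a::euclidean_space \<Rightarrow> 'b::euclidean_space"
  assumes "continuous_on UNIV f"
  shows "continuous_on UNIV (shift_integral e R f)"
proof -
  have "continuous_on UNIV (\<lambda>x. integral (cbox 0 R) (\<lambda>s. f (x - s *\<^sub>R e)))"
    by (rule integral_continuous_on_param)
      (auto simp: split_beta intro!: continuous_on_compose2[OF assms] continuous_intros)
  then show ?thesis
    by (simp add: shift_integral_eq_integral[OF assms, abs_def])
qed

text \<open>The Leibniz rule needs the derivative to be continuous as a map into the bounded linear maps; in
  finite dimension this is continuity of the directional derivatives.\<close>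

lemma shift_integral_has_derivative:
  fixes f :: "'a::euclidean_space \<Rightarrow> 'b::euclidean_space"
  assumes f: "Ck (Suc 0) f"
  shows "(shift_integral e R f has_derivative
      (\<lambda>h. shift_integral e R (\<lambda>y. frechet_derivative f (at y) h) x)) (at x)"
proof -
  define D where "D y = Blinfun (frechet_derivative f (at y))" for y
  note der = Ck_Suc_has_derivative[OF f]
  have D: "blinfun_apply (D y) = frechet_derivative f (at y)" for y
    unfolding D_def using der[of y] by (simp add: bounded_linear_Blinfun_apply has_derivative_bounded_linear)
  have contD: "continuous_on UNIV D"
    by (rule continuous_on_blinfun_componentwise) (use f D in simp)
  have contf: "continuous_on UNIV f" using f by (rule Ck_imp_continuous)
  have int: "(\<lambda>s. D (x - s *\<^sub>R e)) integrable_on cbox 0 R" for x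
    by (intro integrable_continuous continuous_on_compose2[OF contD] continuous_intros) auto
  have "((\<lambda>x. integral (cbox 0 R) (\<lambda>s. f (x - s *\<^sub>R e))) has_derivative
      blinfun_apply (integral (cbox 0 R) (\<lambda>s. D (x - s *\<^sub>R e)))) (at x within UNIV)"
  proof (rule leibniz_rule)
    show "((\<lambda>x. f (x - t *\<^sub>R e)) has_derivative blinfun_apply (D (x - t *\<^sub>R e))) (at x within UNIV)" for x t
      unfolding D
      by (rule has_derivative_compose[OF _ der, of "\<lambda>x. x - t *\<^sub>R e" "\<lambda>h. h" x UNIV])
        (auto intro!: derivative_eq_intros)
    show "(\<lambda>s. f (x - s *\<^sub>R e)) integrable_on cbox 0 R" for x
      by (intro integrable_continuous continuous_on_compose2[OF contf] continuous_intros) auto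
    show "continuous_on (UNIV \<times> cbox 0 R) (\<lambda>(x, t). D (x - t *\<^sub>R e))"
      by (auto simp: split_beta intro!: continuous_on_compose2[OF contD] continuous_intros)
  qed auto
  moreover have "blinfun_apply (integral (cbox 0 R) (\<lambda>s. D (x - s *\<^sub>R e))) h
      = shift_integral e R (\<lambda>y. frechet_derivative f (at y) h) x" for h
  proof -
    have "blinfun_apply (integral (cbox 0 R) (\<lambda>s. D (x - s *\<^sub>R e))) h
        = integral (cbox 0 R) (\<lambda>s. blinfun_apply (D (x - s *\<^sub>R e)) h)"
      by (rule blinfun_apply_integral[OF int])
    also have "\<dots> = shift_integral e R (\<lambda>y. frechet_derivative f (at y) h) x"
      using f by (subst shift_integral_eq_integral) (auto simp: D)
    finally show ?thesis .
  qed
  then have "blinfun_apply (integral (cbox 0 R) (\<lambda>s. D (x - s *\<^sub>R e)))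
      = (\<lambda>h. shift_integral e R (\<lambda>y. frechet_derivative f (at y) h) x)" by (rule ext)
  ultimately show ?thesis
    by (simp add: shift_integral_eq_integral[OF contf, abs_def])
qed

lemma Ck_shift_integral:
  fixes f :: "'a::euclidean_space \<Rightarrow> 'b::euclidean_space"
  shows "Ck k f \<Longrightarrow> Ck k (shift_integral e R f)"
proof (induction k arbitrary: f)
  case 0
  then show ?case using continuous_on_shift_integral by auto
next
  case (Suc k)
  have "Ck (Suc 0) f"
    using Suc.prems by (auto intro: Ck_imp_continuous)
  then show ?case
    by (intro Ck_SucI[OF shift_integral_has_derivative] Suc.IH) (use Suc.prems in auto)
qed

lemma smooth_shift_integral:
  fixes f :: "'a::euclidean_space \<Rightarrow> 'b::euclidean_space"
  shows "smooth f \<Longrightarrow> smooth (shift_integral e R f)"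
  by (simp add: smooth_def Ck_shift_integral)

lemma frechet_derivative_shift_integral:
  fixes f :: "'a::euclidean_space \<Rightarrow> 'b::euclidean_space"
  assumes "smooth f"
  shows "frechet_derivative (shift_integral e R f) (at x) h
    = shift_integral e R (\<lambda>y. frechet_derivative f (at y) h) x"
  using frechet_derivative_at[OF shift_integral_has_derivative, of f e R x] assms smooth_imp_Ck by metis

text \<open>A function that vanishes at the initial points of the segments is thus the segment integral of its own
  derivative: the substitute for the Poincare inequality in a slab.\<close>

lemma shift_integral_derivative:
  fixes f :: "'a::euclidean_space \<Rightarrow> 'b::euclidean_space"
  assumes f: "smooth f" and R: "R \<ge> 0"
  shows "shift_integral e R (\<lambda>y. frechet_derivative f (at y) e) x = f x - f (x - R *\<^sub>R e)"
proof -
  have "((\<lambda>s. - f (x - s *\<^sub>R e)) has_vector_derivative frechet_derivative f (at (x - s *\<^sub>R e)) e) (at s within {0..R})" for s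
  proof -
    have "((\<lambda>s. f (x - s *\<^sub>R e)) has_derivative (\<lambda>h. frechet_derivative f (at (x - s *\<^sub>R e)) (- (h *\<^sub>R e)))) (at s within {0..R})"
      by (rule has_derivative_compose[OF _ smooth_has_derivative[OF f]])
        (auto intro!: derivative_eq_intros)
    from has_derivative_minus[OF this] show ?thesis
      unfolding has_vector_derivative_def
      using has_derivative_linear[OF smooth_has_derivative[OF f, of "x - s *\<^sub>R e"]]
      by (simp add: linear_neg linear_scale)
  qed
  then have "((\<lambda>s. frechet_derivative f (at (x - s *\<^sub>R e)) e) has_integral
      (- f (x - R *\<^sub>R e) - - f (x - 0 *\<^sub>R e))) {0..R}"
    by (intro fundamental_theorem_of_calculus R)
  then show ?thesis
    by (subst shift_integral_eq_integral)
      (auto intro!: smooth_continuous_on smooth_frechet_derivative f integral_unique)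
qed

lemma nn_integral_lborel_translate:
  fixes f :: "'a::euclidean_space \<Rightarrow> ennreal"
  assumes [measurable]: "f \<in> borel_measurable borel"
  shows "(\<integral>\<^sup>+x. f (x - c) \<partial>lborel) = (\<integral>\<^sup>+x. f x \<partial>lborel)"
proof -
  have "(\<integral>\<^sup>+x. f x \<partial>lborel) = (\<integral>\<^sup>+x. f x \<partial>distr lborel borel ((+) (- c)))"
    by (simp add: lborel_distr_plus)
  also have "\<dots> = (\<integral>\<^sup>+x. f (- c + x) \<partial>lborel)"
    by (subst nn_integral_distr) auto
  finally show ?thesis by simp
qed

lemma integrable_lborel_translate:
  fixes f :: "'a::euclidean_space \<Rightarrow> 'b::{banach, second_countable_topology}"
  assumes "integrable lborel f"
  shows "integrable lborel (\<lambda>x. f (x - c))"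
proof -
  have "integrable (distr lborel borel ((+) (- c))) f"
    by (simp add: lborel_distr_plus assms)
  then show ?thesis
    by (subst (asm) integrable_distr_eq) (use assms in auto)
qed

lemma integral_lborel_translate:
  fixes f :: "'a::euclidean_space \<Rightarrow> 'b::{banach, second_countable_topology}"
  assumes [measurable]: "f \<in> borel_measurable borel"
  shows "(LINT x|lborel. f (x - c)) = (LINT x|lborel. f x)"
proof -
  have "(LINT x|lborel. f x) = (LINT x|distr lborel borel ((+) (- c)). f x)"
    by (simp add: lborel_distr_plus)
  also have "\<dots> = (LINT x|lborel. f (- c + x))"
    by (subst integral_distr) auto
  finally show ?thesis by simp
qed

lemma AE_lborel_translate:
  fixes P :: "'a::euclidean_space \<Rightarrow> bool"
  assumes "AE x in lborel. P x"
  shows "AE x in lborel. P (x - c)"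
proof -
  have "AE x in distr lborel borel ((+) (- c)). P x"
    by (subst lborel_distr_plus) (rule assms)
  then have "AE x in lborel. P (- c + x)"
    by (rule AE_distrD[rotated]) simp
  then show ?thesis by simp
qed

lemma borel_measurable_shift_integral[measurable]:
  fixes f :: "'a::euclidean_space \<Rightarrow> 'b::euclidean_space"
  assumes [measurable]: "f \<in> borel_measurable borel"
  shows "shift_integral e R f \<in> borel_measurable borel"
  unfolding shift_integral_def[abs_def] set_lebesgue_integral_def by measurable

text \<open>Stated with nonnegative integrals so that it can be integrated over base points before anything is
  known about integrability along the individual segments.\<close>

lemma norm_set_integral_sq_le:
  fixes g :: "real \<Rightarrow> 'b::euclidean_space"
  assumes R: "R \<ge> 0" and [measurable]: "g \<in> borel_measurable borel"
  shows "ennreal ((norm (LINT s:{0..R}|lborel. g s))\<^sup>2)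
    \<le> ennreal R * (\<integral>\<^sup>+s. ennreal ((norm (g s))\<^sup>2) * indicator {0..R} s \<partial>lborel)"
proof (cases "(\<integral>\<^sup>+s. ennreal ((norm (g s))\<^sup>2) * indicator {0..R} s \<partial>lborel) = \<infinity>")
  case True
  show ?thesis
  proof (cases "R = 0")
    case True
    have "(LINT s:{0..R}|lborel. g s) = 0"
    proof -
      have "AE s in lborel. indicator {0..R} s *\<^sub>R g s = 0"
        using AE_lborel_singleton[of 0] by eventually_elim (use True in \<open>auto simp: indicator_def\<close>)
      then show ?thesis unfolding set_lebesgue_integral_def by (simp add: integral_eq_zero_AE)
    qed
    then show ?thesis by simp
  next
    case False
    then show ?thesis using True R by (simp add: ennreal_mult_top)
  qed
next
  case False
  define h where "h s = indicator {0..R} s *\<^sub>R norm (g s)" for s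
  have hm[measurable]: "h \<in> borel_measurable borel" unfolding h_def by measurable
  have eq: "ennreal ((norm (h s))\<^sup>2) = ennreal ((norm (g s))\<^sup>2) * indicator {0..R} s" for s
    by (auto simp: h_def indicator_def)
  have sq: "square_integrable lborel h"
    unfolding square_integrable_def using False
    unfolding integrable_iff_bounded by (simp add: eq[unfolded real_norm_def power2_abs] top.not_eq_extremum)
  have sq1: "square_integrable lborel (indicator {0..R} :: real \<Rightarrow> real)"
  proof (rule square_integrable_bound)
    show "integrable lborel (indicator {0..R} :: real \<Rightarrow> real)" using R by simp
  qed (auto simp: indicator_def)
  have "norm (LINT s:{0..R}|lborel. g s) \<le> (LINT s|lborel. h s \<bullet> indicator {0..R} s)"
  proof -
    have "norm (LINT s:{0..R}|lborel. g s) \<le> (LINT s|lborel. norm (indicator {0..R} s *\<^sub>R g s))"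
      unfolding set_lebesgue_integral_def by (rule integral_norm_bound)
    also have "\<dots> = (LINT s|lborel. h s \<bullet> indicator {0..R} s)"
      by (intro Bochner_Integration.integral_cong) (auto simp: h_def indicator_def)
    finally show ?thesis .
  qed
  also have "\<dots> \<le> sqrt (LINT s|lborel. (norm (h s))\<^sup>2) * sqrt (LINT s|lborel. (norm (indicator {0..R} s :: real))\<^sup>2)"
    using integral_inner_le[OF sq sq1] by simp
  also have "(LINT s|lborel. (norm (indicator {0..R} s :: real))\<^sup>2) = R"
  proof -
    have "(LINT s|lborel. (norm (indicator {0..R} s :: real))\<^sup>2) = (LINT s|lborel. indicator {0..R} s)"
      by (intro Bochner_Integration.integral_cong) (auto simp: indicator_def)
    then show ?thesis using R by simp
  qed
  finally have "(norm (LINT s:{0..R}|lborel. g s))\<^sup>2 \<le> (sqrt (LINT s|lborel. (norm (h s))\<^sup>2) * sqrt R)\<^sup>2"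
    by (intro power_mono) auto
  also have "\<dots> = R * (LINT s|lborel. (norm (h s))\<^sup>2)"
    using R by (simp add: power_mult_distrib)
  finally have "ennreal ((norm (LINT s:{0..R}|lborel. g s))\<^sup>2) \<le> ennreal (R * (LINT s|lborel. (norm (h s))\<^sup>2))"
    by (rule ennreal_leI)
  also have "\<dots> = ennreal R * (\<integral>\<^sup>+s. ennreal ((norm (h s))\<^sup>2) \<partial>lborel)"
    using R sq by (subst nn_integral_eq_integral) (auto simp: ennreal_mult square_integrable_def)
  finally show ?thesis by (simp only: eq)
qed

text \<open>Averaging over translates: Cauchy--Schwarz on the segment, then Tonelli and the translation
  invariance of Lebesgue measure.\<close>

lemma nn_integral_segment:
  fixes f :: "'a::euclidean_space \<Rightarrow> ennreal"
  assumes R: "a \<le> b" and [measurable]: "f \<in> borel_measurable borel"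
  shows "(\<integral>\<^sup>+x. (\<integral>\<^sup>+s. f (x - s *\<^sub>R e) * indicator {a..b} s \<partial>lborel) \<partial>lborel)
    = ennreal (b - a) * (\<integral>\<^sup>+x. f x \<partial>lborel)"
proof -
  have "(\<integral>\<^sup>+x. (\<integral>\<^sup>+s. f (x - s *\<^sub>R e) * indicator {a..b} s \<partial>lborel) \<partial>lborel)
      = (\<integral>\<^sup>+s. (\<integral>\<^sup>+x. f (x - s *\<^sub>R e) * indicator {a..b} s \<partial>lborel) \<partial>lborel)"
    by (rule lborel_pair.Fubini'[symmetric]) measurable
  also have "\<dots> = (\<integral>\<^sup>+s. (\<integral>\<^sup>+x. f x \<partial>lborel) * indicator {a..b} (s::real) \<partial>lborel)"
    by (intro nn_integral_cong) (simp add: nn_integral_multc nn_integral_lborel_translate)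
  also have "\<dots> = ennreal (b - a) * (\<integral>\<^sup>+x. f x \<partial>lborel)"
    using R by (simp add: nn_integral_cmult_indicator mult.commute)
  finally show ?thesis .
qed

lemma nn_integral_shift_integral_le:
  fixes f :: "'a::euclidean_space \<Rightarrow> 'b::euclidean_space"
  assumes R: "R \<ge> 0" and [measurable]: "f \<in> borel_measurable borel"
  shows "(\<integral>\<^sup>+x. ennreal ((norm (shift_integral e R f x))\<^sup>2) \<partial>lborel)
    \<le> ennreal (R\<^sup>2) * (\<integral>\<^sup>+x. ennreal ((norm (f x))\<^sup>2) \<partial>lborel)"
proof -
  have "(\<integral>\<^sup>+x. ennreal ((norm (shift_integral e R f x))\<^sup>2) \<partial>lborel)
      \<le> (\<integral>\<^sup>+x. ennreal R * (\<integral>\<^sup>+s. ennreal ((norm (f (x - s *\<^sub>R e)))\<^sup>2) * indicator {0..R} s \<partial>lborel) \<partial>lborel)"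
    unfolding shift_integral_def by (intro nn_integral_mono norm_set_integral_sq_le R) measurable
  also have "\<dots> = ennreal R * (ennreal (R - 0) * (\<integral>\<^sup>+x. ennreal ((norm (f x))\<^sup>2) \<partial>lborel))"
    by (subst nn_integral_cmult, measurable, subst nn_integral_segment) (use R in auto)
  also have "\<dots> = ennreal (R\<^sup>2) * (\<integral>\<^sup>+x. ennreal ((norm (f x))\<^sup>2) \<partial>lborel)"
    using R by (simp add: ennreal_mult power2_eq_square mult.assoc)
  finally show ?thesis .
qed

lemma
  fixes f :: "'a::euclidean_space \<Rightarrow> 'b::euclidean_space"
  assumes R: "R \<ge> 0" and f: "square_integrable lborel f"
  shows square_integrable_shift_integral: "square_integrable lborel (shift_integral e R f)"
    and integral_shift_integral_sq_le:
      "(LINT x|lborel. (norm (shift_integral e R f x))\<^sup>2) \<le> R\<^sup>2 * (LINT x|lborel. (norm (f x))\<^sup>2)"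
proof -
  have [measurable]: "f \<in> borel_measurable borel" using f by (simp add: square_integrable_def)
  have "(\<integral>\<^sup>+x. ennreal ((norm (f x))\<^sup>2) \<partial>lborel) = ennreal (LINT x|lborel. (norm (f x))\<^sup>2)"
    using f by (intro nn_integral_eq_integral) (auto simp: square_integrable_def)
  with nn_integral_shift_integral_le[OF R, of f e]
  have le: "(\<integral>\<^sup>+x. ennreal ((norm (shift_integral e R f x))\<^sup>2) \<partial>lborel)
      \<le> ennreal (R\<^sup>2 * (LINT x|lborel. (norm (f x))\<^sup>2))"
    by (simp add: ennreal_mult)
  show sq: "square_integrable lborel (shift_integral e R f)"
    unfolding square_integrable_def integrable_iff_bounded
    using le_less_trans[OF le] by auto
  have "ennreal (LINT x|lborel. (norm (shift_integral e R f x))\<^sup>2)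
      = (\<integral>\<^sup>+x. ennreal ((norm (shift_integral e R f x))\<^sup>2) \<partial>lborel)"
    using sq by (intro nn_integral_eq_integral[symmetric]) (auto simp: square_integrable_def)
  with le show "(LINT x|lborel. (norm (shift_integral e R f x))\<^sup>2) \<le> R\<^sup>2 * (LINT x|lborel. (norm (f x))\<^sup>2)"
    by (metis ennreal_le_iff integral_nonneg_AE AE_I2 mult_nonneg_nonneg zero_le_power2)
qed

text \<open>Tonelli: a square integrable function is square integrable on the segments at almost every base
  point, and on a bounded interval square integrability implies integrability.\<close>

lemma AE_set_integrable_segment:
  fixes f :: "'a::euclidean_space \<Rightarrow> 'b::euclidean_space"
  assumes R: "a \<le> b" and f: "square_integrable lborel f"
  shows "AE x in lborel. set_integrable lborel {a..b} (\<lambda>s. (norm (f (x - s *\<^sub>R e)))\<^sup>2) \<and>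
    set_integrable lborel {a..b} (\<lambda>s. f (x - s *\<^sub>R e))"
proof -
  have [measurable]: "f \<in> borel_measurable borel" using f by (simp add: square_integrable_def)
  have "(\<integral>\<^sup>+x. (\<integral>\<^sup>+s. ennreal ((norm (f (x - s *\<^sub>R e)))\<^sup>2) * indicator {a..b} s \<partial>lborel) \<partial>lborel) \<noteq> \<infinity>"
    using R f by (subst nn_integral_segment)
      (auto simp: square_integrable_def integrable_iff_bounded ennreal_mult_eq_top_iff)
  then have "AE x in lborel. (\<integral>\<^sup>+s. ennreal ((norm (f (x - s *\<^sub>R e)))\<^sup>2) * indicator {a..b} s \<partial>lborel) \<noteq> \<infinity>"
    by (intro nn_integral_noteq_infinite) auto
  then show ?thesis
  proof (rule AE_mp, intro AE_I2 impI conjI)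
    fix x
    assume fin: "(\<integral>\<^sup>+s. ennreal ((norm (f (x - s *\<^sub>R e)))\<^sup>2) * indicator {a..b} s \<partial>lborel) \<noteq> \<infinity>"
    have eq: "ennreal (norm (indicat_real {a..b} s *\<^sub>R (norm (f (x - s *\<^sub>R e)))\<^sup>2))
        = ennreal ((norm (f (x - s *\<^sub>R e)))\<^sup>2) * indicator {a..b} s" for s
      by (auto simp: indicator_def)
    show 1: "set_integrable lborel {a..b} (\<lambda>s. (norm (f (x - s *\<^sub>R e)))\<^sup>2)"
      unfolding set_integrable_def integrable_iff_bounded eq using fin
      by (auto simp: top.not_eq_extremum)
    have 2: "integrable lborel (\<lambda>s. indicat_real {a..b} s *\<^sub>R (1 + (norm (f (x - s *\<^sub>R e)))\<^sup>2))"
      using Bochner_Integration.integrable_add[OF _ 1[unfolded set_integrable_def], of "indicat_real {a..b}"] R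
      by (simp add: algebra_simps)
    have le: "norm y \<le> 1 + (norm y)\<^sup>2" for y :: 'b
      using zero_le_power2[of "norm y - 1"] norm_ge_zero[of y] unfolding power2_diff one_power2 by linarith
    show "set_integrable lborel {a..b} (\<lambda>s. f (x - s *\<^sub>R e))"
      unfolding set_integrable_def
      by (rule Bochner_Integration.integrable_bound[OF 2]) (auto simp: indicator_def le)
  qed
qed

lemma AE_shift_integral_diff:
  fixes f g :: "'a::euclidean_space \<Rightarrow> 'b::euclidean_space"
  assumes "R \<ge> 0" "square_integrable lborel f" "square_integrable lborel g"
  shows "AE x in lborel. shift_integral e R (\<lambda>y. f y - g y) x = shift_integral e R f x - shift_integral e R g x"
  using AE_set_integrable_segment[OF assms(1,2), of e] AE_set_integrable_segment[OF assms(1,3), of e]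
  by eventually_elim (auto simp: shift_integral_def set_integral_diff)

lemma integral_shift_integral:
  fixes f :: "'a::euclidean_space \<Rightarrow> 'b::euclidean_space"
  assumes R: "R \<ge> 0" and f: "integrable lborel f"
  shows "(LINT x|lborel. shift_integral e R f x) = R *\<^sub>R (LINT x|lborel. f x)"
proof -
  have [measurable]: "f \<in> borel_measurable borel" using f by auto
  have int: "integrable (lborel \<Otimes>\<^sub>M lborel) (\<lambda>(x, s). indicat_real {0..R} s *\<^sub>R f (x - s *\<^sub>R e))"
    unfolding integrable_iff_bounded
  proof
    have "(\<integral>\<^sup>+z. ennreal (norm (case z of (x, s) \<Rightarrow> indicat_real {0..R} s *\<^sub>R f (x - s *\<^sub>R e))) \<partial>(lborel \<Otimes>\<^sub>M lborel))
        = (\<integral>\<^sup>+x. (\<integral>\<^sup>+s. ennreal (norm (indicat_real {0..R} s *\<^sub>R f (x - s *\<^sub>R e))) \<partial>lborel) \<partial>lborel)"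
      by (subst lborel.nn_integral_fst[symmetric]) (auto simp: split_beta)
    also have "\<dots> = (\<integral>\<^sup>+x. (\<integral>\<^sup>+s. ennreal (norm (f (x - s *\<^sub>R e))) * indicator {0..R} s \<partial>lborel) \<partial>lborel)"
      by (intro nn_integral_cong) (auto simp: indicator_def)
    also have "\<dots> = ennreal (R - 0) * (\<integral>\<^sup>+x. ennreal (norm (f x)) \<partial>lborel)"
      using R by (rule nn_integral_segment) auto
    also have "\<dots> < \<infinity>"
      using f by (simp add: integrable_iff_bounded ennreal_mult_less_top)
    finally show "(\<integral>\<^sup>+z. ennreal (norm (case z of (x, s) \<Rightarrow> indicat_real {0..R} s *\<^sub>R f (x - s *\<^sub>R e))) \<partial>(lborel \<Otimes>\<^sub>M lborel)) < \<infinity>" .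
  qed measurable
  have "(LINT x|lborel. shift_integral e R f x) = (LINT s|lborel. LINT x|lborel. indicat_real {0..R} s *\<^sub>R f (x - s *\<^sub>R e))"
    unfolding shift_integral_def set_lebesgue_integral_def
    using lborel_pair.Fubini_integral[OF int] by simp
  also have "\<dots> = (LINT s|lborel. indicat_real {0..R} s *\<^sub>R (LINT x|lborel. f x))"
    by (intro Bochner_Integration.integral_cong) (simp_all add: integral_lborel_translate)
  also have "\<dots> = R *\<^sub>R (LINT x|lborel. f x)"
    using R by simp
  finally show ?thesis .
qed

section \<open>Test functions\<close>

lemma test_functionI:
  fixes f :: "'a::real_normed_vector \<Rightarrow> 'b::real_normed_vector"
  assumes "smooth f" "compact K" "K \<subseteq> U" "\<And>x. x \<notin> K \<Longrightarrow> f x = 0"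
  shows "test_function U f"
proof -
  have "closure {x. f x \<noteq> 0} \<subseteq> K"
    using assms by (intro closure_minimal) (auto intro: compact_imp_closed)
  moreover from this have "compact (closure {x. f x \<noteq> 0})"
    using assms(2) by (metis closed_closure compact_Int_closed inf.absorb_iff2)
  ultimately show ?thesis using assms by (auto simp: test_function_def)
qed

lemma test_functionE:
  fixes f :: "'a::real_normed_vector \<Rightarrow> 'b::real_normed_vector"
  assumes "test_function U f"
  obtains K where "compact K" "K \<subseteq> U" "\<And>x. x \<notin> K \<Longrightarrow> f x = 0" "smooth f"
proof
  show "compact (closure {x. f x \<noteq> 0})" "closure {x. f x \<noteq> 0} \<subseteq> U" "smooth f"
    using assms by (auto simp: test_function_def)
  show "f x = 0" if "x \<notin> closure {x. f x \<noteq> 0}" for x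
    using that subsetD[OF closure_subset, of x "{x. f x \<noteq> 0}"] by auto
qed

lemma test_function_smooth: "test_function U f \<Longrightarrow> smooth f"
  by (simp add: test_function_def)

lemma test_function_mono: "test_function U f \<Longrightarrow> U \<subseteq> V \<Longrightarrow> test_function V f"
  by (auto simp: test_function_def)

lemma test_function_zero: "test_function U f \<Longrightarrow> x \<notin> U \<Longrightarrow> f x = 0"
  by (elim test_functionE) auto

lemma frechet_derivative_zero_outside:
  fixes f :: "'a::real_normed_vector \<Rightarrow> 'b::real_normed_vector"
  assumes "closed K" "\<And>x. x \<notin> K \<Longrightarrow> f x = 0" "x \<notin> K"
  shows "frechet_derivative f (at x) = (\<lambda>h. 0)"
proof -
  have "((\<lambda>x. 0) has_derivative (\<lambda>h. 0)) (at x)" by simp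
  then have "(f has_derivative (\<lambda>h. 0)) (at x)"
    by (rule has_derivative_transform_within_open[of _ _ _ _ "- K"]) (use assms in auto)
  then show ?thesis by (rule frechet_derivative_at[symmetric])
qed

lemma test_function_derivative:
  fixes f :: "'a::real_normed_vector \<Rightarrow> 'b::real_normed_vector"
  assumes "test_function U f"
  shows "test_function U (\<lambda>x. frechet_derivative f (at x) h)"
  using assms
proof (rule test_functionE)
  fix K assume K: "compact K" "K \<subseteq> U" "\<And>x. x \<notin> K \<Longrightarrow> f x = 0" "smooth f"
  show ?thesis
    by (rule test_functionI[OF smooth_frechet_derivative[OF K(4)] K(1,2)])
      (simp add: frechet_derivative_zero_outside[OF compact_imp_closed[OF K(1)] K(3)])
qed

lemma test_function_linear:
  fixes f :: "'a::real_normed_vector \<Rightarrow> 'b::real_normed_vector"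
  assumes "bounded_linear L" "test_function U f"
  shows "test_function U (\<lambda>x. L (f x))"
  using assms(2)
proof (rule test_functionE)
  fix K assume K: "compact K" "K \<subseteq> U" "\<And>x. x \<notin> K \<Longrightarrow> f x = 0" "smooth f"
  show ?thesis
    by (rule test_functionI[OF smooth_linear[OF assms(1) K(4)] K(1,2)])
      (simp add: K(3) linear_0[OF bounded_linear.linear[OF assms(1)]])
qed

lemma test_function_add:
  fixes f g :: "'a::real_normed_vector \<Rightarrow> 'b::real_normed_vector"
  assumes "test_function U f" "test_function U g"
  shows "test_function U (\<lambda>x. f x + g x)"
proof -
  obtain K L where "compact K" "K \<subseteq> U" "\<And>x. x \<notin> K \<Longrightarrow> f x = 0" "smooth f"
    "compact L" "L \<subseteq> U" "\<And>x. x \<notin> L \<Longrightarrow> g x = 0" "smooth g"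
    using assms test_functionE by metis
  then show ?thesis
    by (intro test_functionI[of _ "K \<union> L"] smooth_add compact_Un) auto
qed

lemma test_function_sum:
  fixes f :: "'i \<Rightarrow> 'a::real_normed_vector \<Rightarrow> 'b::real_normed_vector"
  assumes "\<And>i. i \<in> I \<Longrightarrow> test_function U (f i)"
  shows "test_function U (\<lambda>x. \<Sum>i\<in>I. f i x)"
proof -
  have "test_function U (\<lambda>x. 0 :: 'b)"
    by (rule test_functionI[of _ "{}"]) (auto simp: smooth_const)
  then show ?thesis
    using assms by (induction I rule: infinite_finite_induct) (auto intro: test_function_add)
qed

lemma test_function_bilinear:
  fixes f :: "'a::real_normed_vector \<Rightarrow> 'b::real_normed_vector"
  assumes B: "bounded_bilinear B" and f: "smooth f" and g: "test_function U g"
  shows "test_function U (\<lambda>x. B (f x) (g x))"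
  using g
proof (rule test_functionE)
  fix K assume K: "compact K" "K \<subseteq> U" "\<And>x. x \<notin> K \<Longrightarrow> g x = 0" "smooth g"
  show ?thesis
    by (rule test_functionI[OF smooth_bilinear[OF B f K(4)] K(1,2)])
      (simp add: K(3) bounded_bilinear.zero_right[OF B])
qed

lemmas test_function_mult = test_function_bilinear[OF bounded_bilinear_mult]

lemma test_function_component:
  "test_function U f \<Longrightarrow> test_function U (\<lambda>x. f x $ i)"
  by (rule test_function_linear[OF bounded_linear_vec_nth])

lemma test_function_bounded_integrable:
  fixes f :: "'a::euclidean_space \<Rightarrow> 'b::euclidean_space"
  assumes "test_function U f"
  shows "integrable lborel f" "square_integrable lborel f" "\<exists>C. \<forall>x. norm (f x) \<le> C"
    "continuous_on UNIV f"
proof -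
  obtain K where "compact K" "K \<subseteq> U" "\<And>x. x \<notin> K \<Longrightarrow> f x = 0" "smooth f"
    using test_functionE[OF assms] by metis
  note K = this(1,3,4)
  show cont: "continuous_on UNIV f" using K smooth_continuous_on by blast
  have "integrable lborel (\<lambda>x. indicator K x *\<^sub>R f x)"
    using K by (intro borel_integrable_compact smooth_continuous_on)
  moreover have "(\<lambda>x. indicator K x *\<^sub>R f x) = f"
    using K by (auto simp: indicator_def fun_eq_iff)
  ultimately show "integrable lborel f" by simp
  have "integrable lborel (\<lambda>x. indicator K x *\<^sub>R (norm (f x))\<^sup>2)"
    using K by (intro borel_integrable_compact continuous_intros smooth_continuous_on)
  moreover have "(\<lambda>x. indicator K x *\<^sub>R (norm (f x))\<^sup>2) = (\<lambda>x. (norm (f x))\<^sup>2)"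
    using K by (auto simp: indicator_def fun_eq_iff)
  ultimately show "square_integrable lborel f"
    using cont by (auto simp: square_integrable_def intro!: borel_measurable_continuous_onI)
  have "bounded (f ` K)"
    using K by (intro compact_imp_bounded compact_continuous_image smooth_continuous_on)
  then obtain C where "\<And>x. x \<in> K \<Longrightarrow> norm (f x) \<le> C" by (auto simp: bounded_iff)
  then show "\<exists>C. \<forall>x. norm (f x) \<le> C"
    using K(2) by (intro exI[of _ "max C 0"]) (metis max.coboundedI1 max.cobounded2 norm_zero)
qed

lemma test_function_shift_integral:
  fixes f :: "'a::euclidean_space \<Rightarrow> 'b::euclidean_space"
  assumes f: "test_function U f" and inv: "\<And>x s. x \<in> U \<Longrightarrow> s \<in> {0..R} \<Longrightarrow> x + s *\<^sub>R e \<in> V"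
  shows "test_function V (shift_integral e R f)"
  using f
proof (rule test_functionE)
  fix K assume K: "compact K" "K \<subseteq> U" "\<And>x. x \<notin> K \<Longrightarrow> f x = 0" "smooth f"
  define K' where "K' = (\<lambda>(x, s). x + s *\<^sub>R e) ` (K \<times> {0..R})"
  show ?thesis
  proof (rule test_functionI)
    show "smooth (shift_integral e R f)" using K smooth_shift_integral by blast
    show "compact K'"
      unfolding K'_def
      by (intro compact_continuous_image compact_Times K)
        (auto simp: split_beta intro!: continuous_intros)
    show "K' \<subseteq> V" using K inv by (force simp: K'_def)
    show "shift_integral e R f x = 0" if "x \<notin> K'" for x
    proof -
      have "f (x - s *\<^sub>R e) = 0" if "s \<in> {0..R}" for s
      proof (rule K(3), rule notI)
        assume "x - s *\<^sub>R e \<in> K"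
        then have "x \<in> K'" unfolding K'_def using that
          by (intro image_eqI[of _ _ "(x - s *\<^sub>R e, s)"]) auto
        then show False using \<open>x \<notin> K'\<close> by blast
      qed
      then have "shift_integral e R f x = (LINT s:{0..R}|lborel. 0)"
        unfolding shift_integral_def by (intro set_lebesgue_integral_cong) auto
      then show ?thesis by (simp add: set_lebesgue_integral_def)
    qed
  qed
qed

text \<open>Averaging over translates does not change the integral, and the average of a derivative over a segment
  is a difference of two translates of the function, which have the same integral.\<close>

lemma integral_derivative_test_function:
  fixes f :: "'a::euclidean_space \<Rightarrow> 'b::euclidean_space"
  assumes f: "test_function U f"
  shows "(LINT x|lborel. frechet_derivative f (at x) e) = 0"
proof -
  note int = test_function_bounded_integrable(1)[OF f]
    and intD = test_function_bounded_integrable(1)[OF test_function_derivative[OF f]]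
  have "(LINT x|lborel. frechet_derivative f (at x) e)
      = (LINT x|lborel. shift_integral e 1 (\<lambda>x. frechet_derivative f (at x) e) x)"
    using integral_shift_integral[OF _ intD, of 1] by simp
  also have "\<dots> = (LINT x|lborel. f x - f (x - 1 *\<^sub>R e))"
    using f by (simp add: shift_integral_derivative test_function_def)
  also have "\<dots> = 0"
    using int integrable_lborel_translate[OF int] integral_lborel_translate[of f] by simp
  finally show ?thesis .
qed

section \<open>Functions determined by their pairings with test functions\<close>

text \<open>Products of one-dimensional steps.  Each factor stays zero up to distance \<open>1 / c n\<close> from its face,
  which keeps the support inside the open box.\<close>

lemma box_bump_exists:
  fixes a b :: "real^'n"
  shows "\<exists>\<psi>. (\<forall>n::nat. test_function (box a b) (\<psi> n) \<and> (\<forall>x. 0 \<le> \<psi> n x \<and> \<psi> n x \<le> 1))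
    \<and> (\<forall>x. (\<lambda>n. \<psi> n x) \<longlonglongrightarrow> indicat_real (box a b) x)"
proof -
  define c where "c n = real (Suc n)" for n
  define \<psi> where "\<psi> n x = (\<Prod>i\<in>UNIV. smooth_step ((-1 - c n * a $ i) + c n * x $ i) *
      smooth_step ((-1 + c n * b $ i) + (- c n) * x $ i))" for n and x :: "real^'n"
  have c0: "c n > 0" for n by (simp add: c_def)
  have nz: "a $ i + 1 / c n \<le> x $ i \<and> x $ i \<le> b $ i - 1 / c n" if "\<psi> n x \<noteq> 0" for n x i
  proof -
    have "smooth_step ((-1 - c n * a $ i) + c n * x $ i) \<noteq> 0"
      "smooth_step ((-1 + c n * b $ i) + (- c n) * x $ i) \<noteq> 0"
      using that by (auto simp: \<psi>_def)
    then have "(-1 - c n * a $ i) + c n * x $ i > 0" "(-1 + c n * b $ i) + (- c n) * x $ i > 0"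
      using smooth_step_eq_0 not_le by blast+
    then show ?thesis using c0[of n] by (simp add: field_simps)
  qed
  have "test_function (box a b) (\<psi> n)" for n
  proof (rule test_functionI)
    show "smooth (\<psi> n)"
      unfolding \<psi>_def
      by (intro smooth_prod smooth_mult smooth_compose_affine smooth_smooth_step
          bounded_linear_const_mult bounded_linear_vec_nth)
    let ?K = "cbox (\<chi> i. a $ i + 1 / c n) (\<chi> i. b $ i - 1 / c n)"
    show "compact ?K" by (rule compact_cbox)
    show "?K \<subseteq> box a b"
      using c0[of n] by (auto simp: mem_box_cart) (smt (verit) divide_pos_pos)+
    show "\<psi> n x = 0" if "x \<notin> ?K" for x
      using nz[of n x] that by (auto simp: mem_box_cart)
  qed
  moreover have "0 \<le> \<psi> n x \<and> \<psi> n x \<le> 1" for n x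
    unfolding \<psi>_def using smooth_step_bounds
    by (auto intro!: prod_nonneg prod_le_1 mult_nonneg_nonneg mult_le_one)
  moreover have "(\<lambda>n. \<psi> n x) \<longlonglongrightarrow> indicator (box a b) x" for x
  proof (cases "x \<in> box a b")
    case False
    have "\<psi> n x = 0" for n
    proof (rule ccontr)
      assume "\<psi> n x \<noteq> 0"
      then have "x \<in> box a b"
        using nz[of n x] c0[of n] unfolding mem_box_cart by (smt (verit) divide_pos_pos)
      then show False using False by blast
    qed
    then show ?thesis using False by simp
  next
    case True
    have lim: "filterlim c at_top sequentially"
      unfolding c_def by (rule filterlim_compose[OF filterlim_real_sequentially filterlim_Suc])
    have "eventually (\<lambda>n. smooth_step ((-1 - c n * a $ i) + c n * x $ i) *
      smooth_step ((-1 + c n * b $ i) + (- c n) * x $ i) = 1) sequentially" for i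
    proof -
      have p: "x $ i - a $ i > 0" "b $ i - x $ i > 0" using True by (auto simp: mem_box_cart)
      have "eventually (\<lambda>n. c n \<ge> 2 / (x $ i - a $ i)) sequentially"
        "eventually (\<lambda>n. c n \<ge> 2 / (b $ i - x $ i)) sequentially"
        using lim by (auto simp: filterlim_at_top)
      then show ?thesis
      proof eventually_elim
        case (elim n)
        then have "(-1 - c n * a $ i) + c n * x $ i \<ge> 1" "(-1 + c n * b $ i) + (- c n) * x $ i \<ge> 1"
          using p by (auto simp: field_simps)
        then show ?case by (simp only: smooth_step_eq_1)
      qed
    qed
    then have "eventually (\<lambda>n. \<forall>i\<in>UNIV. smooth_step ((-1 - c n * a $ i) + c n * x $ i) *
      smooth_step ((-1 + c n * b $ i) + (- c n) * x $ i) = 1) sequentially"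
      by (intro eventually_ball_finite) auto
    then have "eventually (\<lambda>n. \<psi> n x = 1) sequentially"
      by eventually_elim (simp add: \<psi>_def)
    then show ?thesis using True by (simp add: tendsto_eventually)
  qed
  ultimately show ?thesis by blast
qed

lemma square_integrable_indicator_const:
  assumes "emeasure M A < \<infinity>" "A \<in> sets M"
  shows "square_integrable M (indicat_real A)"
proof (rule square_integrable_bound)
  show "integrable M (indicat_real A)" using assms by (simp add: integrable_indicator_iff)
qed (use assms in \<open>auto simp: indicator_def\<close>)

lemma integral_box_eq_0:
  fixes d :: "real^'n \<Rightarrow> real"
  assumes d: "square_integrable lborel d" and "box a b \<subseteq> S"
    and "\<And>\<psi>. test_function S \<psi> \<Longrightarrow> (LINT x|lborel. d x * \<psi> x) = 0"
  shows "(LINT x|lborel. d x * indicat_real (box a b) x) = 0"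
proof -
  obtain \<psi> where \<psi>: "\<And>n::nat. test_function (box a b) (\<psi> n)" "\<And>n x. 0 \<le> \<psi> n x \<and> \<psi> n x \<le> 1"
    "\<And>x. (\<lambda>n. \<psi> n x) \<longlonglongrightarrow> indicat_real (box a b) x"
    using box_bump_exists[of a b] by blast
  have [measurable]: "d \<in> borel_measurable borel" using d by (simp add: square_integrable_def)
  have [measurable]: "\<psi> n \<in> borel_measurable borel" for n
    using test_function_bounded_integrable(1)[OF \<psi>(1)] by auto
  have "(\<lambda>n. LINT x|lborel. d x * \<psi> n x) \<longlonglongrightarrow> (LINT x|lborel. d x * indicat_real (box a b) x)"
  proof (rule integral_dominated_convergence)
    have "integrable lborel (\<lambda>x. d x * indicat_real (box a b) x)"
      using square_integrable_inner[OF d square_integrable_indicator_const[of lborel "box a b"]]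
      by (simp add: emeasure_lborel_box_eq)
    then show "integrable lborel (\<lambda>x. norm (d x * indicat_real (box a b) x))" by (rule integrable_norm)
    show "AE x in lborel. norm (d x * \<psi> n x) \<le> norm (d x * indicat_real (box a b) x)" for n
    proof (intro AE_I2)
      fix x
      show "norm (d x * \<psi> n x) \<le> norm (d x * indicat_real (box a b) x)"
        using \<psi>(2)[of n x] test_function_zero[OF \<psi>(1), of x n]
        by (cases "x \<in> box a b") (auto simp: abs_mult intro: mult_left_le)
    qed
  qed (auto intro!: AE_I2 tendsto_intros \<psi>(3))
  moreover have "(LINT x|lborel. d x * \<psi> n x) = 0" for n
    using assms(3) test_function_mono[OF \<psi>(1) assms(2)] by blast
  ultimately show ?thesis by (simp add: LIMSEQ_const_iff)
qed

text \<open>By approximation with test functions the positive and the negative part of \<open>d\<close> have the same integral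
  over every box; boxes are stable under intersection and generate the Borel sets, so the two densities
  define the same measure.\<close>

lemma AE_eq_0_if_test_orthogonal:
  fixes d :: "real^'n \<Rightarrow> real"
  assumes d: "square_integrable lborel d" and S: "open S"
    and orth: "\<And>\<psi>. test_function S \<psi> \<Longrightarrow> (LINT x|lborel. d x * \<psi> x) = 0"
  shows "AE x in lborel. x \<in> S \<longrightarrow> d x = 0"
proof -
  have [measurable]: "d \<in> borel_measurable borel" using d by (simp add: square_integrable_def)
  have box: "AE x in lborel. x \<in> box a b \<longrightarrow> d x = 0" if ab: "box a b \<subseteq> S" for a b
  proof -
    define p m where "p x = ennreal (max 0 (d x)) * indicator (box a b) x"
      and "m x = ennreal (max 0 (- d x)) * indicator (box a b) x" for x
    have [measurable]: "p \<in> borel_measurable lborel" "m \<in> borel_measurable lborel"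
      unfolding p_def m_def by measurable
    have dB: "integrable lborel (\<lambda>x. d x * indicat_real (box u v) x)" for u v
      using square_integrable_inner[OF d square_integrable_indicator_const[of lborel "box u v"]]
      by (simp add: emeasure_lborel_box_eq)
    have P: "emeasure (density lborel p) (box u v) = ennreal (LINT x|lborel. max 0 (d x * indicat_real (box u v \<inter> box a b) x))" for u v
    proof -
      have "emeasure (density lborel p) (box u v) = (\<integral>\<^sup>+x. ennreal (max 0 (d x * indicat_real (box u v \<inter> box a b) x)) \<partial>lborel)"
        by (auto simp: emeasure_density p_def indicator_def intro!: nn_integral_cong)
      also have "\<dots> = ennreal (LINT x|lborel. max 0 (d x * indicat_real (box u v \<inter> box a b) x))"
        using dB unfolding box_Int_box by (intro nn_integral_eq_integral) auto
      finally show ?thesis .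
    qed
    have Mi: "emeasure (density lborel m) (box u v) = ennreal (LINT x|lborel. max 0 (- (d x * indicat_real (box u v \<inter> box a b) x)))" for u v
    proof -
      have "emeasure (density lborel m) (box u v) = (\<integral>\<^sup>+x. ennreal (max 0 (- (d x * indicat_real (box u v \<inter> box a b) x))) \<partial>lborel)"
        by (auto simp: emeasure_density m_def indicator_def intro!: nn_integral_cong)
      also have "\<dots> = ennreal (LINT x|lborel. max 0 (- (d x * indicat_real (box u v \<inter> box a b) x)))"
        using dB unfolding box_Int_box by (intro nn_integral_eq_integral) auto
      finally show ?thesis .
    qed
    have "density lborel p = density lborel m"
    proof (rule measure_eqI_generator_eq)
      let ?E = "range (\<lambda>(a, b). box a b::(real^'n) set)"
      show "Int_stable ?E"
        by (auto simp: Int_stable_def box_Int_box)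
      show "?E \<subseteq> Pow UNIV" "sets (density lborel p) = sigma_sets UNIV ?E"
        "sets (density lborel m) = sigma_sets UNIV ?E"
        by (simp_all add: borel_eq_box)
      let ?A = "\<lambda>n::nat. box (- (real n *\<^sub>R One)) (real n *\<^sub>R One) :: (real^'n) set"
      show "range ?A \<subseteq> ?E" "(\<Union>i. ?A i) = UNIV"
        unfolding UN_box_eq_UNIV by auto
      show "emeasure (density lborel p) (?A i) \<noteq> \<infinity>" for i by (simp add: P)
      show "emeasure (density lborel p) X = emeasure (density lborel m) X" if X: "X \<in> ?E" for X
      proof -
        from X obtain u v where uv: "X = box u v" by auto
        let ?q = "\<lambda>x. d x * indicat_real (box u v \<inter> box a b) x"
        have i: "integrable lborel ?q" using dB by (simp add: box_Int_box)
        have "(LINT x|lborel. ?q x) = 0"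
          unfolding box_Int_box
          by (rule integral_box_eq_0[OF d _ orth]) (use ab in \<open>auto simp: box_Int_box[symmetric]\<close>)
        moreover have "(LINT x|lborel. ?q x) = (LINT x|lborel. max 0 (?q x) - max 0 (- ?q x))"
          by (intro Bochner_Integration.integral_cong) auto
        ultimately have "(LINT x|lborel. max 0 (?q x)) = (LINT x|lborel. max 0 (- ?q x))"
          using i by (simp add: integrable_max)
        then show ?thesis by (simp add: P Mi uv)
      qed
    qed
    moreover have "(\<integral>\<^sup>+x. p x \<partial>lborel) \<noteq> \<infinity>"
    proof -
      have "(\<integral>\<^sup>+x. p x \<partial>lborel) = (\<integral>\<^sup>+x. p x * indicator (box a b) x \<partial>lborel)"
        by (intro nn_integral_cong) (auto simp: p_def indicator_def)
      also have "\<dots> = emeasure (density lborel p) (box a b)"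
        by (subst emeasure_density) auto
      finally show ?thesis by (simp add: P)
    qed
    ultimately have "AE x in lborel. p x = m x"
      by (subst (asm) finite_density_unique) auto
    then show ?thesis
    proof eventually_elim
      case (elim x)
      show ?case
      proof
        assume "x \<in> box a b"
        then have "ennreal (max 0 (d x)) = ennreal (max 0 (- d x))" using elim by (simp add: p_def m_def)
        then have "max 0 (d x) = max 0 (- d x)" by (subst (asm) ennreal_inj) auto
        then show "d x = 0" by (auto simp: max_def split: if_splits)
      qed
    qed
  qed
  obtain D where D: "countable D" "D \<subseteq> Pow S" "\<And>X. X \<in> D \<Longrightarrow> \<exists>a b. X = box a b" "\<Union>D = S"
    using open_countable_Union_open_box[OF S] by metis
  have "AE x in lborel. \<forall>X\<in>D. x \<in> X \<longrightarrow> d x = 0"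
  proof (subst AE_ball_countable[OF D(1)], intro ballI)
    fix X assume "X \<in> D"
    then obtain a b where "X = box a b" "box a b \<subseteq> S" using D by blast
    then show "AE x in lborel. x \<in> X \<longrightarrow> d x = 0" using box by simp
  qed
  then show ?thesis
    by eventually_elim (use D(4) in auto)
qed

lemma integral_tail_tendsto_0:
  fixes f :: "'a \<Rightarrow> 'b::euclidean_space"
  assumes f: "square_integrable M f" and [measurable]: "\<And>n. A n \<in> sets M"
    and "\<And>x. x \<in> space M \<Longrightarrow> eventually (\<lambda>n. x \<notin> A n) sequentially"
  shows "(\<lambda>n. LINT x|M. (norm (indicat_real (A n) x *\<^sub>R f x))\<^sup>2) \<longlonglongrightarrow> 0"
proof -
  have [measurable]: "f \<in> borel_measurable M" using f by (simp add: square_integrable_def)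
  have "(\<lambda>n. LINT x|M. (norm (indicat_real (A n) x *\<^sub>R f x))\<^sup>2) \<longlonglongrightarrow> (LINT x|M. 0)"
  proof (rule integral_dominated_convergence)
    show "integrable M (\<lambda>x. (norm (f x))\<^sup>2)" using f by (simp add: square_integrable_def)
    show "AE x in M. norm ((norm (indicat_real (A n) x *\<^sub>R f x))\<^sup>2) \<le> (norm (f x))\<^sup>2" for n
      by (intro AE_I2) (auto simp: indicator_def)
    show "AE x in M. (\<lambda>n. (norm (indicat_real (A n) x *\<^sub>R f x))\<^sup>2) \<longlonglongrightarrow> 0"
    proof (intro AE_I2 tendsto_eventually)
      fix x assume "x \<in> space M"
      from assms(3)[OF this] show "eventually (\<lambda>n. (norm (indicat_real (A n) x *\<^sub>R f x))\<^sup>2 = 0) sequentially"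
        by eventually_elim auto
    qed
  qed measurable
  then show ?thesis by simp
qed

text \<open>A square integrable function cannot be invariant under translations unless it vanishes: the
  pairing with \<open>\<psi>\<close> equals the pairing with all translates of \<open>\<psi>\<close>, because their difference is
  a derivative of a test function, and the latter tends to zero.\<close>

lemma AE_eq_0_if_weakly_constant_along:
  fixes d :: "real^'n \<Rightarrow> real" and e :: "real^'n"
  assumes d: "square_integrable lborel d" and S: "open S" and e: "norm e = 1"
    and inv: "\<And>x s. x \<in> S \<Longrightarrow> x + s *\<^sub>R e \<in> S"
    and orth: "\<And>\<psi>. test_function S \<psi> \<Longrightarrow> (LINT x|lborel. d x * frechet_derivative \<psi> (at x) e) = 0"
  shows "AE x in lborel. x \<in> S \<longrightarrow> d x = 0"
proof (rule AE_eq_0_if_test_orthogonal[OF d S])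
  fix \<psi> :: "real^'n \<Rightarrow> real" assume \<psi>: "test_function S \<psi>"
  have [measurable]: "d \<in> borel_measurable borel" using d by (simp add: square_integrable_def)
  note sq = test_function_bounded_integrable(2)[OF \<psi>]
  have [measurable]: "\<psi> \<in> borel_measurable borel" using sq by (simp add: square_integrable_def)
  have sqt: "square_integrable lborel (\<lambda>x. \<psi> (x - c))" for c
    using sq integrable_lborel_translate[of "\<lambda>x. (norm (\<psi> x))\<^sup>2" c] by (auto simp: square_integrable_def)
  have eq: "(LINT x|lborel. d x * \<psi> x) = (LINT x|lborel. d x * \<psi> (x - real n *\<^sub>R e))" for n
  proof -
    let ?Q = "shift_integral e (real n) \<psi>"
    have "test_function S ?Q"
      using \<psi> inv by (rule test_function_shift_integral)
    then have "0 = (LINT x|lborel. d x * frechet_derivative ?Q (at x) e)" using orth by simp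
    also have "\<dots> = (LINT x|lborel. d x * \<psi> x - d x * \<psi> (x - real n *\<^sub>R e))"
      using test_function_smooth[OF \<psi>]
      by (simp add: frechet_derivative_shift_integral shift_integral_derivative algebra_simps)
    also have "\<dots> = (LINT x|lborel. d x * \<psi> x) - (LINT x|lborel. d x * \<psi> (x - real n *\<^sub>R e))"
      using square_integrable_inner[OF d sq] square_integrable_inner[OF d sqt] by simp
    finally show ?thesis by simp
  qed
  obtain K where "compact K" "K \<subseteq> S" "\<And>x. x \<notin> K \<Longrightarrow> \<psi> x = 0" "smooth \<psi>"
    using test_functionE[OF \<psi>] by metis
  note K = this(1,3)
  from K(1) obtain r where r: "\<And>x. x \<in> K \<Longrightarrow> norm x \<le> r"
    using compact_imp_bounded bounded_iff by metis
  define A where "A n = {x::real^'n. real n - r \<le> norm x}" for n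
  have Am[measurable]: "A n \<in> sets lborel" for n unfolding A_def by measurable
  have le: "\<bar>LINT x|lborel. d x * \<psi> x\<bar> \<le> sqrt (LINT x|lborel. (norm (indicat_real (A n) x *\<^sub>R d x))\<^sup>2) * sqrt (LINT x|lborel. (norm (\<psi> x))\<^sup>2)" for n
  proof -
    have "d x * \<psi> (x - real n *\<^sub>R e) = (indicat_real (A n) x *\<^sub>R d x) \<bullet> \<psi> (x - real n *\<^sub>R e)" for x
    proof (cases "x \<in> A n")
      case False
      then have "norm x < real n - r" by (simp add: A_def)
      moreover have "norm (real n *\<^sub>R e) \<le> norm x + norm (x - real n *\<^sub>R e)"
        by (metis norm_minus_commute norm_triangle_sub)
      ultimately have "x - real n *\<^sub>R e \<notin> K" using r[of "x - real n *\<^sub>R e"] e by auto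
      then show ?thesis using K by simp
    qed simp
    then have "(LINT x|lborel. d x * \<psi> x) = (LINT x|lborel. (indicat_real (A n) x *\<^sub>R d x) \<bullet> \<psi> (x - real n *\<^sub>R e))"
      using eq[of n] by (simp only:)
    then show ?thesis
      using integral_inner_le[OF square_integrable_indicator[OF d Am, of n] sqt[of "real n *\<^sub>R e"]]
        integral_lborel_translate[of "\<lambda>x. (norm (\<psi> x))\<^sup>2" "real n *\<^sub>R e"] by simp
  qed
  have "(\<lambda>n. LINT x|lborel. (norm (indicat_real (A n) x *\<^sub>R d x))\<^sup>2) \<longlonglongrightarrow> 0"
  proof (rule integral_tail_tendsto_0[OF d])
    fix x :: "real^'n"
    have "eventually (\<lambda>n. real n > norm x + r) sequentially"
      using filterlim_real_sequentially by (auto simp: filterlim_at_top_dense)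
    then show "eventually (\<lambda>n. x \<notin> A n) sequentially"
      by eventually_elim (auto simp: A_def)
  qed measurable
  then have "(\<lambda>n. sqrt (LINT x|lborel. (norm (indicat_real (A n) x *\<^sub>R d x))\<^sup>2) * sqrt (LINT x|lborel. (norm (\<psi> x))\<^sup>2)) \<longlonglongrightarrow> sqrt 0 * sqrt (LINT x|lborel. (norm (\<psi> x))\<^sup>2)"
    by (intro tendsto_intros)
  then have "\<bar>LINT x|lborel. d x * \<psi> x\<bar> \<le> sqrt 0 * sqrt (LINT x|lborel. (norm (\<psi> x))\<^sup>2)"
    by (rule LIMSEQ_le_const) (use le in blast)
  then show "(LINT x|lborel. d x * \<psi> x) = 0" by simp
qed

section \<open>Matrices\<close>

definition outer :: "real^'m \<Rightarrow> real^'n \<Rightarrow> real^'n^'m" where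
  "outer a b = (\<chi> i j. a $ i * b $ j)"

lemma inner_matrix_eq: "A \<bullet> B = (\<Sum>i\<in>UNIV. \<Sum>j\<in>UNIV. A $ i $ j * B $ i $ j)"
  for A B :: "real^'n^'m"
  by (simp add: inner_vec_def)

lemma matrix_vector_inner: "(A *v b) \<bullet> a = A \<bullet> outer a b" for A :: "real^'n^'m"
  by (simp add: inner_matrix_eq inner_vec_def matrix_vector_mult_def outer_def sum_distrib_right
      sum_distrib_left ac_simps)

lemma norm_outer: "norm (outer a b) = norm a * norm b"
proof -
  have "(norm (outer a b))\<^sup>2 = (norm a)\<^sup>2 * (norm b)\<^sup>2"
    unfolding power2_norm_eq_inner inner_matrix_eq inner_vec_def outer_def sum_product
    by (intro sum.cong) (simp_all add: ac_simps)
  then have "(norm (outer a b))\<^sup>2 = (norm a * norm b)\<^sup>2" by (simp add: power_mult_distrib)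
  then show ?thesis by (rule power2_eq_imp_eq) auto
qed

lemma norm_matrix_vector_le: "norm (A *v b) \<le> norm A * norm b" for A :: "real^'n^'m"
proof -
  have "norm (A *v b) * norm (A *v b) = A \<bullet> outer (A *v b) b"
    by (metis matrix_vector_inner power2_eq_square power2_norm_eq_inner)
  also have "\<dots> \<le> norm A * norm (outer (A *v b) b)" by (rule norm_cauchy_schwarz)
  also have "\<dots> = (norm A * norm b) * norm (A *v b)" by (simp add: norm_outer)
  finally show ?thesis
    by (cases "norm (A *v b) = 0") (auto simp: mult_le_cancel_right)
qed

lemma norm_sq_columns: "(norm A)\<^sup>2 = (\<Sum>j\<in>UNIV. (norm (column j A))\<^sup>2)" for A :: "real^'n^'m"
proof -
  have "(norm A)\<^sup>2 = (\<Sum>i\<in>UNIV. \<Sum>j\<in>UNIV. A $ i $ j * A $ i $ j)"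
    unfolding power2_norm_eq_inner by (rule inner_matrix_eq)
  also have "\<dots> = (\<Sum>j\<in>UNIV. \<Sum>i\<in>UNIV. A $ i $ j * A $ i $ j)" by (rule sum.swap)
  finally show ?thesis
    unfolding power2_norm_eq_inner by (simp add: inner_vec_def column_def)
qed

lemma norm_column_le: "norm (column j A) \<le> norm A" for A :: "real^'n^'m"
proof -
  have "(norm (column j A))\<^sup>2 \<le> (\<Sum>j\<in>UNIV. (norm (column j A))\<^sup>2)"
    by (rule member_le_sum) auto
  then show ?thesis using norm_sq_columns[of A] by (metis norm_ge_zero power2_le_imp_le)
qed

lemma bounded_linear_column: "bounded_linear (column j :: real^'n^'m \<Rightarrow> real^'m)"
  by (rule bounded_linear_intro[where K=1])
    (auto simp: column_def vec_eq_iff norm_column_le[unfolded column_def])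

lemma bounded_bilinear_matrix_vector: "bounded_bilinear ((*v) :: real^'n^'m \<Rightarrow> real^'n \<Rightarrow> real^'m)"
proof (rule bounded_bilinear.intro)
  show "\<exists>K. \<forall>A (b :: real^'n). norm (A *v b :: real^'m) \<le> norm A * norm b * K"
    by (intro exI[of _ 1]) (simp add: norm_matrix_vector_le)
qed (auto simp: matrix_vector_mult_def vec_eq_iff algebra_simps sum.distrib sum_distrib_left)

lemma bounded_bilinear_outer: "bounded_bilinear (outer :: real^'m \<Rightarrow> real^'n \<Rightarrow> real^'n^'m)"
  by (rule bounded_bilinear.intro)
    (auto simp: outer_def vec_eq_iff algebra_simps intro!: exI[of _ 1] norm_outer[unfolded outer_def, THEN eq_refl])

lemma borel_measurable_linear:
  assumes "bounded_linear L" "f \<in> borel_measurable M"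
  shows "(\<lambda>x. L (f x)) \<in> borel_measurable M"
  using measurable_compose[OF assms(2) borel_measurable_continuous_onI]
    bounded_linear.continuous_on[OF assms(1) continuous_on_id] by blast

lemma borel_measurable_bilinear:
  fixes B :: "'a::{second_countable_topology,real_normed_vector} \<Rightarrow> 'b::{second_countable_topology,real_normed_vector} \<Rightarrow> 'c::real_normed_vector"
  assumes "bounded_bilinear B" "f \<in> borel_measurable M" "g \<in> borel_measurable M"
  shows "(\<lambda>x. B (f x) (g x)) \<in> borel_measurable M"
  using assms(2,3)
  by (rule borel_measurable_continuous_Pair)
    (intro bounded_bilinear.continuous_on[OF assms(1)] continuous_intros)

lemmas borel_measurable_nth[measurable] = borel_measurable_linear[OF bounded_linear_vec_nth]
lemmas borel_measurable_column[measurable] = borel_measurable_linear[OF bounded_linear_column]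
lemmas borel_measurable_matrix_vector[measurable] = borel_measurable_bilinear[OF bounded_bilinear_matrix_vector]
lemmas borel_measurable_outer[measurable] = borel_measurable_bilinear[OF bounded_bilinear_outer]

lemma jacobian_nth:
  fixes f :: "real^'n \<Rightarrow> real^'m"
  shows "jacobian f (at x) $ i $ j = frechet_derivative f (at x) (axis j 1) $ i"
  by (simp add: jacobian_def matrix_def)

lemma column_jacobian:
  fixes f :: "real^'n \<Rightarrow> real^'m"
  shows "column j (jacobian f (at x)) = frechet_derivative f (at x) (axis j 1)"
  by (simp add: column_def jacobian_nth)

lemma smooth_matrixI:
  fixes F :: "'a::real_normed_vector \<Rightarrow> real^'n^'m"
  assumes "\<And>j. smooth (\<lambda>x. column j (F x))"
  shows "smooth F"
proof -
  have "F = (\<lambda>x. \<Sum>j\<in>UNIV. outer (column j (F x)) (axis j 1))"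
    by (auto simp: fun_eq_iff vec_eq_iff outer_def column_def axis_def if_distrib cong: if_cong)
  moreover have "smooth (\<lambda>x. \<Sum>j\<in>UNIV. outer (column j (F x)) (axis j 1))"
    by (intro smooth_sum smooth_bilinear[OF bounded_bilinear_outer] assms smooth_const)
  ultimately show ?thesis by simp
qed

lemma test_function_jacobian:
  fixes f :: "real^'n \<Rightarrow> real^'m"
  assumes f: "test_function U f"
  shows "test_function U (\<lambda>x. jacobian f (at x))"
proof -
  obtain K where K: "compact K" "K \<subseteq> U" "\<And>x. x \<notin> K \<Longrightarrow> f x = 0" "smooth f"
    using test_functionE[OF f] by metis
  show ?thesis
  proof (rule test_functionI[OF _ K(1,2)])
    show "smooth (\<lambda>x. jacobian f (at x))"
      using K by (intro smooth_matrixI) (simp add: column_jacobian smooth_frechet_derivative)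
    show "jacobian f (at x) = 0" if "x \<notin> K" for x
      by (simp add: vec_eq_iff jacobian_nth frechet_derivative_zero_outside[OF compact_imp_closed[OF K(1)] K(3) that])
  qed
qed

lemma jacobian_mult_vector:
  fixes f :: "real^'n \<Rightarrow> real^'m"
  assumes "f differentiable (at x)"
  shows "jacobian f (at x) *v h = frechet_derivative f (at x) h"
  using frechet_derivative_at[OF jacobian_works[THEN iffD1, OF assms]] by metis

section \<open>Convergence of pairings\<close>

lemma integral_inner_tendsto:
  assumes a: "\<And>n. square_integrable M (a n)" "square_integrable M a'"
    and b: "\<And>n. square_integrable M (b n)" "square_integrable M b'"
    and lim: "(\<lambda>n. LINT x|M. (norm (a n x - a' x))\<^sup>2) \<longlonglongrightarrow> 0"
      "(\<lambda>n. LINT x|M. (norm (b n x - b' x))\<^sup>2) \<longlonglongrightarrow> 0"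
  shows "(\<lambda>n. LINT x|M. a n x \<bullet> b n x) \<longlonglongrightarrow> (LINT x|M. a' x \<bullet> b' x)"
proof -
  define A B where "A n = sqrt (LINT x|M. (norm (a n x - a' x))\<^sup>2)"
    and "B n = sqrt (LINT x|M. (norm (b n x - b' x))\<^sup>2)" for n
  define a0 b0 where "a0 = sqrt (LINT x|M. (norm (a' x))\<^sup>2)" and "b0 = sqrt (LINT x|M. (norm (b' x))\<^sup>2)"
  have le: "\<bar>(LINT x|M. a n x \<bullet> b n x) - (LINT x|M. a' x \<bullet> b' x)\<bar> \<le> A n * B n + A n * b0 + a0 * B n" for n
  proof -
    note da = square_integrable_diff[OF a(1)[of n] a(2)] and db = square_integrable_diff[OF b(1)[of n] b(2)]
    have "(LINT x|M. a n x \<bullet> b n x) - (LINT x|M. a' x \<bullet> b' x)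
      = (LINT x|M. (a n x - a' x) \<bullet> (b n x - b' x)) + (LINT x|M. (a n x - a' x) \<bullet> b' x)
        + (LINT x|M. a' x \<bullet> (b n x - b' x))"
      using square_integrable_inner[OF a(1)[of n] b(1)[of n]] square_integrable_inner[OF a(1)[of n] b(2)]
        square_integrable_inner[OF a(2) b(1)[of n]] square_integrable_inner[OF a(2) b(2)]
      by (simp add: inner_diff_left inner_diff_right)
    then show ?thesis
      using integral_inner_le[OF da db] integral_inner_le[OF da b(2)] integral_inner_le[OF a(2) db]
      unfolding A_def B_def a0_def b0_def by linarith
  qed
  have "A \<longlonglongrightarrow> 0" "B \<longlonglongrightarrow> 0"
    unfolding A_def B_def using tendsto_real_sqrt[OF lim(1)] tendsto_real_sqrt[OF lim(2)] by simp_all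
  then have "(\<lambda>n. A n * B n + A n * b0 + a0 * B n) \<longlonglongrightarrow> 0 * 0 + 0 * b0 + a0 * 0"
    by (intro tendsto_intros)
  then have lim0: "(\<lambda>n. A n * B n + A n * b0 + a0 * B n) \<longlonglongrightarrow> 0" by simp
  have "(\<lambda>n. (LINT x|M. a n x \<bullet> b n x) - (LINT x|M. a' x \<bullet> b' x)) \<longlonglongrightarrow> 0"
    by (rule Lim_null_comparison[OF _ lim0]) (use le in simp)
  then show ?thesis by (rule LIM_zero_cancel)
qed

lemma integral_inner_tendsto_left:
  assumes "\<And>n. square_integrable M (a n)" "square_integrable M a'" "square_integrable M b"
    and "(\<lambda>n. LINT x|M. (norm (a n x - a' x))\<^sup>2) \<longlonglongrightarrow> 0"
  shows "(\<lambda>n. LINT x|M. a n x \<bullet> b x) \<longlonglongrightarrow> (LINT x|M. a' x \<bullet> b x)"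
  by (rule integral_inner_tendsto) (use assms in auto)

section \<open>Solenoidal fields approximated in the gradient norm\<close>

text \<open>An abstract form of a field in \<open>V \<inter> L\<^sup>2\<close>: \<open>U\<close> and \<open>G\<close> are Borel versions of the field and of its weak
  gradient, extended by zero, so that translations and integration by parts may be carried out on the
  whole space.  Note that \<open>f\<close> is assumed to converge only in the gradient norm.\<close>

locale grad_approximable =
  fixes U :: "real^3 \<Rightarrow> real^3" and G :: "real^3 \<Rightarrow> real^3^3" and f :: "nat \<Rightarrow> real^3 \<Rightarrow> real^3"
  assumes U: "square_integrable lborel U" and G: "square_integrable lborel G"
    and U_outside: "\<And>x. x \<notin> half_space \<Longrightarrow> U x = 0" and G_outside: "\<And>x. x \<notin> half_space \<Longrightarrow> G x = 0"
    and weak: "\<And>\<psi> i j. test_function half_space \<psi> \<Longrightarrow>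
      (LINT x|lborel. U x $ i * frechet_derivative \<psi> (at x) (axis j 1)) = - (LINT x|lborel. G x $ i $ j * \<psi> x)"
    and f: "\<And>n. solenoidal_test (f n)"
    and f_G: "(\<lambda>n. LINT x|lborel. (norm (jacobian (f n) (at x) - G x))\<^sup>2) \<longlonglongrightarrow> 0"

abbreviation e3 :: "real^3" where "e3 \<equiv> axis 3 1"

definition below :: "real \<Rightarrow> (real^3) set" where "below R = {x. x $ 3 < R}"

lemma below_measurable[measurable]: "below R \<in> sets borel"
  unfolding below_def by measurable

lemma half_space_measurable[measurable]: "half_space \<in> sets borel"
  unfolding half_space_def by measurable

lemma open_half_space: "open half_space"
  unfolding half_space_def by (intro open_Collect_less continuous_intros)

lemma integral_by_parts_test:
  fixes g \<psi> :: "'a::euclidean_space \<Rightarrow> real"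
  assumes g: "smooth g" and \<psi>: "test_function S \<psi>"
  shows "(LINT x|lborel. g x * frechet_derivative \<psi> (at x) e)
    = - (LINT x|lborel. frechet_derivative g (at x) e * \<psi> x)"
proof -
  note s\<psi> = test_function_smooth[OF \<psi>]
  have d: "frechet_derivative (\<lambda>x. g x * \<psi> x) (at x) e
      = g x * frechet_derivative \<psi> (at x) e + frechet_derivative g (at x) e * \<psi> x" for x
    using frechet_derivative_at[OF has_derivative_mult[OF smooth_has_derivative[OF g] smooth_has_derivative[OF s\<psi>]], of x]
    by metis
  have "0 = (LINT x|lborel. frechet_derivative (\<lambda>x. g x * \<psi> x) (at x) e)"
    by (rule integral_derivative_test_function[symmetric, OF test_function_mult[OF g \<psi>]])
  also have "\<dots> = (LINT x|lborel. g x * frechet_derivative \<psi> (at x) e)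
      + (LINT x|lborel. frechet_derivative g (at x) e * \<psi> x)"
    unfolding d
    by (intro Bochner_Integration.integral_add test_function_bounded_integrable(1)[OF test_function_mult[OF g test_function_derivative[OF \<psi>]]]
        test_function_bounded_integrable(1)[OF test_function_mult[OF smooth_frechet_derivative[OF g] \<psi>]])
  finally show ?thesis by simp
qed

lemma frechet_derivative_nth:
  fixes f :: "'a::real_normed_vector \<Rightarrow> real^'n"
  assumes "smooth f"
  shows "frechet_derivative (\<lambda>x. f x $ i) (at x) h = frechet_derivative f (at x) h $ i"
  using frechet_derivative_at[OF bounded_linear.has_derivative[OF bounded_linear_vec_nth smooth_has_derivative[OF assms]], of x i]
  by metis

context grad_approximable
begin

lemma f_test: "test_function half_space (f n)"
  using f by (simp add: solenoidal_test_def)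

lemma f_smooth: "smooth (f n)"
  using f_test test_function_smooth by blast

lemma U_measurable[measurable]: "U \<in> borel_measurable borel"
  and G_measurable[measurable]: "G \<in> borel_measurable borel"
  using U G by (auto simp: square_integrable_def)

definition err :: "nat \<Rightarrow> real" where
  "err n = (LINT x|lborel. (norm (jacobian (f n) (at x) - G x))\<^sup>2)"

lemma err_tendsto: "err \<longlonglongrightarrow> 0"
  using f_G by (simp add: err_def[abs_def])

lemma Df_square_integrable: "square_integrable lborel (\<lambda>x. jacobian (f n) (at x))"
  using test_function_bounded_integrable(2)[OF test_function_jacobian[OF f_test]] .

lemma column_G: "square_integrable lborel (\<lambda>x. column j (G x))"
  by (rule square_integrable_bound[where g="\<lambda>x. (norm (G x))\<^sup>2"])
    (use G in \<open>auto simp: square_integrable_def intro!: AE_I2 power_mono norm_column_le\<close>)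

lemma column_Df: "square_integrable lborel (\<lambda>x. frechet_derivative (f n) (at x) h)"
  by (rule test_function_bounded_integrable(2)[OF test_function_derivative[OF f_test]])

lemma column_err: "(LINT x|lborel. (norm (frechet_derivative (f n) (at x) (axis j 1) - column j (G x)))\<^sup>2) \<le> err n"
  unfolding err_def
proof (rule integral_mono)
  show "integrable lborel (\<lambda>x. (norm (frechet_derivative (f n) (at x) (axis j 1) - column j (G x)))\<^sup>2)"
    using square_integrable_diff[OF column_Df column_G] by (rule square_integrableD)
  show "integrable lborel (\<lambda>x. (norm (jacobian (f n) (at x) - G x))\<^sup>2)"
    using square_integrable_diff[OF Df_square_integrable G] by (rule square_integrableD)
  show "(norm (frechet_derivative (f n) (at x) (axis j 1) - column j (G x)))\<^sup>2
      \<le> (norm (jacobian (f n) (at x) - G x))\<^sup>2" for x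
    using norm_column_le[of j "jacobian (f n) (at x) - G x"]
    by (intro power_mono) (auto simp: column_jacobian[symmetric] linear_diff[OF bounded_linear.linear[OF bounded_linear_column]])
qed

lemma f_eq_shift_integral:
  assumes "R \<ge> 0" "x $ 3 < R"
  shows "f n x = shift_integral e3 R (\<lambda>y. frechet_derivative (f n) (at y) e3) x"
proof -
  have "f n (x - R *\<^sub>R e3) = 0"
    using assms by (intro test_function_zero[OF f_test]) (simp add: half_space_def)
  then show ?thesis by (simp add: shift_integral_derivative[OF f_smooth assms(1)])
qed

text \<open>A test field vanishes below the half space, hence on the slab it is the vertical primitive of its own
  vertical derivative; the latter converges in \<open>L\<^sup>2\<close>.\<close>

lemma vertical_primitive_err:
  assumes R: "R \<ge> 0"
  defines "W \<equiv> shift_integral e3 R (\<lambda>y. column 3 (G y))"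
  shows "(LINT x|lborel. (norm (indicat_real (below R) x *\<^sub>R (f n x - W x)))\<^sup>2) \<le> R\<^sup>2 * err n"
proof -
  let ?D = "\<lambda>y. frechet_derivative (f n) (at y) e3 - column 3 (G y)"
  have D: "square_integrable lborel ?D" by (rule square_integrable_diff[OF column_Df column_G])
  have W: "square_integrable lborel W"
    unfolding W_def by (rule square_integrable_shift_integral[OF R column_G])
  have "(LINT x|lborel. (norm (indicat_real (below R) x *\<^sub>R (f n x - W x)))\<^sup>2)
      \<le> (LINT x|lborel. (norm (shift_integral e3 R ?D x))\<^sup>2)"
  proof (rule integral_mono_AE)
    show "integrable lborel (\<lambda>x. (norm (indicat_real (below R) x *\<^sub>R (f n x - W x)))\<^sup>2)"
      by (rule square_integrableD(2)[OF square_integrable_indicator[OF square_integrable_diff[OF test_function_bounded_integrable(2)[OF f_test] W]]]) simp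
    show "integrable lborel (\<lambda>x. (norm (shift_integral e3 R ?D x))\<^sup>2)"
      by (rule square_integrableD(2)[OF square_integrable_shift_integral[OF R D]])
    show "AE x in lborel. (norm (indicat_real (below R) x *\<^sub>R (f n x - W x)))\<^sup>2 \<le> (norm (shift_integral e3 R ?D x))\<^sup>2"
      using AE_shift_integral_diff[OF R column_Df[of n e3] column_G[of 3], of e3]
      by eventually_elim (auto simp: indicator_def below_def W_def f_eq_shift_integral[OF R])
  qed
  also have "\<dots> \<le> R\<^sup>2 * (LINT x|lborel. (norm (?D x))\<^sup>2)"
    by (rule integral_shift_integral_sq_le[OF R D])
  also have "\<dots> \<le> R\<^sup>2 * err n"
    using column_err[of n 3] by (intro mult_left_mono) auto
  finally show ?thesis .
qed

text \<open>The vertical primitive of the weak gradient is the only candidate for the limit of the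
  test fields on a slab; it agrees with the field because their difference has no horizontal
  derivative and is square integrable on the slab.\<close>

lemma U_eq_vertical_primitive:
  assumes R: "R > 0"
  shows "AE x in lborel. x \<in> below R \<longrightarrow> U x = shift_integral e3 R (\<lambda>y. column 3 (G y)) x"
proof -
  define W where "W = shift_integral e3 R (\<lambda>y. column 3 (G y))"
  have R0: "R \<ge> 0" using R by simp
  have W: "square_integrable lborel W"
    unfolding W_def by (rule square_integrable_shift_integral[OF R0 column_G])
  define S where "S = half_space \<inter> below R"
  have S: "open S" unfolding S_def below_def
    by (intro open_Int open_half_space open_Collect_less continuous_intros)
  have [measurable]: "S \<in> sets borel" using S by (rule borel_open)
  \<comment> \<open>The slab is invariant under horizontal translations, in contrast to vertical ones.\<close>
  have "AE x in lborel. x \<in> S \<longrightarrow> indicat_real S x *\<^sub>R (U x $ i - W x $ i) = 0" for i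
  proof (rule AE_eq_0_if_weakly_constant_along)
    show "square_integrable lborel (\<lambda>x. indicat_real S x *\<^sub>R (U x $ i - W x $ i))"
      by (intro square_integrable_indicator square_integrable_diff square_integrable_component U W) simp
    show "open S" by fact
    show "norm (axis 1 1 :: real^3) = 1" by simp
    show "x + s *\<^sub>R axis 1 1 \<in> S" if "x \<in> S" for x s
      using that by (simp add: S_def half_space_def below_def axis_def)
    fix \<psi> :: "real^3 \<Rightarrow> real" assume \<psi>: "test_function S \<psi>"
    let ?e = "axis 1 1 :: real^3"
    let ?D = "\<lambda>x. frechet_derivative \<psi> (at x) ?e"
    have \<psi>h: "test_function half_space \<psi>" using \<psi> by (rule test_function_mono) (auto simp: S_def)
    note D = test_function_derivative[OF \<psi>, of ?e] and D2 = test_function_bounded_integrable(2)[OF test_function_derivative[OF \<psi>, of ?e]]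
      and \<psi>2 = test_function_bounded_integrable(2)[OF \<psi>]
    \<comment> \<open>Both \<open>U\<close> and \<open>W\<close> have the horizontal derivative \<open>G $ i $ 1\<close>: the field by definition of the weak
      gradient, and \<open>W\<close> as limit of the test fields on the slab.\<close>
    have Wl: "(\<lambda>n. LINT x|lborel. f n x $ i \<bullet> ?D x) \<longlonglongrightarrow> (LINT x|lborel. W x $ i \<bullet> ?D x)"
    proof -
      have "(\<lambda>n. LINT x|lborel. (indicat_real (below R) x *\<^sub>R f n x) $ i \<bullet> ?D x)
        \<longlonglongrightarrow> (LINT x|lborel. (indicat_real (below R) x *\<^sub>R W x) $ i \<bullet> ?D x)"
      proof (rule integral_inner_tendsto_left[OF _ _ D2])
        show "square_integrable lborel (\<lambda>x. (indicat_real (below R) x *\<^sub>R f n x) $ i)" for n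
          by (intro square_integrable_component square_integrable_indicator test_function_bounded_integrable(2)[OF f_test]) simp
        show "square_integrable lborel (\<lambda>x. (indicat_real (below R) x *\<^sub>R W x) $ i)"
          by (intro square_integrable_component square_integrable_indicator W) simp
        have le: "(LINT x|lborel. (norm ((indicat_real (below R) x *\<^sub>R f n x) $ i - (indicat_real (below R) x *\<^sub>R W x) $ i))\<^sup>2)
            \<le> R\<^sup>2 * err n" for n
        proof -
          have sq: "square_integrable lborel (\<lambda>x. indicat_real (below R) x *\<^sub>R (f n x - W x))"
            by (intro square_integrable_indicator square_integrable_diff W test_function_bounded_integrable(2)[OF f_test]) simp
          have "(LINT x|lborel. (norm ((indicat_real (below R) x *\<^sub>R f n x) $ i - (indicat_real (below R) x *\<^sub>R W x) $ i))\<^sup>2)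
            \<le> (LINT x|lborel. (norm (indicat_real (below R) x *\<^sub>R (f n x - W x)))\<^sup>2)"
          proof (rule integral_mono)
            show "integrable lborel (\<lambda>x. (norm (indicat_real (below R) x *\<^sub>R (f n x - W x)))\<^sup>2)"
              using sq by (rule square_integrableD)
            show "integrable lborel (\<lambda>x. (norm ((indicat_real (below R) x *\<^sub>R f n x) $ i - (indicat_real (below R) x *\<^sub>R W x) $ i))\<^sup>2)"
              using square_integrableD(2)[OF square_integrable_component[OF sq, of i]]
              by (simp add: algebra_simps)
            show "(norm ((indicat_real (below R) x *\<^sub>R f n x) $ i - (indicat_real (below R) x *\<^sub>R W x) $ i))\<^sup>2
                \<le> (norm (indicat_real (below R) x *\<^sub>R (f n x - W x)))\<^sup>2" for x
              using Finite_Cartesian_Product.norm_nth_le[of "indicat_real (below R) x *\<^sub>R (f n x - W x)" i]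
              by (intro power_mono) (auto simp: algebra_simps)
          qed
          also have "\<dots> \<le> R\<^sup>2 * err n"
            unfolding W_def by (rule vertical_primitive_err[OF R0])
          finally show ?thesis .
        qed
        have l0: "(\<lambda>n. R\<^sup>2 * err n) \<longlonglongrightarrow> 0"
          using tendsto_mult_left[OF err_tendsto, of "R\<^sup>2"] by simp
        show "(\<lambda>n. LINT x|lborel. (norm ((indicat_real (below R) x *\<^sub>R f n x) $ i - (indicat_real (below R) x *\<^sub>R W x) $ i))\<^sup>2) \<longlonglongrightarrow> 0"
          by (rule Lim_null_comparison[OF _ l0]) (use le in simp)
      qed
      moreover have "(indicat_real (below R) x *\<^sub>R g) $ i \<bullet> ?D x = g $ i \<bullet> ?D x" for x and g :: "real^3"
        using test_function_zero[OF D, of x] by (cases "x \<in> below R") (auto simp: S_def)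
      ultimately show ?thesis by (simp only:)
    qed
    have "(\<lambda>n. LINT x|lborel. f n x $ i \<bullet> ?D x) \<longlonglongrightarrow> - (LINT x|lborel. G x $ i $ 1 * \<psi> x)"
    proof -
      have "(LINT x|lborel. f n x $ i \<bullet> ?D x) = - (LINT x|lborel. (jacobian (f n) (at x) \<bullet> (outer (axis i (\<psi> x)) ?e)))" for n
      proof -
        have "jacobian (f n) (at x) \<bullet> (outer (axis i (\<psi> x)) ?e) = frechet_derivative (f n) (at x) ?e $ i * \<psi> x" for x
          by (simp add: matrix_vector_inner[symmetric] jacobian_mult_vector smooth_has_derivative[OF f_smooth, THEN differentiableI] inner_axis)
        then show ?thesis
          using integral_by_parts_test[OF smooth_linear[OF bounded_linear_vec_nth[of i] f_smooth] \<psi>, of n ?e]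
          by (simp add: frechet_derivative_nth[OF f_smooth])
      qed
      moreover have "(\<lambda>n. LINT x|lborel. (jacobian (f n) (at x) \<bullet> (outer (axis i (\<psi> x)) ?e)))
          \<longlonglongrightarrow> (LINT x|lborel. (G x \<bullet> (outer (axis i (\<psi> x)) ?e)))"
      proof (rule integral_inner_tendsto_left[OF Df_square_integrable G _ f_G])
        show "square_integrable lborel (\<lambda>x. outer (axis i (\<psi> x)) ?e)"
        proof (rule square_integrable_bound)
          show "integrable lborel (\<lambda>x. (norm (\<psi> x))\<^sup>2)" using \<psi>2 by (rule square_integrableD)
          have ax: "axis i c = c *\<^sub>R axis i 1" for c :: real by (simp add: axis_def vec_eq_iff)
          show "(\<lambda>x. outer (axis i (\<psi> x)) ?e) \<in> borel_measurable lborel"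
            unfolding ax[of "\<psi> _"] using square_integrableD(1)[OF \<psi>2] by simp
          show "AE x in lborel. (norm (outer (axis i (\<psi> x)) ?e))\<^sup>2 \<le> (norm (\<psi> x))\<^sup>2"
            unfolding norm_outer ax[of "\<psi> _"] by simp
        qed
      qed
      moreover have "G x \<bullet> outer (axis i (\<psi> x)) ?e = G x $ i $ 1 * \<psi> x" for x
        by (simp add: matrix_vector_inner[symmetric] inner_axis matrix_vector_mult_basis column_def)
      ultimately show ?thesis by (simp only: tendsto_minus)
    qed
    from LIMSEQ_unique[OF Wl this] weak[OF \<psi>h, of i 1]
    have "(LINT x|lborel. U x $ i * ?D x) = (LINT x|lborel. W x $ i * ?D x)" by simp
    moreover have "indicat_real S x *\<^sub>R (U x $ i - W x $ i) * ?D x = U x $ i * ?D x - W x $ i * ?D x" for x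
      using test_function_zero[OF D, of x] by (cases "x \<in> S") (auto simp: algebra_simps)
    ultimately show "(LINT x|lborel. indicat_real S x *\<^sub>R (U x $ i - W x $ i) * ?D x) = 0"
      using square_integrable_inner[OF square_integrable_component[OF U] D2]
        square_integrable_inner[OF square_integrable_component[OF W] D2] by simp
  qed
  then have "AE x in lborel. \<forall>i\<in>UNIV. x \<in> S \<longrightarrow> indicat_real S x *\<^sub>R (U x $ i - W x $ i) = 0"
    by (intro AE_finite_allI) auto
  then show ?thesis
  proof eventually_elim
    case (elim x)
    show ?case
    proof
      assume x: "x \<in> below R"
      show "U x = shift_integral e3 R (\<lambda>y. column 3 (G y)) x"
      proof (cases "x \<in> half_space")
        case True
        then show ?thesis using elim x by (simp add: S_def W_def vec_eq_iff)
      next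
        case False
        have "shift_integral e3 R (\<lambda>y. column 3 (G y)) x = (LINT s:{0..R}|lborel. 0)"
          unfolding shift_integral_def
        proof (intro set_lebesgue_integral_cong ballI allI impI)
          fix s assume "s \<in> {0..R}"
          then have "x - s *\<^sub>R e3 \<notin> half_space" using False by (simp add: half_space_def)
          then show "column 3 (G (x - s *\<^sub>R e3)) = 0" by (simp add: G_outside column_def vec_eq_iff)
        qed simp
        then show ?thesis using U_outside[OF False] by (simp add: set_lebesgue_integral_def)
      qed
    qed
  qed
qed

text \<open>Closeness in the gradient norm gives closeness in \<open>L\<^sup>2\<close> of every slab, with a constant that grows with
  the height; this growth is why a vertical cutoff is required later.\<close>

lemma slab_err:
  assumes R: "R > 0"
  shows "(LINT x|lborel. (norm (indicat_real (below R) x *\<^sub>R (f n x - U x)))\<^sup>2) \<le> R\<^sup>2 * err n"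
proof -
  have m: "shift_integral e3 R (\<lambda>y. column 3 (G y)) \<in> borel_measurable borel"
    by (rule borel_measurable_shift_integral) measurable
  have fm: "f n \<in> borel_measurable borel"
    using test_function_bounded_integrable(1)[OF f_test] by auto
  have "(LINT x|lborel. (norm (indicat_real (below R) x *\<^sub>R (f n x - U x)))\<^sup>2)
     = (LINT x|lborel. (norm (indicat_real (below R) x *\<^sub>R (f n x - shift_integral e3 R (\<lambda>y. column 3 (G y)) x)))\<^sup>2)"
  proof (rule integral_cong_AE)
    show "AE x in lborel. (norm (indicat_real (below R) x *\<^sub>R (f n x - U x)))\<^sup>2
       = (norm (indicat_real (below R) x *\<^sub>R (f n x - shift_integral e3 R (\<lambda>y. column 3 (G y)) x)))\<^sup>2"
      using U_eq_vertical_primitive[OF R] by eventually_elim (auto simp: indicator_def)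
  qed (use m fm in measurable)
  also have "\<dots> \<le> R\<^sup>2 * err n" using R by (intro vertical_primitive_err) simp
  finally show ?thesis .
qed

lemma slab_tendsto:
  assumes R: "R > 0"
  shows "(\<lambda>n. LINT x|lborel. (norm (indicat_real (below R) x *\<^sub>R (f n x - U x)))\<^sup>2) \<longlonglongrightarrow> 0"
proof -
  have l0: "(\<lambda>n. R\<^sup>2 * err n) \<longlonglongrightarrow> 0"
    using tendsto_mult_left[OF err_tendsto, of "R\<^sup>2"] by simp
  show ?thesis
    by (rule Lim_null_comparison[OF _ l0]) (use slab_err[OF R] in simp)
qed

end

section \<open>The convective term\<close>

lemma divergence_eq: "divergence F x = (\<Sum>j\<in>UNIV. frechet_derivative F (at x) (axis j 1) $ j)"
  by (simp add: divergence_def trace_def jacobian_nth)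

lemma matrix_vector_columns: "A *v b = (\<Sum>j\<in>UNIV. b $ j *\<^sub>R column j A)" for A :: "real^'n^'m"
  by (simp add: vec_eq_iff matrix_vector_mult_def column_def mult.commute)

text \<open>The identity says that the divergence of \<open>(F \<bullet> \<phi>) F\<close> integrates to zero; as \<open>F\<close> is solenoidal, this
  divergence is the derivative of \<open>F \<bullet> \<phi>\<close> in direction \<open>F\<close>.\<close>

lemma trilinear_antisymmetry_test:
  assumes F: "solenoidal_test F" and \<phi>: "test_function S \<phi>"
  shows "(LINT x|lborel. (jacobian F (at x) *v F x) \<bullet> \<phi> x) = - (LINT x|lborel. (jacobian \<phi> (at x) *v F x) \<bullet> F x)"
proof -
  have Ft: "test_function half_space F" and div: "divergence F x = 0" for x
    using F by (auto simp: solenoidal_test_def)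
  note Fs = test_function_smooth[OF Ft] and \<phi>s = test_function_smooth[OF \<phi>]
  define P where "P x = F x \<bullet> \<phi> x" for x
  have Ps: "smooth P" unfolding P_def by (intro smooth_bilinear[OF bounded_bilinear_inner] Fs \<phi>s)
  have dP: "frechet_derivative P (at x) h = F x \<bullet> frechet_derivative \<phi> (at x) h + frechet_derivative F (at x) h \<bullet> \<phi> x" for x h
  proof -
    have "(P has_derivative (\<lambda>h. F x \<bullet> frechet_derivative \<phi> (at x) h + frechet_derivative F (at x) h \<bullet> \<phi> x)) (at x)"
      unfolding P_def[abs_def]
      by (rule bounded_bilinear.FDERIV[OF bounded_bilinear_inner smooth_has_derivative[OF Fs] smooth_has_derivative[OF \<phi>s]])
    from fun_cong[OF frechet_derivative_at[OF this, symmetric], of h] show ?thesis .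
  qed
  have eq: "(LINT x|lborel. P x * frechet_derivative F (at x) (axis j 1) $ j)
      = - (LINT x|lborel. frechet_derivative P (at x) (axis j 1) * F x $ j)" for j
    using integral_by_parts_test[OF Ps test_function_component[OF Ft], of j "axis j 1"]
    by (simp add: frechet_derivative_nth[OF Fs])
  have i1: "integrable lborel (\<lambda>x. P x * frechet_derivative F (at x) (axis j 1) $ j)" for j
    by (intro test_function_bounded_integrable(1)[OF test_function_mult[OF Ps test_function_component[OF test_function_derivative[OF Ft]]]])
  have i2: "integrable lborel (\<lambda>x. frechet_derivative P (at x) (axis j 1) * F x $ j)" for j
    by (intro test_function_bounded_integrable(1)[OF test_function_mult[OF smooth_frechet_derivative[OF Ps] test_function_component[OF Ft]]])
  have i3: "integrable lborel (\<lambda>x. (jacobian F (at x) *v F x) \<bullet> \<phi> x)"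
    using test_function_bounded_integrable(1)[OF test_function_bilinear[OF bounded_bilinear_inner
        smooth_bilinear[OF bounded_bilinear_matrix_vector test_function_smooth[OF test_function_jacobian[OF Ft]] Fs] \<phi>]] .
  have i4: "integrable lborel (\<lambda>x. (jacobian \<phi> (at x) *v F x) \<bullet> F x)"
    using test_function_bounded_integrable(1)[OF test_function_bilinear[OF bounded_bilinear_inner
        smooth_bilinear[OF bounded_bilinear_matrix_vector test_function_smooth[OF test_function_jacobian[OF \<phi>]] Fs] Ft]] .
  have "0 = (LINT x|lborel. P x * divergence F x)" by (simp add: div)
  also have "\<dots> = (\<Sum>j\<in>UNIV. LINT x|lborel. P x * frechet_derivative F (at x) (axis j 1) $ j)"
    unfolding divergence_eq sum_distrib_left using i1 by (rule Bochner_Integration.integral_sum)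
  also have "\<dots> = - (\<Sum>j\<in>UNIV. LINT x|lborel. frechet_derivative P (at x) (axis j 1) * F x $ j)"
    by (simp add: eq sum_negf)
  also have "(\<Sum>j\<in>UNIV. LINT x|lborel. frechet_derivative P (at x) (axis j 1) * F x $ j)
      = (LINT x|lborel. (\<Sum>j\<in>UNIV. frechet_derivative P (at x) (axis j 1) * F x $ j))"
    using i2 by (rule Bochner_Integration.integral_sum[symmetric])
  also have "\<dots> = (LINT x|lborel. (jacobian F (at x) *v F x) \<bullet> \<phi> x + (jacobian \<phi> (at x) *v F x) \<bullet> F x)"
    by (intro Bochner_Integration.integral_cong refl)
      (simp add: dP matrix_vector_columns column_jacobian inner_sum_left inner_sum_right sum.distrib
        algebra_simps inner_commute)
  finally show ?thesis using i3 i4 by simp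
qed

text \<open>On \<open>A n\<close> the difference is small by assumption; outside \<open>A n\<close> it is only bounded, but there the tail of
  \<open>a\<close> is small.\<close>

lemma weak_tendstoI:
  assumes a: "square_integrable M a" and p: "\<And>n. square_integrable M (p n)" and p': "square_integrable M p'"
    and C: "\<And>n. (LINT x|M. (norm (p n x))\<^sup>2) \<le> C"
    and A[measurable]: "\<And>n. A n \<in> sets M" and ex: "\<And>x. x \<in> space M \<Longrightarrow> eventually (\<lambda>n. x \<in> A n) sequentially"
    and lim: "(\<lambda>n. LINT x|M. (norm (indicat_real (A n) x *\<^sub>R (p n x - p' x)))\<^sup>2) \<longlonglongrightarrow> 0"
  shows "(\<lambda>n. LINT x|M. a x \<bullet> p n x) \<longlonglongrightarrow> (LINT x|M. a x \<bullet> p' x)"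
proof -
  define D where "D = sqrt (2 * C + 2 * (LINT x|M. (norm (p' x))\<^sup>2))"
  define s where "s n = sqrt (LINT x|M. (norm (a x))\<^sup>2) * sqrt (LINT x|M. (norm (indicat_real (A n) x *\<^sub>R (p n x - p' x)))\<^sup>2)" for n
  define t where "t n = sqrt (LINT x|M. (norm (indicat_real (space M - A n) x *\<^sub>R a x))\<^sup>2) * D" for n
  have cA: "space M - A n \<in> sets M" for n by measurable
  have le: "\<bar>(LINT x|M. a x \<bullet> p n x) - (LINT x|M. a x \<bullet> p' x)\<bar> \<le> s n + t n" for n
  proof -
    note d = square_integrable_diff[OF p[of n] p']
    note d1 = square_integrable_indicator[OF d A[of n]] and a1 = square_integrable_indicator[OF a cA[of n]]
    have "(LINT x|M. a x \<bullet> p n x) - (LINT x|M. a x \<bullet> p' x) = (LINT x|M. a x \<bullet> (p n x - p' x))"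
      using square_integrable_inner[OF a p[of n]] square_integrable_inner[OF a p'] by (simp add: inner_diff_right)
    also have "\<dots> = (LINT x|M. a x \<bullet> (indicat_real (A n) x *\<^sub>R (p n x - p' x))
        + (indicat_real (space M - A n) x *\<^sub>R a x) \<bullet> (p n x - p' x))"
      by (intro Bochner_Integration.integral_cong refl) (simp add: indicator_def)
    also have "\<dots> = (LINT x|M. a x \<bullet> (indicat_real (A n) x *\<^sub>R (p n x - p' x)))
        + (LINT x|M. (indicat_real (space M - A n) x *\<^sub>R a x) \<bullet> (p n x - p' x))"
      using square_integrable_inner[OF a d1] square_integrable_inner[OF a1 d] by (rule Bochner_Integration.integral_add)
    finally have eq: "(LINT x|M. a x \<bullet> p n x) - (LINT x|M. a x \<bullet> p' x)
      = (LINT x|M. a x \<bullet> (indicat_real (A n) x *\<^sub>R (p n x - p' x)))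
        + (LINT x|M. (indicat_real (space M - A n) x *\<^sub>R a x) \<bullet> (p n x - p' x))" .
    have "\<bar>LINT x|M. a x \<bullet> (indicat_real (A n) x *\<^sub>R (p n x - p' x))\<bar> \<le> s n"
      unfolding s_def by (rule integral_inner_le[OF a d1])
    moreover have "\<bar>LINT x|M. (indicat_real (space M - A n) x *\<^sub>R a x) \<bullet> (p n x - p' x)\<bar> \<le> t n"
    proof -
      have "(LINT x|M. (norm (p n x - p' x))\<^sup>2) \<le> (LINT x|M. 2 * (norm (p n x))\<^sup>2 + 2 * (norm (p' x))\<^sup>2)"
        by (intro integral_mono Bochner_Integration.integrable_add integrable_mult_right
            square_integrableD[OF d] square_integrableD[OF p] square_integrableD[OF p'] norm_diff_sq_le)
      also have "\<dots> = 2 * (LINT x|M. (norm (p n x))\<^sup>2) + 2 * (LINT x|M. (norm (p' x))\<^sup>2)"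
        using square_integrableD[OF p[of n]] square_integrableD[OF p'] by simp
      finally have "sqrt (LINT x|M. (norm (p n x - p' x))\<^sup>2) \<le> D"
        unfolding D_def using C[of n] by (intro real_sqrt_le_mono) linarith
      then show ?thesis
        unfolding t_def by (intro order_trans[OF integral_inner_le[OF a1 d]] mult_left_mono) auto
    qed
    ultimately show ?thesis unfolding eq by linarith
  qed
  have tail: "(\<lambda>n. LINT x|M. (norm (indicat_real (space M - A n) x *\<^sub>R a x))\<^sup>2) \<longlonglongrightarrow> 0"
  proof (rule integral_tail_tendsto_0[OF a cA])
    show "eventually (\<lambda>n. x \<notin> space M - A n) sequentially" if "x \<in> space M" for x
      using ex[OF that] by eventually_elim simp
  qed
  have "(\<lambda>n. s n + t n) \<longlonglongrightarrow> sqrt (LINT x|M. (norm (a x))\<^sup>2) * sqrt 0 + sqrt 0 * D"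
    unfolding s_def t_def by (intro tendsto_intros lim tail)
  then have lim0: "(\<lambda>n. s n + t n) \<longlonglongrightarrow> 0" by simp
  have "(\<lambda>n. (LINT x|M. a x \<bullet> p n x) - (LINT x|M. a x \<bullet> p' x)) \<longlonglongrightarrow> 0"
    by (rule Lim_null_comparison[OF _ lim0]) (use le in simp)
  then show ?thesis by (rule LIM_zero_cancel)
qed

context grad_approximable
begin

lemma f_square_integrable: "square_integrable lborel (f n)"
  by (rule test_function_bounded_integrable(2)[OF f_test])

lemma f_measurable[measurable]: "f n \<in> borel_measurable borel"
  using f_square_integrable by (auto simp: square_integrable_def)

lemma slab_integrable: "integrable lborel (\<lambda>x. (norm (indicat_real (below R) x *\<^sub>R (f n x - U x)))\<^sup>2)"
  by (intro square_integrableD(2) square_integrable_indicator square_integrable_diff f_square_integrable U) simp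

lemma dominated_by_slab_tendsto:
  assumes R: "R > 0" and m: "\<And>n. h n \<in> borel_measurable borel"
    and le: "\<And>n x. (norm (h n x))\<^sup>2 \<le> K * (norm (indicat_real (below R) x *\<^sub>R (f n x - U x)))\<^sup>2"
  shows "(\<lambda>n. LINT x|lborel. (norm (h n x))\<^sup>2) \<longlonglongrightarrow> 0"
proof -
  have l0: "(\<lambda>n. K * (LINT x|lborel. (norm (indicat_real (below R) x *\<^sub>R (f n x - U x)))\<^sup>2)) \<longlonglongrightarrow> 0"
    using tendsto_mult_left[OF slab_tendsto[OF R], of K] by simp
  have i: "integrable lborel (\<lambda>x. K * (norm (indicat_real (below R) x *\<^sub>R (f n x - U x)))\<^sup>2)" for n
    using slab_integrable by simp
  have "(LINT x|lborel. (norm (h n x))\<^sup>2) \<le> (LINT x|lborel. K * (norm (indicat_real (below R) x *\<^sub>R (f n x - U x)))\<^sup>2)" for n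
    by (rule integral_mono_AE'[OF i]) (use le order_trans[OF zero_le_power2 le] in \<open>auto simp del: norm_scaleR\<close>)
  then have le': "(LINT x|lborel. (norm (h n x))\<^sup>2) \<le> K * (LINT x|lborel. (norm (indicat_real (below R) x *\<^sub>R (f n x - U x)))\<^sup>2)" for n
    by simp
  show ?thesis
    by (rule Lim_null_comparison[OF _ l0]) (use le' in simp)
qed

text \<open>The identity passes to the limit because \<open>\<phi>\<close> has compact support, so that convergence of the fields on
  one slab is enough.\<close>

lemma trilinear_antisymmetry:
  assumes \<phi>: "test_function half_space \<phi>"
  shows "(LINT x|lborel. (G x *v U x) \<bullet> \<phi> x) = - (LINT x|lborel. (jacobian \<phi> (at x) *v U x) \<bullet> U x)"
proof -
  obtain K where K: "compact K" "K \<subseteq> half_space" "\<And>x. x \<notin> K \<Longrightarrow> \<phi> x = 0" "smooth \<phi>"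
    using test_functionE[OF \<phi>] by metis
  obtain R0 where R0: "\<And>x. x \<in> K \<Longrightarrow> norm x \<le> R0"
    using compact_imp_bounded[OF K(1)] by (auto simp: bounded_iff)
  define R where "R = max R0 0 + 1"
  have R: "R > 0" by (simp add: R_def)
  have K_below: "x \<in> below R" if "x \<in> K" for x
    using R0[OF that] component_le_norm_cart[of x 3] by (auto simp: below_def R_def)
  have \<phi>0: "\<phi> x = 0" if "x \<notin> below R" for x using that K_below K(3) by blast
  have J0: "jacobian \<phi> (at x) = 0" if "x \<notin> below R" for x
  proof -
    have "x \<notin> K" using that K_below by blast
    then show ?thesis
      using frechet_derivative_zero_outside[where f=\<phi> and x=x, OF compact_imp_closed[OF K(1)] K(3)]
      by (simp add: vec_eq_iff jacobian_nth)
  qed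
  note J = test_function_jacobian[OF \<phi>]
  obtain C where C: "\<And>x. norm (\<phi> x) \<le> C" using test_function_bounded_integrable(3)[OF \<phi>] by blast
  obtain C' where C': "\<And>x. norm (jacobian \<phi> (at x)) \<le> C'" using test_function_bounded_integrable(3)[OF J] by blast
  have [measurable]: "\<phi> \<in> borel_measurable borel" "(\<lambda>x. jacobian \<phi> (at x)) \<in> borel_measurable borel"
    using test_function_bounded_integrable(1)[OF \<phi>] test_function_bounded_integrable(1)[OF J] by auto
  have sq_outer: "square_integrable lborel (\<lambda>x. outer (\<phi> x) (u x))" if "square_integrable lborel u" for u :: "real^3 \<Rightarrow> real^3"
  proof (rule square_integrable_bound)
    have [measurable]: "u \<in> borel_measurable borel" using that by (simp add: square_integrable_def)
    show "(\<lambda>x. outer (\<phi> x) (u x)) \<in> borel_measurable lborel" by measurable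
    show "integrable lborel (\<lambda>x. C\<^sup>2 * (norm (u x))\<^sup>2)" using square_integrableD(2)[OF that] by simp
    show "AE x in lborel. (norm (outer (\<phi> x) (u x)))\<^sup>2 \<le> C\<^sup>2 * (norm (u x))\<^sup>2"
      by (intro AE_I2) (auto simp: norm_outer power_mult_distrib intro!: mult_right_mono power_mono C)
  qed
  have sq_J: "square_integrable lborel (\<lambda>x. jacobian \<phi> (at x) *v u x)" if "square_integrable lborel u" for u :: "real^3 \<Rightarrow> real^3"
  proof (rule square_integrable_bound)
    have [measurable]: "u \<in> borel_measurable borel" using that by (simp add: square_integrable_def)
    show "(\<lambda>x. jacobian \<phi> (at x) *v u x) \<in> borel_measurable lborel" by measurable
    show "integrable lborel (\<lambda>x. C'\<^sup>2 * (norm (u x))\<^sup>2)" using square_integrableD(2)[OF that] by simp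
    show "AE x in lborel. (norm (jacobian \<phi> (at x) *v u x))\<^sup>2 \<le> C'\<^sup>2 * (norm (u x))\<^sup>2"
      unfolding power_mult_distrib[symmetric]
      by (intro AE_I2 power_mono order_trans[OF norm_matrix_vector_le] mult_right_mono C') auto
  qed
  have "(\<lambda>n. LINT x|lborel. jacobian (f n) (at x) \<bullet> outer (\<phi> x) (f n x)) \<longlonglongrightarrow> (LINT x|lborel. G x \<bullet> outer (\<phi> x) (U x))"
  proof (rule integral_inner_tendsto[OF Df_square_integrable G sq_outer[OF f_square_integrable] sq_outer[OF U] f_G])
    show "(\<lambda>n. LINT x|lborel. (norm (outer (\<phi> x) (f n x) - outer (\<phi> x) (U x)))\<^sup>2) \<longlonglongrightarrow> 0"
    proof (rule dominated_by_slab_tendsto[OF R])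
      show "(norm (outer (\<phi> x) (f n x) - outer (\<phi> x) (U x)))\<^sup>2 \<le> C\<^sup>2 * (norm (indicat_real (below R) x *\<^sub>R (f n x - U x)))\<^sup>2" for n x
      proof (cases "x \<in> below R")
        case True
        have "norm (outer (\<phi> x) (f n x) - outer (\<phi> x) (U x)) = norm (\<phi> x) * norm (f n x - U x)"
          by (simp add: bounded_bilinear.diff_right[OF bounded_bilinear_outer, symmetric] norm_outer)
        then show ?thesis using True C[of x] by (auto simp: power_mult_distrib intro!: mult_right_mono power_mono)
      qed (simp add: \<phi>0 bounded_bilinear.zero_left[OF bounded_bilinear_outer])
    qed measurable
  qed
  moreover have "(\<lambda>n. LINT x|lborel. (jacobian \<phi> (at x) *v f n x) \<bullet> (indicat_real (below R) x *\<^sub>R f n x))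
      \<longlonglongrightarrow> (LINT x|lborel. (jacobian \<phi> (at x) *v U x) \<bullet> (indicat_real (below R) x *\<^sub>R U x))"
  proof (rule integral_inner_tendsto[OF sq_J[OF f_square_integrable] sq_J[OF U] square_integrable_indicator[OF f_square_integrable] square_integrable_indicator[OF U]])
    show "(\<lambda>n. LINT x|lborel. (norm (jacobian \<phi> (at x) *v f n x - jacobian \<phi> (at x) *v U x))\<^sup>2) \<longlonglongrightarrow> 0"
    proof (rule dominated_by_slab_tendsto[OF R])
      show "(norm (jacobian \<phi> (at x) *v f n x - jacobian \<phi> (at x) *v U x))\<^sup>2 \<le> C'\<^sup>2 * (norm (indicat_real (below R) x *\<^sub>R (f n x - U x)))\<^sup>2" for n x
      proof (cases "x \<in> below R")
        case True
        have "norm (jacobian \<phi> (at x) *v f n x - jacobian \<phi> (at x) *v U x) \<le> norm (jacobian \<phi> (at x)) * norm (f n x - U x)"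
          by (simp add: bounded_bilinear.diff_right[OF bounded_bilinear_matrix_vector, symmetric] norm_matrix_vector_le)
        also have "\<dots> \<le> C' * norm (f n x - U x)" by (intro mult_right_mono C') auto
        finally show ?thesis using True by (simp add: power_mult_distrib[symmetric] power_mono)
      qed (simp add: J0)
    qed measurable
    show "(\<lambda>n. LINT x|lborel. (norm (indicat_real (below R) x *\<^sub>R f n x - indicat_real (below R) x *\<^sub>R U x))\<^sup>2) \<longlonglongrightarrow> 0"
      using slab_tendsto[OF R] by (simp add: scaleR_diff_right)
  qed simp_all
  moreover have "(jacobian \<phi> (at x) *v u) \<bullet> (indicat_real (below R) x *\<^sub>R u) = (jacobian \<phi> (at x) *v u) \<bullet> u" for x u
    by (cases "x \<in> below R") (auto simp: J0)
  moreover have "(LINT x|lborel. jacobian (f n) (at x) \<bullet> outer (\<phi> x) (f n x)) = - (LINT x|lborel. (jacobian \<phi> (at x) *v f n x) \<bullet> f n x)" for n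
    using trilinear_antisymmetry_test[OF f \<phi>] by (simp add: matrix_vector_inner)
  ultimately have "(\<lambda>n. - (LINT x|lborel. (jacobian \<phi> (at x) *v f n x) \<bullet> f n x)) \<longlonglongrightarrow> (LINT x|lborel. G x \<bullet> outer (\<phi> x) (U x))"
    "(\<lambda>n. LINT x|lborel. (jacobian \<phi> (at x) *v f n x) \<bullet> f n x) \<longlonglongrightarrow> (LINT x|lborel. (jacobian \<phi> (at x) *v U x) \<bullet> U x)"
    by (simp_all only:)
  from LIMSEQ_unique[OF this(1) tendsto_minus[OF this(2)]] show ?thesis by (simp add: matrix_vector_inner)
qed

end

section \<open>Cutting off in the vertical direction\<close>

text \<open>Cutting off a solenoidal field \<open>f\<close> by a function \<open>\<chi>\<close> of \<open>x\<^sub>3\<close> destroys the divergence constraint.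
  It is restored by cutting off a vector potential instead: \<open>f\<close> is the curl of its vertical
  primitive, rotated by a right angle about the vertical axis, and the curl of \<open>\<chi>\<close> times this
  potential is \<open>\<chi> f\<close> plus \<open>\<chi>'\<close> times the horizontal part of the vertical primitive.\<close>

definition hor :: "real^3 \<Rightarrow> real^3" where
  "hor x = x - (x $ 3) *\<^sub>R e3"

lemma norm_hor_le: "norm (hor x) \<le> norm x"
proof -
  have "(norm (hor x))\<^sup>2 \<le> (norm x)\<^sup>2"
    unfolding power2_norm_eq_inner
    by (simp add: inner_vec_def sum_3 hor_def axis_def)
  then show ?thesis by (rule power2_le_imp_le) simp
qed

lemma bounded_linear_hor: "bounded_linear hor"
  by (rule bounded_linear_intro[where K=1]) (auto simp: hor_def algebra_simps norm_hor_le[unfolded hor_def])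

abbreviation step' :: "real \<Rightarrow> real" where "step' x \<equiv> frechet_derivative smooth_step (at x) 1"
abbreviation step'' :: "real \<Rightarrow> real" where "step'' x \<equiv> frechet_derivative step' (at x) 1"

lemma smooth_step': "smooth step'"
  by (rule smooth_frechet_derivative[OF smooth_smooth_step])

lemma frechet_derivative_locally_const:
  fixes g :: "real \<Rightarrow> real"
  assumes "open S" "x \<in> S" "\<And>y. y \<in> S \<Longrightarrow> g y = c"
  shows "frechet_derivative g (at x) h = 0"
proof -
  have "((\<lambda>x. c) has_derivative (\<lambda>h. 0)) (at x)" by simp
  then have "(g has_derivative (\<lambda>h. 0)) (at x)"
    by (rule has_derivative_transform_within_open[of _ _ _ _ S]) (use assms in auto)
  from fun_cong[OF frechet_derivative_at[OF this, symmetric], of h] show ?thesis .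
qed

lemma step'_eq_0: "x < 0 \<or> x > 1 \<Longrightarrow> step' x = 0"
  using frechet_derivative_locally_const[of "{..<0}" x smooth_step 0]
    frechet_derivative_locally_const[of "{1<..}" x smooth_step 1]
  by (auto simp: smooth_step_eq_0 smooth_step_eq_1)

lemma step''_eq_0: "x < 0 \<or> x > 1 \<Longrightarrow> step'' x = 0"
  using frechet_derivative_locally_const[of "{..<0}" x step' 0]
    frechet_derivative_locally_const[of "{1<..}" x step' 0]
  by (auto simp: step'_eq_0)

lemma step_derivatives_bounded: "\<exists>C>0. \<forall>x. \<bar>step' x\<bar> \<le> C \<and> \<bar>step'' x\<bar> \<le> C"
proof -
  have bd: "\<exists>C. \<forall>x. \<bar>g x\<bar> \<le> C" if g: "continuous_on {0..1} g" "\<And>x. x < 0 \<or> x > 1 \<Longrightarrow> g x = 0" for g :: "real \<Rightarrow> real"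
  proof -
    have "bounded (g ` {0..1})"
      by (intro compact_imp_bounded compact_continuous_image g) auto
    then obtain C where C: "\<forall>x\<in>{0..1}. \<bar>g x\<bar> \<le> C" by (auto simp: bounded_iff)
    have "\<bar>g x\<bar> \<le> max C 0" for x
      using bspec[OF C, of x] g(2)[of x] by (cases "x \<in> {0..1}") auto
    then show ?thesis by blast
  qed
  obtain C1 where C1: "\<And>x. \<bar>step' x\<bar> \<le> C1"
    using bd[OF smooth_continuous_on[OF smooth_step'] step'_eq_0] by blast
  obtain C2 where C2: "\<And>x. \<bar>step'' x\<bar> \<le> C2"
    using bd[OF smooth_continuous_on[OF smooth_frechet_derivative[OF smooth_step']] step''_eq_0] by blast
  show ?thesis
  proof (intro exI[of _ "max (max C1 C2) 1"] conjI allI)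
    show "\<bar>step' x\<bar> \<le> max (max C1 C2) 1" "\<bar>step'' x\<bar> \<le> max (max C1 C2) 1" for x
      using C1[of x] C2[of x] by linarith+
  qed simp
qed

text \<open>Equal to \<open>1\<close> below height \<open>k\<close> and to \<open>0\<close> above height \<open>2 k\<close>; the other two functions are its first and
  second derivatives with respect to the height.\<close>

definition cutoff :: "real \<Rightarrow> real^3 \<Rightarrow> real" where
  "cutoff k x = 1 + (-1) * smooth_step (-1 + inverse k * x $ 3)"
definition cutoff' :: "real \<Rightarrow> real^3 \<Rightarrow> real" where
  "cutoff' k x = - inverse k * step' (-1 + inverse k * x $ 3)"
definition cutoff'' :: "real \<Rightarrow> real^3 \<Rightarrow> real" where
  "cutoff'' k x = - inverse k * (inverse k * step'' (-1 + inverse k * x $ 3))"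

lemma bounded_linear_scaled_height: "bounded_linear (\<lambda>x::real^3. c * x $ 3)"
  by (intro bounded_linear_const_mult bounded_linear_vec_nth)

lemma smooth_cutoff: "smooth (cutoff k)"
  unfolding cutoff_def[abs_def]
  by (intro smooth_add smooth_mult smooth_const smooth_compose_affine smooth_smooth_step bounded_linear_scaled_height)

lemma smooth_cutoff': "smooth (cutoff' k)"
  unfolding cutoff'_def[abs_def]
  by (intro smooth_mult smooth_const smooth_compose_affine[of "\<lambda>x. inverse k * x $ 3" step'] smooth_step' bounded_linear_scaled_height)

lemma height_has_derivative: "((\<lambda>x::real^3. -1 + c * x $ 3) has_derivative (\<lambda>h. c * h $ 3)) (at x)"
  by (auto intro!: derivative_eq_intros bounded_linear_imp_has_derivative bounded_linear_scaled_height)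

lemma frechet_cutoff: "frechet_derivative (cutoff k) (at x) h = cutoff' k x * h $ 3"
proof -
  have "(cutoff k has_derivative (\<lambda>h. cutoff' k x * h $ 3)) (at x)"
    unfolding cutoff_def[abs_def]
    using DERIV_compose_FDERIV[OF smooth_real_has_derivative[OF smooth_smooth_step] height_has_derivative[of "inverse k" x]]
    by (auto intro!: derivative_eq_intros simp: cutoff'_def mult_ac fun_eq_iff)
  from fun_cong[OF frechet_derivative_at[OF this, symmetric], of h] show ?thesis .
qed

lemma frechet_cutoff': "frechet_derivative (cutoff' k) (at x) h = cutoff'' k x * h $ 3"
proof -
  have "(cutoff' k has_derivative (\<lambda>h. cutoff'' k x * h $ 3)) (at x)"
    unfolding cutoff'_def[abs_def]
    using DERIV_compose_FDERIV[OF smooth_real_has_derivative[OF smooth_step'] height_has_derivative[of "inverse k" x]]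
    by (auto intro!: derivative_eq_intros simp: cutoff''_def mult_ac fun_eq_iff)
  from fun_cong[OF frechet_derivative_at[OF this, symmetric], of h] show ?thesis .
qed

lemma cutoff_low: "k > 0 \<Longrightarrow> x $ 3 < k \<Longrightarrow> cutoff k x = 1 \<and> cutoff' k x = 0"
  by (auto simp: cutoff_def cutoff'_def field_simps intro!: smooth_step_eq_0 step'_eq_0)

lemma cutoff_high: "k > 0 \<Longrightarrow> x $ 3 > 2 * k \<Longrightarrow> cutoff k x = 0 \<and> cutoff' k x = 0 \<and> cutoff'' k x = 0"
  by (auto simp: cutoff_def cutoff'_def cutoff''_def field_simps
      intro!: smooth_step_eq_1 step'_eq_0 step''_eq_0)

lemma cutoff_bound: "\<bar>cutoff k x\<bar> \<le> 1"
  using smooth_step_bounds[of "-1 + inverse k * x $ 3"] by (simp add: cutoff_def)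

lemma shift_integral_linear:
  fixes f :: "'a::euclidean_space \<Rightarrow> 'b::euclidean_space" and L :: "'b \<Rightarrow> 'c::euclidean_space"
  assumes L: "bounded_linear L" and f: "continuous_on UNIV f"
  shows "shift_integral e R (\<lambda>y. L (f y)) x = L (shift_integral e R f x)"
  unfolding shift_integral_def set_lebesgue_integral_def
  using integral_bounded_linear[OF L set_integrable_segment[OF f, of R x e, unfolded set_integrable_def]]
  by (simp add: linear_scale[OF bounded_linear.linear[OF L]])

text \<open>The segment of length \<open>2 k\<close> reaches down to the boundary from every point where \<open>cutoff' k\<close> is not zero, so
  that the segment integral is there the vertical primitive of \<open>f\<close>.\<close>

definition curl_cutoff :: "real \<Rightarrow> (real^3 \<Rightarrow> real^3) \<Rightarrow> real^3 \<Rightarrow> real^3" where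
  "curl_cutoff k f x = cutoff k x *\<^sub>R f x + cutoff' k x *\<^sub>R hor (shift_integral e3 (2 * k) f x)"

lemma frechet_curl_cutoff:
  assumes f: "smooth f"
  shows "frechet_derivative (curl_cutoff k f) (at x) h
    = (cutoff k x *\<^sub>R frechet_derivative f (at x) h + (cutoff' k x * h $ 3) *\<^sub>R f x)
    + (cutoff' k x *\<^sub>R hor (shift_integral e3 (2 * k) (\<lambda>y. frechet_derivative f (at y) h) x)
      + (cutoff'' k x * h $ 3) *\<^sub>R hor (shift_integral e3 (2 * k) f x))"
proof -
  have 1: "((\<lambda>x. hor (shift_integral e3 (2 * k) f x)) has_derivative
      (\<lambda>h. hor (frechet_derivative (shift_integral e3 (2 * k) f) (at x) h))) (at x)"
    by (rule bounded_linear.has_derivative[OF bounded_linear_hor smooth_has_derivative[OF smooth_shift_integral[OF f]]])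
  have "(curl_cutoff k f has_derivative (\<lambda>h.
      (cutoff k x *\<^sub>R frechet_derivative f (at x) h + (frechet_derivative (cutoff k) (at x) h) *\<^sub>R f x)
    + (cutoff' k x *\<^sub>R hor (frechet_derivative (shift_integral e3 (2 * k) f) (at x) h)
      + (frechet_derivative (cutoff' k) (at x) h) *\<^sub>R hor (shift_integral e3 (2 * k) f x)))) (at x)"
    unfolding curl_cutoff_def[abs_def]
    by (intro has_derivative_add has_derivative_scaleR 1 smooth_has_derivative smooth_cutoff smooth_cutoff' f)
  from fun_cong[OF frechet_derivative_at[OF this, symmetric], of h] show ?thesis
    by (simp only: frechet_cutoff frechet_cutoff' frechet_derivative_shift_integral[OF f])
qed

lemma bounded_linear_trace: "bounded_linear (trace :: real^'n^'n \<Rightarrow> real)"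
  unfolding trace_def[abs_def]
  by (intro bounded_linear_sum bounded_linear_compose[OF bounded_linear_vec_nth bounded_linear_vec_nth])

text \<open>The two contributions of the cutoff cancel: the derivative of \<open>cutoff k\<close> meets \<open>f $ 3\<close>, and the horizontal
  divergence of the vertical primitive is minus its vertical derivative, that is \<open>- f $ 3\<close>, because
  \<open>f\<close> is solenoidal.\<close>

lemma solenoidal_curl_cutoff:
  assumes f: "solenoidal_test f" and k: "k > 0"
  shows "solenoidal_test (curl_cutoff k f)"
proof -
  have ft: "test_function half_space f" and div: "divergence f x = 0" for x
    using f by (auto simp: solenoidal_test_def)
  note fs = test_function_smooth[OF ft]
  let ?S = "shift_integral e3 (2 * k)"
  have "test_function half_space (?S f)"
    using ft by (rule test_function_shift_integral) (auto simp: half_space_def)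
  then have test: "test_function half_space (curl_cutoff k f)"
    unfolding curl_cutoff_def[abs_def]
    by (intro test_function_add test_function_bilinear[OF bounded_bilinear_scaleR] smooth_cutoff smooth_cutoff' ft
        test_function_linear[OF bounded_linear_hor])
  have "divergence (curl_cutoff k f) x = 0" for x
  proof -
    define J where "J = ?S (\<lambda>y. jacobian f (at y)) x"
    have Jc: "continuous_on UNIV (\<lambda>y. jacobian f (at y))"
      by (rule smooth_continuous_on[OF test_function_smooth[OF test_function_jacobian[OF ft]]])
    have col: "?S (\<lambda>y. frechet_derivative f (at y) (axis j 1)) x = column j J" for j
      unfolding J_def using shift_integral_linear[OF bounded_linear_column Jc, of e3 "2 * k" j x]
      by (simp add: column_jacobian)
    have "trace J = ?S (\<lambda>y. divergence f y) x"
      unfolding J_def divergence_def by (rule shift_integral_linear[OF bounded_linear_trace Jc, symmetric])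
    then have trJ: "trace J = 0"
      unfolding div by (simp add: shift_integral_def set_lebesgue_integral_def)
    \<comment> \<open>\<open>J\<close> is the Jacobian of the segment integral; its last column is a vertical increment of \<open>f\<close> whose lower
      end lies outside the half space wherever \<open>cutoff' k\<close> does not vanish.\<close>
    have c3: "cutoff' k x * (column 3 J $ 3) = cutoff' k x * f x $ 3"
    proof (cases "x $ 3 > 2 * k")
      case True then show ?thesis using cutoff_high[OF k] by simp
    next
      case False
      then have "f (x - (2 * k) *\<^sub>R e3) = 0"
        by (intro test_function_zero[OF ft]) (simp add: half_space_def)
      then have "column 3 J = f x"
        unfolding col[symmetric] using shift_integral_derivative[OF fs, of "2 * k" e3 x] k by simp
      then show ?thesis by simp
    qed
    have dv: "(\<Sum>j\<in>UNIV. frechet_derivative f (at x) (axis j 1) $ j) = 0"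
      using div[of x] by (simp add: divergence_eq)
    have "divergence (curl_cutoff k f) x =
        cutoff k x * (\<Sum>j\<in>UNIV. frechet_derivative f (at x) (axis j 1) $ j)
        + cutoff' k x * f x $ 3 + cutoff' k x * (trace J - column 3 J $ 3)"
      unfolding divergence_eq frechet_curl_cutoff[OF fs] col
      by (simp add: sum_3 hor_def axis_def trace_def column_def algebra_simps)
    also have "\<dots> = 0" unfolding dv trJ using c3 by (auto simp: algebra_simps)
    finally show ?thesis .
  qed
  with test show ?thesis by (simp add: solenoidal_test_def)
qed

lemma norm_sum4_sq_le:
  "(norm ((a + b) + (c + d) :: 'b::real_normed_vector))\<^sup>2 \<le> 4 * (norm a)\<^sup>2 + 4 * (norm b)\<^sup>2 + 4 * (norm c)\<^sup>2 + 4 * (norm d)\<^sup>2"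
  using norm_add_sq_le[of "a + b" "c + d"] norm_add_sq_le[of a b] norm_add_sq_le[of c d] by linarith

context grad_approximable
begin

definition U_bound :: real where "U_bound = 2 * (LINT x|lborel. (norm (U x))\<^sup>2) + 2"
definition G_bound :: real where "G_bound = 2 * (LINT x|lborel. (norm (G x))\<^sup>2) + 2"

lemma slab_norm_le:
  assumes R: "R > 0" and n: "R\<^sup>2 * err n \<le> 1"
  shows "(LINT x|lborel. (norm (indicat_real (below R) x *\<^sub>R f n x))\<^sup>2) \<le> U_bound"
proof -
  have "(LINT x|lborel. (norm (indicat_real (below R) x *\<^sub>R f n x))\<^sup>2)
      \<le> (LINT x|lborel. 2 * (norm (indicat_real (below R) x *\<^sub>R (f n x - U x)))\<^sup>2 + 2 * (norm (U x))\<^sup>2)"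
  proof (rule integral_mono)
    show "integrable lborel (\<lambda>x. (norm (indicat_real (below R) x *\<^sub>R f n x))\<^sup>2)"
      by (intro square_integrableD(2) square_integrable_indicator f_square_integrable) simp
    show "integrable lborel (\<lambda>x. 2 * (norm (indicat_real (below R) x *\<^sub>R (f n x - U x)))\<^sup>2 + 2 * (norm (U x))\<^sup>2)"
      by (intro Bochner_Integration.integrable_add integrable_mult_right slab_integrable square_integrableD(2)[OF U])
    show "(norm (indicat_real (below R) x *\<^sub>R f n x))\<^sup>2
      \<le> 2 * (norm (indicat_real (below R) x *\<^sub>R (f n x - U x)))\<^sup>2 + 2 * (norm (U x))\<^sup>2" for x
      using norm_add_sq_le[of "f n x - U x" "U x"] by (cases "x \<in> below R") auto
  qed
  also have "\<dots> = 2 * (LINT x|lborel. (norm (indicat_real (below R) x *\<^sub>R (f n x - U x)))\<^sup>2) + 2 * (LINT x|lborel. (norm (U x))\<^sup>2)"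
    using slab_integrable square_integrableD(2)[OF U] by (simp del: norm_scaleR)
  also have "\<dots> \<le> U_bound" unfolding U_bound_def using slab_err[OF R, of n] n by linarith
  finally show ?thesis .
qed

lemma column_norm_le:
  assumes n: "err n \<le> 1"
  shows "(LINT x|lborel. (norm (frechet_derivative (f n) (at x) (axis j 1)))\<^sup>2) \<le> G_bound"
proof -
  let ?D = "\<lambda>x. frechet_derivative (f n) (at x) (axis j 1)"
  note d = square_integrableD(2)[OF square_integrable_diff[OF column_Df column_G]]
  have "(LINT x|lborel. (norm (?D x))\<^sup>2) \<le> (LINT x|lborel. 2 * (norm (?D x - column j (G x)))\<^sup>2 + 2 * (norm (G x))\<^sup>2)"
  proof (rule integral_mono)
    show "integrable lborel (\<lambda>x. (norm (?D x))\<^sup>2)" by (rule square_integrableD(2)[OF column_Df])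
    show "integrable lborel (\<lambda>x. 2 * (norm (?D x - column j (G x)))\<^sup>2 + 2 * (norm (G x))\<^sup>2)"
      by (intro Bochner_Integration.integrable_add integrable_mult_right d square_integrableD(2)[OF G])
    show "(norm (?D x))\<^sup>2 \<le> 2 * (norm (?D x - column j (G x)))\<^sup>2 + 2 * (norm (G x))\<^sup>2" for x
    proof -
      have "(norm (column j (G x)))\<^sup>2 \<le> (norm (G x))\<^sup>2" by (intro power_mono norm_column_le) auto
      then show ?thesis using norm_add_sq_le[of "?D x - column j (G x)" "column j (G x)"]
        unfolding diff_add_cancel by linarith
    qed
  qed
  also have "\<dots> = 2 * (LINT x|lborel. (norm (?D x - column j (G x)))\<^sup>2) + 2 * (LINT x|lborel. (norm (G x))\<^sup>2)"
    using d square_integrableD(2)[OF G] by simp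
  also have "\<dots> \<le> G_bound" unfolding G_bound_def using column_err[of n j] n by linarith
  finally show ?thesis .
qed

text \<open>The vertical primitive over a length \<open>2 k\<close> has an \<open>L\<^sup>2\<close> norm of order \<open>k\<close>, which is compensated by the
  factor \<open>1 / k\<close> in the derivative of the cutoff; hence bounds that do not depend on \<open>k\<close>.\<close>

lemma curl_cutoff_bounds:
  assumes C: "C > 0" "\<And>x. \<bar>step' x\<bar> \<le> C" "\<And>x. \<bar>step'' x\<bar> \<le> C"
    and k: "k \<ge> 1" and n: "(3 * k)\<^sup>2 * err n \<le> 1"
  shows "(LINT x|lborel. (norm (curl_cutoff k (f n) x))\<^sup>2) \<le> (2 + 8 * C\<^sup>2) * U_bound"
    and "(LINT x|lborel. (norm (jacobian (curl_cutoff k (f n)) (at x)))\<^sup>2)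
      \<le> 3 * ((4 + 16 * C\<^sup>2) * G_bound + 20 * C\<^sup>2 * U_bound)"
proof -
  let ?S = "shift_integral e3 (2 * k)"
  \<comment> \<open>Only the part of \<open>f n\<close> below height \<open>3 k\<close> enters, as the cutoff vanishes above \<open>2 k\<close>; the whole of \<open>f n\<close> is
    not bounded in \<open>L\<^sup>2\<close> uniformly in \<open>n\<close>.\<close>
  define g where "g x = indicat_real (below (3 * k)) x *\<^sub>R f n x" for x
  have k0: "k > 0" "2 * k \<ge> 0" using k by auto
  have g: "square_integrable lborel g"
    unfolding g_def by (intro square_integrable_indicator f_square_integrable) simp
  have gA: "(LINT x|lborel. (norm (g x))\<^sup>2) \<le> U_bound"
    unfolding g_def using k n by (intro slab_norm_le) auto
  have err: "err n \<le> 1"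
  proof -
    have "1 * err n \<le> (3 * k)\<^sup>2 * err n"
      using k one_le_power[of "3 * k" 2] by (intro mult_right_mono) (simp_all only: err_def, simp_all)
    then show ?thesis using n by simp
  qed
  have Sg: "square_integrable lborel (?S g)" by (rule square_integrable_shift_integral[OF k0(2) g])
  have SgA: "(LINT x|lborel. (norm (?S g x))\<^sup>2) \<le> (2 * k)\<^sup>2 * U_bound"
    by (intro order_trans[OF integral_shift_integral_sq_le[OF k0(2) g]] mult_left_mono gA) auto
  have SF: "?S (f n) x = ?S g x" if "x \<in> below (3 * k)" for x
    unfolding shift_integral_def g_def using that
    by (intro set_lebesgue_integral_cong) (auto simp: below_def)
  let ?c = "C * inverse k"
  have c0: "?c \<ge> 0" using C k by simp
  have ck: "?c\<^sup>2 * (2 * k)\<^sup>2 = 4 * C\<^sup>2" using k0 by (simp add: power2_eq_square field_simps)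
  have c1: "\<bar>cutoff' k x\<bar> \<le> ?c" for x
    unfolding cutoff'_def abs_mult using C(2) k0 by (simp add: mult.commute mult_right_mono)
  have c2: "\<bar>cutoff'' k x\<bar> \<le> ?c" for x
  proof -
    have "\<bar>cutoff'' k x\<bar> = inverse k * (inverse k * \<bar>step'' (-1 + inverse k * x $ 3)\<bar>)"
      unfolding cutoff''_def abs_mult using k0 by simp
    also have "\<dots> \<le> inverse k * (1 * C)"
      using C k k0 by (intro mult_mono) (auto simp: inverse_le_1_iff)
    finally show ?thesis by (simp add: mult.commute)
  qed
  have cc: "?c\<^sup>2 \<le> C\<^sup>2"
    using C k k0 by (intro power_mono) (auto simp: field_simps)
  have scale: "(norm (c *\<^sub>R v))\<^sup>2 \<le> ?c\<^sup>2 * (norm w)\<^sup>2" if "\<bar>c\<bar> \<le> ?c" "norm v \<le> norm w" for c and v w :: "real^3"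
  proof -
    have "norm (c *\<^sub>R v) \<le> ?c * norm w"
      unfolding norm_scaleR using that c0 by (intro mult_mono) auto
    from power_mono[OF this norm_ge_zero, of 2] show ?thesis
      by (simp only: power_mult_distrib[of ?c "norm w"])
  qed
  have scale1: "(norm (c *\<^sub>R v))\<^sup>2 \<le> (norm v)\<^sup>2" if "\<bar>c\<bar> \<le> 1" for c and v :: "real^3"
    unfolding norm_scaleR power_mult_distrib
    using mult_right_mono[OF power_mono[OF that, of 2], of "(norm v)\<^sup>2"] by simp
  have out: "cutoff k x = 0 \<and> cutoff' k x = 0 \<and> cutoff'' k x = 0" if "x \<notin> below (3 * k)" for x
    using that k by (intro cutoff_high) (auto simp: below_def)
  have sol: "solenoidal_test (curl_cutoff k (f n))" by (rule solenoidal_curl_cutoff[OF f k0(1)])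
  then have test: "test_function half_space (curl_cutoff k (f n))" by (simp add: solenoidal_test_def)

  have "(LINT x|lborel. (norm (curl_cutoff k (f n) x))\<^sup>2) \<le> (LINT x|lborel. 2 * (norm (g x))\<^sup>2 + 2 * (?c\<^sup>2 * (norm (?S g x))\<^sup>2))"
  proof (rule integral_mono)
    show "integrable lborel (\<lambda>x. (norm (curl_cutoff k (f n) x))\<^sup>2)"
      by (rule square_integrableD(2)[OF test_function_bounded_integrable(2)[OF test]])
    show "integrable lborel (\<lambda>x. 2 * (norm (g x))\<^sup>2 + 2 * (?c\<^sup>2 * (norm (?S g x))\<^sup>2))"
      by (intro Bochner_Integration.integrable_add integrable_mult_right square_integrableD(2)[OF g] square_integrableD(2)[OF Sg])
    show "(norm (curl_cutoff k (f n) x))\<^sup>2 \<le> 2 * (norm (g x))\<^sup>2 + 2 * (?c\<^sup>2 * (norm (?S g x))\<^sup>2)" for x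
    proof (cases "x \<in> below (3 * k)")
      case True
      have "(norm (curl_cutoff k (f n) x))\<^sup>2 \<le> 2 * (norm (cutoff k x *\<^sub>R g x))\<^sup>2 + 2 * (norm (cutoff' k x *\<^sub>R hor (?S g x)))\<^sup>2"
        unfolding curl_cutoff_def SF[OF True] using True by (simp add: norm_add_sq_le g_def del: norm_scaleR)
      also have "\<dots> \<le> 2 * (norm (g x))\<^sup>2 + 2 * (?c\<^sup>2 * (norm (?S g x))\<^sup>2)"
        by (intro add_mono mult_left_mono scale scale1 c1 cutoff_bound norm_hor_le) auto
      finally show ?thesis .
    qed (simp add: curl_cutoff_def out)
  qed
  also have "\<dots> = 2 * (LINT x|lborel. (norm (g x))\<^sup>2) + 2 * (?c\<^sup>2 * (LINT x|lborel. (norm (?S g x))\<^sup>2))"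
    using square_integrableD(2)[OF g] square_integrableD(2)[OF Sg] by simp
  also have "\<dots> \<le> 2 * U_bound + 2 * (?c\<^sup>2 * ((2 * k)\<^sup>2 * U_bound))"
    by (intro add_mono mult_left_mono gA SgA) auto
  also have "\<dots> = (2 + 8 * C\<^sup>2) * U_bound"
    unfolding mult.assoc[symmetric, of "?c\<^sup>2"] ck by (simp add: algebra_simps)
  finally show "(LINT x|lborel. (norm (curl_cutoff k (f n) x))\<^sup>2) \<le> (2 + 8 * C\<^sup>2) * U_bound" .

  have col: "(LINT x|lborel. (norm (frechet_derivative (curl_cutoff k (f n)) (at x) (axis j 1)))\<^sup>2)
      \<le> (4 + 16 * C\<^sup>2) * G_bound + 20 * C\<^sup>2 * U_bound" for j
  proof -
    let ?e = "axis j 1 :: real^3"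
    let ?D = "\<lambda>x. frechet_derivative (f n) (at x) ?e"
    have SD: "square_integrable lborel (?S ?D)" by (rule square_integrable_shift_integral[OF k0(2) column_Df])
    have SDA: "(LINT x|lborel. (norm (?S ?D x))\<^sup>2) \<le> (2 * k)\<^sup>2 * G_bound"
      by (intro order_trans[OF integral_shift_integral_sq_le[OF k0(2) column_Df]] mult_left_mono column_norm_le err) auto
    have "(LINT x|lborel. (norm (frechet_derivative (curl_cutoff k (f n)) (at x) ?e))\<^sup>2)
      \<le> (LINT x|lborel. 4 * (norm (?D x))\<^sup>2 + 4 * (?c\<^sup>2 * (norm (g x))\<^sup>2) + 4 * (?c\<^sup>2 * (norm (?S ?D x))\<^sup>2) + 4 * (?c\<^sup>2 * (norm (?S g x))\<^sup>2))"
    proof (rule integral_mono)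
      show "integrable lborel (\<lambda>x. (norm (frechet_derivative (curl_cutoff k (f n)) (at x) ?e))\<^sup>2)"
        by (rule square_integrableD(2)[OF test_function_bounded_integrable(2)[OF test_function_derivative[OF test]]])
      show "integrable lborel (\<lambda>x. 4 * (norm (?D x))\<^sup>2 + 4 * (?c\<^sup>2 * (norm (g x))\<^sup>2) + 4 * (?c\<^sup>2 * (norm (?S ?D x))\<^sup>2) + 4 * (?c\<^sup>2 * (norm (?S g x))\<^sup>2))"
        by (intro Bochner_Integration.integrable_add integrable_mult_right square_integrableD(2)[OF g] square_integrableD(2)[OF Sg]
            square_integrableD(2)[OF SD] square_integrableD(2)[OF column_Df])
      fix x :: "real^3"
      have h: "\<bar>c * ?e $ 3\<bar> \<le> \<bar>c\<bar>" for c :: real by (simp add: axis_def)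
      show "(norm (frechet_derivative (curl_cutoff k (f n)) (at x) ?e))\<^sup>2
        \<le> 4 * (norm (?D x))\<^sup>2 + 4 * (?c\<^sup>2 * (norm (g x))\<^sup>2) + 4 * (?c\<^sup>2 * (norm (?S ?D x))\<^sup>2) + 4 * (?c\<^sup>2 * (norm (?S g x))\<^sup>2)"
      proof (cases "x \<in> below (3 * k)")
        case True
        then have fg: "f n x = g x" by (simp add: g_def)
        show ?thesis
          unfolding frechet_curl_cutoff[OF f_smooth] SF[OF True] fg
          by (intro order_trans[OF norm_sum4_sq_le] add_mono mult_left_mono scale scale1 cutoff_bound
              order_trans[OF h] c1 c2 norm_hor_le) auto
      next
        case False
        then show ?thesis using out[OF False] unfolding frechet_curl_cutoff[OF f_smooth] by simp
      qed
    qed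
    also have "\<dots> = 4 * (LINT x|lborel. (norm (?D x))\<^sup>2) + 4 * (?c\<^sup>2 * (LINT x|lborel. (norm (g x))\<^sup>2))
      + 4 * (?c\<^sup>2 * (LINT x|lborel. (norm (?S ?D x))\<^sup>2)) + 4 * (?c\<^sup>2 * (LINT x|lborel. (norm (?S g x))\<^sup>2))"
      using square_integrableD(2)[OF g] square_integrableD(2)[OF Sg] square_integrableD(2)[OF SD] square_integrableD(2)[OF column_Df, of n ?e] by simp
    also have "\<dots> \<le> 4 * G_bound + 4 * (C\<^sup>2 * U_bound) + 4 * (?c\<^sup>2 * ((2 * k)\<^sup>2 * G_bound)) + 4 * (?c\<^sup>2 * ((2 * k)\<^sup>2 * U_bound))"
      by (intro add_mono mult_left_mono mult_mono gA SgA SDA column_norm_le err cc) auto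
    also have "\<dots> = (4 + 16 * C\<^sup>2) * G_bound + 20 * C\<^sup>2 * U_bound"
      unfolding mult.assoc[symmetric, of "?c\<^sup>2"] ck by (simp add: algebra_simps)
    finally show ?thesis .
  qed
  have "(LINT x|lborel. (norm (jacobian (curl_cutoff k (f n)) (at x)))\<^sup>2)
      = (\<Sum>j\<in>UNIV. LINT x|lborel. (norm (frechet_derivative (curl_cutoff k (f n)) (at x) (axis j 1)))\<^sup>2)"
    unfolding norm_sq_columns column_jacobian
    by (rule Bochner_Integration.integral_sum)
      (rule square_integrableD(2)[OF test_function_bounded_integrable(2)[OF test_function_derivative[OF test]]])
  also have "\<dots> \<le> (\<Sum>j\<in>(UNIV::3 set). (4 + 16 * C\<^sup>2) * G_bound + 20 * C\<^sup>2 * U_bound)"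
    by (intro sum_mono col)
  finally show "(LINT x|lborel. (norm (jacobian (curl_cutoff k (f n)) (at x)))\<^sup>2)
      \<le> 3 * ((4 + 16 * C\<^sup>2) * G_bound + 20 * C\<^sup>2 * U_bound)" by simp
qed

text \<open>A diagonal choice: the approximation index \<open>N k\<close> is taken so large that its error on the slab beats the
  growth of the constant in the height \<open>k\<close> of the cutoff.\<close>

lemma bounded_approximants:
  obtains \<phi> :: "nat \<Rightarrow> real^3 \<Rightarrow> real^3" and C :: real
  where "\<And>k. solenoidal_test (\<phi> k)"
    and "\<And>k. (LINT x|lborel. (norm (\<phi> k x))\<^sup>2) \<le> C"
    and "\<And>k. (LINT x|lborel. (norm (jacobian (\<phi> k) (at x)))\<^sup>2) \<le> C"
    and "(\<lambda>k. LINT x|lborel. (norm (indicat_real (below (real (Suc k))) x *\<^sub>R (\<phi> k x - U x)))\<^sup>2) \<longlonglongrightarrow> 0"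
    and "(\<lambda>k. LINT x|lborel. (norm (indicat_real (below (real (Suc k))) x *\<^sub>R (jacobian (\<phi> k) (at x) - G x)))\<^sup>2) \<longlonglongrightarrow> 0"
proof -
  obtain C where C: "C > 0" "\<And>x. \<bar>step' x\<bar> \<le> C" "\<And>x. \<bar>step'' x\<bar> \<le> C"
    using step_derivatives_bounded by blast
  define K where "K k = real (Suc k)" for k
  have K1: "K k \<ge> 1" for k by (simp add: K_def)
  have "\<exists>n. (3 * K k)\<^sup>2 * err n \<le> inverse (K k)" for k
  proof -
    have "(\<lambda>n. (3 * K k)\<^sup>2 * err n) \<longlonglongrightarrow> (3 * K k)\<^sup>2 * 0" by (intro tendsto_intros err_tendsto)
    then have "eventually (\<lambda>n. (3 * K k)\<^sup>2 * err n < inverse (K k)) sequentially"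
      by (rule order_tendstoD(2)) (use K1[of k] in simp)
    then obtain n where "(3 * K k)\<^sup>2 * err n < inverse (K k)"
      by (auto simp: eventually_sequentially)
    then show ?thesis by (intro exI[of _ n]) simp
  qed
  then obtain N where N: "\<And>k. (3 * K k)\<^sup>2 * err (N k) \<le> inverse (K k)" by metis
  define \<phi> where "\<phi> k = curl_cutoff (K k) (f (N k))" for k
  have err0: "err n \<ge> 0" for n by (simp add: err_def)
  have inv: "inverse (K k) \<le> 1" for k using K1[of k] by (simp add: inverse_le_1_iff)
  have N1: "(3 * K k)\<^sup>2 * err (N k) \<le> 1" for k using N[of k] inv[of k] by linarith
  have K0: "K k > 0" for k using K1[of k] by linarith
  have lim: "(\<lambda>k. inverse (K k)) \<longlonglongrightarrow> 0" unfolding K_def by (rule LIMSEQ_inverse_real_of_nat)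
  have eq: "\<phi> k x = f (N k) x" if "x \<in> below (K k)" for k x
    using cutoff_low[OF K0, of x k] that by (simp add: \<phi>_def curl_cutoff_def below_def)
  have "frechet_derivative (\<phi> k) (at x) = frechet_derivative (f (N k)) (at x)" if "x \<in> below (K k)" for k x
  proof -
    have "open (below (K k))" unfolding below_def by (intro open_Collect_less continuous_intros)
    then have "(\<phi> k has_derivative frechet_derivative (f (N k)) (at x)) (at x)"
      by (rule has_derivative_transform_within_open[OF smooth_has_derivative[OF f_smooth] _ that]) (simp add: eq)
    then show ?thesis by (rule frechet_derivative_at[symmetric])
  qed
  then have Jeq: "jacobian (\<phi> k) (at x) = jacobian (f (N k)) (at x)" if "x \<in> below (K k)" for k x
    using that by (simp add: jacobian_def)
  let ?C = "max ((2 + 8 * C\<^sup>2) * U_bound) (3 * ((4 + 16 * C\<^sup>2) * G_bound + 20 * C\<^sup>2 * U_bound))"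
  show thesis
  proof (rule that[of \<phi> ?C])
    show "solenoidal_test (\<phi> k)" for k unfolding \<phi>_def by (rule solenoidal_curl_cutoff[OF f K0])
    show "(LINT x|lborel. (norm (\<phi> k x))\<^sup>2) \<le> ?C" for k
      unfolding \<phi>_def using curl_cutoff_bounds(1)[OF C K1 N1] by (rule order_trans) simp
    show "(LINT x|lborel. (norm (jacobian (\<phi> k) (at x)))\<^sup>2) \<le> ?C" for k
      unfolding \<phi>_def using curl_cutoff_bounds(2)[OF C K1 N1] by (rule order_trans) simp
    have "(LINT x|lborel. (norm (indicat_real (below (K k)) x *\<^sub>R (\<phi> k x - U x)))\<^sup>2) \<le> inverse (K k)" for k
    proof -
      have "(LINT x|lborel. (norm (indicat_real (below (K k)) x *\<^sub>R (\<phi> k x - U x)))\<^sup>2)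
        = (LINT x|lborel. (norm (indicat_real (below (K k)) x *\<^sub>R (f (N k) x - U x)))\<^sup>2)"
        by (intro Bochner_Integration.integral_cong refl) (auto simp: eq indicator_def)
      also have "\<dots> \<le> (K k)\<^sup>2 * err (N k)" by (rule slab_err[OF K0])
      also have "\<dots> \<le> (3 * K k)\<^sup>2 * err (N k)"
        using K0[of k] by (intro mult_right_mono power_mono err0) auto
      also have "\<dots> \<le> inverse (K k)" by (rule N)
      finally show ?thesis .
    qed
    then have "(\<lambda>k. LINT x|lborel. (norm (indicat_real (below (K k)) x *\<^sub>R (\<phi> k x - U x)))\<^sup>2) \<longlonglongrightarrow> 0"
      by (intro Lim_null_comparison[OF _ lim]) simp
    then show "(\<lambda>k. LINT x|lborel. (norm (indicat_real (below (real (Suc k))) x *\<^sub>R (\<phi> k x - U x)))\<^sup>2) \<longlonglongrightarrow> 0"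
      by (simp only: K_def)
    have "(LINT x|lborel. (norm (indicat_real (below (K k)) x *\<^sub>R (jacobian (\<phi> k) (at x) - G x)))\<^sup>2) \<le> inverse (K k)" for k
    proof -
      have "(LINT x|lborel. (norm (indicat_real (below (K k)) x *\<^sub>R (jacobian (\<phi> k) (at x) - G x)))\<^sup>2)
        = (LINT x|lborel. (norm (indicat_real (below (K k)) x *\<^sub>R (jacobian (f (N k)) (at x) - G x)))\<^sup>2)"
        by (intro Bochner_Integration.integral_cong refl) (auto simp: Jeq indicator_def)
      also have "\<dots> \<le> err (N k)" unfolding err_def
      proof (rule integral_mono)
        note d = square_integrable_diff[OF Df_square_integrable G]
        show "integrable lborel (\<lambda>x. (norm (jacobian (f (N k)) (at x) - G x))\<^sup>2)" using d by (rule square_integrableD)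
        show "integrable lborel (\<lambda>x. (norm (indicat_real (below (K k)) x *\<^sub>R (jacobian (f (N k)) (at x) - G x)))\<^sup>2)"
          by (intro square_integrableD(2) square_integrable_indicator d) simp
      qed (auto simp: indicator_def)
      also have "\<dots> \<le> (3 * K k)\<^sup>2 * err (N k)"
      proof -
        have "1 * err (N k) \<le> (3 * K k)\<^sup>2 * err (N k)"
          using K1[of k] by (intro mult_right_mono err0 one_le_power) simp
        then show ?thesis by simp
      qed
      also have "\<dots> \<le> inverse (K k)" by (rule N)
      finally show ?thesis .
    qed
    then have "(\<lambda>k. LINT x|lborel. (norm (indicat_real (below (K k)) x *\<^sub>R (jacobian (\<phi> k) (at x) - G x)))\<^sup>2) \<longlonglongrightarrow> 0"
      by (intro Lim_null_comparison[OF _ lim]) simp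
    then show "(\<lambda>k. LINT x|lborel. (norm (indicat_real (below (real (Suc k))) x *\<^sub>R (jacobian (\<phi> k) (at x) - G x)))\<^sup>2) \<longlonglongrightarrow> 0"
      by (simp only: K_def)
  qed
qed

text \<open>The form in which a field of \<open>V \<inter> L\<^sup>2\<close> is used as a test field: it is reached by solenoidal test fields
  in every pairing of the field or its gradient with a square integrable function.\<close>

lemma weak_approximants:
  obtains \<phi> :: "nat \<Rightarrow> real^3 \<Rightarrow> real^3" and C :: real
  where "\<And>k. solenoidal_test (\<phi> k)"
    and "\<And>k. (LINT x|lborel. (norm (\<phi> k x))\<^sup>2) \<le> C"
    and "\<And>k. (LINT x|lborel. (norm (jacobian (\<phi> k) (at x)))\<^sup>2) \<le> C"
    and "\<And>a. square_integrable lborel a \<Longrightarrow> (\<lambda>k. LINT x|lborel. a x \<bullet> \<phi> k x) \<longlonglongrightarrow> (LINT x|lborel. a x \<bullet> U x)"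
    and "\<And>Q. square_integrable lborel Q \<Longrightarrow>
      (\<lambda>k. LINT x|lborel. Q x \<bullet> jacobian (\<phi> k) (at x)) \<longlonglongrightarrow> (LINT x|lborel. Q x \<bullet> G x)"
proof (rule bounded_approximants)
  fix \<phi> C assume \<phi>: "\<And>k. solenoidal_test (\<phi> k)"
    "\<And>k. (LINT x|lborel. (norm (\<phi> k x))\<^sup>2) \<le> C"
    "\<And>k. (LINT x|lborel. (norm (jacobian (\<phi> k) (at x)))\<^sup>2) \<le> C"
    "(\<lambda>k. LINT x|lborel. (norm (indicat_real (below (real (Suc k))) x *\<^sub>R (\<phi> k x - U x)))\<^sup>2) \<longlonglongrightarrow> 0"
    "(\<lambda>k. LINT x|lborel. (norm (indicat_real (below (real (Suc k))) x *\<^sub>R (jacobian (\<phi> k) (at x) - G x)))\<^sup>2) \<longlonglongrightarrow> 0"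
  have t: "test_function half_space (\<phi> k)" for k using \<phi>(1) by (simp add: solenoidal_test_def)
  have ex: "eventually (\<lambda>k. x \<in> below (real (Suc k))) sequentially" for x
  proof -
    have "filterlim (\<lambda>k. real (Suc k)) at_top sequentially"
      by (rule filterlim_compose[OF filterlim_real_sequentially filterlim_Suc])
    then show ?thesis by (auto simp: filterlim_at_top_dense below_def)
  qed
  show thesis
  proof (rule that[of \<phi> C, OF \<phi>(1,2,3)])
    show "(\<lambda>k. LINT x|lborel. a x \<bullet> \<phi> k x) \<longlonglongrightarrow> (LINT x|lborel. a x \<bullet> U x)" if "square_integrable lborel a" for a
      by (rule weak_tendstoI[OF that test_function_bounded_integrable(2)[OF t] U \<phi>(2) _ ex \<phi>(4)]) simp
    show "(\<lambda>k. LINT x|lborel. Q x \<bullet> jacobian (\<phi> k) (at x)) \<longlonglongrightarrow> (LINT x|lborel. Q x \<bullet> G x)" if "square_integrable lborel Q" for Q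
      by (rule weak_tendstoI[OF that test_function_bounded_integrable(2)[OF test_function_jacobian[OF t]] G \<phi>(3) _ ex \<phi>(5)]) simp
  qed
qed

end

section \<open>Boundedness from horizontal continuity\<close>

lemma norm_sq_3: "(a + b + c)\<^sup>2 \<le> 3 * a\<^sup>2 + 3 * b\<^sup>2 + 3 * (c::real)\<^sup>2"
  using zero_le_power2[of "a - b"] zero_le_power2[of "b - c"] zero_le_power2[of "a - c"]
  by (simp add: power2_eq_square algebra_simps)

text \<open>The integral of an indicator over the space is also the integral of its averages over unit vertical
  segments, and these averages are at most the one-dimensional measure of the set of heights.\<close>

lemma AE_lborel_height:
  assumes "AE z in lborel. P (z::real)"
  shows "AE x in lborel. P ((x::real^3) $ 3)"
proof -
  obtain N where N: "{z. \<not> P z} \<subseteq> N" "N \<in> null_sets lborel"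
    using assms by (auto elim!: AE_E simp: null_sets_def)
  have [measurable]: "N \<in> sets borel" using N by (auto simp: null_sets_def)
  have "(\<integral>\<^sup>+x. indicator N ((x::real^3) $ 3) \<partial>lborel)
      = (\<integral>\<^sup>+x. (\<integral>\<^sup>+s. indicator N ((x - s *\<^sub>R (- e3)) $ 3) * indicator {0..1} s \<partial>lborel) \<partial>lborel)"
    by (subst nn_integral_segment[where f="\<lambda>x. indicator N (x $ 3)"]) auto
  also have "\<dots> \<le> (\<integral>\<^sup>+x. (\<integral>\<^sup>+s. indicator N (s - (- (x $ 3))) \<partial>lborel) \<partial>(lborel :: (real^3) measure))"
    by (intro nn_integral_mono) (auto simp: indicator_def add.commute)
  also have "\<dots> = (\<integral>\<^sup>+x. (\<integral>\<^sup>+s. indicator N s \<partial>lborel) \<partial>(lborel :: (real^3) measure))"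
    by (subst nn_integral_lborel_translate) auto
  also have "\<dots> = 0" using N(2) by (simp add: null_sets_def)
  finally have "AE x in lborel. indicator N ((x::real^3) $ 3) = (0::ennreal)"
    by (subst (asm) le_zero_eq, subst (asm) nn_integral_0_iff_AE) auto
  then show ?thesis
    by eventually_elim (use N in \<open>auto simp: indicator_def split: if_splits\<close>)
qed

context grad_approximable
begin

text \<open>True for the test fields by the fundamental theorem of calculus; both sides converge in \<open>L\<^sup>2\<close> of every
  slab.\<close>

lemma vertical_increment:
  assumes s: "s \<ge> 0"
  shows "AE z in lborel. U (z + s *\<^sub>R e3) = U z + shift_integral (- e3) s (\<lambda>y. column 3 (G y)) z"
proof -
  let ?S = "shift_integral (- e3) s"
  let ?g = "\<lambda>y. column 3 (G y)"
  define \<Delta> where "\<Delta> z = U (z + s *\<^sub>R e3) - U z - ?S ?g z" for z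
  have Sg: "square_integrable lborel (?S ?g)" by (rule square_integrable_shift_integral[OF s column_G])
  have tr: "square_integrable lborel (\<lambda>z. h (z + s *\<^sub>R e3))" if "square_integrable lborel h" for h :: "real^3 \<Rightarrow> real^3"
    using integrable_lborel_translate[of "\<lambda>x. (norm (h x))\<^sup>2" "- (s *\<^sub>R e3)"] that by (auto simp: square_integrable_def)
  have \<Delta>: "square_integrable lborel \<Delta>"
    unfolding \<Delta>_def by (intro square_integrable_diff tr U Sg)
  have main: "AE z in lborel. z \<in> below R \<longrightarrow> \<Delta> z = 0" if R: "R > 0" for R
  proof -
    define q where "q n x = (norm (indicat_real (below (R + s)) x *\<^sub>R (f n x - U x)))\<^sup>2" for n x
    have qi: "integrable lborel (q n)" for n unfolding q_def by (rule slab_integrable)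
    have qt: "integrable lborel (\<lambda>z. q n (z + s *\<^sub>R e3))" for n
      using integrable_lborel_translate[OF qi, of n "- (s *\<^sub>R e3)"] by simp
    have qerr: "(LINT x|lborel. q n x) \<le> (R + s)\<^sup>2 * err n" for n
      unfolding q_def by (rule slab_err) (use R s in simp)
    have qerr': "(LINT x|lborel. q n (x + s *\<^sub>R e3)) \<le> (R + s)\<^sup>2 * err n" for n
    proof -
      have "q n \<in> borel_measurable borel" using qi by auto
      from integral_lborel_translate[OF this, of "- (s *\<^sub>R e3)"] show ?thesis using qerr[of n] by simp
    qed
    define h where "h n x = ?g x - frechet_derivative (f n) (at x) e3" for n x
    have hsq: "square_integrable lborel (h n)" for n
      unfolding h_def by (rule square_integrable_diff[OF column_G column_Df])
    have Shsq: "square_integrable lborel (?S (h n))" for n by (rule square_integrable_shift_integral[OF s hsq])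
    have Sherr: "(LINT x|lborel. (norm (?S (h n) x))\<^sup>2) \<le> s\<^sup>2 * err n" for n
    proof -
      have "(LINT x|lborel. (norm (h n x))\<^sup>2) \<le> err n"
        unfolding h_def using column_err[of n 3] by (simp add: norm_minus_commute)
      then show ?thesis
        by (intro order_trans[OF integral_shift_integral_sq_le[OF s hsq]] mult_left_mono) auto
    qed
    have fS: "f n (z + s *\<^sub>R e3) - f n z = ?S (\<lambda>y. frechet_derivative (f n) (at y) e3) z" for n z
    proof -
      have c: "continuous_on UNIV (\<lambda>y. frechet_derivative (f n) (at y) e3)"
        by (rule smooth_continuous_on[OF smooth_frechet_derivative[OF f_smooth]])
      have "f n z - f n (z + s *\<^sub>R e3) = ?S (\<lambda>y. frechet_derivative (f n) (at y) (- e3)) z"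
        using shift_integral_derivative[OF f_smooth s, of "- e3" n z] by simp
      also have "\<dots> = ?S (\<lambda>y. - frechet_derivative (f n) (at y) e3) z"
        by (simp add: linear_neg[OF has_derivative_linear[OF smooth_has_derivative[OF f_smooth]]])
      also have "\<dots> = - ?S (\<lambda>y. frechet_derivative (f n) (at y) e3) z"
        by (rule shift_integral_linear[OF bounded_linear_minus[OF bounded_linear_ident] c])
      finally show ?thesis by (simp add: algebra_simps)
    qed
    have le: "(LINT z|lborel. (norm (indicat_real (below R) z *\<^sub>R \<Delta> z))\<^sup>2)
        \<le> 4 * ((R + s)\<^sup>2 * err n) + 4 * ((R + s)\<^sup>2 * err n) + 4 * (s\<^sup>2 * err n)" for n
    proof -
      have "(LINT z|lborel. (norm (indicat_real (below R) z *\<^sub>R \<Delta> z))\<^sup>2)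
        \<le> (LINT z|lborel. 4 * q n (z + s *\<^sub>R e3) + 4 * q n z + 4 * (norm (?S (h n) z))\<^sup>2)"
      proof (rule integral_mono_AE)
        show "integrable lborel (\<lambda>z. (norm (indicat_real (below R) z *\<^sub>R \<Delta> z))\<^sup>2)"
          by (intro square_integrableD(2) square_integrable_indicator \<Delta>) simp
        show "integrable lborel (\<lambda>z. 4 * q n (z + s *\<^sub>R e3) + 4 * q n z + 4 * (norm (?S (h n) z))\<^sup>2)"
          by (intro Bochner_Integration.integrable_add integrable_mult_right qi qt square_integrableD(2)[OF Shsq])
        show "AE z in lborel. (norm (indicat_real (below R) z *\<^sub>R \<Delta> z))\<^sup>2
          \<le> 4 * q n (z + s *\<^sub>R e3) + 4 * q n z + 4 * (norm (?S (h n) z))\<^sup>2"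
          using AE_shift_integral_diff[OF s column_G[of 3] column_Df[of n e3], of "- e3"]
        proof eventually_elim
          case (elim z)
          show ?case
          proof (cases "z \<in> below R")
            case True
            then have b: "z \<in> below (R + s)" "z + s *\<^sub>R e3 \<in> below (R + s)"
              using s by (auto simp: below_def)
            have "\<Delta> z = ((U (z + s *\<^sub>R e3) - f n (z + s *\<^sub>R e3)) + (f n z - U z)) + (- ?S (h n) z + 0)"
              unfolding h_def elim \<Delta>_def fS[symmetric] by simp
            also have "(norm \<dots>)\<^sup>2 \<le> 4 * (norm (U (z + s *\<^sub>R e3) - f n (z + s *\<^sub>R e3)))\<^sup>2
              + 4 * (norm (f n z - U z))\<^sup>2 + 4 * (norm (- ?S (h n) z))\<^sup>2 + 4 * (norm (0::real^3))\<^sup>2"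
              by (rule norm_sum4_sq_le)
            finally show ?thesis using True b by (simp add: q_def norm_minus_commute)
          qed (simp add: q_def)
        qed
      qed
      also have "\<dots> = 4 * (LINT z|lborel. q n (z + s *\<^sub>R e3)) + 4 * (LINT z|lborel. q n z) + 4 * (LINT z|lborel. (norm (?S (h n) z))\<^sup>2)"
        using qi[of n] qt[of n] square_integrableD(2)[OF Shsq[of n]] by simp
      also have "\<dots> \<le> 4 * ((R + s)\<^sup>2 * err n) + 4 * ((R + s)\<^sup>2 * err n) + 4 * (s\<^sup>2 * err n)"
        by (intro add_mono mult_left_mono qerr qerr' Sherr) auto
      finally show ?thesis .
    qed
    have "(\<lambda>n. 4 * ((R + s)\<^sup>2 * err n) + 4 * ((R + s)\<^sup>2 * err n) + 4 * (s\<^sup>2 * err n))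
        \<longlonglongrightarrow> 4 * ((R + s)\<^sup>2 * 0) + 4 * ((R + s)\<^sup>2 * 0) + 4 * (s\<^sup>2 * 0)"
      by (intro tendsto_intros err_tendsto)
    then have "(LINT z|lborel. (norm (indicat_real (below R) z *\<^sub>R \<Delta> z))\<^sup>2)
        \<le> 4 * ((R + s)\<^sup>2 * 0) + 4 * ((R + s)\<^sup>2 * 0) + 4 * (s\<^sup>2 * 0)"
      by (rule LIMSEQ_le_const) (use le in blast)
    then have "(LINT z|lborel. (norm (indicat_real (below R) z *\<^sub>R \<Delta> z))\<^sup>2) = 0"
      by (simp add: antisym del: norm_scaleR)
    moreover have "integrable lborel (\<lambda>z. (norm (indicat_real (below R) z *\<^sub>R \<Delta> z))\<^sup>2)"
      by (intro square_integrableD(2) square_integrable_indicator \<Delta>) simp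
    ultimately have "AE z in lborel. (norm (indicat_real (below R) z *\<^sub>R \<Delta> z))\<^sup>2 = 0"
      by (subst (asm) integral_nonneg_eq_0_iff_AE) (simp_all del: norm_scaleR)
    then show ?thesis by eventually_elim auto
  qed
  have "AE z in lborel. \<forall>n. z \<in> below (real (Suc n)) \<longrightarrow> \<Delta> z = 0"
    unfolding AE_all_countable by (intro allI main) simp
  then show ?thesis
  proof eventually_elim
    case (elim z)
    obtain n where "z $ 3 < real n" using reals_Archimedean2 by blast
    then have "z \<in> below (real (Suc n))" by (auto simp: below_def)
    then have "\<Delta> z = 0" using elim by blast
    then show ?case by (simp add: \<Delta>_def algebra_simps)
  qed
qed

text \<open>A point value is compared with the values at the points of a unit cube: first horizontally, by
  the modulus of continuity, then vertically, by the vertical derivative.\<close>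

lemma bounded_if_horizontally_continuous:
  assumes \<kappa>: "\<kappa> \<ge> 0"
    and hc: "\<And>\<zeta>. \<zeta> $ 3 = 0 \<Longrightarrow> norm \<zeta> \<le> 2 \<Longrightarrow> AE x in lborel. norm (U x) \<le> \<kappa> + norm (U (x + \<zeta>))"
  shows "AE x in lborel. (norm (U x))\<^sup>2
    \<le> 3 * \<kappa>\<^sup>2 + 3 * (LINT x|lborel. (norm (U x))\<^sup>2) + 3 * (LINT x|lborel. (norm (G x))\<^sup>2)"
proof -
  let ?g = "\<lambda>y. column 3 (G y)"
  define h where "h z = (\<integral>\<^sup>+r. ennreal ((norm (?g (z - r *\<^sub>R (- e3))))\<^sup>2) * indicator {0..1} r \<partial>lborel)" for z
  have [measurable]: "?g \<in> borel_measurable borel" by measurable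
  have [measurable]: "h \<in> borel_measurable borel" unfolding h_def by measurable
  \<comment> \<open>Displacements downwards, since \<open>vertical_increment\<close> moves upwards from the displaced point.\<close>
  define Q where "Q = cbox (\<chi> i. -1) (0::real^3)"
  have Q1: "emeasure lborel Q = 1"
  proof -
    have "emeasure lborel Q = ennreal (\<Prod>b\<in>Basis. (0 - ((\<chi> i. -1) :: real^3)) \<bullet> b)"
      unfolding Q_def by (rule emeasure_lborel_cbox) (auto simp: Basis_vec_def inner_axis)
    also have "(\<Prod>b\<in>Basis. (0 - ((\<chi> i. -1) :: real^3)) \<bullet> b) = (\<Prod>b\<in>(Basis::(real^3) set). 1)"
      by (intro prod.cong) (auto simp: Basis_vec_def inner_axis)
    finally show ?thesis by simp
  qed
  have [measurable]: "Q \<in> sets borel" by (simp add: Q_def)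
  define P where "P x \<zeta> \<longleftrightarrow> (\<zeta> \<in> Q \<longrightarrow>
      ennreal ((norm (U x))\<^sup>2) \<le> ennreal (3 * \<kappa>\<^sup>2) + 3 * ennreal ((norm (U (x + \<zeta>)))\<^sup>2) + 3 * h (x + \<zeta>))" for x \<zeta>
  \<comment> \<open>For fixed \<open>\<zeta>\<close> the comparison holds for almost every \<open>x\<close>, with a null set that depends on \<open>\<zeta>\<close>; Fubini
    exchanges the two quantifiers so that one may integrate over \<open>\<zeta>\<close> at a fixed \<open>x\<close>.\<close>
  have fixed: "AE x in lborel. P x \<zeta>" for \<zeta>
  proof (cases "\<zeta> \<in> Q")
    case False then show ?thesis by (simp add: P_def)
  next
    case True
    define s where "s = - \<zeta> $ 3"
    have zi: "-1 \<le> \<zeta> $ i" "\<zeta> $ i \<le> 0" for i using True by (auto simp: Q_def mem_box_cart)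
    have s: "0 \<le> s" "s \<le> 1" using zi[of 3] by (auto simp: s_def)
    define \<eta> where "\<eta> = \<zeta> + s *\<^sub>R e3"
    have eta3: "\<eta> $ 3 = 0" by (simp add: \<eta>_def s_def)
    have etan: "norm \<eta> \<le> 2"
    proof -
      have "norm \<eta> \<le> (\<Sum>i\<in>UNIV. \<bar>\<eta> $ i\<bar>)" by (rule norm_le_l1_cart)
      also have "\<dots> = \<bar>\<zeta> $ 1\<bar> + \<bar>\<zeta> $ 2\<bar>" by (simp add: sum_3 \<eta>_def s_def axis_def)
      also have "\<dots> \<le> 2" using zi[of 1] zi[of 2] by linarith
      finally show ?thesis .
    qed
    have "AE x in lborel. U ((x - (- \<zeta>)) + s *\<^sub>R e3) = U (x - (- \<zeta>)) + shift_integral (- e3) s ?g (x - (- \<zeta>))"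
      by (rule AE_lborel_translate[OF vertical_increment[OF s(1)]])
    with hc[OF eta3 etan] show ?thesis
    proof eventually_elim
      case (elim x)
      let ?z = "x + \<zeta>"
      have "norm (U x) \<le> \<kappa> + (norm (U ?z) + norm (shift_integral (- e3) s ?g ?z))"
        using elim norm_triangle_ineq[of "U ?z" "shift_integral (- e3) s ?g ?z"] by (simp add: \<eta>_def add.assoc)
      then have "(norm (U x))\<^sup>2 \<le> (\<kappa> + norm (U ?z) + norm (shift_integral (- e3) s ?g ?z))\<^sup>2"
        by (intro power_mono) auto
      also have "\<dots> \<le> 3 * \<kappa>\<^sup>2 + 3 * (norm (U ?z))\<^sup>2 + 3 * (norm (shift_integral (- e3) s ?g ?z))\<^sup>2"
        by (rule norm_sq_3)
      finally have "ennreal ((norm (U x))\<^sup>2) \<le> ennreal (3 * \<kappa>\<^sup>2 + 3 * (norm (U ?z))\<^sup>2 + 3 * (norm (shift_integral (- e3) s ?g ?z))\<^sup>2)"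
        by (rule ennreal_leI)
      also have "\<dots> = ennreal (3 * \<kappa>\<^sup>2) + 3 * ennreal ((norm (U ?z))\<^sup>2) + 3 * ennreal ((norm (shift_integral (- e3) s ?g ?z))\<^sup>2)"
        by (simp add: ennreal_plus ennreal_mult del: ennreal_plus[symmetric])
      also have "\<dots> \<le> ennreal (3 * \<kappa>\<^sup>2) + 3 * ennreal ((norm (U ?z))\<^sup>2) + 3 * h ?z"
      proof (intro add_mono mult_left_mono order_refl)
        have "ennreal ((norm (shift_integral (- e3) s ?g ?z))\<^sup>2)
          \<le> ennreal s * (\<integral>\<^sup>+r. ennreal ((norm (?g (?z - r *\<^sub>R (- e3))))\<^sup>2) * indicator {0..s} r \<partial>lborel)"
          unfolding shift_integral_def by (rule norm_set_integral_sq_le[OF s(1)]) measurable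
        also have "\<dots> \<le> 1 * h ?z"
          unfolding h_def using s by (intro mult_mono nn_integral_mono) (auto simp: indicator_def)
        finally show "ennreal ((norm (shift_integral (- e3) s ?g ?z))\<^sup>2) \<le> h ?z" by simp
      qed simp_all
      finally show ?case by (simp add: P_def)
    qed
  qed
  have Pm: "Measurable.pred (lborel \<Otimes>\<^sub>M lborel) (\<lambda>z. P (fst z) (snd z))"
    unfolding P_def by measurable
  have "(\<integral>\<^sup>+z. h z \<partial>lborel) = ennreal (1 - 0) * (\<integral>\<^sup>+z. ennreal ((norm (?g z))\<^sup>2) \<partial>lborel)"
    unfolding h_def by (rule nn_integral_segment) auto
  also have "\<dots> \<le> (\<integral>\<^sup>+z. ennreal ((norm (G z))\<^sup>2) \<partial>lborel)"
    by (auto intro!: nn_integral_mono ennreal_leI power_mono norm_column_le)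
  finally have hle: "(\<integral>\<^sup>+z. h z \<partial>lborel) \<le> (\<integral>\<^sup>+z. ennreal ((norm (G z))\<^sup>2) \<partial>lborel)" .
  have "AE x in lborel. AE \<zeta> in lborel. P x \<zeta>"
    by (subst lborel_pair.AE_commute) (use Pm fixed in \<open>auto simp: pred_def\<close>)
  then show ?thesis
  proof eventually_elim
    case (elim x)
    let ?M = "3 * \<kappa>\<^sup>2 + 3 * (LINT x|lborel. (norm (U x))\<^sup>2) + 3 * (LINT x|lborel. (norm (G x))\<^sup>2)"
    have "ennreal ((norm (U x))\<^sup>2) = (\<integral>\<^sup>+\<zeta>. ennreal ((norm (U x))\<^sup>2) * indicator Q \<zeta> \<partial>lborel)"
      by (simp add: nn_integral_cmult_indicator Q1)
    also have "\<dots> \<le> (\<integral>\<^sup>+\<zeta>. ennreal (3 * \<kappa>\<^sup>2) * indicator Q \<zeta> + (3 * ennreal ((norm (U (\<zeta> - (- x))))\<^sup>2) + 3 * h (\<zeta> - (- x))) \<partial>lborel)"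
      by (rule nn_integral_mono_AE) (use elim in eventually_elim, auto simp: P_def indicator_def add.commute add.left_commute)
    also have "\<dots> = ennreal (3 * \<kappa>\<^sup>2) + (3 * (\<integral>\<^sup>+z. ennreal ((norm (U z))\<^sup>2) \<partial>lborel) + 3 * (\<integral>\<^sup>+z. h z \<partial>lborel))"
      by (subst nn_integral_add, measurable, subst nn_integral_add, measurable,
          subst nn_integral_cmult, measurable, subst nn_integral_cmult, measurable,
          subst nn_integral_lborel_translate[where f="\<lambda>z. ennreal ((norm (U z))\<^sup>2)"], measurable,
          subst nn_integral_lborel_translate[where f=h], measurable)
        (simp add: nn_integral_cmult_indicator Q1)
    also have "\<dots> \<le> ennreal (3 * \<kappa>\<^sup>2) + (3 * (\<integral>\<^sup>+z. ennreal ((norm (U z))\<^sup>2) \<partial>lborel) + 3 * (\<integral>\<^sup>+z. ennreal ((norm (G z))\<^sup>2) \<partial>lborel))"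
      by (intro add_mono mult_left_mono hle order_refl) simp_all
    also have "ennreal (3 * \<kappa>\<^sup>2) + (3 * (\<integral>\<^sup>+z. ennreal ((norm (U z))\<^sup>2) \<partial>lborel) + 3 * (\<integral>\<^sup>+z. ennreal ((norm (G z))\<^sup>2) \<partial>lborel)) = ennreal ?M"
      using square_integrableD(2)[OF U] square_integrableD(2)[OF G]
      by (simp add: nn_integral_eq_integral ennreal_mult[symmetric] add.assoc flip: ennreal_plus ennreal_numeral)
    finally have "ennreal ((norm (U x))\<^sup>2) \<le> ennreal ?M" .
    then show ?case by (subst (asm) ennreal_le_iff) auto
  qed
qed

end

section \<open>From the half space to the whole space\<close>

lemma AE_lebesgue_on_iff:
  assumes "S \<in> sets borel"
  shows "(AE x in lebesgue_on S. P x) \<longleftrightarrow> (AE x in lborel. x \<in> S \<longrightarrow> P x)"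
proof -
  have "S \<in> sets lebesgue" using assms by simp
  then show ?thesis by (simp add: AE_restrict_space_iff AE_completion_iff)
qed

lemma lebesgue_ex_borel_version:
  fixes f :: "'a::euclidean_space \<Rightarrow> 'b::euclidean_space"
  assumes "f \<in> borel_measurable lebesgue"
  shows "\<exists>F\<in>borel_measurable borel. AE x in lborel. f x = F x"
proof -
  have "\<exists>h. h \<in> borel_measurable borel \<and> (AE x in lborel. f x \<bullet> b = h x)" for b
    using completion_ex_borel_measurable_real[of "\<lambda>x. f x \<bullet> b" lborel] assms by auto
  then obtain h where h: "\<And>b. h b \<in> borel_measurable borel" "\<And>b. AE x in lborel. f x \<bullet> b = h b x"
    by metis
  have [measurable]: "h b \<in> borel_measurable borel" for b by (rule h)
  have "AE x in lborel. \<forall>b\<in>Basis. f x \<bullet> b = h b x"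
    by (intro AE_finite_allI h) simp
  then have "AE x in lborel. f x = (\<Sum>b\<in>Basis. h b x *\<^sub>R b)"
  proof eventually_elim
    case (elim x)
    have "f x = (\<Sum>b\<in>Basis. (f x \<bullet> b) *\<^sub>R b)" by (simp add: euclidean_representation)
    then show ?case using elim by simp
  qed
  then show ?thesis by (intro bexI[of _ "\<lambda>x. \<Sum>b\<in>Basis. h b x *\<^sub>R b"]) measurable
qed

lemma lebesgue_on_ex_borel_version:
  fixes f :: "'a::euclidean_space \<Rightarrow> 'b::euclidean_space"
  assumes f: "f \<in> borel_measurable (lebesgue_on S)" and S: "S \<in> sets borel"
  shows "\<exists>F\<in>borel_measurable borel. (\<forall>x. x \<notin> S \<longrightarrow> F x = 0) \<and> (AE x in lebesgue_on S. f x = F x)"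
proof -
  have "(\<lambda>x. indicat_real S x *\<^sub>R f x) \<in> borel_measurable lebesgue"
    using f S by (subst (asm) borel_measurable_restrict_space_iff) auto
  then obtain F where F: "F \<in> borel_measurable borel" "AE x in lborel. indicat_real S x *\<^sub>R f x = F x"
    using lebesgue_ex_borel_version by blast
  show ?thesis
  proof (intro bexI[of _ "\<lambda>x. indicat_real S x *\<^sub>R F x"] conjI)
    show "AE x in lebesgue_on S. f x = indicat_real S x *\<^sub>R F x"
      unfolding AE_lebesgue_on_iff[OF S] using F(2) by eventually_elim auto
    show "(\<lambda>x. indicat_real S x *\<^sub>R F x) \<in> borel_measurable borel"
      using F(1) S by measurable
  qed auto
qed

lemma
  fixes f F :: "'a::euclidean_space \<Rightarrow> 'b::{banach, second_countable_topology}"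
  assumes S: "S \<in> sets borel" and f: "f \<in> borel_measurable (lebesgue_on S)"
    and F: "F \<in> borel_measurable borel" "\<And>x. x \<notin> S \<Longrightarrow> F x = 0"
    and eq: "AE x in lebesgue_on S. f x = F x"
  shows integral_lebesgue_on_eq: "(LINT x|lebesgue_on S. f x) = (LINT x|lborel. F x)"
    and integrable_lebesgue_on_eq: "integrable (lebesgue_on S) f \<longleftrightarrow> integrable lborel F"
proof -
  have Sl: "S \<inter> space lebesgue \<in> sets lebesgue" using S by simp
  have Fl: "F \<in> borel_measurable (lebesgue_on S)"
    using F(1) by (intro measurable_restrict_space1 measurable_completion) simp
  have ind: "(\<lambda>x. indicat_real S x *\<^sub>R F x) = F" using F(2) by (auto simp: fun_eq_iff indicator_def)
  have "(LINT x|lebesgue_on S. f x) = (LINT x|lebesgue_on S. F x)"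
    by (rule integral_cong_AE[OF f Fl eq])
  also have "\<dots> = (LINT x|lborel. F x)"
    unfolding integral_restrict_space[OF Sl] ind using F(1) by (simp add: integral_completion)
  finally show "(LINT x|lebesgue_on S. f x) = (LINT x|lborel. F x)" .
  have "integrable (lebesgue_on S) f \<longleftrightarrow> integrable (lebesgue_on S) F"
    by (rule integrable_cong_AE[OF f Fl eq])
  also have "\<dots> \<longleftrightarrow> integrable lborel F"
    unfolding integrable_restrict_space[OF Sl] ind using F(1) by (simp add: integrable_completion)
  finally show "integrable (lebesgue_on S) f \<longleftrightarrow> integrable lborel F" .
qed

lemma square_integrable_lebesgue_on_eq:
  fixes f F :: "'a::euclidean_space \<Rightarrow> 'b::euclidean_space"
  assumes S: "S \<in> sets borel" and f: "f \<in> borel_measurable (lebesgue_on S)"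
    and F: "F \<in> borel_measurable borel" "\<And>x. x \<notin> S \<Longrightarrow> F x = 0"
    and eq: "AE x in lebesgue_on S. f x = F x"
  shows "square_integrable (lebesgue_on S) f \<longleftrightarrow> square_integrable lborel F"
proof -
  have "integrable (lebesgue_on S) (\<lambda>x. (norm (f x))\<^sup>2) \<longleftrightarrow> integrable lborel (\<lambda>x. (norm (F x))\<^sup>2)"
    by (rule integrable_lebesgue_on_eq[OF S]) (use f F eq in auto)
  then show ?thesis using f F(1) by (simp add: square_integrable_def)
qed

lemma in_Lp_2: "in_Lp 2 f \<longleftrightarrow> square_integrable (lebesgue_on half_space) f"
  by (simp add: in_Lp_def square_integrable_def)

lemma L2_norm_sq: "(L2_norm f)\<^sup>2 = (LINT x|lebesgue_on half_space. (norm (f x))\<^sup>2)"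
  unfolding L2_norm_def by (rule real_sqrt_pow2) simp

lemma L2_norm_nonneg: "L2_norm f \<ge> 0"
  by (simp add: L2_norm_def)

lemma L2_norm_sq_inner: "(L2_norm f)\<^sup>2 = L2_inner f f"
  by (simp add: L2_norm_sq L2_inner_def power2_norm_eq_inner)

lemma L2_inner_le:
  assumes "in_Lp 2 f" "in_Lp 2 g"
  shows "\<bar>L2_inner f g\<bar> \<le> L2_norm f * L2_norm g"
  using integral_inner_le[of "lebesgue_on half_space" f g] assms
  by (simp add: in_Lp_2 L2_inner_def L2_norm_def)

lemma test_function_borel_half_space:
  fixes \<phi> :: "real^3 \<Rightarrow> 'b::euclidean_space"
  assumes "test_function half_space \<phi>"
  shows "\<phi> \<in> borel_measurable borel" "\<And>x. x \<notin> half_space \<Longrightarrow> \<phi> x = 0"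
    "\<phi> \<in> borel_measurable (lebesgue_on half_space)" "in_Lp 2 \<phi>"
proof -
  show 1: "\<phi> \<in> borel_measurable borel"
    using test_function_bounded_integrable(1)[OF assms] by auto
  show 2: "\<phi> x = 0" if "x \<notin> half_space" for x using test_function_zero[OF assms that] .
  show 3: "\<phi> \<in> borel_measurable (lebesgue_on half_space)"
    using 1 by (intro measurable_restrict_space1 measurable_completion) simp
  show "in_Lp 2 \<phi>"
    unfolding in_Lp_2 using square_integrable_lebesgue_on_eq[OF half_space_measurable 3 1 2] test_function_bounded_integrable(2)[OF assms]
    by simp
qed

lemma has_weak_gradient_weak_gradient:
  "has_weak_gradient u G \<Longrightarrow> has_weak_gradient u (weak_gradient u)"
  unfolding weak_gradient_def by (rule someI[of "has_weak_gradient u" G])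

lemma space_V_weak_gradient:
  assumes "u \<in> space_V"
  shows "has_weak_gradient u (weak_gradient u)" "in_Lp 2 (weak_gradient u)"
  using assms has_weak_gradient_weak_gradient by (auto simp: space_V_def W12_hom_zero_def)

text \<open>Transfers a field of \<open>V \<inter> L\<^sup>2\<close> to the setting in which the approximation results were proved.\<close>

lemma zero_extension:
  assumes V: "u \<in> space_V" and u2: "in_Lp 2 u"
  obtains U G f where "grad_approximable U G f"
    and "AE x in lebesgue_on half_space. u x = U x"
    and "AE x in lebesgue_on half_space. weak_gradient u x = G x"
proof -
  let ?H = "lebesgue_on half_space"
  note hw = space_V_weak_gradient(1)[OF V] and G2 = space_V_weak_gradient(2)[OF V]
  have um: "u \<in> borel_measurable ?H" and gm: "weak_gradient u \<in> borel_measurable ?H"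
    using u2 G2 by (auto simp: in_Lp_def)
  obtain U where U: "U \<in> borel_measurable borel" "\<And>x. x \<notin> half_space \<Longrightarrow> U x = 0" "AE x in ?H. u x = U x"
    using lebesgue_on_ex_borel_version[OF um half_space_measurable] by blast
  obtain G where G: "G \<in> borel_measurable borel" "\<And>x. x \<notin> half_space \<Longrightarrow> G x = 0" "AE x in ?H. weak_gradient u x = G x"
    using lebesgue_on_ex_borel_version[OF gm half_space_measurable] by blast
  have [measurable]: "U \<in> borel_measurable borel" "G \<in> borel_measurable borel" by fact+
  obtain f where f: "\<And>n. solenoidal_test (f n)" "grad_tendsto f u"
    using V by (auto simp: space_V_def)
  have ft: "test_function half_space (f n)" for n using f by (simp add: solenoidal_test_def)
  have "grad_approximable U G f"
  proof
    show "square_integrable lborel U"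
      using square_integrable_lebesgue_on_eq[OF half_space_measurable um U] u2 by (simp add: in_Lp_2)
    show "square_integrable lborel G"
      using square_integrable_lebesgue_on_eq[OF half_space_measurable gm G] G2 by (simp add: in_Lp_2)
    show "U x = 0" "G x = 0" if "x \<notin> half_space" for x using U G that by auto
    show "solenoidal_test (f n)" for n by fact
    show "(LINT x|lborel. U x $ i * frechet_derivative \<psi> (at x) (axis j 1)) = - (LINT x|lborel. G x $ i $ j * \<psi> x)"
      if \<psi>: "test_function half_space \<psi>" for \<psi> i j
    proof -
      note p = test_function_borel_half_space[OF \<psi>] and dp = test_function_borel_half_space[OF test_function_derivative[OF \<psi>, of "axis j 1"]]
      have [measurable]: "\<psi> \<in> borel_measurable borel" "(\<lambda>x. frechet_derivative \<psi> (at x) (axis j 1)) \<in> borel_measurable borel"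
        by (fact p dp)+
      have "(LINT x|?H. u x $ i * frechet_derivative \<psi> (at x) (axis j 1)) = (LINT x|lborel. U x $ i * frechet_derivative \<psi> (at x) (axis j 1))"
      proof (rule integral_lebesgue_on_eq[OF half_space_measurable])
        show "(\<lambda>x. u x $ i * frechet_derivative \<psi> (at x) (axis j 1)) \<in> borel_measurable ?H"
          by (intro borel_measurable_times borel_measurable_nth um dp)
        show "AE x in ?H. u x $ i * frechet_derivative \<psi> (at x) (axis j 1) = U x $ i * frechet_derivative \<psi> (at x) (axis j 1)"
          using U(3) by eventually_elim simp
      qed (auto simp: dp)
      moreover have "(LINT x|?H. weak_gradient u x $ i $ j * \<psi> x) = (LINT x|lborel. G x $ i $ j * \<psi> x)"
      proof (rule integral_lebesgue_on_eq[OF half_space_measurable])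
        show "(\<lambda>x. weak_gradient u x $ i $ j * \<psi> x) \<in> borel_measurable ?H"
          by (intro borel_measurable_times borel_measurable_nth gm p)
        show "AE x in ?H. weak_gradient u x $ i $ j * \<psi> x = G x $ i $ j * \<psi> x"
          using G(3) by eventually_elim simp
      qed (auto simp: p)
      ultimately show ?thesis using hw \<psi> by (simp add: has_weak_gradient_def)
    qed
    have eq: "(L2_norm (\<lambda>x. jacobian (f n) (at x) - weak_gradient u x))\<^sup>2 = (LINT x|lborel. (norm (jacobian (f n) (at x) - G x))\<^sup>2)" for n
    proof -
      note J = test_function_borel_half_space[OF test_function_jacobian[OF ft[of n]]]
      have [measurable]: "(\<lambda>x. jacobian (f n) (at x)) \<in> borel_measurable borel"
        "(\<lambda>x. jacobian (f n) (at x)) \<in> borel_measurable ?H" "weak_gradient u \<in> borel_measurable ?H" by (fact J gm)+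
      show ?thesis unfolding L2_norm_sq
      proof (rule integral_lebesgue_on_eq[OF half_space_measurable])
        show "(\<lambda>x. (norm (jacobian (f n) (at x) - weak_gradient u x))\<^sup>2) \<in> borel_measurable ?H"
          by measurable
        show "AE x in ?H. (norm (jacobian (f n) (at x) - weak_gradient u x))\<^sup>2 = (norm (jacobian (f n) (at x) - G x))\<^sup>2"
          using G(3) by eventually_elim simp
      qed (auto simp: J G)
    qed
    have "(\<lambda>n. (L2_norm (\<lambda>x. jacobian (f n) (at x) - weak_gradient u x))\<^sup>2) \<longlonglongrightarrow> 0\<^sup>2"
      using f(2) unfolding grad_tendsto_def by (intro tendsto_power)
    then show "(\<lambda>n. LINT x|lborel. (norm (jacobian (f n) (at x) - G x))\<^sup>2) \<longlonglongrightarrow> 0"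
      unfolding eq by simp
  qed
  from that[OF this U(3) G(3)] show thesis .
qed

lemma L2_inner_eq_lborel:
  fixes a A b B :: "real^3 \<Rightarrow> 'b::euclidean_space"
  assumes "a \<in> borel_measurable (lebesgue_on half_space)" "b \<in> borel_measurable (lebesgue_on half_space)"
    and "A \<in> borel_measurable borel" "B \<in> borel_measurable borel"
    and "\<And>x. x \<notin> half_space \<Longrightarrow> A x = 0 \<or> B x = 0"
    and "AE x in lebesgue_on half_space. a x = A x" "AE x in lebesgue_on half_space. b x = B x"
  shows "L2_inner a b = (LINT x|lborel. A x \<bullet> B x)"
  unfolding L2_inner_def
proof (rule integral_lebesgue_on_eq[OF half_space_measurable])
  show "AE x in lebesgue_on half_space. a x \<bullet> b x = A x \<bullet> B x"
    using assms(6,7) by eventually_elim simp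
  show "A x \<bullet> B x = 0" if "x \<notin> half_space" for x using assms(5)[OF that] by auto
qed (use assms(1-4) in auto)

lemma L2_norm_sq_eq_lborel:
  fixes a A :: "real^3 \<Rightarrow> 'b::euclidean_space"
  assumes "a \<in> borel_measurable (lebesgue_on half_space)" "A \<in> borel_measurable borel"
    and "\<And>x. x \<notin> half_space \<Longrightarrow> A x = 0" "AE x in lebesgue_on half_space. a x = A x"
  shows "(L2_norm a)\<^sup>2 = (LINT x|lborel. (norm (A x))\<^sup>2)"
  unfolding L2_norm_sq_inner power2_norm_eq_inner by (rule L2_inner_eq_lborel) (use assms in auto)

lemma V_weak_approximants:
  assumes V: "u \<in> space_V" and u2: "in_Lp 2 u"
  obtains \<phi> :: "nat \<Rightarrow> real^3 \<Rightarrow> real^3" and C :: real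
  where "\<And>k. solenoidal_test (\<phi> k)" "\<And>k. L2_norm (\<phi> k) \<le> C"
    and "\<And>k. L2_norm (\<lambda>x. jacobian (\<phi> k) (at x)) \<le> C"
    and "\<And>a. in_Lp 2 a \<Longrightarrow> (\<lambda>k. L2_inner a (\<phi> k)) \<longlonglongrightarrow> L2_inner a u"
    and "\<And>Q. in_Lp 2 Q \<Longrightarrow> (\<lambda>k. L2_inner Q (\<lambda>x. jacobian (\<phi> k) (at x))) \<longlonglongrightarrow> L2_inner Q (weak_gradient u)"
proof (rule zero_extension[OF V u2])
  fix U G f assume a: "grad_approximable U G f" and Ueq: "AE x in lebesgue_on half_space. u x = U x"
    and Geq: "AE x in lebesgue_on half_space. weak_gradient u x = G x"
  interpret grad_approximable U G f by fact
  have um: "u \<in> borel_measurable (lebesgue_on half_space)" "weak_gradient u \<in> borel_measurable (lebesgue_on half_space)"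
    using u2 space_V_weak_gradient(2)[OF V] by (auto simp: in_Lp_def)
  show thesis
  proof (rule weak_approximants)
    fix \<phi> C
    assume \<phi>: "\<And>k. solenoidal_test (\<phi> k)"
     "\<And>k. (LINT x|lborel. (norm (\<phi> k x))\<^sup>2) \<le> C"
     "\<And>k. (LINT x|lborel. (norm (jacobian (\<phi> k) (at x)))\<^sup>2) \<le> C"
     "\<And>a. square_integrable lborel a \<Longrightarrow> (\<lambda>k. LINT x|lborel. a x \<bullet> \<phi> k x) \<longlonglongrightarrow> (LINT x|lborel. a x \<bullet> U x)"
     "\<And>Q. square_integrable lborel Q \<Longrightarrow>
      (\<lambda>k. LINT x|lborel. Q x \<bullet> jacobian (\<phi> k) (at x)) \<longlonglongrightarrow> (LINT x|lborel. Q x \<bullet> G x)"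
    have t: "test_function half_space (\<phi> k)" for k using \<phi>(1) by (simp add: solenoidal_test_def)
    note p = test_function_borel_half_space[OF t] and J = test_function_borel_half_space[OF test_function_jacobian[OF t]]
    have version: "\<exists>A. square_integrable lborel A \<and> (\<forall>x. x \<notin> half_space \<longrightarrow> A x = 0) \<and> (AE x in lebesgue_on half_space. a x = A x)"
      if a: "in_Lp 2 a" for a :: "real^3 \<Rightarrow> 'b::euclidean_space"
    proof -
      have am: "a \<in> borel_measurable (lebesgue_on half_space)" using a by (simp add: in_Lp_def)
      obtain A where A: "A \<in> borel_measurable borel" "\<And>x. x \<notin> half_space \<Longrightarrow> A x = 0" "AE x in lebesgue_on half_space. a x = A x"
        using lebesgue_on_ex_borel_version[OF am half_space_measurable] by blast
      then show ?thesis
        using square_integrable_lebesgue_on_eq[OF half_space_measurable am A] a by (auto simp: in_Lp_2)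
    qed
    show thesis
    proof (rule that[of \<phi> "sqrt C"])
      show "solenoidal_test (\<phi> k)" for k by (rule \<phi>)
      show "L2_norm (\<phi> k) \<le> sqrt C" for k
        using \<phi>(2)[of k] by (intro real_le_rsqrt) (subst L2_norm_sq_eq_lborel[OF p(3) p(1) p(2)], auto)
      show "L2_norm (\<lambda>x. jacobian (\<phi> k) (at x)) \<le> sqrt C" for k
        using \<phi>(3)[of k] by (intro real_le_rsqrt) (subst L2_norm_sq_eq_lborel[OF J(3) J(1) J(2)], auto)
      show "(\<lambda>k. L2_inner a (\<phi> k)) \<longlonglongrightarrow> L2_inner a u" if a: "in_Lp 2 a" for a
      proof -
        obtain A where A: "square_integrable lborel A" "\<And>x. x \<notin> half_space \<Longrightarrow> A x = 0" "AE x in lebesgue_on half_space. a x = A x"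
          using version[OF a] by blast
        have am: "a \<in> borel_measurable (lebesgue_on half_space)" "A \<in> borel_measurable borel"
          using a A by (auto simp: in_Lp_def square_integrable_def)
        have "L2_inner a (\<phi> k) = (LINT x|lborel. A x \<bullet> \<phi> k x)" for k
          by (rule L2_inner_eq_lborel) (use am A p in auto)
        moreover have "L2_inner a u = (LINT x|lborel. A x \<bullet> U x)"
          by (rule L2_inner_eq_lborel) (use am A um Ueq in auto)
        ultimately show ?thesis using \<phi>(4)[OF A(1)] by simp
      qed
      show "(\<lambda>k. L2_inner Q (\<lambda>x. jacobian (\<phi> k) (at x))) \<longlonglongrightarrow> L2_inner Q (weak_gradient u)" if a: "in_Lp 2 Q" for Q
      proof -
        obtain A where A: "square_integrable lborel A" "\<And>x. x \<notin> half_space \<Longrightarrow> A x = 0" "AE x in lebesgue_on half_space. Q x = A x"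
          using version[OF a] by blast
        have am: "Q \<in> borel_measurable (lebesgue_on half_space)" "A \<in> borel_measurable borel"
          using a A by (auto simp: in_Lp_def square_integrable_def)
        have "L2_inner Q (\<lambda>x. jacobian (\<phi> k) (at x)) = (LINT x|lborel. A x \<bullet> jacobian (\<phi> k) (at x))" for k
          by (rule L2_inner_eq_lborel) (use am A J in auto)
        moreover have "L2_inner Q (weak_gradient u) = (LINT x|lborel. A x \<bullet> G x)"
          by (rule L2_inner_eq_lborel) (use am A um Geq in auto)
        ultimately show ?thesis using \<phi>(5)[OF A(1)] by simp
      qed
    qed
  qed
qed

lemma V_trilinear_antisymmetry:
  assumes V: "u \<in> space_V" and u2: "in_Lp 2 u" and \<phi>: "test_function half_space \<phi>"
  shows "L2_inner (\<lambda>x. weak_gradient u x *v u x) \<phi> = - L2_inner (\<lambda>x. jacobian \<phi> (at x) *v u x) u"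
proof (rule zero_extension[OF V u2])
  fix U G f assume a: "grad_approximable U G f" and Ueq: "AE x in lebesgue_on half_space. u x = U x"
    and Geq: "AE x in lebesgue_on half_space. weak_gradient u x = G x"
  interpret grad_approximable U G f by fact
  have um: "u \<in> borel_measurable (lebesgue_on half_space)" "weak_gradient u \<in> borel_measurable (lebesgue_on half_space)"
    using u2 space_V_weak_gradient(2)[OF V] by (auto simp: in_Lp_def)
  note p = test_function_borel_half_space[OF \<phi>] and J = test_function_borel_half_space[OF test_function_jacobian[OF \<phi>]]
  have "L2_inner (\<lambda>x. weak_gradient u x *v u x) \<phi> = (LINT x|lborel. (G x *v U x) \<bullet> \<phi> x)"
  proof (rule L2_inner_eq_lborel)
    show "AE x in lebesgue_on half_space. weak_gradient u x *v u x = G x *v U x"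
      using Ueq Geq by eventually_elim simp
  qed (use um p in \<open>auto intro!: borel_measurable_matrix_vector\<close>)
  moreover have "L2_inner (\<lambda>x. jacobian \<phi> (at x) *v u x) u = (LINT x|lborel. (jacobian \<phi> (at x) *v U x) \<bullet> U x)"
  proof (rule L2_inner_eq_lborel)
    show "AE x in lebesgue_on half_space. jacobian \<phi> (at x) *v u x = jacobian \<phi> (at x) *v U x"
      using Ueq by eventually_elim simp
  qed (use um p J Ueq U_outside in \<open>auto intro!: borel_measurable_matrix_vector\<close>)
  ultimately show ?thesis using trilinear_antisymmetry[OF \<phi>] by simp
qed

lemma hpoint_nth: "hpoint p z $ 1 = p $ 1" "hpoint p z $ 2 = p $ 2" "hpoint p z $ 3 = z"
  by (simp_all add: hpoint_def)

lemma norm_vec2: "norm (p :: real^2) = sqrt ((p $ 1)\<^sup>2 + (p $ 2)\<^sup>2)"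
  by (simp add: norm_eq_sqrt_inner inner_vec_def sum_2 power2_eq_square)

lemma norm_vec3: "norm (p :: real^3) = sqrt ((p $ 1)\<^sup>2 + (p $ 2)\<^sup>2 + (p $ 3)\<^sup>2)"
  by (simp add: norm_eq_sqrt_inner inner_vec_def sum_3 power2_eq_square)

text \<open>The hypothesis on \<open>u\<close> holds pointwise at almost every height.  For a fixed horizontal displacement it
  gives an estimate at almost every point for the Borel version as well, because a null set and its
  translate are avoided at the same time.\<close>

lemma V_C_hor_bounded:
  assumes V: "u \<in> space_V" and u2: "in_Lp 2 u" and hor: "u \<in> C_hor \<omega>"
    and \<omega>: "\<And>s. s > 0 \<Longrightarrow> \<omega> s \<ge> 0" "mono_on {0<..} \<omega>"
  shows "AE x in lebesgue_on half_space. (norm (u x))\<^sup>2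
    \<le> 3 * (\<omega> 2)\<^sup>2 + 3 * (L2_norm u)\<^sup>2 + 3 * (L2_norm (weak_gradient u))\<^sup>2"
proof (rule zero_extension[OF V u2])
  fix U G f assume a: "grad_approximable U G f" and Ueq: "AE x in lebesgue_on half_space. u x = U x"
    and Geq: "AE x in lebesgue_on half_space. weak_gradient u x = G x"
  interpret grad_approximable U G f by fact
  have um: "u \<in> borel_measurable (lebesgue_on half_space)" "weak_gradient u \<in> borel_measurable (lebesgue_on half_space)"
    using u2 space_V_weak_gradient(2)[OF V] by (auto simp: in_Lp_def)
  have hz: "AE z in lborel. 0 < z \<longrightarrow> (\<forall>p q. p \<noteq> q \<longrightarrow> norm (u (hpoint p z) - u (hpoint q z)) \<le> \<omega> (norm (p - q)))"
    using hor AE_lebesgue_on_iff[of "{0::real<..}"] by (simp add: C_hor_def)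
  have Ueq': "AE x in lborel. x \<in> half_space \<longrightarrow> u x = U x"
    using Ueq by (simp add: AE_lebesgue_on_iff)
  have "AE x in lborel. (norm (U x))\<^sup>2
    \<le> 3 * (\<omega> 2)\<^sup>2 + 3 * (LINT x|lborel. (norm (U x))\<^sup>2) + 3 * (LINT x|lborel. (norm (G x))\<^sup>2)"
  proof (rule bounded_if_horizontally_continuous)
    show "\<omega> 2 \<ge> 0" using \<omega>(1) by simp
    fix \<zeta> :: "real^3" assume \<zeta>: "\<zeta> $ 3 = 0" "norm \<zeta> \<le> 2"
    have "AE x in lborel. x - (- \<zeta>) \<in> half_space \<longrightarrow> u (x - (- \<zeta>)) = U (x - (- \<zeta>))"
      by (rule AE_lborel_translate[OF Ueq'])
    with Ueq' AE_lborel_height[OF hz]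
    show "AE x in lborel. norm (U x) \<le> \<omega> 2 + norm (U (x + \<zeta>))"
    proof eventually_elim
      case (elim x)
      show ?case
      proof (cases "x \<in> half_space \<and> \<zeta> \<noteq> 0")
        case False
        then show ?thesis using \<omega>(1)[of 2] U_outside[of x] by auto
      next
        case True
        define p q :: "real^2" where "p = vector [x $ 1, x $ 2]" and "q = vector [x $ 1 + \<zeta> $ 1, x $ 2 + \<zeta> $ 2]"
        have x: "hpoint p (x $ 3) = x" "hpoint q (x $ 3) = x + \<zeta>"
          using \<zeta> by (simp_all add: vec_eq_iff forall_3 hpoint_nth p_def q_def)
        have n: "norm (p - q) = norm \<zeta>"
          using \<zeta> by (simp add: norm_vec2 norm_vec3 p_def q_def)
        then have "p \<noteq> q" using True by auto
        moreover have "0 < x $ 3" "x + \<zeta> \<in> half_space" using True \<zeta> by (auto simp: half_space_def)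
        ultimately have "norm (u x - u (x + \<zeta>)) \<le> \<omega> (norm \<zeta>)"
          using elim x n by metis
        also have "\<dots> \<le> \<omega> 2"
          using \<zeta> True by (intro mono_onD[OF \<omega>(2)]) auto
        finally have "norm (u x - u (x + \<zeta>)) \<le> \<omega> 2" .
        moreover have "u x = U x" "u (x + \<zeta>) = U (x + \<zeta>)"
          using elim True \<open>x + \<zeta> \<in> half_space\<close> by auto
        ultimately show ?thesis using norm_triangle_sub[of "U x" "U (x + \<zeta>)"] by simp
      qed
    qed
  qed
  then have bd: "AE x in lebesgue_on half_space. (norm (U x))\<^sup>2
    \<le> 3 * (\<omega> 2)\<^sup>2 + 3 * (LINT x|lborel. (norm (U x))\<^sup>2) + 3 * (LINT x|lborel. (norm (G x))\<^sup>2)"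
    unfolding AE_lebesgue_on_iff[OF half_space_measurable] by eventually_elim simp
  have nU: "(L2_norm u)\<^sup>2 = (LINT x|lborel. (norm (U x))\<^sup>2)"
    by (rule L2_norm_sq_eq_lborel) (use um Ueq U_outside in auto)
  have nG: "(L2_norm (weak_gradient u))\<^sup>2 = (LINT x|lborel. (norm (G x))\<^sup>2)"
    by (rule L2_norm_sq_eq_lborel) (use um Geq G_outside in auto)
  from bd Ueq show ?thesis
    unfolding nU nG by eventually_elim simp
qed

lemma convective_square_integrable:
  assumes V: "u \<in> space_V" and u2: "in_Lp 2 u"
    and M: "AE x in lebesgue_on half_space. (norm (u x))\<^sup>2 \<le> M"
  shows "in_Lp 2 (\<lambda>x. weak_gradient u x *v u x)"
    and "L2_norm (\<lambda>x. weak_gradient u x *v u x) \<le> sqrt M * L2_norm (weak_gradient u)"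
proof -
  let ?H = "lebesgue_on half_space"
  note G2 = space_V_weak_gradient(2)[OF V]
  have m: "u \<in> borel_measurable ?H" "weak_gradient u \<in> borel_measurable ?H"
    using u2 G2 by (auto simp: in_Lp_def)
  have gi: "integrable ?H (\<lambda>x. (norm (weak_gradient u x))\<^sup>2)"
    using G2 by (simp add: in_Lp_def)
  have le: "AE x in ?H. (norm (weak_gradient u x *v u x))\<^sup>2 \<le> M * (norm (weak_gradient u x))\<^sup>2"
    using M
  proof eventually_elim
    case (elim x)
    have "(norm (weak_gradient u x *v u x))\<^sup>2 \<le> (norm (weak_gradient u x) * norm (u x))\<^sup>2"
      by (intro power_mono norm_matrix_vector_le) simp
    also have "\<dots> \<le> (norm (weak_gradient u x))\<^sup>2 * M"
      unfolding power_mult_distrib by (intro mult_left_mono elim) simp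
    finally show ?case by (simp add: mult.commute)
  qed
  show sq: "in_Lp 2 (\<lambda>x. weak_gradient u x *v u x)"
    unfolding in_Lp_2
    by (rule square_integrable_bound[OF _ _ le]) (use m gi in \<open>auto intro!: borel_measurable_matrix_vector\<close>)
  have "(L2_norm (\<lambda>x. weak_gradient u x *v u x))\<^sup>2 \<le> (LINT x|?H. M * (norm (weak_gradient u x))\<^sup>2)"
    unfolding L2_norm_sq by (rule integral_mono_AE[OF _ _ le]) (use sq gi in \<open>auto simp: in_Lp_def\<close>)
  also have "\<dots> = M * (L2_norm (weak_gradient u))\<^sup>2" by (simp add: L2_norm_sq)
  finally have "sqrt ((L2_norm (\<lambda>x. weak_gradient u x *v u x))\<^sup>2) \<le> sqrt (M * (L2_norm (weak_gradient u))\<^sup>2)"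
    by (rule real_sqrt_le_mono)
  then show "L2_norm (\<lambda>x. weak_gradient u x *v u x) \<le> sqrt M * L2_norm (weak_gradient u)"
    by (simp add: real_sqrt_mult L2_norm_nonneg)
qed

text \<open>For a bounded field both the convective term and \<open>outer (u x) (u x)\<close> are square integrable.  The weak
  approximants may therefore be inserted into the antisymmetry of the convective form on both sides,
  which makes the pairing equal to its own negative.\<close>

lemma convective_orthogonal:
  assumes V: "u \<in> space_V" and u2: "in_Lp 2 u"
    and M: "AE x in lebesgue_on half_space. (norm (u x))\<^sup>2 \<le> M"
  shows "L2_inner (\<lambda>x. weak_gradient u x *v u x) u = 0"
proof (rule V_weak_approximants[OF V u2])
  fix \<phi> C
  assume \<phi>: "\<And>k. solenoidal_test (\<phi> k)" "\<And>k. L2_norm (\<phi> k) \<le> C"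
    "\<And>k. L2_norm (\<lambda>x. jacobian (\<phi> k) (at x)) \<le> C"
    "\<And>a. in_Lp 2 a \<Longrightarrow> (\<lambda>k. L2_inner a (\<phi> k)) \<longlonglongrightarrow> L2_inner a u"
    "\<And>Q. in_Lp 2 Q \<Longrightarrow> (\<lambda>k. L2_inner Q (\<lambda>x. jacobian (\<phi> k) (at x))) \<longlonglongrightarrow> L2_inner Q (weak_gradient u)"
  let ?H = "lebesgue_on half_space"
  have um: "u \<in> borel_measurable ?H" using u2 by (simp add: in_Lp_def)
  have oo: "in_Lp 2 (\<lambda>x. outer (u x) (u x))"
    unfolding in_Lp_2
  proof (rule square_integrable_bound)
    show "(\<lambda>x. outer (u x) (u x)) \<in> borel_measurable ?H" by (intro borel_measurable_outer um)
    show "integrable ?H (\<lambda>x. M * (norm (u x))\<^sup>2)" using u2 by (simp add: in_Lp_def)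
    show "AE x in ?H. (norm (outer (u x) (u x)))\<^sup>2 \<le> M * (norm (u x))\<^sup>2"
      using M
    proof eventually_elim
      case (elim x)
      then show ?case unfolding norm_outer power_mult_distrib by (rule mult_right_mono) simp
    qed
  qed
  have 1: "(\<lambda>k. L2_inner (\<lambda>x. weak_gradient u x *v u x) (\<phi> k)) \<longlonglongrightarrow> L2_inner (\<lambda>x. weak_gradient u x *v u x) u"
    by (rule \<phi>(4)[OF convective_square_integrable(1)[OF V u2 M]])
  have eq: "L2_inner (\<lambda>x. A x *v u x) u = L2_inner (\<lambda>x. outer (u x) (u x)) A" for A
    unfolding L2_inner_def matrix_vector_inner by (simp add: inner_commute)
  have "L2_inner (\<lambda>x. weak_gradient u x *v u x) (\<phi> k) = - L2_inner (\<lambda>x. outer (u x) (u x)) (\<lambda>x. jacobian (\<phi> k) (at x))" for k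
    using V_trilinear_antisymmetry[OF V u2, of "\<phi> k"] \<phi>(1)[of k] by (simp add: solenoidal_test_def eq)
  then have 2: "(\<lambda>k. L2_inner (\<lambda>x. weak_gradient u x *v u x) (\<phi> k)) \<longlonglongrightarrow> - L2_inner (\<lambda>x. outer (u x) (u x)) (weak_gradient u)"
    using tendsto_minus[OF \<phi>(5)[OF oo]] by simp
  have "L2_inner (\<lambda>x. weak_gradient u x *v u x) u = - L2_inner (\<lambda>x. weak_gradient u x *v u x) u"
    using LIMSEQ_unique[OF 1 2] by (simp add: eq)
  then show ?thesis by simp
qed

section \<open>Functions of time\<close>

lemma borel_measurable_lebesgue_on_AE:
  fixes f g :: "'a::euclidean_space \<Rightarrow> real"
  assumes S: "S \<in> sets borel" and f: "f \<in> borel_measurable (lebesgue_on S)"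
    and eq: "AE x in lebesgue_on S. f x = g x"
  shows "g \<in> borel_measurable (lebesgue_on S)"
proof -
  have Sl: "S \<in> sets lebesgue" using S by simp
  have "(\<lambda>x. if x \<in> S then g x else 0) \<in> borel_measurable lebesgue"
  proof (rule borel_measurable_AE)
    show "(\<lambda>x. if x \<in> S then f x else 0) \<in> borel_measurable lebesgue"
      using f Sl by (simp add: borel_measurable_if)
    have "AE x in lborel. x \<in> S \<longrightarrow> f x = g x" using eq by (simp add: AE_lebesgue_on_iff[OF S])
    then have "AE x in lebesgue. x \<in> S \<longrightarrow> f x = g x" by (rule AE_completion)
    then show "AE x in lebesgue. (if x \<in> S then f x else 0) = (if x \<in> S then g x else 0)"
      by eventually_elim auto
  qed
  then show ?thesis using Sl by (simp add: borel_measurable_if)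
qed

lemma
  fixes f :: "real \<Rightarrow> real"
  assumes f: "f \<in> borel_measurable (lebesgue_on S)" and S: "S \<in> sets borel" "S' \<in> sets borel"
    and eq: "AE x in lborel. x \<in> S \<longleftrightarrow> x \<in> S'"
  shows integral_lebesgue_on_AE_set: "(LINT x|lebesgue_on S'. f x) = (LINT x|lebesgue_on S. f x)"
    and integrable_lebesgue_on_AE_set: "integrable (lebesgue_on S') f \<longleftrightarrow> integrable (lebesgue_on S) f"
proof -
  have Sl: "S \<inter> space lebesgue \<in> sets lebesgue" "S' \<inter> space lebesgue \<in> sets lebesgue" using S by simp_all
  have m: "(\<lambda>x. indicat_real S x *\<^sub>R f x) \<in> borel_measurable lebesgue"
    using f borel_measurable_restrict_space_iff[OF Sl(1)] by blast
  have e: "AE x in lebesgue. indicat_real S x *\<^sub>R f x = indicat_real S' x *\<^sub>R f x"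
    using AE_completion[OF eq] by eventually_elim (auto simp: indicator_def)
  have m': "(\<lambda>x. indicat_real S' x *\<^sub>R f x) \<in> borel_measurable lebesgue"
    by (rule borel_measurable_AE[OF m e])
  show "(LINT x|lebesgue_on S'. f x) = (LINT x|lebesgue_on S. f x)"
    unfolding integral_restrict_space[OF Sl(1)] integral_restrict_space[OF Sl(2)]
    by (rule integral_cong_AE[OF m m' e, symmetric])
  show "integrable (lebesgue_on S') f \<longleftrightarrow> integrable (lebesgue_on S) f"
    unfolding integrable_restrict_space[OF Sl(1)] integrable_restrict_space[OF Sl(2)]
    by (rule integrable_cong_AE[OF m m' e, symmetric])
qed

lemma AE_interval_closure: "AE x in lborel. x \<in> {a..b::real} \<longleftrightarrow> x \<in> {a<..<b}"
  using AE_lborel_singleton[of a] AE_lborel_singleton[of b] by eventually_elim auto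

lemma
  fixes f :: "real \<Rightarrow> real"
  assumes f: "continuous_on {a..b} f"
  shows integrable_continuous_open_interval: "integrable (lebesgue_on {a<..<b}) f"
    and integral_continuous_open_interval: "(LINT x|lebesgue_on {a<..<b}. f x) = integral {a..b} f"
proof -
  have i: "integrable (lebesgue_on {a..b}) f" using f by (rule continuous_imp_integrable_real)
  then have m: "f \<in> borel_measurable (lebesgue_on {a..b})" by auto
  show "integrable (lebesgue_on {a<..<b}) f"
    using integrable_lebesgue_on_AE_set[OF m _ _ AE_interval_closure] i by simp
  show "(LINT x|lebesgue_on {a<..<b}. f x) = integral {a..b} f"
    using integral_lebesgue_on_AE_set[OF m _ _ AE_interval_closure] lebesgue_integral_eq_integral[OF i] by simp
qed

text \<open>Such a function is a supremum of continuous functions, hence lower semicontinuous, even if the supremum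
  is uncountable.\<close>

lemma measurable_if_touched_below:
  fixes a :: "real \<Rightarrow> real"
  assumes ex: "\<And>t. t \<in> {0..T} \<Longrightarrow> \<exists>\<psi>. continuous_on {0..T} \<psi> \<and> (\<forall>s\<in>{0..T}. \<psi> s \<le> a s) \<and> \<psi> t = a t"
  shows "(\<lambda>s. indicat_real {0<..<T} s * a s) \<in> borel_measurable borel"
    and "a \<in> borel_measurable (lebesgue_on {0<..<T})"
proof -
  obtain \<psi> where \<psi>: "\<And>t. t \<in> {0..T} \<Longrightarrow> continuous_on {0..T} (\<psi> t) \<and> (\<forall>s\<in>{0..T}. \<psi> t s \<le> a s) \<and> \<psi> t t = a t"
    using ex by metis
  have op: "open {s\<in>{0<..<T}. c < a s}" for c
  proof -
    have "{s\<in>{0<..<T}. c < a s} = (\<Union>t\<in>{0<..<T}. {0<..<T} \<inter> \<psi> t -` {c<..})"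
    proof (intro equalityI subsetI)
      fix s assume "s \<in> {s\<in>{0<..<T}. c < a s}"
      then show "s \<in> (\<Union>t\<in>{0<..<T}. {0<..<T} \<inter> \<psi> t -` {c<..})"
        using \<psi>[of s] by (intro UN_I[of s]) auto
    next
      fix s assume "s \<in> (\<Union>t\<in>{0<..<T}. {0<..<T} \<inter> \<psi> t -` {c<..})"
      then obtain t where t: "t \<in> {0<..<T}" "s \<in> {0<..<T}" "\<psi> t s > c" by auto
      then have "\<psi> t s \<le> a s" using \<psi>[of t] by auto
      then show "s \<in> {s\<in>{0<..<T}. c < a s}" using t by auto
    qed
    moreover have "open ({0<..<T} \<inter> \<psi> t -` {c<..})" if "t \<in> {0<..<T}" for t
    proof (rule continuous_open_preimage)
      show "continuous_on {0<..<T} (\<psi> t)"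
        using \<psi>[of t] that by (meson continuous_on_subset greaterThanLessThan_subseteq_atLeastAtMost_iff order_refl atLeastAtMost_iff greaterThanLessThan_iff less_imp_le)
    qed auto
    ultimately show ?thesis by (metis (no_types, lifting) open_UN)
  qed
  show b: "(\<lambda>s. indicat_real {0<..<T} s * a s) \<in> borel_measurable borel"
    unfolding borel_measurable_iff_greater
  proof
    fix c
    have "{w \<in> space borel. c < indicat_real {0<..<T} w * a w}
        = {s\<in>{0<..<T}. c < a s} \<union> (if c < 0 then - {0<..<T} else {})"
      by (auto simp: indicator_def split: if_splits)
    also have "\<dots> \<in> sets borel"
      using op by (intro sets.Un) auto
    finally show "{w \<in> space borel. c < indicat_real {0<..<T} w * a w} \<in> sets borel" .
  qed
  have "(\<lambda>s. indicat_real {0<..<T} s * a s) \<in> borel_measurable (lebesgue_on {0<..<T})"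
    using b by (intro measurable_restrict_space1 measurable_completion) simp
  then show "a \<in> borel_measurable (lebesgue_on {0<..<T})"
    by (rule borel_measurable_lebesgue_on_AE[rotated]) (auto intro!: AE_I2)
qed

text \<open>The weak derivative of \<open>g\<close> is \<open>- k\<close> with initial value \<open>g0\<close>.  It is tested with smooth approximations of
  the indicator of \<open>{..t}\<close>: minus their derivatives form an approximate identity to the right of \<open>t\<close>.  The
  value at \<open>t = T\<close> follows by continuity.\<close>

lemma primitive_if_weak_derivative:
  fixes g k :: "real \<Rightarrow> real" and T :: real
  defines "\<mu> \<equiv> lebesgue_on {0<..<T}"
  assumes T: "T > 0" and g: "continuous_on {0..T} g" and k: "integrable \<mu> k"
    and weak: "\<And>\<eta> c. smooth \<eta> \<Longrightarrow> c < T \<Longrightarrow> (\<And>\<tau>. \<tau> \<notin> {-2..c} \<Longrightarrow> \<eta> \<tau> = 0) \<Longrightarrow>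
      (LINT \<tau>|\<mu>. frechet_derivative \<eta> (at \<tau>) 1 * g \<tau> - \<eta> \<tau> * k \<tau>) = - (\<eta> 0 * g0)"
    and t: "t \<in> {0..T}"
  shows "g t = g0 - (LINT \<tau>|\<mu>. indicat_real {..t} \<tau> * k \<tau>)"
proof -
  have km[measurable]: "k \<in> borel_measurable \<mu>" using k by auto
  have id_measurable[measurable]: "(\<lambda>x. x) \<in> borel_measurable \<mu>"
    unfolding \<mu>_def by (intro measurable_restrict_space1 measurable_completion) simp
  have sp: "space \<mu> = {0<..<T}" by (simp add: \<mu>_def)
  have interior: "g t = g0 - (LINT \<tau>|\<mu>. indicat_real {..t} \<tau> * k \<tau>)" if t: "0 \<le> t" "t < T" for t
  proof -
    define \<delta> where "\<delta> n = (T - t) / real (n + 2)" for n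
    have \<delta>0: "\<delta> n > 0" for n using t by (simp add: \<delta>_def)
    have \<delta>1: "t + \<delta> n < T" for n
    proof -
      have "\<delta> n \<le> (T - t) / 2" unfolding \<delta>_def using t by (intro divide_left_mono) auto
      then show ?thesis using t by simp
    qed
    have \<delta>lim: "\<delta> \<longlonglongrightarrow> 0"
      unfolding \<delta>_def by (rule LIMSEQ_ignore_initial_segment[OF lim_const_over_n])
    define P where "P n \<tau> = smooth_step (- t / \<delta> n + inverse (\<delta> n) * \<tau>)" for n \<tau>
    define \<rho> where "\<rho> n \<tau> = step' (- t / \<delta> n + inverse (\<delta> n) * \<tau>) * inverse (\<delta> n)" for n \<tau>
    have Psm: "smooth (P n)" for n
      unfolding P_def by (intro smooth_compose_affine smooth_smooth_step bounded_linear_mult_right)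
    have \<rho>sm: "smooth (\<rho> n)" for n
      unfolding \<rho>_def
      by (intro smooth_mult smooth_const smooth_compose_affine[of "\<lambda>x. inverse (\<delta> n) * x" step'] smooth_step' bounded_linear_mult_right)
    have Pd: "(P n has_real_derivative \<rho> n \<tau>) (at \<tau>)" for n \<tau>
      unfolding P_def \<rho>_def
      by (rule DERIV_chain2[OF smooth_real_has_derivative[OF smooth_smooth_step]])
        (auto intro!: derivative_eq_intros)
    have Pmono: "mono (P n)" for n
      unfolding P_def using \<delta>0[of n]
      by (intro monoI monoD[OF mono_smooth_step]) (simp add: mult_left_mono)
    have \<rho>0: "\<rho> n \<tau> \<ge> 0" for n \<tau>
      using mono_on_imp_deriv_nonneg[of UNIV "P n" "\<rho> n \<tau>" \<tau>] Pd Pmono by (auto simp: mono_on_def mono_def)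
    have arg: "- t / \<delta> n + inverse (\<delta> n) * \<tau> = (\<tau> - t) / \<delta> n" for n \<tau>
      by (simp add: divide_inverse algebra_simps)
    have P_lo: "P n \<tau> = 0" if "\<tau> \<le> t" for n \<tau>
      unfolding P_def arg using that \<delta>0[of n] by (intro smooth_step_eq_0) (simp add: divide_nonpos_pos)
    have P_hi: "P n \<tau> = 1" if "\<tau> \<ge> t + \<delta> n" for n \<tau>
      unfolding P_def arg using that \<delta>0[of n] by (intro smooth_step_eq_1) (simp add: field_simps)
    have \<rho>z: "\<rho> n \<tau> = 0" if "\<tau> < t \<or> \<tau> > t + \<delta> n" for n \<tau>
    proof -
      have "(\<tau> - t) / \<delta> n < 0 \<or> (\<tau> - t) / \<delta> n > 1" using that \<delta>0[of n] by (auto simp: field_simps)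
      then show ?thesis unfolding \<rho>_def arg by (simp add: step'_eq_0)
    qed
    have P01: "0 \<le> P n \<tau>" "P n \<tau> \<le> 1" for n \<tau> unfolding P_def by (rule smooth_step_bounds)+
    \<comment> \<open>The first factor makes the support compact at negative times, without changing the values from \<open>-1\<close> on.\<close>
    define \<eta> where "\<eta> n \<tau> = smooth_step (2 + \<tau>) * (1 + (-1) * P n \<tau>)" for n \<tau>
    have \<eta>sm: "smooth (\<eta> n)" for n
      unfolding \<eta>_def
      by (intro smooth_mult smooth_add smooth_const Psm smooth_compose_affine[of "\<lambda>x. x"] smooth_smooth_step bounded_linear_ident)
    have \<eta>pos: "\<eta> n \<tau> = 1 - P n \<tau>" if "\<tau> > -1" for n \<tau>
      using that by (simp add: \<eta>_def smooth_step_eq_1)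
    have \<eta>d: "frechet_derivative (\<eta> n) (at \<tau>) 1 = - \<rho> n \<tau>" if "\<tau> > 0" for n \<tau>
    proof -
      have "((\<lambda>\<tau>. 1 - P n \<tau>) has_derivative (\<lambda>h. - \<rho> n \<tau> * h)) (at \<tau>)"
        using Pd[of n \<tau>] by (auto intro!: derivative_eq_intros simp: has_field_derivative_def)
      then have "(\<eta> n has_derivative (\<lambda>h. - \<rho> n \<tau> * h)) (at \<tau>)"
        by (rule has_derivative_transform_within_open[of _ _ _ _ "{-1<..}"]) (use that \<eta>pos in auto)
      from fun_cong[OF frechet_derivative_at[OF this, symmetric], of 1] show ?thesis by simp
    qed
    have \<rho>c: "continuous_on S (\<rho> n)" for n S by (rule smooth_continuous_on[OF \<rho>sm])
    have \<rho>i: "integrable \<mu> (\<rho> n)" for n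
      unfolding \<mu>_def by (rule integrable_continuous_open_interval[OF \<rho>c])
    have \<rho>gi: "integrable \<mu> (\<lambda>\<tau>. \<rho> n \<tau> * g \<tau>)" for n
      unfolding \<mu>_def by (intro integrable_continuous_open_interval continuous_on_mult \<rho>c g)
    have \<rho>1: "(LINT \<tau>|\<mu>. \<rho> n \<tau>) = 1" for n
    proof -
      have "(\<rho> n has_integral (P n T - P n 0)) {0..T}"
        using T by (intro fundamental_theorem_of_calculus)
          (auto simp: has_real_derivative_iff_has_vector_derivative[symmetric] intro: has_field_derivative_at_within Pd)
      moreover have "P n T = 1" "P n 0 = 0" using P_hi[of n T] P_lo[of 0 n] \<delta>1[of n] t by auto
      ultimately show ?thesis
        unfolding \<mu>_def integral_continuous_open_interval[OF \<rho>c] by (simp add: integral_unique)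
    qed
    have \<eta>1: "\<bar>\<eta> n \<tau>\<bar> \<le> 1" if "\<tau> > 0" for n \<tau>
      using \<eta>pos[of \<tau> n] P01[of n \<tau>] that by simp
    have [measurable]: "\<eta> n \<in> borel_measurable \<mu>" for n
      unfolding \<mu>_def using borel_measurable_continuous_onI[OF smooth_continuous_on[OF \<eta>sm, of UNIV]]
      by (intro measurable_restrict_space1 measurable_completion) simp
    have \<eta>ki: "integrable \<mu> (\<lambda>\<tau>. \<eta> n \<tau> * k \<tau>)" for n
    proof (rule Bochner_Integration.integrable_bound[OF k])
      show "AE \<tau> in \<mu>. norm (\<eta> n \<tau> * k \<tau>) \<le> norm (k \<tau>)"
        using \<eta>1 by (intro AE_I2) (auto simp: sp abs_mult intro!: mult_left_le_one_le)
    qed measurable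
    have id: "- (LINT \<tau>|\<mu>. \<rho> n \<tau> * g \<tau>) - (LINT \<tau>|\<mu>. \<eta> n \<tau> * k \<tau>) = - g0" for n
    proof -
      have "(LINT \<tau>|\<mu>. frechet_derivative (\<eta> n) (at \<tau>) 1 * g \<tau> - \<eta> n \<tau> * k \<tau>) = - (\<eta> n 0 * g0)"
      proof (rule weak[OF \<eta>sm \<delta>1])
        show "\<eta> n \<tau> = 0" if "\<tau> \<notin> {-2..t + \<delta> n}" for \<tau>
          using that P_hi[of n \<tau>] by (cases "\<tau> < -2") (auto simp: \<eta>_def smooth_step_eq_0)
      qed
      moreover have "\<eta> n 0 = 1" using \<eta>pos[of 0 n] P_lo[of 0 n] t by simp
      moreover have "(LINT \<tau>|\<mu>. frechet_derivative (\<eta> n) (at \<tau>) 1 * g \<tau> - \<eta> n \<tau> * k \<tau>)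
          = (LINT \<tau>|\<mu>. - (\<rho> n \<tau> * g \<tau>) - \<eta> n \<tau> * k \<tau>)"
        by (intro Bochner_Integration.integral_cong refl) (simp add: sp \<eta>d)
      ultimately show ?thesis using \<rho>gi[of n] \<eta>ki[of n] by simp
    qed
    have l1: "(\<lambda>n. LINT \<tau>|\<mu>. \<rho> n \<tau> * g \<tau>) \<longlonglongrightarrow> g t"
    proof (rule LIMSEQ_I)
      fix r :: real assume r: "r > 0"
      have "(g \<longlongrightarrow> g t) (at t within {0..T})" using g t by (auto simp: continuous_on_def)
      then obtain d where d: "d > 0" "\<And>s. s \<in> {0..T} \<Longrightarrow> \<bar>s - t\<bar> < d \<Longrightarrow> \<bar>g s - g t\<bar> < r / 2"
        using r unfolding tendsto_iff eventually_at
        by (metis dist_real_def half_gt_zero_iff abs_zero diff_self)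
      from \<delta>lim d(1) obtain N where N: "\<And>n. n \<ge> N \<Longrightarrow> \<delta> n < d"
        using order_tendstoD(2)[OF \<delta>lim d(1)] by (auto simp: eventually_sequentially)
      have "norm ((LINT \<tau>|\<mu>. \<rho> n \<tau> * g \<tau>) - g t) < r" if n: "n \<ge> N" for n
      proof -
        have "(LINT \<tau>|\<mu>. \<rho> n \<tau> * g \<tau>) - g t = (LINT \<tau>|\<mu>. \<rho> n \<tau> * g \<tau>) - (LINT \<tau>|\<mu>. \<rho> n \<tau> * g t)"
          using \<rho>1[of n] by simp
        also have "\<dots> = (LINT \<tau>|\<mu>. \<rho> n \<tau> * (g \<tau> - g t))"
          using \<rho>gi[of n] \<rho>i[of n] by (simp add: right_diff_distrib)
        also have "norm \<dots> \<le> (LINT \<tau>|\<mu>. \<rho> n \<tau> * (r / 2))"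
        proof (rule order_trans[OF integral_norm_bound integral_mono])
          show "integrable \<mu> (\<lambda>\<tau>. norm (\<rho> n \<tau> * (g \<tau> - g t)))"
            by (rule integrable_norm) (use \<rho>gi[of n] \<rho>i[of n] in \<open>simp add: right_diff_distrib\<close>)
          show "integrable \<mu> (\<lambda>\<tau>. \<rho> n \<tau> * (r / 2))" using \<rho>i[of n] by simp
          fix \<tau> assume "\<tau> \<in> space \<mu>"
          then have \<tau>: "\<tau> \<in> {0<..<T}" by (simp add: sp)
          show "norm (\<rho> n \<tau> * (g \<tau> - g t)) \<le> \<rho> n \<tau> * (r / 2)"
          proof (cases "\<tau> < t \<or> \<tau> > t + \<delta> n")
            case True then show ?thesis by (simp add: \<rho>z)
          next
            case False
            then have "\<bar>g \<tau> - g t\<bar> < r / 2" using N[OF n] \<tau> by (intro d) auto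
            then have "\<rho> n \<tau> * \<bar>g \<tau> - g t\<bar> \<le> \<rho> n \<tau> * (r / 2)"
              by (intro mult_left_mono \<rho>0) simp
            then show ?thesis using \<rho>0[of n \<tau>] by (simp only: real_norm_def abs_mult abs_of_nonneg)
          qed
        qed
        also have "\<dots> = r / 2" using \<rho>1[of n] by simp
        also have "\<dots> < r" using r by simp
        finally show ?thesis .
      qed
      then show "\<exists>no. \<forall>n\<ge>no. norm ((LINT \<tau>|\<mu>. \<rho> n \<tau> * g \<tau>) - g t) < r" by blast
    qed
    have l2: "(\<lambda>n. LINT \<tau>|\<mu>. \<eta> n \<tau> * k \<tau>) \<longlonglongrightarrow> (LINT \<tau>|\<mu>. indicat_real {..t} \<tau> * k \<tau>)"
    proof (rule integral_dominated_convergence)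
      show "integrable \<mu> (\<lambda>\<tau>. norm (k \<tau>))" using k by simp
      show "AE \<tau> in \<mu>. norm (\<eta> n \<tau> * k \<tau>) \<le> norm (k \<tau>)" for n
        using \<eta>1 by (intro AE_I2) (auto simp: sp abs_mult intro!: mult_left_le_one_le)
      show "AE \<tau> in \<mu>. (\<lambda>n. \<eta> n \<tau> * k \<tau>) \<longlonglongrightarrow> indicat_real {..t} \<tau> * k \<tau>"
      proof (intro AE_I2 tendsto_mult tendsto_const)
        fix \<tau> assume "\<tau> \<in> space \<mu>"
        then have \<tau>: "\<tau> > 0" by (simp add: sp)
        show "(\<lambda>n. \<eta> n \<tau>) \<longlonglongrightarrow> indicat_real {..t} \<tau>"
        proof (cases "\<tau> \<le> t")
          case True then show ?thesis using \<eta>pos[of \<tau>] \<tau> by (simp add: P_lo)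
        next
          case False
          then have "eventually (\<lambda>n. \<delta> n < \<tau> - t) sequentially"
            by (intro order_tendstoD(2)[OF \<delta>lim]) simp
          then have "eventually (\<lambda>n. \<eta> n \<tau> = 0) sequentially"
            by eventually_elim (use \<eta>pos[of \<tau>] \<tau> in \<open>simp add: P_hi\<close>)
          then show ?thesis using False by (simp add: tendsto_eventually)
        qed
      qed
    qed measurable
    have "(\<lambda>n. - (LINT \<tau>|\<mu>. \<rho> n \<tau> * g \<tau>) - (LINT \<tau>|\<mu>. \<eta> n \<tau> * k \<tau>)) \<longlonglongrightarrow> - g t - (LINT \<tau>|\<mu>. indicat_real {..t} \<tau> * k \<tau>)"
      by (intro tendsto_intros l1 l2)
    then have "- g0 = - g t - (LINT \<tau>|\<mu>. indicat_real {..t} \<tau> * k \<tau>)"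
      unfolding id by (simp add: LIMSEQ_const_iff)
    then show ?thesis by simp
  qed
  show ?thesis
  proof (cases "t < T")
    case True then show ?thesis using interior t by simp
  next
    case False
    then have tT: "t = T" using t by simp
    define s where "s n = T - T / real (n + 2)" for n
    have s: "0 \<le> s n" "s n < T" for n using T by (auto simp: s_def field_simps)
    have "s \<longlonglongrightarrow> T - 0"
      unfolding s_def by (intro tendsto_diff tendsto_const LIMSEQ_ignore_initial_segment[OF lim_const_over_n])
    then have sl: "s \<longlonglongrightarrow> T" by simp
    have l1: "(\<lambda>n. g (s n)) \<longlonglongrightarrow> g T"
      by (rule continuous_on_tendsto_compose[OF g sl]) (use T s in \<open>auto simp: less_imp_le\<close>)
    have "(\<lambda>n. LINT \<tau>|\<mu>. indicat_real {..s n} \<tau> * k \<tau>) \<longlonglongrightarrow> (LINT \<tau>|\<mu>. indicat_real {..T} \<tau> * k \<tau>)"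
    proof (rule integral_dominated_convergence)
      show "integrable \<mu> (\<lambda>\<tau>. norm (k \<tau>))" using k by simp
      show "AE \<tau> in \<mu>. norm (indicat_real {..s n} \<tau> * k \<tau>) \<le> norm (k \<tau>)" for n
        by (intro AE_I2) (auto simp: indicator_def)
      show "AE \<tau> in \<mu>. (\<lambda>n. indicat_real {..s n} \<tau> * k \<tau>) \<longlonglongrightarrow> indicat_real {..T} \<tau> * k \<tau>"
      proof (intro AE_I2 tendsto_mult tendsto_const)
        fix \<tau> assume "\<tau> \<in> space \<mu>"
        then have \<tau>: "\<tau> < T" by (simp add: sp)
        then have "eventually (\<lambda>n. \<tau> < s n) sequentially"
          by (rule order_tendstoD(1)[OF sl])
        then have "eventually (\<lambda>n. indicat_real {..s n} \<tau> = indicat_real {..T} \<tau>) sequentially"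
          by eventually_elim (use \<tau> in auto)
        then show "(\<lambda>n. indicat_real {..s n} \<tau>) \<longlonglongrightarrow> indicat_real {..T} \<tau>" by (rule tendsto_eventually)
      qed
    qed measurable
    then have "(\<lambda>n. g0 - (LINT \<tau>|\<mu>. indicat_real {..s n} \<tau> * k \<tau>)) \<longlonglongrightarrow> g0 - (LINT \<tau>|\<mu>. indicat_real {..T} \<tau> * k \<tau>)"
      by (intro tendsto_intros)
    then have "(\<lambda>n. g (s n)) \<longlonglongrightarrow> g0 - (LINT \<tau>|\<mu>. indicat_real {..T} \<tau> * k \<tau>)"
      by (simp only: interior[OF s])
    from LIMSEQ_unique[OF l1 this] show ?thesis unfolding tT .
  qed
qed

section \<open>Pairings along the solution\<close>

lemma L2_inner_scaleR_right: "L2_inner f (\<lambda>x. c *\<^sub>R g x) = c * L2_inner f g"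
  by (simp add: L2_inner_def)

lemma L2_inner_commute: "L2_inner f g = L2_inner g f"
  by (simp add: L2_inner_def inner_commute)

lemma L2_inner_zero_left: "L2_inner (\<lambda>x. 0) g = 0"
  by (simp add: L2_inner_def)

lemma in_Lp_zero: "in_Lp 2 (\<lambda>x. 0)"
  by (simp add: in_Lp_def)

lemma L2_inner_polarize_le:
  assumes "in_Lp 2 f" "in_Lp 2 g"
  shows "2 * L2_inner f g \<le> (L2_norm f)\<^sup>2 + (L2_norm g)\<^sup>2"
proof -
  have "2 * L2_inner f g \<le> 2 * (L2_norm f * L2_norm g)"
    using L2_inner_le[OF assms] by linarith
  also have "\<dots> \<le> (L2_norm f)\<^sup>2 + (L2_norm g)\<^sup>2"
    using zero_le_power2[of "L2_norm f - L2_norm g"] by (simp add: power2_diff)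
  finally show ?thesis .
qed

lemma bounded_linear_transpose: "bounded_linear (transpose :: real^'n^'m \<Rightarrow> real^'m^'n)"
proof -
  have "linear (transpose :: real^'n^'m \<Rightarrow> real^'m^'n)"
    by (rule linearI) (simp_all add: transpose_def vec_eq_iff)
  then show ?thesis by (simp add: linear_conv_bounded_linear)
qed

lemma transpose_inner: "(transpose A *v b) \<bullet> a = b \<bullet> (A *v a)" for A :: "real^'n^'m"
  by (metis dot_lmul_matrix vector_transpose_matrix transpose_matrix_vector)

lemma norm_transpose_vector_le: "norm (transpose A *v b) \<le> norm A * norm b" for A :: "real^'n^'m"
proof -
  let ?y = "transpose A *v b"
  have "norm ?y * norm ?y = b \<bullet> (A *v ?y)"
    using transpose_inner[of A b ?y] by (simp add: power2_norm_eq_inner[symmetric] power2_eq_square)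
  also have "\<dots> \<le> norm b * norm (A *v ?y)" by (rule norm_cauchy_schwarz)
  also have "\<dots> \<le> norm b * (norm A * norm ?y)" by (intro mult_left_mono norm_matrix_vector_le) auto
  finally have "norm ?y * norm ?y \<le> (norm A * norm b) * norm ?y" by (simp add: ac_simps)
  then show ?thesis by (cases "norm ?y = 0") (auto simp: mult_le_cancel_right)
qed

text \<open>Moving the derivatives onto the test field shows that the pairing with the gradient is determined by
  a pairing with \<open>u\<close> itself, which is continuous in time along a solution.\<close>

lemma weak_gradient_pairing:
  assumes V: "u \<in> space_V" and u2: "in_Lp 2 u" and \<phi>: "test_function half_space \<phi>"
  defines "L \<equiv> \<lambda>x. \<Sum>j\<in>UNIV. frechet_derivative (\<lambda>y. frechet_derivative \<phi> (at y) (axis j 1)) (at x) (axis j 1)"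
  shows "L2_inner (weak_gradient u) (\<lambda>x. jacobian \<phi> (at x)) = - L2_inner u L"
proof -
  let ?H = "lebesgue_on half_space"
  let ?D = "\<lambda>j x. frechet_derivative \<phi> (at x) (axis j 1)"
  let ?DD = "\<lambda>j x. frechet_derivative (?D j) (at x) (axis j 1)"
  note hw = space_V_weak_gradient(1)[OF V] and G2 = space_V_weak_gradient(2)[OF V]
  have t1: "test_function half_space (?D j)" for j by (rule test_function_derivative[OF \<phi>])
  have t2: "test_function half_space (?DD j)" for j by (rule test_function_derivative[OF t1])
  have Gij: "square_integrable ?H (\<lambda>x. weak_gradient u x $ i $ j)" for i j
    using G2 by (intro square_integrable_component) (simp add: in_Lp_2)
  have ui: "square_integrable ?H (\<lambda>x. u x $ i)" for i
    using u2 by (intro square_integrable_component) (simp add: in_Lp_2)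
  have Di: "square_integrable ?H (\<lambda>x. ?D j x $ i)" for i j
    using test_function_borel_half_space(4)[OF t1] by (intro square_integrable_component) (simp add: in_Lp_2)
  have DDi: "square_integrable ?H (\<lambda>x. ?DD j x $ i)" for i j
    using test_function_borel_half_space(4)[OF t2] by (intro square_integrable_component) (simp add: in_Lp_2)
  note i1 = square_integrable_inner[OF Gij Di, unfolded inner_real_def]
    and i2 = square_integrable_inner[OF ui DDi, unfolded inner_real_def]
  have e: "(LINT x|?H. weak_gradient u x $ i $ j * ?D j x $ i) = - (LINT x|?H. u x $ i * ?DD j x $ i)" for i j
  proof -
    have "(LINT x|?H. u x $ i * frechet_derivative (\<lambda>x. ?D j x $ i) (at x) (axis j 1))
        = - (LINT x|?H. weak_gradient u x $ i $ j * ?D j x $ i)"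
      using hw test_function_component[OF t1] unfolding has_weak_gradient_def by blast
    then show ?thesis by (simp add: frechet_derivative_nth[OF test_function_smooth[OF t1]])
  qed
  have "L2_inner (weak_gradient u) (\<lambda>x. jacobian \<phi> (at x)) = (LINT x|?H. (\<Sum>i\<in>UNIV. \<Sum>j\<in>UNIV. weak_gradient u x $ i $ j * ?D j x $ i))"
    unfolding L2_inner_def inner_matrix_eq jacobian_nth ..
  also have "\<dots> = (\<Sum>i\<in>UNIV. LINT x|?H. (\<Sum>j\<in>UNIV. weak_gradient u x $ i $ j * ?D j x $ i))"
    by (intro Bochner_Integration.integral_sum Bochner_Integration.integrable_sum i1)
  also have "\<dots> = (\<Sum>i\<in>UNIV. \<Sum>j\<in>UNIV. LINT x|?H. weak_gradient u x $ i $ j * ?D j x $ i)"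
    by (intro sum.cong refl Bochner_Integration.integral_sum i1)
  also have "\<dots> = - (\<Sum>i\<in>UNIV. \<Sum>j\<in>UNIV. LINT x|?H. u x $ i * ?DD j x $ i)"
    unfolding e sum_negf ..
  also have "(\<Sum>i\<in>UNIV. \<Sum>j\<in>UNIV. LINT x|?H. u x $ i * ?DD j x $ i) = (\<Sum>i\<in>UNIV. LINT x|?H. (\<Sum>j\<in>UNIV. u x $ i * ?DD j x $ i))"
    by (intro sum.cong refl Bochner_Integration.integral_sum[symmetric] i2)
  also have "\<dots> = (LINT x|?H. (\<Sum>i\<in>UNIV. \<Sum>j\<in>UNIV. u x $ i * ?DD j x $ i))"
    by (intro Bochner_Integration.integral_sum[symmetric] Bochner_Integration.integrable_sum i2)
  also have "\<dots> = L2_inner u L"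
    unfolding L2_inner_def L_def by (simp add: inner_vec_def sum_distrib_left)
  finally show ?thesis .
qed

text \<open>A Leray--Hopf solution whose convective term lies in \<open>L\<^sup>1(0,T; L\<^sup>2)\<close> and is orthogonal to the solution at
  almost every time.  Horizontal continuity enters the energy balance through these two
  properties.\<close>

locale bounded_convection =
  fixes T \<nu> :: real and v0 :: "real^3 \<Rightarrow> real^3" and v :: "real \<Rightarrow> real^3 \<Rightarrow> real^3" and b :: "real \<Rightarrow> real"
  assumes T: "T > 0" and \<nu>: "\<nu> > 0" and v0: "in_Lp 2 v0" and lh: "leray_hopf T \<nu> v0 v"
    and b: "integrable (lebesgue_on {0<..<T}) b"
    and good: "AE \<tau> in lebesgue_on {0<..<T}. v \<tau> \<in> space_V \<and>
      in_Lp 2 (\<lambda>x. weak_gradient (v \<tau>) x *v v \<tau> x) \<and>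
      L2_norm (\<lambda>x. weak_gradient (v \<tau>) x *v v \<tau> x) \<le> b \<tau> \<and>
      L2_inner (\<lambda>x. weak_gradient (v \<tau>) x *v v \<tau> x) (v \<tau>) = 0"
begin

abbreviation \<mu> :: "real measure" where "\<mu> \<equiv> lebesgue_on {0<..<T}"

text \<open>A fixed null set of exceptional times that is measurable, so that functions may be redefined on it
  without losing measurability.\<close>

definition bad :: "real set" where
  "bad = (SOME N. N \<in> null_sets \<mu> \<and> (\<forall>\<tau>\<in>{0<..<T} - N. v \<tau> \<in> space_V \<and>
      in_Lp 2 (\<lambda>x. weak_gradient (v \<tau>) x *v v \<tau> x) \<and>
      L2_norm (\<lambda>x. weak_gradient (v \<tau>) x *v v \<tau> x) \<le> b \<tau> \<and>
      L2_inner (\<lambda>x. weak_gradient (v \<tau>) x *v v \<tau> x) (v \<tau>) = 0))"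

definition ok :: "real set" where "ok = {0<..<T} - bad"

lemma bad_props: "bad \<in> null_sets \<mu> \<and> (\<forall>\<tau>\<in>{0<..<T} - bad. v \<tau> \<in> space_V \<and>
      in_Lp 2 (\<lambda>x. weak_gradient (v \<tau>) x *v v \<tau> x) \<and>
      L2_norm (\<lambda>x. weak_gradient (v \<tau>) x *v v \<tau> x) \<le> b \<tau> \<and>
      L2_inner (\<lambda>x. weak_gradient (v \<tau>) x *v v \<tau> x) (v \<tau>) = 0)"
  unfolding bad_def
proof (rule someI_ex)
  obtain N where N: "{\<tau> \<in> space \<mu>. \<not> (v \<tau> \<in> space_V \<and>
      in_Lp 2 (\<lambda>x. weak_gradient (v \<tau>) x *v v \<tau> x) \<and>
      L2_norm (\<lambda>x. weak_gradient (v \<tau>) x *v v \<tau> x) \<le> b \<tau> \<and>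
      L2_inner (\<lambda>x. weak_gradient (v \<tau>) x *v v \<tau> x) (v \<tau>) = 0)} \<subseteq> N" "emeasure \<mu> N = 0" "N \<in> sets \<mu>"
    using good by (rule AE_E)
  then show "\<exists>N. N \<in> null_sets \<mu> \<and> (\<forall>\<tau>\<in>{0<..<T} - N. v \<tau> \<in> space_V \<and>
      in_Lp 2 (\<lambda>x. weak_gradient (v \<tau>) x *v v \<tau> x) \<and>
      L2_norm (\<lambda>x. weak_gradient (v \<tau>) x *v v \<tau> x) \<le> b \<tau> \<and>
      L2_inner (\<lambda>x. weak_gradient (v \<tau>) x *v v \<tau> x) (v \<tau>) = 0)"
    by (intro exI[of _ N]) auto
qed

lemma sets_ok[measurable]: "ok \<in> sets \<mu>"
  unfolding ok_def using bad_props by (intro sets.Diff) auto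

lemma AE_ok: "AE \<tau> in \<mu>. \<tau> \<in> ok"
  using AE_not_in[of bad \<mu>] bad_props by (auto simp: ok_def elim!: AE_mp intro!: AE_I2)

lemma ok_interval: "\<tau> \<in> ok \<Longrightarrow> \<tau> \<in> {0<..<T}" by (simp add: ok_def)

text \<open>With the value zero at exceptional times the bounds below hold at every time, which avoids null sets
  that depend on a second time variable.\<close>

definition grd :: "real \<Rightarrow> real^3 \<Rightarrow> real^3^3" where
  "grd \<tau> = (if \<tau> \<in> ok then weak_gradient (v \<tau>) else (\<lambda>x. 0))"

definition conv :: "real \<Rightarrow> real^3 \<Rightarrow> real^3" where
  "conv \<tau> = (if \<tau> \<in> ok then (\<lambda>x. weak_gradient (v \<tau>) x *v v \<tau> x) else (\<lambda>x. 0))"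

lemma ok_V: "\<tau> \<in> ok \<Longrightarrow> v \<tau> \<in> space_V"
  using bad_props by (auto simp: ok_def)

lemma grd_L2: "in_Lp 2 (grd \<tau>)"
  using ok_V space_V_weak_gradient(2) in_Lp_zero by (auto simp: grd_def)

lemma conv_L2: "in_Lp 2 (conv \<tau>)"
  using bad_props in_Lp_zero by (auto simp: conv_def ok_def)

lemma conv_norm_le: "L2_norm (conv \<tau>) \<le> \<bar>b \<tau>\<bar>"
proof (cases "\<tau> \<in> ok")
  case True
  then have "L2_norm (conv \<tau>) \<le> b \<tau>" using bad_props by (simp add: conv_def ok_def)
  then show ?thesis by linarith
qed (simp add: conv_def L2_norm_def)

lemma conv_orthogonal: "L2_inner (conv \<tau>) (v \<tau>) = 0"
  using bad_props by (auto simp: conv_def ok_def L2_inner_zero_left)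

lemma v_L2: "t \<in> {0..T} \<Longrightarrow> in_Lp 2 (v t)"
  using lh by (simp add: leray_hopf_def)

lemma ok_L2: "t \<in> ok \<Longrightarrow> in_Lp 2 (v t)"
  using v_L2 ok_interval by force

lemma weakly_continuous: "in_Lp 2 w \<Longrightarrow> continuous_on {0..T} (\<lambda>t. L2_inner (v t) w)"
  using lh by (simp add: leray_hopf_def)

lemma energy_bound:
  assumes "t \<in> {0..T}"
  shows "L2_norm (v t) \<le> L2_norm v0"
proof -
  have "(L2_norm (v t))\<^sup>2 / 2 + \<nu> * (LINT \<tau>|lebesgue_on {0..t}. (L2_norm (weak_gradient (v \<tau>)))\<^sup>2) \<le> (L2_norm v0)\<^sup>2 / 2"
    using lh assms by (simp add: leray_hopf_def)
  moreover have "0 \<le> \<nu> * (LINT \<tau>|lebesgue_on {0..t}. (L2_norm (weak_gradient (v \<tau>)))\<^sup>2)"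
    using \<nu> by simp
  ultimately have "(L2_norm (v t))\<^sup>2 \<le> (L2_norm v0)\<^sup>2" by linarith
  then show ?thesis using L2_norm_nonneg power2_le_imp_le by blast
qed

definition gsq :: "real \<Rightarrow> real" where "gsq \<tau> = (L2_norm (weak_gradient (v \<tau>)))\<^sup>2"

lemma gsq_integrable: "integrable \<mu> gsq"
  using lh unfolding gsq_def[abs_def] leray_hopf_def in_L2_V_def by blast

lemma gsq_nonneg: "gsq \<tau> \<ge> 0" by (simp add: gsq_def)

lemma grd_norm_sq_le: "(L2_norm (grd \<tau>))\<^sup>2 \<le> gsq \<tau>"
  by (auto simp: grd_def gsq_def L2_norm_def)

lemma borel_measurable_\<mu>:
  assumes "f \<in> borel_measurable borel"
  shows "f \<in> borel_measurable \<mu>"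
  using assms by (intro measurable_restrict_space1 measurable_completion) simp

lemma continuous_measurable_\<mu>:
  assumes "continuous_on {0..T} f"
  shows "(f :: real \<Rightarrow> real) \<in> borel_measurable \<mu>"
  using integrable_continuous_open_interval[OF assms] by auto

text \<open>A nonnegative quadratic form lies above its linearisation at \<open>v t\<close>, which is weakly continuous.  The
  form given by \<open>J\<close> becomes nonnegative after adding \<open>c\<close> times the squared norm.\<close>

lemma quadratic_touched_below:
  fixes J :: "real^3 \<Rightarrow> real^3^3"
  assumes J: "J \<in> borel_measurable (lebesgue_on half_space)" "\<And>x. norm (J x) \<le> c" and t: "t \<in> {0..T}"
  defines "p \<equiv> \<lambda>s. L2_inner (\<lambda>x. c *\<^sub>R v s x + J x *v v s x) (v s)"
  shows "\<exists>\<psi>. continuous_on {0..T} \<psi> \<and> (\<forall>s\<in>{0..T}. \<psi> s \<le> p s) \<and> \<psi> t = p t"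
proof -
  let ?H = "lebesgue_on half_space"
  \<comment> \<open>Half the gradient of the form at \<open>v t\<close>; \<open>J x\<close> need not be symmetric.\<close>
  define w where "w x = c *\<^sub>R v t x + (1/2) *\<^sub>R (J x *v v t x + transpose (J x) *v v t x)" for x
  have c0: "c \<ge> 0" using J(2)[of 0] norm_ge_zero[of "J 0"] by linarith
  have vm[measurable]: "v s \<in> borel_measurable ?H" if "s \<in> {0..T}" for s
    using v_L2[OF that] by (simp add: in_Lp_def)
  have Jv: "in_Lp 2 (\<lambda>x. J x *v v s x)" if s: "s \<in> {0..T}" for s
    unfolding in_Lp_2
  proof (rule square_integrable_bound)
    show "(\<lambda>x. J x *v v s x) \<in> borel_measurable ?H" by (intro borel_measurable_matrix_vector J vm s)
    show "integrable ?H (\<lambda>x. c\<^sup>2 * (norm (v s x))\<^sup>2)" using v_L2[OF s] by (simp add: in_Lp_def)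
    show "AE x in ?H. (norm (J x *v v s x))\<^sup>2 \<le> c\<^sup>2 * (norm (v s x))\<^sup>2"
      unfolding power_mult_distrib[symmetric]
      by (intro AE_I2 power_mono order_trans[OF norm_matrix_vector_le] mult_right_mono J) auto
  qed
  have JTv: "in_Lp 2 (\<lambda>x. transpose (J x) *v v s x)" if s: "s \<in> {0..T}" for s
    unfolding in_Lp_2
  proof (rule square_integrable_bound)
    show "(\<lambda>x. transpose (J x) *v v s x) \<in> borel_measurable ?H"
      by (intro borel_measurable_matrix_vector borel_measurable_linear[OF bounded_linear_transpose] J vm s)
    show "integrable ?H (\<lambda>x. c\<^sup>2 * (norm (v s x))\<^sup>2)" using v_L2[OF s] by (simp add: in_Lp_def)
    show "AE x in ?H. (norm (transpose (J x) *v v s x))\<^sup>2 \<le> c\<^sup>2 * (norm (v s x))\<^sup>2"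
      unfolding power_mult_distrib[symmetric]
      by (intro AE_I2 power_mono order_trans[OF norm_transpose_vector_le] mult_right_mono J) auto
  qed
  have cs: "square_integrable ?H (\<lambda>x. a *\<^sub>R h x)" if "in_Lp 2 h" for a and h :: "real^3 \<Rightarrow> real^3"
    by (rule square_integrable_scaleR[where K="\<bar>a\<bar>"]) (use that in \<open>auto simp: in_Lp_2\<close>)
  have w2: "in_Lp 2 w"
    unfolding in_Lp_2 w_def[abs_def]
    by (intro square_integrable_add cs v_L2[OF t])
      (use Jv[OF t] JTv[OF t] in \<open>simp add: in_Lp_2 square_integrable_add\<close>)
  define \<psi> where "\<psi> s = 2 * L2_inner (v s) w - p t" for s
  have q2: "square_integrable ?H (\<lambda>x. c *\<^sub>R v s x + J x *v v s x)" if "s \<in> {0..T}" for s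
    by (intro square_integrable_add cs v_L2 that) (use Jv[OF that] in \<open>simp add: in_Lp_2\<close>)
  have pi: "integrable ?H (\<lambda>x. (c *\<^sub>R v s x + J x *v v s x) \<bullet> v s x)" if "s \<in> {0..T}" for s
    by (rule square_integrable_inner[OF q2[OF that]]) (use v_L2[OF that] in \<open>simp add: in_Lp_2\<close>)
  have wi: "integrable ?H (\<lambda>x. v s x \<bullet> w x)" if "s \<in> {0..T}" for s
    by (rule square_integrable_inner) (use v_L2[OF that] w2 in \<open>simp_all add: in_Lp_2\<close>)
  have "continuous_on {0..T} \<psi>"
    unfolding \<psi>_def by (intro continuous_intros weakly_continuous w2)
  moreover have "\<psi> t = p t"
  proof -
    have "v t x \<bullet> w x = (c *\<^sub>R v t x + J x *v v t x) \<bullet> v t x" for x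
      unfolding w_def using transpose_inner[of "J x" "v t x" "v t x"]
      by (simp add: inner_add_left inner_add_right inner_commute)
    then have "L2_inner (v t) w = p t" by (simp add: L2_inner_def p_def)
    then show ?thesis by (simp add: \<psi>_def)
  qed
  moreover have "\<psi> s \<le> p s" if s: "s \<in> {0..T}" for s
  proof -
    have pt: "0 \<le> (c *\<^sub>R v s x + J x *v v s x) \<bullet> v s x - 2 * (v s x \<bullet> w x) + (c *\<^sub>R v t x + J x *v v t x) \<bullet> v t x" for x
    proof -
      let ?d = "v s x - v t x"
      have "- (norm (J x *v ?d) * norm ?d) \<le> (J x *v ?d) \<bullet> ?d"
        using Cauchy_Schwarz_ineq2[of "J x *v ?d" ?d] by linarith
      moreover have "norm (J x *v ?d) * norm ?d \<le> (c * norm ?d) * norm ?d"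
        by (intro mult_right_mono order_trans[OF norm_matrix_vector_le] J) auto
      ultimately have "0 \<le> c * (?d \<bullet> ?d) + (J x *v ?d) \<bullet> ?d"
        by (simp add: power2_norm_eq_inner[symmetric] power2_eq_square)
      also have "\<dots> = (c *\<^sub>R v s x + J x *v v s x) \<bullet> v s x - 2 * (v s x \<bullet> w x) + (c *\<^sub>R v t x + J x *v v t x) \<bullet> v t x"
        unfolding w_def using transpose_inner[of "J x" "v t x" "v s x"]
        by (simp add: bounded_bilinear.diff_right[OF bounded_bilinear_matrix_vector] inner_add_left inner_add_right
            inner_diff_left inner_diff_right inner_commute algebra_simps)
      finally show ?thesis .
    qed
    have "0 \<le> (LINT x|?H. (c *\<^sub>R v s x + J x *v v s x) \<bullet> v s x - 2 * (v s x \<bullet> w x) + (c *\<^sub>R v t x + J x *v v t x) \<bullet> v t x)"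
      using pt by (intro integral_nonneg_AE AE_I2)
    also have "\<dots> = p s - 2 * L2_inner (v s) w + p t"
      unfolding p_def L2_inner_def using pi[OF s] pi[OF t] wi[OF s] by simp
    finally show ?thesis by (simp add: \<psi>_def)
  qed
  ultimately show ?thesis by blast
qed

definition nsq :: "real \<Rightarrow> real" where "nsq t = (L2_norm (v t))\<^sup>2"

lemma nsq_measurable: "(\<lambda>s. indicat_real {0<..<T} s * nsq s) \<in> borel_measurable borel"
  "nsq \<in> borel_measurable \<mu>"
proof -
  have "\<exists>\<psi>. continuous_on {0..T} \<psi> \<and> (\<forall>s\<in>{0..T}. \<psi> s \<le> nsq s) \<and> \<psi> t = nsq t" if "t \<in> {0..T}" for t
    using quadratic_touched_below[of "\<lambda>x. 0" 1, OF _ _ that] by (simp add: nsq_def L2_norm_sq_inner)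
  then show "(\<lambda>s. indicat_real {0<..<T} s * nsq s) \<in> borel_measurable borel" "nsq \<in> borel_measurable \<mu>"
    using measurable_if_touched_below[of T nsq] by blast+
qed

lemma quadratic_measurable:
  fixes J :: "real^3 \<Rightarrow> real^3^3"
  assumes J: "test_function half_space J"
  shows "(\<lambda>s. L2_inner (\<lambda>x. J x *v v s x) (v s)) \<in> borel_measurable \<mu>"
proof -
  let ?H = "lebesgue_on half_space"
  obtain c where c: "\<And>x. norm (J x) \<le> c" using test_function_bounded_integrable(3)[OF J] by blast
  have Jm: "J \<in> borel_measurable ?H" by (rule test_function_borel_half_space(3)[OF J])
  have m: "(\<lambda>s. L2_inner (\<lambda>x. c *\<^sub>R v s x + J x *v v s x) (v s)) \<in> borel_measurable \<mu>"
    by (rule measurable_if_touched_below(2)) (rule quadratic_touched_below[OF Jm c])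
  have "(\<lambda>s. L2_inner (\<lambda>x. c *\<^sub>R v s x + J x *v v s x) (v s) - c * nsq s) \<in> borel_measurable \<mu>"
    using m nsq_measurable(2) by measurable
  moreover have "L2_inner (\<lambda>x. c *\<^sub>R v s x + J x *v v s x) (v s) - c * nsq s = L2_inner (\<lambda>x. J x *v v s x) (v s)"
    if "s \<in> space \<mu>" for s
  proof -
    have vs: "in_Lp 2 (v s)" using that by (intro v_L2) auto
    then have vm: "v s \<in> borel_measurable ?H" by (simp add: in_Lp_def)
    have Jv: "square_integrable ?H (\<lambda>x. J x *v v s x)"
    proof (rule square_integrable_bound)
      show "(\<lambda>x. J x *v v s x) \<in> borel_measurable ?H" by (intro borel_measurable_matrix_vector Jm vm)
      show "integrable ?H (\<lambda>x. c\<^sup>2 * (norm (v s x))\<^sup>2)" using vs by (simp add: in_Lp_def)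
      show "AE x in ?H. (norm (J x *v v s x))\<^sup>2 \<le> c\<^sup>2 * (norm (v s x))\<^sup>2"
        unfolding power_mult_distrib[symmetric]
        by (intro AE_I2 power_mono order_trans[OF norm_matrix_vector_le] mult_right_mono c) auto
    qed
    have v2: "square_integrable ?H (v s)" using vs by (simp add: in_Lp_2)
    show ?thesis
      unfolding nsq_def L2_norm_sq_inner L2_inner_def
      using square_integrable_inner[OF Jv v2] square_integrable_inner[OF v2 v2]
      by (simp add: inner_add_left)
  qed
  ultimately show ?thesis using measurable_cong by (metis (mono_tags, lifting))
qed

lemma grd_pairing_measurable:
  assumes \<phi>: "test_function half_space \<phi>"
  shows "(\<lambda>\<tau>. L2_inner (grd \<tau>) (\<lambda>x. jacobian \<phi> (at x))) \<in> borel_measurable \<mu>"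
proof -
  let ?L = "\<lambda>x. \<Sum>j\<in>UNIV. frechet_derivative (\<lambda>y. frechet_derivative \<phi> (at y) (axis j 1)) (at x) (axis j 1)"
  have "test_function half_space ?L"
    by (intro test_function_sum test_function_derivative \<phi>)
  then have "(\<lambda>\<tau>. L2_inner (v \<tau>) ?L) \<in> borel_measurable \<mu>"
    by (intro continuous_measurable_\<mu> weakly_continuous test_function_borel_half_space(4))
  then have "(\<lambda>\<tau>. indicat_real ok \<tau> * (- L2_inner (v \<tau>) ?L)) \<in> borel_measurable \<mu>"
    by measurable
  moreover have "indicat_real ok \<tau> * (- L2_inner (v \<tau>) ?L) = L2_inner (grd \<tau>) (\<lambda>x. jacobian \<phi> (at x))" for \<tau>
    using weak_gradient_pairing[OF ok_V ok_L2 \<phi>, of \<tau>] by (cases "\<tau> \<in> ok") (simp_all add: grd_def L2_inner_zero_left)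
  ultimately show ?thesis by (simp only:)
qed

text \<open>By antisymmetry the pairing is a quadratic form in the solution with the bounded coefficient
  \<open>jacobian \<phi>\<close>, and does not contain its gradient.\<close>

lemma conv_pairing_measurable:
  assumes \<phi>: "test_function half_space \<phi>"
  shows "(\<lambda>\<tau>. L2_inner (conv \<tau>) \<phi>) \<in> borel_measurable \<mu>"
proof -
  have "(\<lambda>\<tau>. indicat_real ok \<tau> * (- L2_inner (\<lambda>x. jacobian \<phi> (at x) *v v \<tau> x) (v \<tau>))) \<in> borel_measurable \<mu>"
    using quadratic_measurable[OF test_function_jacobian[OF \<phi>]] by measurable
  moreover have "indicat_real ok \<tau> * (- L2_inner (\<lambda>x. jacobian \<phi> (at x) *v v \<tau> x) (v \<tau>)) = L2_inner (conv \<tau>) \<phi>" for \<tau>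
    using V_trilinear_antisymmetry[OF ok_V ok_L2 \<phi>, of \<tau>] by (cases "\<tau> \<in> ok") (simp_all add: conv_def L2_inner_zero_left)
  ultimately show ?thesis by (simp only:)
qed

lemma grd_pairing_le:
  assumes "in_Lp 2 Q" "L2_norm Q \<le> C"
  shows "\<bar>L2_inner (grd \<tau>) Q\<bar> \<le> gsq \<tau> + C\<^sup>2"
proof -
  have "\<bar>L2_inner (grd \<tau>) Q\<bar> \<le> L2_norm (grd \<tau>) * L2_norm Q" by (rule L2_inner_le[OF grd_L2 assms(1)])
  also have "\<dots> \<le> (L2_norm (grd \<tau>))\<^sup>2 + (L2_norm Q)\<^sup>2"
  proof -
    have "0 \<le> (L2_norm (grd \<tau>) - L2_norm Q)\<^sup>2" "0 \<le> L2_norm (grd \<tau>) * L2_norm Q"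
      by (simp_all add: L2_norm_nonneg)
    then show ?thesis unfolding power2_diff by linarith
  qed
  also have "\<dots> \<le> gsq \<tau> + C\<^sup>2"
    using assms(2) by (intro add_mono grd_norm_sq_le power_mono L2_norm_nonneg)
  finally show ?thesis .
qed

lemma conv_pairing_le:
  assumes "in_Lp 2 w" "L2_norm w \<le> C"
  shows "\<bar>L2_inner (conv \<tau>) w\<bar> \<le> \<bar>b \<tau>\<bar> * C"
proof -
  have "\<bar>L2_inner (conv \<tau>) w\<bar> \<le> L2_norm (conv \<tau>) * L2_norm w" by (rule L2_inner_le[OF conv_L2 assms(1)])
  also have "\<dots> \<le> \<bar>b \<tau>\<bar> * C"
    using assms(2) by (intro mult_mono conv_norm_le L2_norm_nonneg) auto
  finally show ?thesis .
qed

lemma integrable_const_\<mu>: "integrable \<mu> (\<lambda>\<tau>. c :: real)"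
  by (rule integrable_continuous_open_interval) simp

lemma indicator_measurable_\<mu>: "A \<in> sets borel \<Longrightarrow> indicat_real A \<in> borel_measurable \<mu>"
  by (intro borel_measurable_\<mu>) simp

lemma integrable_indicator_\<mu>:
  fixes f :: "real \<Rightarrow> real"
  assumes f: "integrable \<mu> f" and A: "A \<in> sets borel"
  shows "integrable \<mu> (\<lambda>\<tau>. indicat_real A \<tau> * f \<tau>)"
proof (rule Bochner_Integration.integrable_bound[OF f])
  show "(\<lambda>\<tau>. indicat_real A \<tau> * f \<tau>) \<in> borel_measurable \<mu>"
    by (intro borel_measurable_times indicator_measurable_\<mu> A) (use f in auto)
qed (auto intro!: AE_I2 simp: indicator_def)

text \<open>The rate at which \<open>(v(\<tau>), w)\<close> decreases, where \<open>Q\<close> stands for the gradient of \<open>w\<close>.  Keeping \<open>Q\<close> and \<open>w\<close>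
  separate allows \<open>w\<close> to be a test field or a value of the solution.\<close>

definition rate :: "(real^3 \<Rightarrow> real^3^3) \<Rightarrow> (real^3 \<Rightarrow> real^3) \<Rightarrow> real \<Rightarrow> real" where
  "rate Q w \<tau> = \<nu> * L2_inner (grd \<tau>) Q + L2_inner (conv \<tau>) w"

lemma rate_le:
  assumes "in_Lp 2 Q" "L2_norm Q \<le> C" "in_Lp 2 w" "L2_norm w \<le> C"
  shows "\<bar>rate Q w \<tau>\<bar> \<le> \<nu> * (gsq \<tau> + C\<^sup>2) + \<bar>b \<tau>\<bar> * C"
proof -
  have "\<bar>rate Q w \<tau>\<bar> \<le> \<nu> * \<bar>L2_inner (grd \<tau>) Q\<bar> + \<bar>L2_inner (conv \<tau>) w\<bar>"
    unfolding rate_def using \<nu> abs_triangle_ineq[of "\<nu> * L2_inner (grd \<tau>) Q"] by (simp add: abs_mult)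
  also have "\<dots> \<le> \<nu> * (gsq \<tau> + C\<^sup>2) + \<bar>b \<tau>\<bar> * C"
    using \<nu> by (intro add_mono mult_left_mono grd_pairing_le conv_pairing_le assms) auto
  finally show ?thesis .
qed

lemma rate_bound_integrable: "integrable \<mu> (\<lambda>\<tau>. \<nu> * (gsq \<tau> + C\<^sup>2) + \<bar>b \<tau>\<bar> * C)"
  using gsq_integrable b integrable_const_\<mu>[of "C\<^sup>2"] by (intro Bochner_Integration.integrable_add integrable_mult_right integrable_mult_left integrable_abs)

lemma rate_test_measurable:
  assumes \<phi>: "test_function half_space \<phi>"
  shows "rate (\<lambda>x. jacobian \<phi> (at x)) \<phi> \<in> borel_measurable \<mu>"
  unfolding rate_def[abs_def] using grd_pairing_measurable[OF \<phi>] conv_pairing_measurable[OF \<phi>] by measurable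

lemma rate_test_integrable:
  assumes \<phi>: "test_function half_space \<phi>"
  shows "integrable \<mu> (rate (\<lambda>x. jacobian \<phi> (at x)) \<phi>)"
proof -
  let ?C = "max (L2_norm (\<lambda>x. jacobian \<phi> (at x))) (L2_norm \<phi>)"
  show ?thesis
  proof (rule Bochner_Integration.integrable_bound[OF rate_bound_integrable[of ?C] rate_test_measurable[OF \<phi>]])
    show "AE \<tau> in \<mu>. norm (rate (\<lambda>x. jacobian \<phi> (at x)) \<phi> \<tau>) \<le> norm (\<nu> * (gsq \<tau> + ?C\<^sup>2) + \<bar>b \<tau>\<bar> * ?C)"
    proof (rule AE_I2)
      fix \<tau>
      have "\<bar>rate (\<lambda>x. jacobian \<phi> (at x)) \<phi> \<tau>\<bar> \<le> \<nu> * (gsq \<tau> + ?C\<^sup>2) + \<bar>b \<tau>\<bar> * ?C"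
        by (rule rate_le) (auto intro: test_function_borel_half_space(4) test_function_jacobian \<phi>)
      then show "norm (rate (\<lambda>x. jacobian \<phi> (at x)) \<phi> \<tau>) \<le> norm (\<nu> * (gsq \<tau> + ?C\<^sup>2) + \<bar>b \<tau>\<bar> * ?C)"
        unfolding real_norm_def using abs_ge_self order_trans by blast
    qed
  qed
qed

text \<open>The weak formulation is used with products of a function of time and a fixed solenoidal field.\<close>

lemma test_identity:
  assumes \<phi>: "solenoidal_test \<phi>" and t: "t \<in> {0..T}"
  shows "L2_inner (v t) \<phi> = L2_inner v0 \<phi> - (LINT \<tau>|\<mu>. indicat_real {..t} \<tau> * rate (\<lambda>x. jacobian \<phi> (at x)) \<phi> \<tau>)"
proof -
  have ft: "test_function half_space \<phi>" and div: "\<And>x. divergence \<phi> x = 0" using \<phi> by (auto simp: solenoidal_test_def)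
  note \<phi>s = test_function_smooth[OF ft]
  obtain K where K: "compact K" "K \<subseteq> half_space" "\<And>x. x \<notin> K \<Longrightarrow> \<phi> x = 0" "smooth \<phi>"
    using test_functionE[OF ft] by metis
  let ?k = "rate (\<lambda>x. jacobian \<phi> (at x)) \<phi>"
  show ?thesis
  proof (rule primitive_if_weak_derivative[OF T _ rate_test_integrable[OF ft] _ t])
    show "continuous_on {0..T} (\<lambda>t. L2_inner (v t) \<phi>)"
      by (rule weakly_continuous[OF test_function_borel_half_space(4)[OF ft]])
    fix \<eta> :: "real \<Rightarrow> real" and c assume \<eta>: "smooth \<eta>" "c < T" "\<And>\<tau>. \<tau> \<notin> {-2..c} \<Longrightarrow> \<eta> \<tau> = 0"
    define \<Phi> where "\<Phi> p = \<eta> (fst p) *\<^sub>R \<phi> (snd p)" for p :: "real \<times> (real^3)"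
    have \<Phi>t: "\<Phi> (s, x) = \<eta> s *\<^sub>R \<phi> x" for s x by (simp add: \<Phi>_def)
    have D: "frechet_derivative (\<lambda>y. \<Phi> (s, y)) (at x) h = \<eta> s *\<^sub>R frechet_derivative \<phi> (at x) h" for s x h
    proof -
      have "((\<lambda>y. \<Phi> (s, y)) has_derivative (\<lambda>h. \<eta> s *\<^sub>R frechet_derivative \<phi> (at x) h)) (at x)"
        unfolding \<Phi>t by (intro has_derivative_scaleR_right smooth_has_derivative \<phi>s)
      from fun_cong[OF frechet_derivative_at[OF this, symmetric], of h] show ?thesis .
    qed
    have J: "jacobian (\<lambda>y. \<Phi> (s, y)) (at x) = \<eta> s *\<^sub>R jacobian \<phi> (at x)" for s x
      by (simp add: vec_eq_iff jacobian_nth D)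
    have Dt: "frechet_derivative \<Phi> (at (s, x)) (1, 0) = frechet_derivative \<eta> (at s) 1 *\<^sub>R \<phi> x" for s x
    proof -
      have "((\<lambda>p. \<eta> (fst p)) has_derivative (\<lambda>h. frechet_derivative \<eta> (at s) (fst h))) (at (s, x))"
        by (rule has_derivative_compose[of fst fst]) (simp_all add: has_derivative_fst[OF has_derivative_ident] smooth_has_derivative[OF \<eta>(1)])
      moreover have "((\<lambda>p. \<phi> (snd p)) has_derivative (\<lambda>h. frechet_derivative \<phi> (at x) (snd h))) (at (s, x))"
        by (rule has_derivative_compose[of snd snd]) (simp_all add: has_derivative_snd[OF has_derivative_ident] smooth_has_derivative[OF \<phi>s])
      ultimately have "(\<Phi> has_derivative (\<lambda>h. \<eta> s *\<^sub>R frechet_derivative \<phi> (at x) (snd h) + frechet_derivative \<eta> (at s) (fst h) *\<^sub>R \<phi> x)) (at (s, x))"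
        unfolding \<Phi>_def[abs_def] by (rule has_derivative_eq_rhs[OF has_derivative_scaleR]) simp
      from fun_cong[OF frechet_derivative_at[OF this, symmetric], of "(1, 0)"] show ?thesis
        by (simp add: linear_0[OF has_derivative_linear[OF smooth_has_derivative[OF \<phi>s]]])
    qed
    have "solenoidal_test_time T \<Phi>"
      unfolding solenoidal_test_time_def
    proof (intro conjI ballI allI)
      show "test_function ({..<T} \<times> half_space) \<Phi>"
      proof (rule test_functionI[of _ "{-2..c} \<times> K"])
        show "smooth \<Phi>" unfolding \<Phi>_def[abs_def]
          by (intro smooth_scaleR smooth_compose_linear[OF bounded_linear_fst] smooth_compose_linear[OF bounded_linear_snd] \<eta> \<phi>s)
        show "compact ({-2..c} \<times> K)" by (intro compact_Times K) simp
        show "{-2..c} \<times> K \<subseteq> {..<T} \<times> half_space" using \<eta>(2) K(2) by auto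
        show "\<Phi> p = 0" if "p \<notin> {-2..c} \<times> K" for p
          using that \<eta>(3)[of "fst p"] K(3)[of "snd p"] by (cases p) (auto simp: \<Phi>_def)
      qed
      show "divergence (\<lambda>y. \<Phi> (s, y)) x = 0" for s x
        using div[of x] by (simp add: divergence_def J trace_def sum_distrib_left[symmetric])
    qed
    then have "(LINT t|\<mu>.
          L2_inner (v t) (\<lambda>x. frechet_derivative \<Phi> (at (t, x)) (1, 0))
        - \<nu> * L2_inner (weak_gradient (v t)) (\<lambda>x. jacobian (\<lambda>y. \<Phi> (t, y)) (at x))
        - L2_inner (\<lambda>x. weak_gradient (v t) x *v v t x) (\<lambda>x. \<Phi> (t, x)))
     = - L2_inner v0 (\<lambda>x. \<Phi> (0, x))"
      using lh by (simp add: leray_hopf_def weak_formulation_def)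
    moreover have "(LINT t|\<mu>.
          L2_inner (v t) (\<lambda>x. frechet_derivative \<Phi> (at (t, x)) (1, 0))
        - \<nu> * L2_inner (weak_gradient (v t)) (\<lambda>x. jacobian (\<lambda>y. \<Phi> (t, y)) (at x))
        - L2_inner (\<lambda>x. weak_gradient (v t) x *v v t x) (\<lambda>x. \<Phi> (t, x)))
      = (LINT \<tau>|\<mu>. frechet_derivative \<eta> (at \<tau>) 1 * L2_inner (v \<tau>) \<phi> - \<eta> \<tau> * ?k \<tau>)"
    proof (rule integral_cong_AE)
      let ?F = "\<lambda>\<tau>. frechet_derivative \<eta> (at \<tau>) 1 * L2_inner (v \<tau>) \<phi> - \<eta> \<tau> * ?k \<tau>"
      have [measurable]: "(\<lambda>\<tau>. frechet_derivative \<eta> (at \<tau>) 1) \<in> borel_measurable \<mu>" "\<eta> \<in> borel_measurable \<mu>"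
        "(\<lambda>\<tau>. L2_inner (v \<tau>) \<phi>) \<in> borel_measurable \<mu>" "?k \<in> borel_measurable \<mu>"
        by (intro continuous_measurable_\<mu> smooth_continuous_on smooth_frechet_derivative \<eta>
            weakly_continuous test_function_borel_half_space(4)[OF ft] rate_test_measurable[OF ft])+
      show Fm: "?F \<in> borel_measurable \<mu>" by measurable
      show ae: "AE t in \<mu>. L2_inner (v t) (\<lambda>x. frechet_derivative \<Phi> (at (t, x)) (1, 0))
        - \<nu> * L2_inner (weak_gradient (v t)) (\<lambda>x. jacobian (\<lambda>y. \<Phi> (t, y)) (at x))
        - L2_inner (\<lambda>x. weak_gradient (v t) x *v v t x) (\<lambda>x. \<Phi> (t, x)) = ?F t"
        using AE_ok by eventually_elim
          (simp add: Dt J[unfolded \<Phi>t] \<Phi>t L2_inner_scaleR_right rate_def grd_def conv_def algebra_simps)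
      show "(\<lambda>t. L2_inner (v t) (\<lambda>x. frechet_derivative \<Phi> (at (t, x)) (1, 0))
        - \<nu> * L2_inner (weak_gradient (v t)) (\<lambda>x. jacobian (\<lambda>y. \<Phi> (t, y)) (at x))
        - L2_inner (\<lambda>x. weak_gradient (v t) x *v v t x) (\<lambda>x. \<Phi> (t, x))) \<in> borel_measurable \<mu>"
        by (rule borel_measurable_lebesgue_on_AE[OF _ Fm eventually_mono[OF ae sym]]) simp
    qed
    ultimately show "(LINT \<tau>|\<mu>. frechet_derivative \<eta> (at \<tau>) 1 * L2_inner (v \<tau>) \<phi> - \<eta> \<tau> * ?k \<tau>) = - (\<eta> 0 * L2_inner v0 \<phi>)"
      by (simp add: \<Phi>t L2_inner_scaleR_right)
  qed
qed

end

section \<open>The energy balance\<close>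

context bounded_convection
begin

lemma rate_v_limit:
  assumes s: "s \<in> ok"
  obtains \<phi> C where "\<And>k. solenoidal_test (\<phi> k)" "C \<ge> 0"
    and "\<And>k \<tau>. \<bar>rate (\<lambda>x. jacobian (\<phi> k) (at x)) (\<phi> k) \<tau>\<bar> \<le> \<nu> * (gsq \<tau> + C\<^sup>2) + \<bar>b \<tau>\<bar> * C"
    and "\<And>\<tau>. (\<lambda>k. rate (\<lambda>x. jacobian (\<phi> k) (at x)) (\<phi> k) \<tau>) \<longlonglongrightarrow> rate (grd s) (v s) \<tau>"
    and "\<And>\<tau>. (\<lambda>k. L2_inner (conv \<tau>) (\<phi> k)) \<longlonglongrightarrow> L2_inner (conv \<tau>) (v s)"
    and "\<And>t. t \<in> {0..T} \<Longrightarrow> (\<lambda>k. L2_inner (v t) (\<phi> k)) \<longlonglongrightarrow> L2_inner (v t) (v s)"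
proof (rule V_weak_approximants[OF ok_V[OF s] ok_L2[OF s]])
  fix \<phi> C
  assume \<phi>: "\<And>k. solenoidal_test (\<phi> k)" "\<And>k. L2_norm (\<phi> k) \<le> C"
    "\<And>k. L2_norm (\<lambda>x. jacobian (\<phi> k) (at x)) \<le> C"
    "\<And>a. in_Lp 2 a \<Longrightarrow> (\<lambda>k. L2_inner a (\<phi> k)) \<longlonglongrightarrow> L2_inner a (v s)"
    "\<And>Q. in_Lp 2 Q \<Longrightarrow> (\<lambda>k. L2_inner Q (\<lambda>x. jacobian (\<phi> k) (at x))) \<longlonglongrightarrow> L2_inner Q (weak_gradient (v s))"
  have t: "test_function half_space (\<phi> k)" for k using \<phi>(1) by (simp add: solenoidal_test_def)
  show thesis
  proof (rule that[of \<phi> C])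
    show "solenoidal_test (\<phi> k)" for k by (rule \<phi>)
    show "C \<ge> 0" using \<phi>(2)[of 0] L2_norm_nonneg[of "\<phi> 0"] by linarith
    show "\<bar>rate (\<lambda>x. jacobian (\<phi> k) (at x)) (\<phi> k) \<tau>\<bar> \<le> \<nu> * (gsq \<tau> + C\<^sup>2) + \<bar>b \<tau>\<bar> * C" for k \<tau>
      by (rule rate_le) (intro \<phi> test_function_borel_half_space(4) test_function_jacobian t)+
    show "(\<lambda>k. rate (\<lambda>x. jacobian (\<phi> k) (at x)) (\<phi> k) \<tau>) \<longlonglongrightarrow> rate (grd s) (v s) \<tau>" for \<tau>
      using \<phi>(4)[OF conv_L2, of \<tau>] \<phi>(5)[OF grd_L2, of \<tau>] s
      unfolding rate_def by (auto simp: grd_def[of s] intro!: tendsto_intros)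
    show "(\<lambda>k. L2_inner (conv \<tau>) (\<phi> k)) \<longlonglongrightarrow> L2_inner (conv \<tau>) (v s)" for \<tau> by (rule \<phi>(4)[OF conv_L2])
    show "(\<lambda>k. L2_inner (v t) (\<phi> k)) \<longlonglongrightarrow> L2_inner (v t) (v s)" if "t \<in> {0..T}" for t by (rule \<phi>(4)[OF v_L2[OF that]])
  qed
qed

text \<open>The identity for test fields passes to the weak approximants of \<open>v s\<close>: the rates converge at every time
  and are dominated by a function that is integrable in time.\<close>

lemma increment_identity:
  assumes s: "s \<in> ok" and t: "0 \<le> t'" "t' \<le> t" "t \<le> T"
  shows "L2_inner (v t) (v s) - L2_inner (v t') (v s) = - (LINT \<tau>|\<mu>. indicat_real {t'<..t} \<tau> * rate (grd s) (v s) \<tau>)"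
    and "integrable \<mu> (\<lambda>\<tau>. indicat_real {t'<..t} \<tau> * rate (grd s) (v s) \<tau>)"
    and "(\<lambda>\<tau>. L2_inner (conv \<tau>) (v s)) \<in> borel_measurable \<mu>"
proof (rule_tac [!] rate_v_limit[OF s])
  fix \<phi> :: "nat \<Rightarrow> real^3 \<Rightarrow> real^3" and C :: real
  let ?r = "\<lambda>k. rate (\<lambda>x. jacobian (\<phi> k) (at x)) (\<phi> k)"
  let ?B = "\<lambda>\<tau>. \<nu> * (gsq \<tau> + C\<^sup>2) + \<bar>b \<tau>\<bar> * C"
  assume \<phi>: "\<And>k. solenoidal_test (\<phi> k)" and C: "C \<ge> 0" and le: "\<And>k \<tau>. \<bar>?r k \<tau>\<bar> \<le> ?B \<tau>"
    and lim: "\<And>\<tau>. (\<lambda>k. ?r k \<tau>) \<longlonglongrightarrow> rate (grd s) (v s) \<tau>"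
    and limc: "\<And>\<tau>. (\<lambda>k. L2_inner (conv \<tau>) (\<phi> k)) \<longlonglongrightarrow> L2_inner (conv \<tau>) (v s)"
    and limv: "\<And>t. t \<in> {0..T} \<Longrightarrow> (\<lambda>k. L2_inner (v t) (\<phi> k)) \<longlonglongrightarrow> L2_inner (v t) (v s)"
  have ft: "test_function half_space (\<phi> k)" for k using \<phi> by (simp add: solenoidal_test_def)
  have rm[measurable]: "?r k \<in> borel_measurable \<mu>" for k by (rule rate_test_measurable[OF ft])
  have ri: "integrable \<mu> (?r k)" for k by (rule rate_test_integrable[OF ft])
  have lm[measurable]: "rate (grd s) (v s) \<in> borel_measurable \<mu>"
    by (rule borel_measurable_LIMSEQ_real[OF lim rm])
  have i1[measurable]: "indicat_real {t'<..t} \<in> borel_measurable \<mu>" by (rule indicator_measurable_\<mu>) simp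
  have ile: "norm (indicat_real {t'<..t} \<tau> * x) \<le> B" if "\<bar>x\<bar> \<le> B" for \<tau> x B
    using that by (auto simp: indicator_def)
  have mA: "(\<lambda>\<tau>. indicat_real {t'<..t} \<tau> * ?r k \<tau>) \<in> borel_measurable \<mu>" for k
    by (intro borel_measurable_times i1 rm)
  have mB: "(\<lambda>\<tau>. indicat_real {t'<..t} \<tau> * rate (grd s) (v s) \<tau>) \<in> borel_measurable \<mu>"
    by (intro borel_measurable_times i1 lm)
  have aelim: "AE \<tau> in \<mu>. (\<lambda>k. indicat_real {t'<..t} \<tau> * ?r k \<tau>) \<longlonglongrightarrow> indicat_real {t'<..t} \<tau> * rate (grd s) (v s) \<tau>"
    by (intro AE_I2 tendsto_intros lim)
  have aele: "AE \<tau> in \<mu>. norm (indicat_real {t'<..t} \<tau> * ?r k \<tau>) \<le> ?B \<tau>" for k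
    by (intro AE_I2 ile le)
  note dom = mB mA rate_bound_integrable[of C] aelim aele
  have conv: "(\<lambda>k. LINT \<tau>|\<mu>. indicat_real {t'<..t} \<tau> * ?r k \<tau>) \<longlonglongrightarrow> (LINT \<tau>|\<mu>. indicat_real {t'<..t} \<tau> * rate (grd s) (v s) \<tau>)"
    by (rule integral_dominated_convergence[OF dom])
  show "integrable \<mu> (\<lambda>\<tau>. indicat_real {t'<..t} \<tau> * rate (grd s) (v s) \<tau>)"
    by (rule integrable_dominated_convergence[OF dom])
  show "(\<lambda>\<tau>. L2_inner (conv \<tau>) (v s)) \<in> borel_measurable \<mu>"
    by (rule borel_measurable_LIMSEQ_real[OF limc conv_pairing_measurable[OF ft]])
  have tt: "t \<in> {0..T}" "t' \<in> {0..T}" using t by auto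
  have "L2_inner (v t) (\<phi> k) - L2_inner (v t') (\<phi> k) = - (LINT \<tau>|\<mu>. indicat_real {t'<..t} \<tau> * ?r k \<tau>)" for k
  proof -
    have i: "integrable \<mu> (\<lambda>\<tau>. indicat_real {..a} \<tau> * ?r k \<tau>)" for a
      by (rule integrable_indicator_\<mu>[OF ri]) simp
    have "L2_inner (v t) (\<phi> k) - L2_inner (v t') (\<phi> k)
        = (LINT \<tau>|\<mu>. indicat_real {..t'} \<tau> * ?r k \<tau>) - (LINT \<tau>|\<mu>. indicat_real {..t} \<tau> * ?r k \<tau>)"
      using test_identity[OF \<phi> tt(1)] test_identity[OF \<phi> tt(2)] by simp
    also have "\<dots> = (LINT \<tau>|\<mu>. indicat_real {..t'} \<tau> * ?r k \<tau> - indicat_real {..t} \<tau> * ?r k \<tau>)"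
      by (rule Bochner_Integration.integral_diff[OF i i, symmetric])
    also have "\<dots> = (LINT \<tau>|\<mu>. - (indicat_real {t'<..t} \<tau> * ?r k \<tau>))"
      by (intro Bochner_Integration.integral_cong refl) (use t(2) in \<open>auto simp: indicator_def\<close>)
    finally show ?thesis by simp
  qed
  then have "(\<lambda>k. L2_inner (v t) (\<phi> k) - L2_inner (v t') (\<phi> k)) \<longlonglongrightarrow> - (LINT \<tau>|\<mu>. indicat_real {t'<..t} \<tau> * rate (grd s) (v s) \<tau>)"
    using tendsto_minus[OF conv] by simp
  from LIMSEQ_unique[OF tendsto_diff[OF limv[OF tt(1)] limv[OF tt(2)]] this]
  show "L2_inner (v t) (v s) - L2_inner (v t') (v s) = - (LINT \<tau>|\<mu>. indicat_real {t'<..t} \<tau> * rate (grd s) (v s) \<tau>)" .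
qed

lemma ok_dense:
  assumes s: "s \<in> {0..T}" and r: "r > 0"
  shows "\<exists>q\<in>ok. \<bar>q - s\<bar> < r"
proof (rule ccontr)
  assume none: "\<not> ?thesis"
  define lo hi where "lo = max 0 (s - r)" and "hi = min T (s + r)"
  have lh': "lo < hi" using s r T by (auto simp: lo_def hi_def)
  have "AE q in lborel. q \<in> {0<..<T} \<longrightarrow> q \<in> ok"
    using AE_ok by (simp add: AE_lebesgue_on_iff)
  then have "AE q in lborel. q \<notin> {lo<..<hi}"
  proof eventually_elim
    case (elim q)
    show ?case
    proof
      assume q: "q \<in> {lo<..<hi}"
      then have "q \<in> {0<..<T}" "\<bar>q - s\<bar> < r" by (auto simp: lo_def hi_def)
      then show False using elim none by blast
    qed
  qed
  then have "{lo<..<hi} \<in> null_sets lborel" by (subst (asm) AE_iff_null_sets[symmetric]) auto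
  then show False using lh' by (simp add: null_sets_def)
qed

lemma conv_pairing_continuous:
  "continuous_on {0..T} (\<lambda>s. L2_inner (conv \<tau>) (v s))"
  using weakly_continuous[OF conv_L2, of \<tau>] by (simp add: L2_inner_commute)

text \<open>Known for \<open>s \<in> ok\<close>; these times are dense, and the pairing is continuous in \<open>s\<close>.\<close>

lemma conv_v_measurable:
  assumes s: "s \<in> {0..T}"
  shows "(\<lambda>\<tau>. L2_inner (conv \<tau>) (v s)) \<in> borel_measurable \<mu>"
proof -
  have "\<exists>q\<in>ok. \<bar>q - s\<bar> < inverse (real (Suc n))" for n by (rule ok_dense[OF s]) simp
  then obtain q where q: "\<And>n. q n \<in> ok" "\<And>n. \<bar>q n - s\<bar> < inverse (real (Suc n))" by metis
  have "(\<lambda>n. q n - s) \<longlonglongrightarrow> 0"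
    by (rule Lim_null_comparison[OF _ LIMSEQ_inverse_real_of_nat]) (use q(2) in \<open>simp add: less_imp_le\<close>)
  then have ql: "q \<longlonglongrightarrow> s" by (rule LIM_zero_cancel)
  have qr: "q n \<in> {0..T}" for n using ok_interval[OF q(1), of n] by auto
  have "(\<lambda>n. L2_inner (conv \<tau>) (v (q n))) \<longlonglongrightarrow> L2_inner (conv \<tau>) (v s)" for \<tau>
    by (rule continuous_on_tendsto_compose[OF conv_pairing_continuous ql s]) (intro always_eventually allI qr)
  then show ?thesis
    by (rule borel_measurable_LIMSEQ_real) (rule increment_identity(3)[OF q(1), of 0 0], use T in auto)
qed

definition clamp :: "real \<Rightarrow> real" where "clamp s = max 0 (min T s)"

lemma clamp_range: "clamp s \<in> {0..T}" using T by (auto simp: clamp_def)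

lemma clamp_eq: "s \<in> {0..T} \<Longrightarrow> clamp s = s" by (auto simp: clamp_def)

text \<open>Measurable in the first and continuous in the second variable; the second is discretised by
  \<open>\<lfloor>(n + 1) s\<rfloor> / (n + 1)\<close>.\<close>

lemma conv_pairing_jointly_measurable:
  "(\<lambda>z. L2_inner (conv (fst z)) (v (snd z))) \<in> borel_measurable (\<mu> \<Otimes>\<^sub>M \<mu>)"
proof -
  have idm: "(\<lambda>x. x) \<in> borel_measurable \<mu>" by (rule borel_measurable_\<mu>) simp
  have sm[measurable]: "snd \<in> borel_measurable (\<mu> \<Otimes>\<^sub>M \<mu>)"
    by (rule measurable_compose[OF measurable_snd idm])
  let ?q = "\<lambda>n s. real_of_int \<lfloor>real (Suc n) * s\<rfloor> / real (Suc n)"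
  have m: "(\<lambda>z. L2_inner (conv (fst z)) (v (clamp (?q n (snd z))))) \<in> borel_measurable (\<mu> \<Otimes>\<^sub>M \<mu>)" for n
  proof (rule measurable_compose_countable[where g="\<lambda>z. \<lfloor>real (Suc n) * snd z\<rfloor>" and
        f="\<lambda>i z. L2_inner (conv (fst z)) (v (clamp (real_of_int i / real (Suc n))))"])
    show "(\<lambda>z. L2_inner (conv (fst z)) (v (clamp (real_of_int i / real (Suc n))))) \<in> borel_measurable (\<mu> \<Otimes>\<^sub>M \<mu>)" for i
      by (rule measurable_compose[OF measurable_fst conv_v_measurable[OF clamp_range]])
    show "(\<lambda>z. \<lfloor>real (Suc n) * snd z\<rfloor>) \<in> (\<mu> \<Otimes>\<^sub>M \<mu>) \<rightarrow>\<^sub>M count_space UNIV" by measurable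
  qed
  have "(\<lambda>n. L2_inner (conv (fst z)) (v (clamp (?q n (snd z))))) \<longlonglongrightarrow> L2_inner (conv (fst z)) (v (clamp (snd z)))" for z :: "real \<times> real"
  proof (rule continuous_on_tendsto_compose[OF conv_pairing_continuous _ clamp_range])
    let ?s = "snd z"
    have "(\<lambda>n. ?q n ?s - ?s) \<longlonglongrightarrow> 0"
    proof (rule Lim_null_comparison[OF _ LIMSEQ_inverse_real_of_nat], rule always_eventually, rule allI)
      fix n
      have "\<bar>real_of_int \<lfloor>real (Suc n) * ?s\<rfloor> - real (Suc n) * ?s\<bar> \<le> 1" by linarith
      then have "\<bar>real_of_int \<lfloor>real (Suc n) * ?s\<rfloor> - real (Suc n) * ?s\<bar> * inverse (real (Suc n)) \<le> 1 * inverse (real (Suc n))"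
        by (rule mult_right_mono) simp
      moreover have "?q n ?s - ?s = (real_of_int \<lfloor>real (Suc n) * ?s\<rfloor> - real (Suc n) * ?s) * inverse (real (Suc n))"
        by (simp add: field_simps)
      ultimately show "norm (?q n ?s - ?s) \<le> inverse (real (Suc n))" by (simp add: abs_mult)
    qed
    then have "(\<lambda>n. ?q n ?s) \<longlonglongrightarrow> ?s" by (rule LIM_zero_cancel)
    then show "(\<lambda>n. clamp (?q n ?s)) \<longlonglongrightarrow> clamp ?s"
      unfolding clamp_def by (intro tendsto_intros)
  qed (use clamp_range in \<open>auto intro!: always_eventually\<close>)
  then have "(\<lambda>z. L2_inner (conv (fst z)) (v (clamp (snd z)))) \<in> borel_measurable (\<mu> \<Otimes>\<^sub>M \<mu>)"
    by (rule borel_measurable_LIMSEQ_real[OF _ m])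
  moreover have "L2_inner (conv (fst z)) (v (clamp (snd z))) = L2_inner (conv (fst z)) (v (snd z))"
    if "z \<in> space (\<mu> \<Otimes>\<^sub>M \<mu>)" for z
  proof -
    have "snd z \<in> {0..T}" using that by (auto simp: space_pair_measure)
    then show ?thesis by (simp add: clamp_eq)
  qed
  ultimately show ?thesis by (subst measurable_cong[symmetric]) auto
qed

lemma nsq_nonneg: "nsq s \<ge> 0" by (simp add: nsq_def)

lemma nsq_le: "s \<in> {0..T} \<Longrightarrow> nsq s \<le> (L2_norm v0)\<^sup>2"
  unfolding nsq_def by (intro power_mono energy_bound L2_norm_nonneg)

lemma nsq_integrable: "integrable \<mu> nsq"
proof (rule Bochner_Integration.integrable_bound[OF integrable_const_\<mu>[of "(L2_norm v0)\<^sup>2"] nsq_measurable(2)])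
  show "AE s in \<mu>. norm (nsq s) \<le> norm ((L2_norm v0)\<^sup>2)"
    using nsq_nonneg nsq_le by (intro AE_I2) auto
qed

lemma integral_\<mu>_lborel:
  fixes f F :: "real \<Rightarrow> real"
  assumes F: "F \<in> borel_measurable borel" and out: "\<And>x. x \<notin> {0<..<T} \<Longrightarrow> F x = 0"
    and eq: "\<And>x. x \<in> {0<..<T} \<Longrightarrow> f x = F x"
  shows "(LINT x|\<mu>. f x) = (LINT x|lborel. F x)" "f \<in> borel_measurable \<mu>"
    "integrable lborel F \<Longrightarrow> integrable \<mu> f"
proof -
  show m: "f \<in> borel_measurable \<mu>"
    by (rule borel_measurable_lebesgue_on_AE[OF _ borel_measurable_\<mu>[OF F]]) (auto intro!: AE_I2 eq[symmetric])
  show "(LINT x|\<mu>. f x) = (LINT x|lborel. F x)"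
    by (rule integral_lebesgue_on_eq[OF _ m F out]) (auto intro!: AE_I2 eq)
  have "integrable \<mu> f \<longleftrightarrow> integrable lborel F"
    by (rule integrable_lebesgue_on_eq[OF _ m F out]) (auto intro!: AE_I2 eq)
  then show "integrable lborel F \<Longrightarrow> integrable \<mu> f" by simp
qed

lemma interval_measure_le:
  assumes "a \<le> c"
  shows "(LINT s|\<mu>. indicat_real {a..c} s) \<le> c - a"
proof -
  have "(LINT s|\<mu>. indicat_real {a..c} s) = (LINT s|lborel. indicat_real ({a..c} \<inter> {0<..<T}) s)"
    by (rule integral_\<mu>_lborel(1)) (auto simp: indicator_def)
  also have "\<dots> \<le> (LINT s|lborel. indicat_real {a..c} s)"
  proof (rule integral_mono)
    show "integrable lborel (indicat_real ({a..c} \<inter> {0<..<T}))"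
      by (rule integrable_real_indicator) (auto intro: le_less_trans[OF emeasure_mono[of _ "{a..c}"]] simp: assms)
    show "integrable lborel (indicat_real {a..c})" using assms by simp
  qed (auto simp: indicator_def)
  also have "\<dots> = c - a" using assms by simp
  finally show ?thesis .
qed

text \<open>Substituting \<open>s + h\<close> for \<open>s\<close> cancels everything except an initial interval of length \<open>h\<close> and a final
  one, on which \<open>min (s + h) t = t\<close>.\<close>

lemma averaged_increments:
  assumes h: "0 < h" "h < t" "t \<le> T"
  shows "(LINT s|\<mu>. indicat_real {..<t} s * (nsq (min (s + h) t) - nsq s))
      = h * nsq t - (LINT s|\<mu>. indicat_real {..h} s * nsq s)"
    and "integrable \<mu> (\<lambda>s. indicat_real {..<t} s * (nsq (min (s + h) t) - nsq s))"
proof -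
  define n0 where "n0 s = indicat_real {0<..<T} s * nsq s" for s
  have n0m[measurable]: "n0 \<in> borel_measurable borel" unfolding n0_def[abs_def] by (rule nsq_measurable)
  have n0b: "\<bar>n0 s\<bar> \<le> indicat_real {0<..<T} s * (L2_norm v0)\<^sup>2" for s
    using nsq_nonneg[of s] nsq_le[of s] by (auto simp: n0_def indicator_def)
  have n0i: "integrable lborel n0"
  proof (rule Bochner_Integration.integrable_bound)
    show "integrable lborel (\<lambda>s. indicat_real {0<..<T} s * (L2_norm v0)\<^sup>2)" using T by simp
    show "AE s in lborel. norm (n0 s) \<le> norm (indicat_real {0<..<T} s * (L2_norm v0)\<^sup>2)"
      using n0b by (intro AE_I2) (metis abs_ge_self order_trans real_norm_def)
  qed simp
  have ind: "integrable lborel (\<lambda>s. indicat_real A s * n0 s)" if "A \<in> sets borel" for A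
    using integrable_mult_indicator[OF _ n0i, of A] that by simp
  have tr: "integrable lborel (\<lambda>s. indicat_real {h<..<t} (s - (- h)) * n0 (s - (- h)))"
    by (rule integrable_lborel_translate[of "\<lambda>s. indicat_real {h<..<t} s * n0 s"]) (simp add: ind)
  have ci: "integrable lborel (\<lambda>s. indicat_real {t - h..<t} s * nsq t)" using h by simp
  let ?F = "\<lambda>s. (indicat_real {h<..<t} (s - (- h)) * n0 (s - (- h)) + indicat_real {t - h..<t} s * nsq t)
      - indicat_real {0<..<t} s * n0 s"
  have F: "indicat_real {..<t} s * (nsq (min (s + h) t) - nsq s) = ?F s" if "s \<in> {0<..<T}" for s
  proof (cases "s + h < t")
    case True then show ?thesis using that h by (auto simp: indicator_def n0_def min_absorb1)
  next
    case False then show ?thesis using that h by (auto simp: indicator_def n0_def min_absorb2)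
  qed
  have Fm: "?F \<in> borel_measurable borel" by measurable
  have Fi: "integrable lborel ?F"
    by (intro Bochner_Integration.integrable_diff Bochner_Integration.integrable_add tr ci ind) simp
  have out: "?F s = 0" if "s \<notin> {0<..<T}" for s
    using that h by (auto simp: indicator_def n0_def)
  show "integrable \<mu> (\<lambda>s. indicat_real {..<t} s * (nsq (min (s + h) t) - nsq s))"
    by (rule integral_\<mu>_lborel(3)[OF Fm out F Fi])
  have "(LINT s|\<mu>. indicat_real {..<t} s * (nsq (min (s + h) t) - nsq s)) = (LINT s|lborel. ?F s)"
    by (rule integral_\<mu>_lborel(1)[OF Fm out F])
  also have "\<dots> = ((LINT s|lborel. indicat_real {h<..<t} (s - (- h)) * n0 (s - (- h))) + (LINT s|lborel. indicat_real {t - h..<t} s * nsq t))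
      - (LINT s|lborel. indicat_real {0<..<t} s * n0 s)"
    by (subst Bochner_Integration.integral_diff, intro Bochner_Integration.integrable_add tr ci, rule ind, simp,
        subst Bochner_Integration.integral_add[OF tr ci], rule refl)
  also have "(LINT s|lborel. indicat_real {h<..<t} (s - (- h)) * n0 (s - (- h))) = (LINT s|lborel. indicat_real {h<..<t} s * n0 s)"
    by (rule integral_lborel_translate[of "\<lambda>s. indicat_real {h<..<t} s * n0 s"]) measurable
  also have "(LINT s|lborel. indicat_real {t - h..<t} s * nsq t) = h * nsq t" using h by simp
  also have "((LINT s|lborel. indicat_real {h<..<t} s * n0 s) + h * nsq t) - (LINT s|lborel. indicat_real {0<..<t} s * n0 s)
      = h * nsq t - ((LINT s|lborel. indicat_real {0<..<t} s * n0 s) - (LINT s|lborel. indicat_real {h<..<t} s * n0 s))"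
    by simp
  also have "(LINT s|lborel. indicat_real {0<..<t} s * n0 s) - (LINT s|lborel. indicat_real {h<..<t} s * n0 s)
      = (LINT s|lborel. indicat_real {0<..<t} s * n0 s - indicat_real {h<..<t} s * n0 s)"
    by (rule Bochner_Integration.integral_diff[symmetric]) (simp_all add: ind)
  also have "\<dots> = (LINT s|\<mu>. indicat_real {..h} s * nsq s)"
  proof (rule integral_\<mu>_lborel(1)[symmetric])
    show "(\<lambda>s. indicat_real {0<..<t} s * n0 s - indicat_real {h<..<t} s * n0 s) \<in> borel_measurable borel" by measurable
  qed (use h in \<open>auto simp: indicator_def n0_def\<close>)
  finally show "(LINT s|\<mu>. indicat_real {..<t} s * (nsq (min (s + h) t) - nsq s))
      = h * nsq t - (LINT s|\<mu>. indicat_real {..h} s * nsq s)" .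
qed

text \<open>The indicator of \<open>s < \<tau> \<le> min (s + h) t\<close>: the times \<open>\<tau>\<close> that lie in the increment starting at \<open>s\<close>.\<close>

definition window :: "real \<Rightarrow> real \<Rightarrow> real \<Rightarrow> real \<Rightarrow> real" where
  "window h t \<tau> s = (if s < \<tau> \<and> \<tau> \<le> s + h \<and> \<tau> \<le> t then 1 else 0)"

lemma window_bounds: "0 \<le> window h t \<tau> s" "window h t \<tau> s \<le> 1"
  by (auto simp: window_def)

lemma window_measurable[measurable]: "(\<lambda>z. window h t (fst z) (snd z)) \<in> borel_measurable (\<mu> \<Otimes>\<^sub>M \<mu>)"
proof -
  have idm: "(\<lambda>x. x) \<in> borel_measurable \<mu>" by (rule borel_measurable_\<mu>) simp
  have [measurable]: "snd \<in> borel_measurable (\<mu> \<Otimes>\<^sub>M \<mu>)" "fst \<in> borel_measurable (\<mu> \<Otimes>\<^sub>M \<mu>)"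
    by (rule measurable_compose[OF measurable_snd idm], rule measurable_compose[OF measurable_fst idm])
  show ?thesis unfolding window_def by measurable
qed

lemma window_sections[measurable]:
  "(\<lambda>s. window h t \<tau> s) \<in> borel_measurable \<mu>" "(\<lambda>\<tau>. window h t \<tau> s) \<in> borel_measurable \<mu>"
  unfolding window_def by (rule borel_measurable_\<mu>, measurable)+

lemma window_section_integrable:
  "integrable \<mu> (\<lambda>s. window h t \<tau> s)" "integrable \<mu> (\<lambda>\<tau>. window h t \<tau> s)"
  by (rule Bochner_Integration.integrable_bound[OF integrable_const_\<mu>[of 1] window_sections(1)],
      simp add: window_bounds, rule Bochner_Integration.integrable_bound[OF integrable_const_\<mu>[of 1] window_sections(2)],
      simp add: window_bounds)

lemma window_integral_le:
  assumes "h > 0"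
  shows "(LINT s|\<mu>. window h t \<tau> s) \<le> h * indicat_real {..t} \<tau>"
    and "(LINT \<tau>|\<mu>. window h t \<tau> s) \<le> h * indicat_real {..t} s"
proof -
  have i: "integrable \<mu> (indicat_real {a..c})" for a c
    using integrable_indicator_\<mu>[OF integrable_const_\<mu>[of 1], of "{a..c}"] by simp
  show "(LINT s|\<mu>. window h t \<tau> s) \<le> h * indicat_real {..t} \<tau>"
  proof (cases "\<tau> \<le> t")
    case True
    have "(LINT s|\<mu>. window h t \<tau> s) \<le> (LINT s|\<mu>. indicat_real {\<tau> - h..\<tau>} s)"
      by (rule integral_mono[OF window_section_integrable(1) i]) (auto simp: window_def indicator_def)
    also have "\<dots> \<le> h" using interval_measure_le[of "\<tau> - h" \<tau>] assms by simp
    finally show ?thesis using True by simp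
  qed (simp add: window_def)
  show "(LINT \<tau>|\<mu>. window h t \<tau> s) \<le> h * indicat_real {..t} s"
  proof (cases "s \<le> t")
    case True
    have "(LINT \<tau>|\<mu>. window h t \<tau> s) \<le> (LINT \<tau>|\<mu>. indicat_real {s..s + h} \<tau>)"
      by (rule integral_mono[OF window_section_integrable(2) i]) (auto simp: window_def indicator_def)
    also have "\<dots> \<le> h" using interval_measure_le[of s "s + h"] assms by simp
    finally show ?thesis using True by simp
  next
    case False
    then have "window h t \<tau> s = 0" for \<tau> by (auto simp: window_def)
    then show ?thesis using False by simp
  qed
qed

lemma finite_\<mu>: "finite_measure \<mu>"
  by (rule finite_measure_lebesgue_on) simp

lemma pair_\<mu>: "pair_sigma_finite \<mu> \<mu>"
  using finite_\<mu> by (simp add: finite_measure.axioms(1) finite_measure_def pair_sigma_finite_def)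

lemma window_weight_integrable:
  assumes g: "integrable \<mu> g"
  shows "integrable (\<mu> \<Otimes>\<^sub>M \<mu>) (\<lambda>z. window h t (fst z) (snd z) * g (fst z))"
    and "integrable (\<mu> \<Otimes>\<^sub>M \<mu>) (\<lambda>z. window h t (fst z) (snd z) * g (snd z))"
proof -
  interpret pair_sigma_finite \<mu> \<mu> by (rule pair_\<mu>)
  have gm[measurable]: "g \<in> borel_measurable \<mu>" using g by auto
  have 1: "integrable (\<mu> \<Otimes>\<^sub>M \<mu>) (\<lambda>z. g (fst z))"
  proof (rule Fubini_integrable)
    show "integrable \<mu> (\<lambda>x. LINT y|\<mu>. norm (g (fst (x, y))))"
      using g by simp
    show "AE x in \<mu>. integrable \<mu> (\<lambda>y. g (fst (x, y)))"
      by (simp add: integrable_const_\<mu>)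
  qed measurable
  have 2: "integrable (\<mu> \<Otimes>\<^sub>M \<mu>) (\<lambda>z. g (snd z))"
    using integrable_product_swap[OF 1] by (simp add: case_prod_unfold)
  have le: "norm (window h t a c * y) \<le> norm y" for a c y
    using window_bounds[of h t a c] by (simp add: abs_mult mult_left_le_one_le)
  show "integrable (\<mu> \<Otimes>\<^sub>M \<mu>) (\<lambda>z. window h t (fst z) (snd z) * g (fst z))"
    by (rule Bochner_Integration.integrable_bound[OF 1]) (measurable, intro AE_I2 le)
  show "integrable (\<mu> \<Otimes>\<^sub>M \<mu>) (\<lambda>z. window h t (fst z) (snd z) * g (snd z))"
    by (rule Bochner_Integration.integrable_bound[OF 2]) (measurable, intro AE_I2 le)
qed

lemma conv_v_le:
  assumes "s \<in> {0..T}"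
  shows "\<bar>L2_inner (conv \<tau>) (v s)\<bar> \<le> \<bar>b \<tau>\<bar> * L2_norm v0"
  by (rule conv_pairing_le[OF v_L2[OF assms] energy_bound[OF assms]])

lemma window_conv_integrable:
  "integrable (\<mu> \<Otimes>\<^sub>M \<mu>) (\<lambda>z. window h t (fst z) (snd z) * L2_inner (conv (fst z)) (v (snd z)))"
proof (rule Bochner_Integration.integrable_bound)
  show "integrable (\<mu> \<Otimes>\<^sub>M \<mu>) (\<lambda>z. window h t (fst z) (snd z) * (\<bar>b (fst z)\<bar> * L2_norm v0))"
    by (rule window_weight_integrable(1)) (use b in simp)
  show "(\<lambda>z. window h t (fst z) (snd z) * L2_inner (conv (fst z)) (v (snd z))) \<in> borel_measurable (\<mu> \<Otimes>\<^sub>M \<mu>)"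
    by (intro borel_measurable_times window_measurable conv_pairing_jointly_measurable)
  show "AE z in \<mu> \<Otimes>\<^sub>M \<mu>. norm (window h t (fst z) (snd z) * L2_inner (conv (fst z)) (v (snd z)))
      \<le> norm (window h t (fst z) (snd z) * (\<bar>b (fst z)\<bar> * L2_norm v0))"
  proof (rule AE_I2)
    fix z assume "z \<in> space (\<mu> \<Otimes>\<^sub>M \<mu>)"
    then have "snd z \<in> {0..T}" by (auto simp: space_pair_measure)
    then show "norm (window h t (fst z) (snd z) * L2_inner (conv (fst z)) (v (snd z)))
      \<le> norm (window h t (fst z) (snd z) * (\<bar>b (fst z)\<bar> * L2_norm v0))"
      using conv_v_le[of "snd z" "fst z"] L2_norm_nonneg[of v0] by (simp add: abs_mult mult_left_mono)
  qed
qed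

text \<open>The convective part of the double integral, integrated first over \<open>s\<close>, that is over the factor in which
  the pairing is continuous.\<close>

definition conv_average :: "real \<Rightarrow> real \<Rightarrow> real \<Rightarrow> real" where
  "conv_average h t \<tau> = (LINT s|\<mu>. window h t \<tau> s * L2_inner (conv \<tau>) (v s))"

text \<open>Since \<open>(\<nabla>v(\<tau>), \<nabla>v(s))\<close> is bounded by the mean of the two squared norms, and each of them is integrated
  over a window of length at most \<open>h\<close> in the other variable, the bound takes the place of a
  continuity of the gradient in time, which is not available.\<close>

lemma energy_increment_lower:
  assumes h: "0 < h" "h < t" and t: "t \<le> T"
  shows "h * nsq t - (LINT s|\<mu>. indicat_real {..h} s * nsq s)
    \<ge> - 2 * \<nu> * h * (LINT \<tau>|\<mu>. indicat_real {..t} \<tau> * gsq \<tau>) - 2 * (LINT \<tau>|\<mu>. conv_average h t \<tau>)"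
    and "integrable \<mu> (conv_average h t)"
proof -
  interpret pair_sigma_finite \<mu> \<mu> by (rule pair_\<mu>)
  let ?N = "\<lambda>\<tau> s. L2_inner (conv \<tau>) (v s)"
  let ?Gt = "LINT \<tau>|\<mu>. indicat_real {..t} \<tau> * gsq \<tau>"
  note g1 = window_weight_integrable(1)[OF gsq_integrable, of h t]
    and g2 = window_weight_integrable(2)[OF gsq_integrable, of h t]
    and gN = window_conv_integrable[of h t]
  \<comment> \<open>An upper bound for \<open>window h t \<tau> s * rate (grd s) (v s) \<tau>\<close> that is jointly integrable.\<close>
  define Z where "Z z = (\<nu> / 2) * (window h t (fst z) (snd z) * gsq (fst z)) + (\<nu> / 2) * (window h t (fst z) (snd z) * gsq (snd z))
    + window h t (fst z) (snd z) * ?N (fst z) (snd z)" for z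
  have Zi: "integrable (\<mu> \<Otimes>\<^sub>M \<mu>) Z"
    unfolding Z_def[abs_def] by (intro Bochner_Integration.integrable_add integrable_mult_right g1 g2 gN)
  have Zi': "integrable (\<mu> \<Otimes>\<^sub>M \<mu>) (\<lambda>(\<tau>, s). Z (\<tau>, s))" using Zi by (simp add: case_prod_unfold)
  have sec: "AE s in \<mu>. integrable \<mu> (\<lambda>\<tau>. Z (\<tau>, s))" by (rule AE_integrable_snd[OF Zi'])
  have Yi: "integrable \<mu> (\<lambda>s. LINT \<tau>|\<mu>. Z (\<tau>, s))" by (rule integrable_snd[OF Zi'])
  have pw: "AE s in \<mu>. - 2 * (LINT \<tau>|\<mu>. Z (\<tau>, s)) \<le> indicat_real {..<t} s * (nsq (min (s + h) t) - nsq s)"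
    using AE_ok sec
  proof eventually_elim
    case (elim s)
    have s: "s \<in> {0..T}" using ok_interval[OF elim(1)] by auto
    show ?case
    proof (cases "s < t")
      case False
      then have "window h t \<tau> s = 0" for \<tau> by (auto simp: window_def)
      then show ?thesis using False by (simp add: Z_def)
    next
      case True
      define w where "w = min (s + h) t"
      have w: "0 \<le> s" "s \<le> w" "w \<le> T" "w \<in> {0..T}" using s True h t by (auto simp: w_def)
      have win: "indicat_real {s<..w} \<tau> = window h t \<tau> s" for \<tau> by (auto simp: window_def w_def indicator_def)
      have "2 * (L2_inner (v w) (v s) - L2_inner (v s) (v s)) \<le> nsq w - nsq s"
        using L2_inner_polarize_le[OF v_L2[OF w(4)] v_L2[OF s]] by (simp add: nsq_def L2_norm_sq_inner)
      moreover have "L2_inner (v w) (v s) - L2_inner (v s) (v s) = - (LINT \<tau>|\<mu>. window h t \<tau> s * rate (grd s) (v s) \<tau>)"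
        using increment_identity(1)[OF elim(1) w(1-3)] by (simp add: win)
      moreover have "(LINT \<tau>|\<mu>. window h t \<tau> s * rate (grd s) (v s) \<tau>) \<le> (LINT \<tau>|\<mu>. Z (\<tau>, s))"
      proof (rule integral_mono[OF _ elim(2)])
        show "integrable \<mu> (\<lambda>\<tau>. window h t \<tau> s * rate (grd s) (v s) \<tau>)"
          using increment_identity(2)[OF elim(1) w(1-3)] by (simp add: win)
        fix \<tau>
        have "2 * L2_inner (grd \<tau>) (grd s) \<le> gsq \<tau> + gsq s"
          using L2_inner_polarize_le[OF grd_L2 grd_L2, of \<tau> s] grd_norm_sq_le[of \<tau>] grd_norm_sq_le[of s] by linarith
        then have "\<nu> * L2_inner (grd \<tau>) (grd s) \<le> \<nu> * ((gsq \<tau> + gsq s) / 2)"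
          using \<nu> by (intro mult_left_mono) auto
        then have "rate (grd s) (v s) \<tau> \<le> (\<nu> / 2) * gsq \<tau> + (\<nu> / 2) * gsq s + ?N \<tau> s"
          unfolding rate_def by (simp add: field_simps)
        then have "window h t \<tau> s * rate (grd s) (v s) \<tau> \<le> window h t \<tau> s * ((\<nu> / 2) * gsq \<tau> + (\<nu> / 2) * gsq s + ?N \<tau> s)"
          by (rule mult_left_mono[OF _ window_bounds(1)])
        then show "window h t \<tau> s * rate (grd s) (v s) \<tau> \<le> Z (\<tau>, s)"
          by (simp add: Z_def algebra_simps)
      qed
      ultimately show ?thesis using True by (simp add: w_def)
    qed
  qed
  have "(LINT s|\<mu>. - 2 * (LINT \<tau>|\<mu>. Z (\<tau>, s))) \<le> (LINT s|\<mu>. indicat_real {..<t} s * (nsq (min (s + h) t) - nsq s))"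
    by (rule integral_mono_AE[OF _ averaged_increments(2)[OF h t] pw]) (intro integrable_mult_right Yi)
  then have A: "- 2 * (LINT s|\<mu>. LINT \<tau>|\<mu>. Z (\<tau>, s)) \<le> h * nsq t - (LINT s|\<mu>. indicat_real {..h} s * nsq s)"
    unfolding averaged_increments(1)[OF h t] by simp
  have "(LINT s|\<mu>. LINT \<tau>|\<mu>. Z (\<tau>, s)) = (LINT z|(\<mu> \<Otimes>\<^sub>M \<mu>). Z z)"
    using integral_snd[OF Zi'] by (simp add: case_prod_unfold)
  also have "\<dots> = (\<nu> / 2) * (LINT z|(\<mu> \<Otimes>\<^sub>M \<mu>). window h t (fst z) (snd z) * gsq (fst z))
     + (\<nu> / 2) * (LINT z|(\<mu> \<Otimes>\<^sub>M \<mu>). window h t (fst z) (snd z) * gsq (snd z))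
     + (LINT z|(\<mu> \<Otimes>\<^sub>M \<mu>). window h t (fst z) (snd z) * ?N (fst z) (snd z))"
    unfolding Z_def using g1 g2 gN by simp
  also have "(LINT z|(\<mu> \<Otimes>\<^sub>M \<mu>). window h t (fst z) (snd z) * gsq (fst z)) \<le> h * ?Gt"
  proof -
    have "(LINT z|(\<mu> \<Otimes>\<^sub>M \<mu>). window h t (fst z) (snd z) * gsq (fst z)) = (LINT \<tau>|\<mu>. LINT s|\<mu>. window h t \<tau> s * gsq \<tau>)"
      using integral_fst[of "\<lambda>\<tau> s. window h t \<tau> s * gsq \<tau>"] g1 by (simp add: case_prod_unfold)
    also have "\<dots> \<le> (LINT \<tau>|\<mu>. h * (indicat_real {..t} \<tau> * gsq \<tau>))"
    proof (rule integral_mono)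
      show "integrable \<mu> (\<lambda>\<tau>. LINT s|\<mu>. window h t \<tau> s * gsq \<tau>)"
        using integrable_fst[of "\<lambda>\<tau> s. window h t \<tau> s * gsq \<tau>"] g1 by (simp add: case_prod_unfold)
      show "integrable \<mu> (\<lambda>\<tau>. h * (indicat_real {..t} \<tau> * gsq \<tau>))"
        by (intro integrable_mult_right integrable_indicator_\<mu> gsq_integrable) simp
      show "(LINT s|\<mu>. window h t \<tau> s * gsq \<tau>) \<le> h * (indicat_real {..t} \<tau> * gsq \<tau>)" for \<tau>
        using mult_right_mono[OF window_integral_le(1)[OF h(1), of t \<tau>] gsq_nonneg[of \<tau>]] by (simp add: mult.assoc)
    qed
    also have "\<dots> = h * ?Gt" by simp
    finally show ?thesis .
  qed
  also have "(LINT z|(\<mu> \<Otimes>\<^sub>M \<mu>). window h t (fst z) (snd z) * gsq (snd z)) \<le> h * ?Gt"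
  proof -
    have "(LINT z|(\<mu> \<Otimes>\<^sub>M \<mu>). window h t (fst z) (snd z) * gsq (snd z)) = (LINT s|\<mu>. LINT \<tau>|\<mu>. window h t \<tau> s * gsq s)"
      using integral_snd[of "\<lambda>\<tau> s. window h t \<tau> s * gsq s"] g2 by (simp add: case_prod_unfold)
    also have "\<dots> \<le> (LINT s|\<mu>. h * (indicat_real {..t} s * gsq s))"
    proof (rule integral_mono)
      show "integrable \<mu> (\<lambda>s. LINT \<tau>|\<mu>. window h t \<tau> s * gsq s)"
        using integrable_snd[of "\<lambda>\<tau> s. window h t \<tau> s * gsq s"] g2 by (simp add: case_prod_unfold)
      show "integrable \<mu> (\<lambda>s. h * (indicat_real {..t} s * gsq s))"
        by (intro integrable_mult_right integrable_indicator_\<mu> gsq_integrable) simp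
      show "(LINT \<tau>|\<mu>. window h t \<tau> s * gsq s) \<le> h * (indicat_real {..t} s * gsq s)" for s
        using mult_right_mono[OF window_integral_le(2)[OF h(1), of t s] gsq_nonneg[of s]] by (simp add: mult.assoc)
    qed
    also have "\<dots> = h * ?Gt" by simp
    finally show ?thesis .
  qed
  also have "(LINT z|(\<mu> \<Otimes>\<^sub>M \<mu>). window h t (fst z) (snd z) * ?N (fst z) (snd z)) = (LINT \<tau>|\<mu>. conv_average h t \<tau>)"
    unfolding conv_average_def using integral_fst[of "\<lambda>\<tau> s. window h t \<tau> s * ?N \<tau> s"] gN by (simp add: case_prod_unfold)
  finally have B: "(LINT s|\<mu>. LINT \<tau>|\<mu>. Z (\<tau>, s)) \<le> (\<nu> / 2) * (h * ?Gt) + (\<nu> / 2) * (h * ?Gt) + (LINT \<tau>|\<mu>. conv_average h t \<tau>)"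
    using \<nu> by (auto intro: add_mono mult_left_mono)
  then show "h * nsq t - (LINT s|\<mu>. indicat_real {..h} s * nsq s)
    \<ge> - 2 * \<nu> * h * ?Gt - 2 * (LINT \<tau>|\<mu>. conv_average h t \<tau>)"
    using A by (simp add: algebra_simps)
  show "integrable \<mu> (conv_average h t)"
    unfolding conv_average_def[abs_def] using integrable_fst[of "\<lambda>\<tau> s. window h t \<tau> s * ?N \<tau> s"] gN by (simp add: case_prod_unfold)
qed

lemma conv_average_section_integrable:
  "integrable \<mu> (\<lambda>s. window h t \<tau> s * L2_inner (conv \<tau>) (v s))"
proof (rule Bochner_Integration.integrable_bound[OF integrable_const_\<mu>[of "\<bar>b \<tau>\<bar> * L2_norm v0"]])
  show "(\<lambda>s. window h t \<tau> s * L2_inner (conv \<tau>) (v s)) \<in> borel_measurable \<mu>"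
    by (intro borel_measurable_times window_sections continuous_measurable_\<mu> conv_pairing_continuous)
  show "AE s in \<mu>. norm (window h t \<tau> s * L2_inner (conv \<tau>) (v s)) \<le> norm (\<bar>b \<tau>\<bar> * L2_norm v0)"
  proof (rule AE_I2)
    fix s assume "s \<in> space \<mu>"
    then have "s \<in> {0..T}" by auto
    from conv_v_le[OF this, of \<tau>] have "window h t \<tau> s * \<bar>L2_inner (conv \<tau>) (v s)\<bar> \<le> 1 * (\<bar>b \<tau>\<bar> * L2_norm v0)"
      using window_bounds[of h t \<tau> s] by (intro mult_mono) auto
    then show "norm (window h t \<tau> s * L2_inner (conv \<tau>) (v s)) \<le> norm (\<bar>b \<tau>\<bar> * L2_norm v0)"
      using window_bounds[of h t \<tau> s] L2_norm_nonneg[of v0] by (simp add: abs_mult)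
  qed
qed

lemma conv_average_le:
  assumes h: "h > 0" and e: "e \<ge> 0"
    and le: "\<And>s. s \<in> {0<..<T} \<Longrightarrow> \<tau> - h \<le> s \<Longrightarrow> s < \<tau> \<Longrightarrow> \<bar>L2_inner (conv \<tau>) (v s)\<bar> \<le> e"
  shows "\<bar>conv_average h t \<tau>\<bar> \<le> h * e"
proof -
  have "\<bar>conv_average h t \<tau>\<bar> \<le> (LINT s|\<mu>. \<bar>window h t \<tau> s * L2_inner (conv \<tau>) (v s)\<bar>)"
    unfolding conv_average_def by (rule integral_abs_bound)
  also have "\<dots> \<le> (LINT s|\<mu>. window h t \<tau> s * e)"
  proof (rule integral_mono)
    show "integrable \<mu> (\<lambda>s. \<bar>window h t \<tau> s * L2_inner (conv \<tau>) (v s)\<bar>)"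
      by (intro integrable_abs conv_average_section_integrable)
    show "integrable \<mu> (\<lambda>s. window h t \<tau> s * e)" by (intro integrable_mult_left window_section_integrable)
    fix s assume "s \<in> space \<mu>"
    then show "\<bar>window h t \<tau> s * L2_inner (conv \<tau>) (v s)\<bar> \<le> window h t \<tau> s * e"
      using le[of s] by (auto simp: window_def)
  qed
  also have "\<dots> = (LINT s|\<mu>. window h t \<tau> s) * e" by simp
  also have "\<dots> \<le> (h * 1) * e"
    by (intro mult_right_mono e order_trans[OF window_integral_le(1)[OF h]] mult_left_mono) (use h in \<open>auto simp: indicator_def\<close>)
  finally show ?thesis by simp
qed

text \<open>At a fixed \<open>\<tau>\<close> the average runs over times \<open>s\<close> in \<open>[\<tau> - h, \<tau>)\<close>, where the pairing with \<open>v s\<close> is close to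
  the pairing with \<open>v \<tau>\<close>, which vanishes.\<close>

lemma conv_average_tendsto:
  assumes h: "\<And>n. h n > 0" "h \<longlonglongrightarrow> 0" and int: "\<And>n. integrable \<mu> (conv_average (h n) t)"
  shows "(\<lambda>n. LINT \<tau>|\<mu>. conv_average (h n) t \<tau> / h n) \<longlonglongrightarrow> 0"
proof -
  have "(\<lambda>n. LINT \<tau>|\<mu>. conv_average (h n) t \<tau> / h n) \<longlonglongrightarrow> (LINT \<tau>|\<mu>. 0)"
  proof (rule integral_dominated_convergence)
    show "integrable \<mu> (\<lambda>\<tau>. \<bar>b \<tau>\<bar> * L2_norm v0)" using b by simp
    show "AE \<tau> in \<mu>. norm (conv_average (h n) t \<tau> / h n) \<le> \<bar>b \<tau>\<bar> * L2_norm v0" for n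
    proof (rule AE_I2)
      fix \<tau>
      have "\<bar>conv_average (h n) t \<tau>\<bar> \<le> h n * (\<bar>b \<tau>\<bar> * L2_norm v0)"
        by (rule conv_average_le[OF h(1)]) (auto intro: conv_v_le simp: L2_norm_nonneg)
      then show "norm (conv_average (h n) t \<tau> / h n) \<le> \<bar>b \<tau>\<bar> * L2_norm v0"
        using h(1)[of n] by (simp add: field_simps)
    qed
    show "AE \<tau> in \<mu>. (\<lambda>n. conv_average (h n) t \<tau> / h n) \<longlonglongrightarrow> 0"
    proof (rule AE_I2, rule LIMSEQ_I)
      fix \<tau> r :: real assume "\<tau> \<in> space \<mu>" and r: "r > 0"
      then have \<tau>: "\<tau> \<in> {0..T}" by auto
      have "((\<lambda>s. L2_inner (conv \<tau>) (v s)) \<longlongrightarrow> 0) (at \<tau> within {0..T})"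
        using conv_pairing_continuous[of \<tau>] \<tau> conv_orthogonal[of \<tau>] unfolding continuous_on_def by force
      then obtain d where d: "d > 0" "\<And>s. s \<in> {0..T} \<Longrightarrow> s \<noteq> \<tau> \<Longrightarrow> \<bar>s - \<tau>\<bar> < d \<Longrightarrow> \<bar>L2_inner (conv \<tau>) (v s)\<bar> < r / 2"
        using half_gt_zero[OF r] unfolding tendsto_iff eventually_at dist_real_def by (metis diff_0_right)
      obtain N where N: "\<And>n. n \<ge> N \<Longrightarrow> h n < d"
        using order_tendstoD(2)[OF h(2) d(1)] by (auto simp: eventually_sequentially)
      have "norm (conv_average (h n) t \<tau> / h n - 0) < r" if n: "n \<ge> N" for n
      proof -
        have "\<bar>conv_average (h n) t \<tau>\<bar> \<le> h n * (r / 2)"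
        proof (rule conv_average_le[OF h(1)])
          fix s assume "s \<in> {0<..<T}" "\<tau> - h n \<le> s" "s < \<tau>"
          then show "\<bar>L2_inner (conv \<tau>) (v s)\<bar> \<le> r / 2" using d(2)[of s] N[OF n] by simp
        qed (use r in simp)
        then have "norm (conv_average (h n) t \<tau> / h n) \<le> r / 2" using h(1)[of n] by (simp add: field_simps)
        then show ?thesis using r unfolding diff_zero by linarith
      qed
      then show "\<exists>no. \<forall>n\<ge>no. norm (conv_average (h n) t \<tau> / h n - 0) < r" by blast
    qed
  qed (use int in auto)
  then show ?thesis by simp
qed

text \<open>Weak lower semicontinuity of the norm at the initial time: \<open>\<parallel>v(s)\<parallel>\<^sup>2 \<ge> 2 (v(s), v\<^sub>0) - \<parallel>v\<^sub>0\<parallel>\<^sup>2\<close>.\<close>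

lemma initial_average_lower:
  assumes v00: "AE x in lebesgue_on half_space. v 0 x = v0 x"
    and h: "\<And>n. h n > 0" "h \<longlonglongrightarrow> 0" "\<And>n. h n < T" and e: "e > 0"
  shows "eventually (\<lambda>n. (LINT s|\<mu>. indicat_real {..h n} s * nsq s) \<ge> h n * ((L2_norm v0)\<^sup>2 - e)) sequentially"
proof -
  let ?H = "lebesgue_on half_space"
  have z: "0 \<in> {0..T}" using T by simp
  have "L2_inner (v 0) v0 = L2_inner v0 v0"
    unfolding L2_inner_def
  proof (rule integral_cong_AE)
    have m: "v 0 \<in> borel_measurable ?H" "v0 \<in> borel_measurable ?H" using v_L2[OF z] v0 by (auto simp: in_Lp_def)
    show "(\<lambda>x. v 0 x \<bullet> v0 x) \<in> borel_measurable ?H" "(\<lambda>x. v0 x \<bullet> v0 x) \<in> borel_measurable ?H"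
      using m by (auto intro: borel_measurable_inner)
    show "AE x in ?H. v 0 x \<bullet> v0 x = v0 x \<bullet> v0 x" using v00 by eventually_elim simp
  qed
  then have start: "L2_inner (v 0) v0 = (L2_norm v0)\<^sup>2" by (simp add: L2_norm_sq_inner)
  have "((\<lambda>s. L2_inner (v s) v0) \<longlongrightarrow> (L2_norm v0)\<^sup>2) (at 0 within {0..T})"
    using weakly_continuous[OF v0] z start unfolding continuous_on_def by force
  then obtain d where d: "d > 0" "\<And>s. s \<in> {0..T} \<Longrightarrow> s \<noteq> 0 \<Longrightarrow> \<bar>s - 0\<bar> < d \<Longrightarrow> \<bar>L2_inner (v s) v0 - (L2_norm v0)\<^sup>2\<bar> < e / 2"
    using half_gt_zero[OF e] unfolding tendsto_iff eventually_at dist_real_def by metis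
  have "eventually (\<lambda>n. h n < d) sequentially" by (rule order_tendstoD(2)[OF h(2) d(1)])
  then show ?thesis
  proof eventually_elim
    case (elim n)
    have i: "integrable \<mu> (\<lambda>s. indicat_real {..h n} s * g s)" if "integrable \<mu> g" for g :: "real \<Rightarrow> real"
      by (rule integrable_indicator_\<mu>[OF that]) simp
    have "h n * ((L2_norm v0)\<^sup>2 - e) = (LINT s|lborel. indicat_real {0<..h n} s * ((L2_norm v0)\<^sup>2 - e))"
      using h(1)[of n] by simp
    also have "\<dots> = (LINT s|\<mu>. indicat_real {..h n} s * ((L2_norm v0)\<^sup>2 - e))"
      by (rule integral_\<mu>_lborel(1)[symmetric]) (use h(3)[of n] in \<open>auto simp: indicator_def\<close>)
    also have "\<dots> \<le> (LINT s|\<mu>. indicat_real {..h n} s * nsq s)"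
    proof (rule integral_mono[OF i[OF integrable_const_\<mu>] i[OF nsq_integrable]])
      fix s assume "s \<in> space \<mu>"
      then have s: "s \<in> {0..T}" "s > 0" by auto
      show "indicat_real {..h n} s * ((L2_norm v0)\<^sup>2 - e) \<le> indicat_real {..h n} s * nsq s"
      proof (cases "s \<le> h n")
        case True
        then have "\<bar>L2_inner (v s) v0 - (L2_norm v0)\<^sup>2\<bar> < e / 2" using d(2)[of s] s elim by simp
        then have "(L2_norm v0)\<^sup>2 - e \<le> nsq s"
          using L2_inner_polarize_le[OF v_L2[OF s(1)] v0] unfolding nsq_def by linarith
        then show ?thesis using True by simp
      qed simp
    qed
    finally show ?case .
  qed
qed

lemma energy_lower_bound:
  assumes v00: "AE x in lebesgue_on half_space. v 0 x = v0 x" and t: "0 < t" "t \<le> T"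
  shows "(L2_norm v0)\<^sup>2 \<le> nsq t + 2 * \<nu> * (LINT \<tau>|\<mu>. indicat_real {..t} \<tau> * gsq \<tau>)"
proof (rule field_le_epsilon)
  fix e :: real assume e: "e > 0"
  let ?Gt = "LINT \<tau>|\<mu>. indicat_real {..t} \<tau> * gsq \<tau>"
  define h where "h n = t / real (n + 2)" for n
  have h0: "h n > 0" for n using t by (simp add: h_def)
  have ht: "h n < t" for n
  proof -
    have "t * 1 < t * real (n + 2)" using t by (intro mult_strict_left_mono) auto
    then show ?thesis by (simp add: h_def divide_less_eq)
  qed
  have hT: "h n < T" for n using ht[of n] t by linarith
  have hl: "h \<longlonglongrightarrow> 0" unfolding h_def by (rule LIMSEQ_ignore_initial_segment[OF lim_const_over_n])
  have ci: "integrable \<mu> (conv_average (h n) t)" for n by (rule energy_increment_lower(2)[OF h0 ht t(2)])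
  let ?c = "\<lambda>n. LINT \<tau>|\<mu>. conv_average (h n) t \<tau> / h n"
  have "?c \<longlonglongrightarrow> 0" by (rule conv_average_tendsto[OF h0 hl ci])
  then have "eventually (\<lambda>n. ?c n < e / 4) sequentially"
    by (rule order_tendstoD(2)) (use e in simp)
  moreover have "eventually (\<lambda>n. (LINT s|\<mu>. indicat_real {..h n} s * nsq s) \<ge> h n * ((L2_norm v0)\<^sup>2 - e / 2)) sequentially"
    by (rule initial_average_lower[OF v00 h0 hl hT]) (use e in simp)
  ultimately have "eventually (\<lambda>n. ?c n < e / 4 \<and> (LINT s|\<mu>. indicat_real {..h n} s * nsq s) \<ge> h n * ((L2_norm v0)\<^sup>2 - e / 2)) sequentially"
    by (rule eventually_conj)
  then obtain n where n: "?c n < e / 4" "(LINT s|\<mu>. indicat_real {..h n} s * nsq s) \<ge> h n * ((L2_norm v0)\<^sup>2 - e / 2)"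
    by (auto simp: eventually_sequentially)
  have c: "(LINT \<tau>|\<mu>. conv_average (h n) t \<tau>) = h n * ?c n" using h0[of n] by simp
  have "h n * nsq t \<ge> h n * ((L2_norm v0)\<^sup>2 - e / 2) - 2 * \<nu> * h n * ?Gt - 2 * (h n * ?c n)"
    using energy_increment_lower(1)[OF h0 ht t(2), of n] n(2) unfolding c by linarith
  also have "h n * ((L2_norm v0)\<^sup>2 - e / 2) - 2 * \<nu> * h n * ?Gt - 2 * (h n * ?c n) = h n * ((L2_norm v0)\<^sup>2 - e / 2 - 2 * \<nu> * ?Gt - 2 * ?c n)"
    by (simp only: algebra_simps)
  finally have "(L2_norm v0)\<^sup>2 - e / 2 - 2 * \<nu> * ?Gt - 2 * ?c n \<le> nsq t"
    using h0[of n] by (simp only: mult_le_cancel_left_pos)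
  then show "(L2_norm v0)\<^sup>2 \<le> nsq t + 2 * \<nu> * ?Gt + e" using n(1) by linarith
qed

lemma dissipation_eq:
  assumes t: "t \<in> {0..T}"
  shows "(LINT \<tau>|lebesgue_on {0..t}. (L2_norm (weak_gradient (v \<tau>)))\<^sup>2) = (LINT \<tau>|\<mu>. indicat_real {..t} \<tau> * gsq \<tau>)"
proof -
  have S: "{0..t} \<inter> space lebesgue \<in> sets lebesgue" "{0<..<T} \<inter> space lebesgue \<in> sets lebesgue" by simp_all
  have gm: "(\<lambda>\<tau>. indicat_real {..t} \<tau> * gsq \<tau>) \<in> borel_measurable \<mu>"
    using integrable_indicator_\<mu>[OF gsq_integrable, of "{..t}"] by auto
  have m: "(\<lambda>\<tau>. indicat_real {0<..<T} \<tau> *\<^sub>R (indicat_real {..t} \<tau> * gsq \<tau>)) \<in> borel_measurable lebesgue"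
    by (rule borel_measurable_restrict_space_iff[OF S(2), THEN iffD1, OF gm])
  have "AE \<tau> in lborel. indicat_real {0<..<T} \<tau> *\<^sub>R (indicat_real {..t} \<tau> * gsq \<tau>) = indicat_real {0..t} \<tau> *\<^sub>R gsq \<tau>"
    using AE_lborel_singleton[of 0] AE_lborel_singleton[of T]
    by eventually_elim (use t in \<open>auto simp: indicator_def\<close>)
  then have e: "AE \<tau> in lebesgue. indicat_real {0<..<T} \<tau> *\<^sub>R (indicat_real {..t} \<tau> * gsq \<tau>) = indicat_real {0..t} \<tau> *\<^sub>R gsq \<tau>"
    by (rule AE_completion)
  have "(LINT \<tau>|lebesgue_on {0..t}. gsq \<tau>) = (LINT \<tau>|\<mu>. indicat_real {..t} \<tau> * gsq \<tau>)"
    unfolding integral_restrict_space[OF S(1)] integral_restrict_space[OF S(2)]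
    by (rule integral_cong_AE[OF m borel_measurable_AE[OF m e] e, symmetric])
  then show ?thesis by (simp add: gsq_def)
qed

end

text \<open>With \<open>m(t)\<close> the bound for \<open>|v(t)|\<^sup>2\<close> and \<open>g(t) = \<parallel>\<nabla>v(t)\<parallel>\<^sup>2\<close>, the convective term has norm at most
  \<open>sqrt (m g) \<le> m + g\<close>, which is integrable in time.\<close>

lemma bounded_convection_if_horizontally_continuous:
  assumes T: "T > 0" and \<nu>: "\<nu> > 0"
    and \<omega>: "\<And>s. s > 0 \<Longrightarrow> \<omega> s \<ge> 0" "mono_on {0<..} \<omega>"
    and v0: "v0 \<in> space_H" and lh: "leray_hopf T \<nu> v0 v" and hc: "in_L2_C_hor T \<omega> v"
  shows "\<exists>b. bounded_convection T \<nu> v0 v b"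
proof -
  obtain f where f: "\<And>t. t \<in> {0..T} \<Longrightarrow> 0 \<le> f t" "integrable (lebesgue_on {0..T}) (\<lambda>t. (f t)\<^sup>2)"
    "AE t in lebesgue_on {0..T}. v t \<in> C_hor (\<lambda>s. f t * \<omega> s)"
    using hc unfolding in_L2_C_hor_def by blast
  let ?\<mu> = "lebesgue_on {0<..<T}"
  have v0': "in_Lp 2 v0" using v0 by (simp add: space_H_def)
  have vL2: "in_Lp 2 (v t)" if "t \<in> {0..T}" for t using lh that by (simp add: leray_hopf_def)
  define g where "g t = (L2_norm (weak_gradient (v t)))\<^sup>2" for t
  have gi: "integrable ?\<mu> g"
    using lh unfolding g_def[abs_def] leray_hopf_def in_L2_V_def by blast
  have Vae: "AE t in ?\<mu>. v t \<in> space_V"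
    using lh unfolding leray_hopf_def in_L2_V_def by blast
  have fi: "integrable ?\<mu> (\<lambda>t. (f t)\<^sup>2)"
  proof -
    have "(\<lambda>t. (f t)\<^sup>2) \<in> borel_measurable (lebesgue_on {0..T})" using f(2) by auto
    from integrable_lebesgue_on_AE_set[OF this _ _ AE_interval_closure] show ?thesis using f(2) by simp
  qed
  have hae: "AE t in ?\<mu>. v t \<in> C_hor (\<lambda>s. f t * \<omega> s)"
  proof -
    have "AE t in lborel. t \<in> {0..T} \<longrightarrow> v t \<in> C_hor (\<lambda>s. f t * \<omega> s)"
      using f(3) by (simp add: AE_lebesgue_on_iff)
    then have "AE t in lborel. t \<in> {0<..<T} \<longrightarrow> v t \<in> C_hor (\<lambda>s. f t * \<omega> s)"
      by eventually_elim auto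
    then show ?thesis by (simp add: AE_lebesgue_on_iff)
  qed
  define m where "m t = 3 * ((f t)\<^sup>2 * (\<omega> 2)\<^sup>2) + 3 * (L2_norm v0)\<^sup>2 + 3 * g t" for t
  have ci: "integrable ?\<mu> (\<lambda>t. c :: real)" for c by (rule integrable_continuous_open_interval) simp
  have mi: "integrable ?\<mu> (\<lambda>t. m t + g t)"
    unfolding m_def by (intro Bochner_Integration.integrable_add integrable_mult_right integrable_mult_left fi gi ci)
  have "bounded_convection T \<nu> v0 v (\<lambda>t. m t + g t)"
  proof
    show "T > 0" "\<nu> > 0" "in_Lp 2 v0" "leray_hopf T \<nu> v0 v" by fact+
    show "integrable ?\<mu> (\<lambda>t. m t + g t)" by (rule mi)
    have sp: "AE t in ?\<mu>. t \<in> {0..T}" by (rule AE_I2) auto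
    show "AE \<tau> in ?\<mu>. v \<tau> \<in> space_V \<and>
      in_Lp 2 (\<lambda>x. weak_gradient (v \<tau>) x *v v \<tau> x) \<and>
      L2_norm (\<lambda>x. weak_gradient (v \<tau>) x *v v \<tau> x) \<le> m \<tau> + g \<tau> \<and>
      L2_inner (\<lambda>x. weak_gradient (v \<tau>) x *v v \<tau> x) (v \<tau>) = 0"
      using Vae hae sp
    proof eventually_elim
      case (elim t)
      note V = elim(1) and v2 = vL2[OF elim(3)] and f0 = f(1)[OF elim(3)]
      have "(L2_norm (v t))\<^sup>2 / 2 + \<nu> * (LINT \<tau>|lebesgue_on {0..t}. (L2_norm (weak_gradient (v \<tau>)))\<^sup>2) \<le> (L2_norm v0)\<^sup>2 / 2"
        using lh elim(3) by (simp add: leray_hopf_def)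
      moreover have "0 \<le> \<nu> * (LINT \<tau>|lebesgue_on {0..t}. (L2_norm (weak_gradient (v \<tau>)))\<^sup>2)"
        using \<nu> by simp
      ultimately have vb: "(L2_norm (v t))\<^sup>2 \<le> (L2_norm v0)\<^sup>2" by linarith
      have "AE x in lebesgue_on half_space. (norm (v t x))\<^sup>2
        \<le> 3 * (f t * \<omega> 2)\<^sup>2 + 3 * (L2_norm (v t))\<^sup>2 + 3 * (L2_norm (weak_gradient (v t)))\<^sup>2"
      proof (rule V_C_hor_bounded[OF V v2 elim(2)])
        show "0 \<le> f t * \<omega> s" if "s > 0" for s using f0 \<omega>(1)[OF that] by simp
        show "mono_on {0<..} (\<lambda>s. f t * \<omega> s)"
          using \<omega>(2) f0 by (auto simp: mono_on_def intro!: mult_left_mono)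
      qed
      then have M: "AE x in lebesgue_on half_space. (norm (v t x))\<^sup>2 \<le> m t"
        by eventually_elim (use vb in \<open>simp add: m_def g_def power_mult_distrib\<close>)
      have m0: "m t \<ge> 0" "g t \<ge> 0" by (simp_all add: m_def g_def)
      have "L2_norm (\<lambda>x. weak_gradient (v t) x *v v t x) \<le> sqrt (m t) * sqrt (g t)"
        using convective_square_integrable(2)[OF V v2 M] by (simp add: g_def L2_norm_nonneg)
      also have "\<dots> \<le> m t + g t"
      proof -
        have "0 \<le> (sqrt (m t) - sqrt (g t))\<^sup>2" "0 \<le> sqrt (m t) * sqrt (g t)" using m0 by simp_all
        then show ?thesis unfolding power2_diff using m0 by simp
      qed
      finally show ?case
        using V convective_square_integrable(1)[OF V v2 M] convective_orthogonal[OF V v2 M] by blast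
    qed
  qed
  then show ?thesis by blast
qed

theorem theorem6p1:
  fixes T \<nu> :: real
    and \<omega> :: "real \<Rightarrow> real"
    and v0 :: "real^3 \<Rightarrow> real^3"
    and v :: "real \<Rightarrow> real^3 \<Rightarrow> real^3"
  assumes "T > 0" and "\<nu> > 0"
    and "\<And>s. s > 0 \<Longrightarrow> \<omega> s \<ge> 0"
    and "mono_on {0<..} \<omega>"
    and "(\<omega> \<longlongrightarrow> 0) (at_right 0)"
    and "v0 \<in> space_H"
    and "leray_hopf T \<nu> v0 v"
    and "in_L2_C_hor T \<omega> v"
  shows "\<forall>t\<in>{0..T}.
    (L2_norm (v t))\<^sup>2 / 2 + \<nu> * (LINT \<tau>|lebesgue_on {0..t}. (L2_norm (weak_gradient (v \<tau>)))\<^sup>2)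
      = (L2_norm v0)\<^sup>2 / 2"
proof
  fix t assume t: "t \<in> {0..T}"
  obtain b where "bounded_convection T \<nu> v0 v b"
    using bounded_convection_if_horizontally_continuous[OF assms(1-4,6-8)] by blast
  then interpret bounded_convection T \<nu> v0 v b .
  have v00: "AE x in lebesgue_on half_space. v 0 x = v0 x"
    using assms(7) by (simp add: leray_hopf_def)
  have upper: "(L2_norm (v t))\<^sup>2 / 2 + \<nu> * (LINT \<tau>|lebesgue_on {0..t}. (L2_norm (weak_gradient (v \<tau>)))\<^sup>2) \<le> (L2_norm v0)\<^sup>2 / 2"
    using assms(7) t by (simp add: leray_hopf_def)
  have "(L2_norm v0)\<^sup>2 \<le> nsq t + 2 * \<nu> * (LINT \<tau>|\<mu>. indicat_real {..t} \<tau> * gsq \<tau>)"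
  proof (cases "t = 0")
    case False
    then show ?thesis using energy_lower_bound[OF v00] t by auto
  next
    case True
    have "(L2_norm v0)\<^sup>2 = nsq 0"
      unfolding nsq_def L2_norm_sq
    proof (rule integral_cong_AE)
      have m: "v 0 \<in> borel_measurable (lebesgue_on half_space)" "v0 \<in> borel_measurable (lebesgue_on half_space)"
        using v_L2[of 0] v0 T by (auto simp: in_Lp_def)
      show "(\<lambda>x. (norm (v0 x))\<^sup>2) \<in> borel_measurable (lebesgue_on half_space)"
        "(\<lambda>x. (norm (v 0 x))\<^sup>2) \<in> borel_measurable (lebesgue_on half_space)" using m by simp_all
      show "AE x in lebesgue_on half_space. (norm (v0 x))\<^sup>2 = (norm (v 0 x))\<^sup>2"
        using v00 by eventually_elim simp
    qed
    moreover have "(LINT \<tau>|\<mu>. indicat_real {..t} \<tau> * gsq \<tau>) \<ge> 0"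
      using gsq_nonneg by (intro integral_nonneg_AE AE_I2) simp
    ultimately show ?thesis using True \<nu> by simp
  qed
  then show "(L2_norm (v t))\<^sup>2 / 2 + \<nu> * (LINT \<tau>|lebesgue_on {0..t}. (L2_norm (weak_gradient (v \<tau>)))\<^sup>2) = (L2_norm v0)\<^sup>2 / 2"
    using upper unfolding dissipation_eq[OF t] nsq_def by (simp add: field_simps)
qed

end
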